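(* Let $\mathbb{K}$ be a field and $\mathcal{S}$ a linear subspace of $\mathrm{M}_{n,p}(\mathbb{K})$ with $\operatorname{codim}\mathcal{S}\leq d_n(\mathbb{K})$, such that no nonzero $x\in\mathbb{K}^p$ satisfies $Mx=0$ for all $M\in\mathcal{S}$. Let $q\geq 1$. Then (a) the linear range-preserving maps $F:\mathcal{S}\to\mathrm{M}_{n,q}(\mathbb{K})$ are exactly the maps $M\mapsto\begin{bmatrix}M & 0_{n\times(q-p)}\end{bmatrix}Q$ with $Q\in\mathrm{GL}_q(\mathbb{K})$ (in particular such maps exist only if $q\geq p$); (b) if $\mathcal{S}$ has none of Types 1, 2, 3, then the range-preserving group homomorphisms $\mathcal{S}\to\mathrm{M}_{n,q}(\mathbb{K})$ are exactly these same maps.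
   Context: $d_n(\mathbb{K}):=2n-3$ if $\mathbb{K}$ has more than $2$ elements and $2n-4$ if $\mathbb{K}$ has $2$ elements. A map $F:\mathcal{S}\to\mathrm{M}_{n,q}(\mathbb{K})$ is range-preserving when $\operatorname{im}F(M)=\operatorname{im}M$ (column spaces) for all $M\in\mathcal{S}$. Types (for $\mathcal{S}\subset\mathrm{M}_{n,p}(\mathbb{K})$; $\mathcal{S}x=\{Mx:M\in\mathcal{S}\}$): Type 1 when $\dim\mathcal{S}x=1$ for some $x\in\mathbb{K}^p$; Type 2 when $\mathbb{K}$ has characteristic $2$ and $P\mathcal{S}Q^{-1}$, for some invertible $P,Q$, is the set of matrices $\begin{bmatrix}A&C\\0&B\end{bmatrix}$ with $A$ a $2\times 2$ symmetric matrix, $B\in\mathrm{M}_{n-2,p-2}(\mathbb{K})$, $C\in\mathrm{M}_{2,p-2}(\mathbb{K})$ arbitrary; Type 3 when $\mathbb{K}$ has characteristic $2$, $n=3$ and $P\mathcal{S}Q^{-1}$, for some invertible $P,Q$, is the set of matrices $\begin{bmatrix}A&B\end{bmatrix}$ with $A$ a $3\times 3$ symmetric matrix and $B\in\mathrm{M}_{3,p-3}(\mathbb{K})$ arbitrary. *)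

theory Defs
  imports "Jordan_Normal_Form.VS_Connect"
begin

definition mat_subspace_dim :: "nat \<Rightarrow> nat \<Rightarrow> 'a::field mat set \<Rightarrow> nat" where
  "mat_subspace_dim n p W =
     vectorspace.dim (class_ring :: 'a ring) ((module_mat TYPE('a) n p)\<lparr>carrier := W\<rparr>)"

definition vec_subspace_dim :: "nat \<Rightarrow> 'a::field vec set \<Rightarrow> nat" where
  "vec_subspace_dim n W =
     vectorspace.dim (class_ring :: 'a ring) ((module_vec TYPE('a) n)\<lparr>carrier := W\<rparr>)"

definition d_n :: "'a::field itself \<Rightarrow> nat \<Rightarrow> int" where
  "d_n ty n = (if card (UNIV :: 'a set) = 2 then 2 * int n - 4 else 2 * int n - 3)"

definition im_mat :: "'a::field mat \<Rightarrow> 'a vec set" where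
  "im_mat M = vec_space.col_space (dim_row M) M"

definition range_preserving :: "nat \<Rightarrow> nat \<Rightarrow> 'a::field mat set \<Rightarrow> ('a mat \<Rightarrow> 'a mat) \<Rightarrow> bool" where
  "range_preserving n q S F \<longleftrightarrow> (\<forall>M\<in>S. F M \<in> carrier_mat n q \<and> im_mat (F M) = im_mat M)"

definition linear_on :: "'a::field mat set \<Rightarrow> ('a mat \<Rightarrow> 'a mat) \<Rightarrow> bool" where
  "linear_on S F \<longleftrightarrow> (\<forall>A\<in>S. \<forall>B\<in>S. F (A + B) = F A + F B) \<and> (\<forall>c. \<forall>A\<in>S. F (c \<cdot>\<^sub>m A) = c \<cdot>\<^sub>m F A)"

definition additive_on :: "'a::field mat set \<Rightarrow> ('a mat \<Rightarrow> 'a mat) \<Rightarrow> bool" where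
  "additive_on S F \<longleftrightarrow> (\<forall>A\<in>S. \<forall>B\<in>S. F (A + B) = F A + F B)"

definition pad_zero_cols :: "nat \<Rightarrow> 'a::field mat \<Rightarrow> 'a mat" where
  "pad_zero_cols q M = four_block_mat M (0\<^sub>m (dim_row M) (q - dim_col M))
                                       (0\<^sub>m 0 (dim_col M)) (0\<^sub>m 0 (q - dim_col M))"

definition standard_map_on :: "nat \<Rightarrow> nat \<Rightarrow> 'a::field mat set \<Rightarrow> ('a mat \<Rightarrow> 'a mat) \<Rightarrow> bool" where
  "standard_map_on p q S F \<longleftrightarrow> p \<le> q \<and>
     (\<exists>Q. Q \<in> carrier_mat q q \<and> invertible_mat Q \<and> (\<forall>M\<in>S. F M = pad_zero_cols q M * Q))"

definition sym_mats :: "nat \<Rightarrow> 'a::field mat set" where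
  "sym_mats k = {A. A \<in> carrier_mat k k \<and> transpose_mat A = A}"

definition type1 :: "nat \<Rightarrow> nat \<Rightarrow> 'a::field mat set \<Rightarrow> bool" where
  "type1 n p S \<longleftrightarrow> (\<exists>x\<in>carrier_vec p. vec_subspace_dim n {M *\<^sub>v x | M. M \<in> S} = 1)"

text \<open>Type 2: characteristic 2 and P S Q^{-1} = {[A C; 0 B]} with A symmetric 2x2
  (R below plays the role of Q^{-1}, which ranges over all of GL_p as Q does).\<close>
definition type2 :: "nat \<Rightarrow> nat \<Rightarrow> 'a::field mat set \<Rightarrow> bool" where
  "type2 n p S \<longleftrightarrow> semiring_char TYPE('a) = 2 \<and> 2 \<le> n \<and> 2 \<le> p \<and>
     (\<exists>P R. P \<in> carrier_mat n n \<and> invertible_mat P \<and> R \<in> carrier_mat p p \<and> invertible_mat R \<and>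
        (\<lambda>M. P * M * R) ` S =
          {four_block_mat A C (0\<^sub>m (n - 2) 2) B | A B C.
             A \<in> sym_mats 2 \<and> B \<in> carrier_mat (n - 2) (p - 2) \<and> C \<in> carrier_mat 2 (p - 2)})"

definition type3 :: "nat \<Rightarrow> nat \<Rightarrow> 'a::field mat set \<Rightarrow> bool" where
  "type3 n p S \<longleftrightarrow> semiring_char TYPE('a) = 2 \<and> n = 3 \<and> 3 \<le> p \<and>
     (\<exists>P R. P \<in> carrier_mat n n \<and> invertible_mat P \<and> R \<in> carrier_mat p p \<and> invertible_mat R \<and>
        (\<lambda>M. P * M * R) ` S =
          {four_block_mat A B (0\<^sub>m 0 3) (0\<^sub>m 0 (p - 3)) | A B.
             A \<in> sym_mats 3 \<and> B \<in> carrier_mat 3 (p - 3)})"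

end

theory Submission
  imports Defs "HOL-Library.Function_Algebras"
begin

text \<open>
  Everything is dualised: the matrix space is the annihilator of a space \<open>W\<close> of tensors, so that its
  codimension is \<open>dim W\<close>, and each column of a range-preserving map becomes a map \<open>F\<close> sending
  \<open>s \<in> ann W\<close> to a functional that vanishes on \<open>f\<close> whenever the row \<open>s (tens f \<cdot>)\<close> vanishes. The
  question is whether \<open>F\<close> is local, \<open>F s f = s (tens f u)\<close> for a fixed \<open>u\<close>: then all columns
  together say \<open>F M = M Y\<close>.

  Locality is proved by two reductions. Either some column \<open>x\<close> meets \<open>W\<close> in many rows: then one adds all
  tensors \<open>tens f x\<close> to \<open>W\<close>, which costs little, and lifts the conclusion back. Or no column does: then
  some functionals \<open>y\<close> contract \<open>W\<close> to at least two dimensions, the restrictions of \<open>F\<close> to the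
  hyperplanes \<open>y = 0\<close> satisfy the same codimension bound by induction, and two (or three) of these
  restrictions are glued.

  For additive \<open>F\<close> the same induction is run on the defect of homogeneity \<open>F (c s) - c F s\<close>, which is
  either zero or of the form \<open>b (s (tens f (h f)))\<close> with \<open>b\<close> additive, in characteristic 2. In the
  second case the tensors \<open>tens f (h g) - tens g (h f)\<close> lie in \<open>W\<close>, and counting dimensions shows that
  they exhaust \<open>W\<close>: this leaves \<open>h\<close> of rank 2, giving Type 2, or rank \<open>3 = n\<close>, giving Type 3.

  Finally \<open>Y\<close> has a right inverse: if the columns of \<open>Y\<close> spanned only \<open>H\<close> and \<open>x \<notin> H\<close>, then
  \<open>s \<mapsto> s (tens \<cdot> x)\<close> would be range compatible with respect to \<open>H\<close>, hence given by some \<open>u \<in> H\<close>, and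
  all matrices would kill \<open>x - u\<close>.
\<close>

section \<open>Finitely generated subspaces\<close>

text \<open>Dictionary: \<open>V\<close> is the dual of the target space, \<open>U\<close> the space
  the matrices act on, and \<open>s\<close> is the matrix with entries \<open>s (tens f u)\<close>.
  The slice of \<open>W\<close> at \<open>x\<close> is the annihilator of all vectors
  \<open>M x\<close>; these vectors fill at most a line, a plane, or at least three dimensions
  according as the slice has dimension at least \<open>dim V - 1\<close>, equal to
  \<open>dim V - 2\<close>, or at most \<open>dim V - 3\<close>. These thresholds organise all case
  splits. The bounded quantity is the excess \<open>dim W - dim (TP V X)\<close>. Adding a column
  \<open>x\<close> lowers it by the dimension of the slice at \<open>x\<close>; restricting to a
  hyperplane given by a contraction of rank two lowers it by at least two while \<open>dim V\<close>
  drops by one. Bounds \<open>2 * dim V - 3\<close> and \<open>2 * dim V - 4\<close> are therefore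
  stable, and an excess of at most \<open>dim V - 2\<close> always gives locality. The obstacle is
  that an additive map of a line need not be a homothety: a column whose values form a line leaves a
  factor depending on the matrix. Linearity removes it; for additive maps it is the source of the
  map \<open>b\<close>. The bound \<open>2 * dim V - 3\<close> needs a scalar other than 0 and 1, in
  order to compare a matrix with several multiples of another one.\<close>

context vector_space
begin

text \<open>\<open>dim\<close> is the cardinality of a basis, hence 0 for an infinite one, and the
  function spaces below may be infinite-dimensional. Dimension counts therefore carry this
  hypothesis.\<close>

definition fin_gen :: "'b set \<Rightarrow> bool" where
  "fin_gen S \<longleftrightarrow> (\<exists>B. finite B \<and> S \<subseteq> span B)"

lemma fin_gen_subset: "A \<subseteq> B \<Longrightarrow> local.fin_gen B \<Longrightarrow> local.fin_gen A"
  unfolding local.fin_gen_def by blast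

lemma fin_gen_finite: "finite B \<Longrightarrow> local.fin_gen B"
  unfolding local.fin_gen_def using span_superset by blast

lemma fin_gen_span: "local.fin_gen A \<Longrightarrow> local.fin_gen (span A)"
  unfolding local.fin_gen_def by (meson span_minimal subspace_span)

lemma fin_gen_Un: assumes "local.fin_gen A" "local.fin_gen B" shows "local.fin_gen (A \<union> B)"
proof -
  from assms obtain S T where "finite S" "A \<subseteq> span S" "finite T" "B \<subseteq> span T"
    unfolding local.fin_gen_def by blast
  then have "finite (S \<union> T)" "A \<union> B \<subseteq> span (S \<union> T)"
    using span_mono[of S "S \<union> T"] span_mono[of T "S \<union> T"] by auto
  then show ?thesis unfolding local.fin_gen_def by blast
qed

lemma independent_subset_fin_gen:
  assumes "local.fin_gen S" "independent B" "B \<subseteq> S"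
  shows "finite B" "card B \<le> dim S"
proof -
  from assms(1) obtain T where "finite T" "S \<subseteq> span T" unfolding local.fin_gen_def by blast
  moreover from maximal_independent_subset_extend[OF assms(3,2)]
  obtain C where C: "B \<subseteq> C" "C \<subseteq> S" "independent C" "S \<subseteq> span C" by blast
  ultimately have "finite C" using independent_span_bound[of T C] by blast
  then show "finite B" "card B \<le> dim S"
    using C finite_subset card_mono[OF \<open>finite C\<close> C(1)] basis_card_eq_dim[of C S] by auto
qed

lemma fin_gen_basis:
  assumes "subspace S" "local.fin_gen S"
  obtains B where "finite B" "independent B" "span B = S" "card B = dim S" "B \<subseteq> S"
proof -
  obtain B where B: "B \<subseteq> S" "independent B" "S \<subseteq> span B" "card B = dim S"
    using basis_exists by blast
  moreover have "span B = S" using B assms(1) span_subspace by blast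
  ultimately show ?thesis using that independent_subset_fin_gen[OF assms(2)] by blast
qed

lemma dim_mono_fin_gen:
  assumes "A \<subseteq> B" "local.fin_gen B"
  shows "dim A \<le> dim B"
proof -
  obtain C where "C \<subseteq> A" "independent C" "A \<subseteq> span C" "card C = dim A" using basis_exists by blast
  then show ?thesis using independent_subset_fin_gen[OF assms(2), of C] assms(1) by force
qed

text \<open>A basis of \<open>A\<close> extended inside \<open>B\<close> has no room to grow. This
  is the equality case of the later dimension counts: it turns a numerical bound on \<open>W\<close>
  into a description of \<open>W\<close>.\<close>

lemma subspace_dim_eq_imp_eq:
  assumes "subspace A" "A \<subseteq> B" "local.fin_gen B" "dim B \<le> dim A"
  shows "A = B"
proof -
  obtain C where C: "C \<subseteq> A" "independent C" "A \<subseteq> span C" "card C = dim A" using basis_exists by blast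
  obtain D where D: "C \<subseteq> D" "D \<subseteq> B" "independent D" "B \<subseteq> span D"
    using maximal_independent_subset_extend[of C B] C assms(2) by blast
  have "finite D" "card D = dim B"
    using independent_subset_fin_gen[OF assms(3) D(3,2)] basis_card_eq_dim[OF D(2,4,3)] by auto
  then have "C = D" using card_seteq[of D C] D(1) C(4) assms(4) by auto
  then show ?thesis using D(4) C assms(1,2) span_minimal by blast
qed

lemma dim_insert_notin:
  assumes "subspace S" "local.fin_gen S" "x \<notin> S"
  shows "dim (span (insert x S)) = Suc (dim S)"
proof -
  obtain B where B: "finite B" "independent B" "span B = S" "card B = dim S" "B \<subseteq> S"
    using fin_gen_basis[OF assms(1,2)] .
  have "independent (insert x B)" using B assms(3) by (simp add: independent_insertI)
  moreover have "span S = S" using B(3) span_span[of B] by simp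
  then have "span (insert x B) = span (insert x S)"
    using B(3) by (simp add: span_insert del: span_eq_iff)
  moreover have "x \<notin> B" using B(5) assms(3) by auto
  ultimately show ?thesis using dim_eq_card[of "insert x B" "span (insert x S)"] B(1,4)
    by (simp add: span_span)
qed

lemma dim_zero_space: "dim {0} = 0"
  using dim_eq_card[of "{}" "{0}"] independent_empty by simp

lemma dim_0_imp:
  assumes "subspace S" "local.fin_gen S" "dim S = 0" shows "S = {0}"
  using subspace_dim_eq_imp_eq[of "{0}" S] assms subspace_0 dim_zero_space by auto

lemma exists_notin_smaller:
  assumes "local.fin_gen S" "subspace T" "dim T < dim S" "local.fin_gen T"
  shows "\<exists>x\<in>S. x \<notin> T"
  using dim_mono_fin_gen[of S T] assms by force

lemma dim_span_insert_le:
  assumes "local.fin_gen S"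
  shows "dim (span (insert x S)) \<le> Suc (dim S)"
proof (cases "x \<in> span S")
  case True then show ?thesis by (simp add: span_redundant)
next
  case False
  have "span (insert x (span S)) = span (insert x S)"
    by (simp add: span_insert span_span)
  then show ?thesis using dim_insert_notin[of "span S" x] fin_gen_span[OF assms] False by simp
qed

text \<open>A basis \<open>C\<close> of the intersection is extended to a basis \<open>D\<close> of
  \<open>B\<close>. The vectors of \<open>D - C\<close> stay independent modulo \<open>A\<close>, so
  adjoining them to \<open>A\<close> one by one raises the dimension by one each time.\<close>

lemma dim_sum_Int:
  assumes A: "subspace A" "local.fin_gen A" and B: "subspace B" "local.fin_gen B"
  shows "dim (span (A \<union> B)) + dim (A \<inter> B) = dim A + dim B"
proof -
  have AB: "subspace (A \<inter> B)" using A(1) B(1) by (rule subspace_inter)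
  have fAB: "local.fin_gen (A \<inter> B)" using fin_gen_subset[OF _ A(2), of "A \<inter> B"] by blast
  obtain C where C: "finite C" "independent C" "span C = A \<inter> B" "card C = dim (A \<inter> B)" "C \<subseteq> A \<inter> B"
    using fin_gen_basis[OF AB fAB] .
  have "C \<subseteq> B" using C(5) by blast
  from maximal_independent_subset_extend[OF this C(2)]
  obtain D where D: "C \<subseteq> D" "D \<subseteq> B" "independent D" "B \<subseteq> span D" .
  have fD: "finite D" and cD: "card D = dim B"
    using independent_subset_fin_gen(1)[OF B(2) D(3,2)] basis_card_eq_dim[OF D(2,4,3)] by simp_all
  have "dim (span (A \<union> E)) = dim A + card E" if "E \<subseteq> D - C" "finite E" for E
    using that(2,1)
  proof (induction E rule: finite_induct)
    case empty then show ?case using A(1) by simp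
  next
    case (insert e E)
    have "e \<notin> span (A \<union> E)"
    proof
      assume "e \<in> span (A \<union> E)"
      then obtain a b where ab: "e = a + b" "a \<in> span A" "b \<in> span E" unfolding span_Un by blast
      have "a \<in> A" using ab(2) span_minimal[OF subset_refl A(1)] by blast
      have "E \<subseteq> B" "e \<in> B" using insert.prems D(2) by auto
      then have "b \<in> B" using ab(3) B(1) span_minimal by blast
      have "a = e - b" using ab(1) by simp
      then have "a \<in> B" using \<open>b \<in> B\<close> \<open>e \<in> B\<close> B(1) subspace_diff by simp
      then have "a \<in> span C" using C(3) \<open>a \<in> A\<close> by simp
      then have "e \<in> span (C \<union> E)" using ab unfolding span_Un by blast
      moreover have "C \<union> E \<subseteq> D - {e}" using D(1) insert.prems insert.hyps(2) by blast
      ultimately have "e \<in> span (D - {e})" using span_mono by blast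
      moreover have "e \<in> D" using insert.prems by blast
      ultimately show False using D(3) unfolding dependent_def by blast
    qed
    moreover have "local.fin_gen (span (A \<union> E))"
      using fin_gen_span fin_gen_Un[OF A(2) fin_gen_finite[OF insert.hyps(1)]] by blast
    ultimately have "dim (span (insert e (span (A \<union> E)))) = Suc (dim (span (A \<union> E)))"
      using dim_insert_notin[OF subspace_span] by blast
    moreover have "span (insert e (span (A \<union> E))) = span (A \<union> insert e E)"
      by (simp add: span_insert span_span)
    ultimately show ?case using insert by simp
  qed
  from this[of "D - C"] have "dim (span (A \<union> (D - C))) = dim A + card (D - C)" using fD by simp
  moreover have "span (A \<union> (D - C)) = span (A \<union> B)"
  proof
    show "span (A \<union> (D - C)) \<subseteq> span (A \<union> B)" by (rule span_mono) (use D(2) in blast)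
    have "B \<subseteq> span (A \<union> (D - C))"
    proof -
      have "D \<subseteq> A \<union> (D - C)" using C(5) by blast
      then show ?thesis using D(4) span_mono by blast
    qed
    moreover have "A \<subseteq> span (A \<union> (D - C))" using span_superset[of "A \<union> (D - C)"] by blast
    ultimately show "span (A \<union> B) \<subseteq> span (A \<union> (D - C))" by (intro span_minimal) auto
  qed
  moreover have "card (D - C) + card C = card D" using C(1) D(1) fD
    by (metis card_Diff_subset card_mono le_add_diff_inverse2)
  ultimately show ?thesis using C(4) cD by simp
qed

end

context vector_space_pair
begin

lemma fin_gen_image:
  assumes "Vector_Spaces.linear s1 s2 f" "vs1.fin_gen S"
  shows "vs2.fin_gen (f ` S)"
proof -
  interpret f: Vector_Spaces.linear s1 s2 f by fact
  from assms(2) obtain B where "finite B" "S \<subseteq> vs1.span B" unfolding vs1.fin_gen_def by blast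
  then have "finite (f ` B)" "f ` S \<subseteq> vs2.span (f ` B)" using f.span_image[of B] by auto
  then show ?thesis unfolding vs2.fin_gen_def by blast
qed

lemma rank_nullity:
  assumes lin: "Vector_Spaces.linear s1 s2 f" and S: "vs1.subspace S" "vs1.fin_gen S"
  shows "vs1.dim S = vs1.dim {x \<in> S. f x = 0} + vs2.dim (f ` S)"
proof -
  interpret f: Vector_Spaces.linear s1 s2 f by fact
  let ?K = "{x \<in> S. f x = 0}"
  have K: "vs1.subspace ?K" using f.subspace_kernel vs1.subspace_inter[OF S(1), of "{x. f x = 0}"]
    by (simp add: Collect_conj_eq)
  obtain B where B: "finite B" "vs1.independent B" "vs1.span B = ?K" "card B = vs1.dim ?K" "B \<subseteq> ?K"
    using vs1.fin_gen_basis[OF K vs1.fin_gen_subset[OF _ S(2)]] by blast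
  obtain C where C: "B \<subseteq> C" "C \<subseteq> S" "vs1.independent C" "S \<subseteq> vs1.span C"
    using vs1.maximal_independent_subset_extend[of B S] B by blast
  have fC: "finite C" and cC: "card C = vs1.dim S"
    using vs1.independent_subset_fin_gen[OF S(2) C(3,2)] vs1.basis_card_eq_dim[OF C(2,4,3)] by auto
  let ?D = "C - B"
  have iD: "vs1.independent ?D" using C(3) vs1.independent_mono by blast
  \<comment> \<open>A kernel vector in the span of \<open>C - B\<close> also lies in the span of
    \<open>B\<close>, so its coordinates with respect to \<open>C\<close> are supported on two
    disjoint sets and vanish.\<close>
  have inj: "inj_on f (vs1.span ?D)"
  proof (subst f.inj_on_iff_eq_0, simp, safe)
    fix x assume x: "x \<in> vs1.span ?D" "f x = 0"
    have "x \<in> S" using x(1) C(2) S(1) vs1.span_minimal[of ?D S] by auto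
    then have "x \<in> vs1.span B" using x B by simp
    have "vs1.representation C x = vs1.representation B x"
      using vs1.representation_extend[OF C(3) \<open>x \<in> vs1.span B\<close> C(1)] .
    moreover have "vs1.representation C x = vs1.representation ?D x"
      using vs1.representation_extend[OF C(3) x(1)] by auto
    ultimately have "vs1.representation C x b = 0" for b
      using vs1.representation_ne_zero[of B x b] vs1.representation_ne_zero[of ?D x b] by fastforce
    moreover have "x \<in> vs1.span C" using \<open>x \<in> S\<close> C(4) by auto
    ultimately show "x = 0" using vs1.sum_nonzero_representation_eq[OF C(3), of x] by auto
  qed
  have "vs2.independent (f ` ?D)" using f.independent_injective_image[OF iD inj] .
  moreover have "vs2.span (f ` ?D) = f ` S"
  proof -
    have "vs1.span C = S" using C S(1) vs1.span_subspace by blast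
    then have "f ` S = vs2.span (f ` C)" using f.span_image by metis
    also have "\<dots> = vs2.span (f ` ?D)"
    proof -
      have "f ` C \<subseteq> insert 0 (f ` ?D)" using B(5) by auto
      then show ?thesis
        using vs2.span_mono[of "f ` C" "insert 0 (f ` ?D)"] vs2.span_mono[of "f ` ?D" "f ` C"] by auto
    qed
    finally show ?thesis by simp
  qed
  ultimately have "vs2.dim (f ` S) = card (f ` ?D)"
    using vs2.dim_span_eq_card_independent[of "f ` ?D"] vs2.dim_span[of "f ` S"] by simp
  also have "\<dots> = card ?D" by (rule card_image[OF inj_on_subset[OF inj vs1.span_superset]])
  finally show ?thesis using B(1,4) C(1) cC fC card_mono[OF fC C(1)]
    by (simp add: card_Diff_subset)
qed

lemma dim_inj_image:
  assumes "Vector_Spaces.linear s1 s2 f" "vs1.subspace S" "vs1.fin_gen S"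
    and "\<And>x. x \<in> S \<Longrightarrow> f x = 0 \<Longrightarrow> x = 0"
  shows "vs2.dim (f ` S) = vs1.dim S"
proof -
  have "{x \<in> S. f x = 0} = {0}"
    using assms vs1.subspace_0 linear_0 by blast
  then show ?thesis using rank_nullity[OF assms(1-3)] vs1.dim_zero_space by simp
qed

end

section \<open>Functionals, annihilators and tensors\<close>

text \<open>One scaling for three kinds of objects: vectors, tensors (indexed by pairs) and
  functionals (indexed by vectors) are all functions into the field.\<close>

definition sc :: "'a::field \<Rightarrow> ('i \<Rightarrow> 'a) \<Rightarrow> ('i \<Rightarrow> 'a)" where
  "sc c f = (\<lambda>i. c * f i)"

lemma sc_apply: "sc c f i = c * f i"
  by (simp add: sc_def)

lemma vector_space_field: "vector_space ((*) :: 'a::field \<Rightarrow> 'a \<Rightarrow> 'a)"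
  by unfold_locales (auto simp: algebra_simps)

global_interpretation fn: vector_space "sc :: 'a::field \<Rightarrow> ('i \<Rightarrow> 'a) \<Rightarrow> ('i \<Rightarrow> 'a)"
  by unfold_locales (auto simp: fun_eq_iff sc_apply algebra_simps)

global_interpretation ff: vector_space_pair
  "sc :: 'a::field \<Rightarrow> ('i \<Rightarrow> 'a) \<Rightarrow> ('i \<Rightarrow> 'a)" "sc :: 'a::field \<Rightarrow> ('j \<Rightarrow> 'a) \<Rightarrow> ('j \<Rightarrow> 'a)"
  by unfold_locales

definition functional :: "(('i \<Rightarrow> 'a::field) \<Rightarrow> 'a) \<Rightarrow> bool" where
  "functional s \<longleftrightarrow> (\<forall>x y. s (x + y) = s x + s y) \<and> (\<forall>c x. s (sc c x) = c * s x)"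

lemma functional_iff: "functional s \<longleftrightarrow> Vector_Spaces.linear sc (*) s"
  by (simp add: functional_def Vector_Spaces.linear_iff vector_space_field fn.vector_space_axioms)

lemma linear_sc_iff:
  "Vector_Spaces.linear sc sc f \<longleftrightarrow> (\<forall>x y. f (x + y) = f x + f y) \<and> (\<forall>c x. f (sc c x) = sc c (f x))"
  by (simp add: Vector_Spaces.linear_iff fn.vector_space_axioms)

lemma functional_add: "functional s \<Longrightarrow> s (x + y) = s x + s y"
  and functional_sc: "functional s \<Longrightarrow> s (sc c x) = c * s x"
  by (auto simp: functional_def)

lemma functional_0: "functional s \<Longrightarrow> s 0 = 0"
  using functional_sc[of s 0 0] by (simp add: fn.scale_zero_left)

lemma functional_minus: "functional s \<Longrightarrow> s (- x) = - s x"
  using functional_sc[of s "- 1" x] by (simp add: fn.scale_minus_left)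

lemma functional_diff: "functional s \<Longrightarrow> s (x - y) = s x - s y"
  using functional_add[of s x "- y"] functional_minus[of s y] by simp

lemmas functional_simps = functional_add functional_sc functional_0 functional_minus functional_diff

lemma functionalI:
  "(\<And>x y. s (x + y) = s x + s y) \<Longrightarrow> (\<And>c x. s (sc c x) = c * s x) \<Longrightarrow> functional s"
  by (simp add: functional_def)

lemma functional_plus: "functional s \<Longrightarrow> functional t \<Longrightarrow> functional (s + t)"
  by (rule functionalI) (simp_all add: functional_add[of s] functional_add[of t] functional_sc[of s] functional_sc[of t] distrib_left)

lemma functional_scale: "functional s \<Longrightarrow> functional (sc c s)"
  by (rule functionalI) (simp_all add: functional_add[of s] functional_sc[of s] distrib_left sc_apply)

lemma functional_zero: "functional 0"
  by (rule functionalI) simp_all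

lemma functional_minus_fun: "functional s \<Longrightarrow> functional t \<Longrightarrow> functional (s - t)"
  by (rule functionalI) (simp_all add: functional_add[of s] functional_add[of t] functional_sc[of s] functional_sc[of t] right_diff_distrib)

lemma functional_span_zero:
  assumes "functional s" "\<And>x. x \<in> A \<Longrightarrow> s x = 0" "y \<in> fn.span A" shows "s y = 0"
  by (rule fn.span_induct_alt[where h="\<lambda>y. s y = 0", OF assms(3)])
     (simp_all add: functional_simps[OF assms(1)] assms(2))

lemma subspace_Int_kernel:
  assumes "fn.subspace S" "functional s" shows "fn.subspace {x \<in> S. s x = 0}"
  using assms(1) by (auto simp: fn.subspace_def functional_simps[OF assms(2)])

lemma functional_extend:
  fixes B :: "('i \<Rightarrow> 'a::field) set"
  assumes "fn.independent B" shows "\<exists>s. functional s \<and> (\<forall>b\<in>B. s b = f b)"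
proof -
  interpret fk: vector_space_pair
    "sc :: 'a::field \<Rightarrow> ('i \<Rightarrow> 'a) \<Rightarrow> ('i \<Rightarrow> 'a)" "(*) :: 'a::field \<Rightarrow> 'a \<Rightarrow> 'a"
    using vector_space_field by (intro vector_space_pair.intro fn.vector_space_axioms)
  show ?thesis using fk.linear_independent_extend[OF assms] by (simp add: functional_iff)
qed

text \<open>On a basis of \<open>B\<close> extended by vectors of \<open>A\<close>, prescribe 0 on
  the first part and \<open>s\<close> on the second. This is how matrices are made to order below: a
  prescribed part together with a killed row, or an extension that still annihilates
  \<open>W\<close>.\<close>

lemma functional_agree_zero:
  assumes A: "fn.subspace A" and B: "fn.subspace B" and s: "functional s"
    and z: "\<And>x. x \<in> A \<Longrightarrow> x \<in> B \<Longrightarrow> s x = 0"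
  shows "\<exists>t. functional t \<and> (\<forall>x\<in>A. t x = s x) \<and> (\<forall>x\<in>B. t x = 0)"
proof -
  obtain C where C: "C \<subseteq> B" "fn.independent C" "B \<subseteq> fn.span C"
    using fn.maximal_independent_subset by blast
  have sC: "fn.span C = B" using C B fn.span_subspace by blast
  obtain D where D: "C \<subseteq> D" "D \<subseteq> C \<union> A" "fn.independent D" "C \<union> A \<subseteq> fn.span D"
    using fn.maximal_independent_subset_extend[of C "C \<union> A"] C by blast
  obtain t where t: "functional t" "\<forall>b\<in>D. t b = (if b \<in> C then 0 else s b)"
    using functional_extend[OF D(3), of "\<lambda>b. if b \<in> C then 0 else s b"] by blast
  have tB: "t x = 0" if "x \<in> B" for x
  proof (rule functional_span_zero[OF t(1)])
    show "x \<in> fn.span C" using sC that by simp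
  qed (use t(2) D(1) in auto)
  have DA: "fn.span (D - C) \<subseteq> A" using D(2) A fn.span_minimal[of "D - C" A] by auto
  have ts: "t x = s x" if "x \<in> fn.span (D - C)" for x
  proof -
    have "functional (t - s)" using functional_minus_fun t(1) s .
    from functional_span_zero[OF this, of "D - C" x] t(2) that show ?thesis by auto
  qed
  have "t x = s x" if "x \<in> A" for x
  proof -
    have "x \<in> fn.span (C \<union> (D - C))" using that D(1,4) by (simp add: Un_absorb1 subset_iff)
    then obtain b a where ba: "x = b + a" "b \<in> B" "a \<in> fn.span (D - C)"
      unfolding fn.span_Un sC by blast
    then have "b = x - a" by simp
    then have "b \<in> A" using that ba(3) DA A fn.subspace_diff by blast
    then show ?thesis using ba z tB ts functional_add[OF t(1), of b a] functional_add[OF s, of b a] by auto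
  qed
  then show ?thesis using t(1) tB by blast
qed

lemma functional_separate:
  assumes "fn.subspace W" "e \<notin> W"
  shows "\<exists>s. functional s \<and> (\<forall>x\<in>W. s x = 0) \<and> s e = 1"
proof -
  obtain C where C: "C \<subseteq> W" "fn.independent C" "W \<subseteq> fn.span C"
    using fn.maximal_independent_subset by blast
  have sC: "fn.span C = W" using C assms(1) fn.span_subspace by blast
  have "fn.independent (insert e C)" using C(2) assms(2) sC by (simp add: fn.independent_insertI)
  from functional_extend[OF this, of "\<lambda>b. if b = e then 1 else 0"] obtain s where
    s: "functional s" "\<forall>b\<in>insert e C. s b = (if b = e then 1 else 0)" by blast
  have "s x = 0" if "x \<in> W" for x
  proof (rule functional_span_zero[OF s(1)])
    show "x \<in> fn.span C" using sC that by simp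
  qed (use s(2) C(1) assms(2) in auto)
  then show ?thesis using s by auto
qed

definition ann :: "('i \<Rightarrow> 'a::field) set \<Rightarrow> (('i \<Rightarrow> 'a) \<Rightarrow> 'a) set" where
  "ann W = {s. functional s \<and> (\<forall>x\<in>W. s x = 0)}"

lemma annD: "s \<in> ann W \<Longrightarrow> functional s" "s \<in> ann W \<Longrightarrow> x \<in> W \<Longrightarrow> s x = 0"
  by (auto simp: ann_def)

lemma ann_antimono: "V \<subseteq> W \<Longrightarrow> ann W \<subseteq> ann V"
  by (auto simp: ann_def)

lemma ann_plus: "s \<in> ann W \<Longrightarrow> t \<in> ann W \<Longrightarrow> s + t \<in> ann W"
  by (simp add: ann_def functional_plus)

lemma ann_scale: "s \<in> ann W \<Longrightarrow> sc c s \<in> ann W"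
  by (simp add: ann_def functional_scale sc_apply)

lemma ann_minus: "s \<in> ann W \<Longrightarrow> t \<in> ann W \<Longrightarrow> s - t \<in> ann W"
  by (simp add: ann_def functional_minus_fun)

lemma ann_zero: "0 \<in> ann W"
  by (simp add: ann_def functional_zero)

lemma ann_span: "ann (fn.span W) = ann W"
  using functional_span_zero fn.span_base unfolding ann_def by blast

lemma ann_separate: "fn.subspace W \<Longrightarrow> e \<notin> W \<Longrightarrow> \<exists>s\<in>ann W. s e = 1"
  using functional_separate[of W e] by (auto simp: ann_def)

lemma mem_iff_ann: "fn.subspace W \<Longrightarrow> e \<in> W \<longleftrightarrow> (\<forall>s\<in>ann W. s e = 0)"
  using ann_separate[of W e] annD(2)[of _ W e] by fastforce

section \<open>Rank one tensors, contractions and tensor products of subspaces\<close>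

definition tens :: "('i \<Rightarrow> 'a::field) \<Rightarrow> ('j \<Rightarrow> 'a) \<Rightarrow> ('i \<times> 'j \<Rightarrow> 'a)" where
  "tens f u = (\<lambda>(i, j). f i * u j)"

text \<open>A tensor is read as the operator \<open>y \<mapsto> ctr y N\<close>; contraction acts on
  the first factor only.\<close>

definition ctr :: "(('i \<Rightarrow> 'a::field) \<Rightarrow> 'a) \<Rightarrow> ('i \<times> 'j \<Rightarrow> 'a) \<Rightarrow> ('j \<Rightarrow> 'a)" where
  "ctr y N = (\<lambda>j. y (\<lambda>i. N (i, j)))"

lemma tens_add_left: "tens (f + g) u = tens f u + tens g u"
  by (rule ext) (simp add: tens_def split_beta distrib_right)

lemma tens_add_right: "tens f (u + v) = tens f u + tens f v"
  by (rule ext) (simp add: tens_def split_beta distrib_left)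

lemma tens_diff_left: "tens (f - g) u = tens f u - tens g u"
  by (rule ext) (simp add: tens_def split_beta left_diff_distrib)

lemma tens_diff_right: "tens f (u - v) = tens f u - tens f v"
  by (rule ext) (simp add: tens_def split_beta right_diff_distrib)

lemma tens_sc_left: "tens (sc c f) u = sc c (tens f u)"
  and tens_sc_right: "tens f (sc c u) = sc c (tens f u)"
  and tens_0_left: "tens 0 u = 0"
  and tens_0_right: "tens f 0 = 0"
  by (rule ext, simp add: tens_def split_beta sc_apply)+

lemmas tens_simps = tens_add_left tens_add_right tens_sc_left tens_sc_right tens_0_left tens_0_right
  tens_diff_left tens_diff_right

lemma ctr_add: assumes "functional y" shows "ctr y (M + N) = ctr y M + ctr y N"
  using functional_add[OF assms, of "\<lambda>i. M (i, _)" "\<lambda>i. N (i, _)"]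
  by (simp add: ctr_def fun_eq_iff plus_fun_def)

lemma ctr_sc: assumes "functional y" shows "ctr y (sc c M) = sc c (ctr y M)"
  using functional_sc[OF assms, of c "\<lambda>i. M (i, _)"]
  by (simp add: ctr_def fun_eq_iff sc_def)

lemma linear_ctr: "functional y \<Longrightarrow> Vector_Spaces.linear sc sc (ctr y)"
  by (simp add: linear_sc_iff ctr_add ctr_sc)

lemma ctr_0: "functional y \<Longrightarrow> ctr y 0 = 0"
  using ctr_sc[of y 0 0] by simp

lemma ctr_diff: "functional y \<Longrightarrow> ctr y (M - N) = ctr y M - ctr y N"
  using ctr_add[of y "M - N" N] by simp

lemma ctr_fun_add: "ctr (y + z) N = ctr y N + ctr z N"
  by (auto simp: ctr_def)

lemma ctr_fun_sc: "ctr (sc c y) N = sc c (ctr y N)"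
  by (simp add: ctr_def fun_eq_iff sc_apply)

lemma ctr_tens: "functional y \<Longrightarrow> ctr y (tens f u) = sc (y f) u"
  using functional_sc[of y "u _" f] by (simp add: ctr_def tens_def fun_eq_iff sc_def mult.commute)

definition TP :: "('i \<Rightarrow> 'a::field) set \<Rightarrow> ('j \<Rightarrow> 'a) set \<Rightarrow> ('i \<times> 'j \<Rightarrow> 'a) set" where
  "TP A B = fn.span {tens f u | f u. f \<in> A \<and> u \<in> B}"

lemma subspace_TP [simp]: "fn.subspace (TP A B)"
  by (simp add: TP_def)

lemma tens_in_TP: "f \<in> A \<Longrightarrow> u \<in> B \<Longrightarrow> tens f u \<in> TP A B"
  unfolding TP_def by (rule fn.span_base) blast

lemma TP_minimal:
  assumes "\<And>f u. f \<in> A \<Longrightarrow> u \<in> B \<Longrightarrow> tens f u \<in> W" "fn.subspace W" shows "TP A B \<subseteq> W"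
  unfolding TP_def by (rule fn.span_minimal) (use assms in auto)

lemma TP_mono: "A \<subseteq> A' \<Longrightarrow> B \<subseteq> B' \<Longrightarrow> TP A B \<subseteq> TP A' B'"
  by (rule TP_minimal) (auto intro: tens_in_TP)

lemma fin_gen_TP:
  assumes "fn.fin_gen A" "fn.fin_gen B" shows "fn.fin_gen (TP A B)"
proof -
  obtain S T where S: "finite S" "A \<subseteq> fn.span S" and T: "finite T" "B \<subseteq> fn.span T"
    using assms unfolding fn.fin_gen_def by blast
  let ?R = "(\<lambda>(f, u). tens f u) ` (S \<times> T)"
  have 1: "tens f u \<in> fn.span ?R" if "f \<in> S" "u \<in> fn.span T" for f u
  proof (rule fn.span_induct_alt[where h="\<lambda>u. tens f u \<in> fn.span ?R", OF that(2)])
    show "tens f 0 \<in> fn.span ?R" by (simp add: tens_simps fn.span_zero)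
  next
    fix c x y assume "x \<in> T" and y: "tens f y \<in> fn.span ?R"
    then have "tens f x \<in> fn.span ?R" using that(1) by (intro fn.span_base image_eqI[of _ _ "(f, x)"]) auto
    then show "tens f (sc c x + y) \<in> fn.span ?R"
      using y by (simp add: tens_simps fn.span_add fn.span_scale)
  qed
  have 2: "tens f u \<in> fn.span ?R" if "f \<in> fn.span S" "u \<in> fn.span T" for f u
  proof (rule fn.span_induct_alt[where h="\<lambda>f. tens f u \<in> fn.span ?R", OF that(1)])
    show "tens 0 u \<in> fn.span ?R" by (simp add: tens_simps fn.span_zero)
  next
    fix c x y assume "x \<in> S" and y: "tens y u \<in> fn.span ?R"
    then show "tens (sc c x + y) u \<in> fn.span ?R"
      using 1[OF _ that(2)] by (simp add: tens_simps fn.span_add fn.span_scale)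
  qed
  have "TP A B \<subseteq> fn.span ?R" by (rule TP_minimal) (use 2 S(2) T(2) in blast, rule fn.subspace_span)
  moreover have "finite ?R" using S(1) T(1) by simp
  ultimately show ?thesis unfolding fn.fin_gen_def by (intro exI[of _ ?R] conjI)
qed

lemma ctr_TP:
  assumes y: "functional y" and "N \<in> TP A B" "fn.subspace B" shows "ctr y N \<in> B"
proof -
  have "TP A B \<subseteq> {N. ctr y N \<in> B}"
    by (rule TP_minimal)
       (auto simp: fn.subspace_def ctr_0 ctr_add ctr_sc ctr_tens y
         intro: fn.subspace_0 fn.subspace_add fn.subspace_scale assms(3))
  then show ?thesis using assms(2) by auto
qed

text \<open>Each \<open>g\<close> is \<open>sc (y g) f\<close> plus a vector killed by
  \<open>y\<close>, so subtracting \<open>tens f (ctr y N)\<close> removes exactly the component of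
  \<open>N\<close> along \<open>f\<close>.\<close>

lemma TP_split:
  fixes A :: "('i \<Rightarrow> 'a::field) set" and B :: "('j \<Rightarrow> 'a) set"
  assumes y: "functional y" and A: "fn.subspace A" and B: "fn.subspace B"
    and f: "f \<in> A" "y f = 1" and N: "N \<in> TP A B"
  shows "N - tens f (ctr y N) \<in> TP {g \<in> A. y g = 0} B"
proof -
  let ?T = "TP {g \<in> A. y g = 0} B"
  define r where "r N = N - tens f (ctr y N)" for N :: "'i \<times> 'j \<Rightarrow> 'a"
  have add: "r (M + N) = r M + r N" and scale: "r (sc c N) = sc c (r N)" for c M N
    by (simp_all add: r_def ctr_add ctr_sc y tens_simps fn.scale_right_diff_distrib)
  have "TP A B \<subseteq> {N. r N \<in> ?T}"
  proof (rule TP_minimal)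
    fix g u assume g: "g \<in> A" "u \<in> B"
    have "r (tens g u) = tens (g - sc (y g) f) u"
      by (simp add: r_def g ctr_tens y tens_simps)
    also have "\<dots> \<in> ?T" using g f A
      by (intro tens_in_TP) (auto simp: functional_simps[OF y] intro: fn.subspace_diff fn.subspace_scale)
    finally show "tens g u \<in> {N. r N \<in> ?T}" by simp
  next
    have "r 0 = 0" using scale[of 0 0] by simp
    then show "fn.subspace {N. r N \<in> ?T}"
      by (auto simp: fn.subspace_def add scale intro: fn.subspace_0 fn.subspace_add fn.subspace_scale subspace_TP)
  qed
  then show ?thesis using N by (auto simp: r_def)
qed

lemma subspace_ctr_vimage:
  "functional y \<Longrightarrow> fn.subspace B \<Longrightarrow> fn.subspace {N. ctr y N \<in> B}"
  by (simp add: fn.subspace_def ctr_0 ctr_add ctr_sc)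

lemma ctr_TP_kernel:
  assumes y: "functional y" and N: "N \<in> TP {g \<in> A. y g = 0} B" shows "ctr y N = 0"
proof -
  have "TP {g \<in> A. y g = 0} B \<subseteq> {N. ctr y N \<in> {0}}"
  proof (rule TP_minimal)
    show "tens f u \<in> {N. ctr y N \<in> {0}}" if "f \<in> {g \<in> A. y g = 0}" for f u
      using that by (simp add: ctr_tens y)
    show "fn.subspace {N. ctr y N \<in> {0}}" by (rule subspace_ctr_vimage[OF y fn.subspace_single_0])
  qed
  then show ?thesis using N by blast
qed

lemma TP_kernel:
  assumes y: "functional y" and A: "fn.subspace A" and B: "fn.subspace B"
  shows "TP {g \<in> A. y g = 0} B = {N \<in> TP A B. ctr y N = 0}"
proof (intro equalityI subsetI CollectI conjI)
  fix N assume N: "N \<in> TP {g \<in> A. y g = 0} B"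
  then show "N \<in> TP A B" using TP_mono[of "{g \<in> A. y g = 0}" A B B] by blast
  show "ctr y N = 0" using ctr_TP_kernel[OF y N] .
next
  fix N assume "N \<in> {N \<in> TP A B. ctr y N = 0}"
  then have N: "N \<in> TP A B" "ctr y N = 0" by simp_all
  show "N \<in> TP {g \<in> A. y g = 0} B"
  proof (cases "\<exists>g\<in>A. y g \<noteq> 0")
    case True
    then obtain g where g: "g \<in> A" "y g \<noteq> 0" by blast
    then have f: "sc (1 / y g) g \<in> A" "y (sc (1 / y g) g) = 1"
      using A y by (simp_all add: functional_sc[of y] fn.subspace_scale)
    show ?thesis using TP_split[OF y A B f N(1)] N(2) by (simp add: tens_0_right)
  next
    case False
    then have "{g \<in> A. y g = 0} = A" by blast
    with N(1) show ?thesis by simp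
  qed
qed

lemma linear_tens_left: "Vector_Spaces.linear sc sc (\<lambda>f. tens f x)"
  by (simp add: linear_sc_iff tens_simps)

lemma tens_eq_0_imp:
  assumes "tens f x = 0" "x \<noteq> 0" shows "f = 0"
proof (rule ext)
  fix i
  from assms(2) obtain j where "x j \<noteq> 0" by (auto simp: fun_eq_iff)
  moreover have "f i * x j = 0" using fun_cong[OF assms(1), of "(i, j)"] by (simp add: tens_def)
  ultimately show "f i = 0 i" by simp
qed

lemma functional_tens_left: assumes "functional s" shows "functional (\<lambda>f. s (tens f x))"
  by (rule functionalI) (simp_all add: tens_simps functional_simps[OF assms])

section \<open>Adding all tensors with a given second factor\<close>

definition tcol :: "('i \<Rightarrow> 'a::field) set \<Rightarrow> ('j \<Rightarrow> 'a) \<Rightarrow> ('i \<times> 'j \<Rightarrow> 'a) set" where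
  "tcol A x = (\<lambda>f. tens f x) ` A"

text \<open>For a subspace \<open>W\<close> this is the annihilator in \<open>A\<close> of the
  column \<open>x\<close> of the matrices in \<open>ann W\<close>, that is of the functionals
  \<open>s (tens . x)\<close>. Its codimension in \<open>A\<close> is the dimension of the space of
  these columns.\<close>

definition slice :: "('i \<Rightarrow> 'a::field) set \<Rightarrow> ('i \<times> 'j \<Rightarrow> 'a) set \<Rightarrow> ('j \<Rightarrow> 'a) \<Rightarrow> ('i \<Rightarrow> 'a) set" where
  "slice A W x = {f \<in> A. tens f x \<in> W}"

text \<open>Dually, \<open>ann (add_col A W x)\<close> consists of the matrices of
  \<open>ann W\<close> that kill \<open>x\<close>, see \<open>mem_ann_add_col\<close>.\<close>

definition add_col :: "('i \<Rightarrow> 'a::field) set \<Rightarrow> ('i \<times> 'j \<Rightarrow> 'a) set \<Rightarrow> ('j \<Rightarrow> 'a) \<Rightarrow> ('i \<times> 'j \<Rightarrow> 'a) set" where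
  "add_col A W x = fn.span (W \<union> tcol A x)"

lemma subspace_col: "fn.subspace A \<Longrightarrow> fn.subspace (tcol A x)"
  unfolding tcol_def by (rule ff.linear_subspace_image[OF linear_tens_left])

lemma fin_gen_col: "fn.fin_gen A \<Longrightarrow> fn.fin_gen (tcol A x)"
  unfolding tcol_def by (rule ff.fin_gen_image[OF linear_tens_left])

lemma subspace_slice: assumes "fn.subspace A" "fn.subspace W" shows "fn.subspace (slice A W x)"
  unfolding slice_def fn.subspace_def
  using assms by (simp add: tens_simps fn.subspace_0 fn.subspace_add fn.subspace_scale)

lemma fin_gen_slice: "fn.fin_gen A \<Longrightarrow> fn.fin_gen (slice A W x)"
  by (rule fn.fin_gen_subset[of _ A]) (simp_all add: slice_def)

text \<open>The map \<open>f \<mapsto> tens f x\<close> is injective for nonzero \<open>x\<close>,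
  so \<open>W \<inter> tcol A x\<close> is a copy of the slice; the rest is the dimension formula
  for sums.\<close>

lemma dim_add_col:
  assumes A: "fn.subspace A" "fn.fin_gen A" and W: "fn.subspace W" "fn.fin_gen W" and x: "x \<noteq> 0"
  shows "fn.dim (add_col A W x) + fn.dim (slice A W x) = fn.dim W + fn.dim A"
proof -
  have inj: "fn.dim ((\<lambda>f. tens f x) ` S) = fn.dim S" if "fn.subspace S" "fn.fin_gen S" for S
    using ff.dim_inj_image[OF linear_tens_left that] tens_eq_0_imp x by blast
  have "W \<inter> tcol A x = (\<lambda>f. tens f x) ` slice A W x"
    by (auto simp: tcol_def slice_def)
  then have "fn.dim (W \<inter> tcol A x) = fn.dim (slice A W x)"
    using inj[OF subspace_slice[OF A(1) W(1)] fin_gen_slice[OF A(2)]] by simp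
  moreover have "fn.dim (tcol A x) = fn.dim A" using inj[OF A] by (simp add: tcol_def)
  ultimately show ?thesis
    using fn.dim_sum_Int[OF W subspace_col[OF A(1), of x] fin_gen_col[OF A(2), of x]] by (simp add: add_col_def)
qed

lemma subspace_add_col [simp]: "fn.subspace (add_col A W x)"
  by (simp add: add_col_def)

lemma fin_gen_add_col: "fn.fin_gen A \<Longrightarrow> fn.fin_gen W \<Longrightarrow> fn.fin_gen (add_col A W x)"
  unfolding add_col_def by (intro fn.fin_gen_span fn.fin_gen_Un fin_gen_col)

lemma add_col_superset: "W \<subseteq> add_col A W x"
  unfolding add_col_def using fn.span_superset by blast

lemma tens_in_add_col: "f \<in> A \<Longrightarrow> tens f x \<in> add_col A W x"
  unfolding add_col_def tcol_def by (rule fn.span_base) blast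

lemma add_col_minimal:
  "W \<subseteq> T \<Longrightarrow> (\<And>f. f \<in> A \<Longrightarrow> tens f x \<in> T) \<Longrightarrow> fn.subspace T \<Longrightarrow> add_col A W x \<subseteq> T"
  unfolding add_col_def tcol_def by (rule fn.span_minimal) auto

lemma mem_ann_add_col:
  "s \<in> ann (add_col A W x) \<longleftrightarrow> s \<in> ann W \<and> (\<forall>f\<in>A. s (tens f x) = 0)"
  unfolding add_col_def ann_span by (auto simp: ann_def tcol_def)

lemma TP_insert:
  assumes "fn.subspace X"
  shows "TP A (fn.span (insert x X)) = add_col A (TP A X) x"
proof
  show "TP A (fn.span (insert x X)) \<subseteq> add_col A (TP A X) x"
  proof (rule TP_minimal)
    fix f u assume f: "f \<in> A" and "u \<in> fn.span (insert x X)"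
    moreover have "fn.span X = X" using assms by simp
    ultimately obtain k where "u - sc k x \<in> X" unfolding fn.span_insert by blast
    then have "tens f (u - sc k x) + sc k (tens f x) \<in> add_col A (TP A X) x"
      using tens_in_TP[OF f] add_col_superset[of "TP A X" A x] tens_in_add_col[OF f]
      by (intro fn.subspace_add fn.subspace_scale subspace_add_col) blast+
    then show "tens f u \<in> add_col A (TP A X) x" by (simp add: tens_simps)
  qed simp
next
  have "X \<subseteq> fn.span (insert x X)" "x \<in> fn.span (insert x X)"
    using fn.span_superset[of "insert x X"] by blast+
  then show "add_col A (TP A X) x \<subseteq> TP A (fn.span (insert x X))"
    by (intro add_col_minimal TP_mono tens_in_TP) simp_all
qed

text \<open>Contract with a functional taking the value 1 at \<open>f\<close>: from
  \<open>tens f x\<close> in \<open>TP A X\<close> it would produce \<open>x\<close> in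
  \<open>X\<close>.\<close>

lemma slice_TP:
  assumes A: "fn.subspace A" and X: "fn.subspace X" and x: "x \<notin> X"
  shows "slice A (TP A X) x = {0}"
proof -
  have "f = 0" if "tens f x \<in> TP A X" for f
  proof (rule ccontr)
    assume "f \<noteq> 0"
    then have "f \<notin> {0}" by simp
    from functional_separate[OF fn.subspace_single_0 this] obtain y where y: "functional y" "y f = 1" by blast
    have "ctr y (tens f x) \<in> X" by (rule ctr_TP[OF y(1) that X])
    then show False using x y by (simp add: ctr_tens fn.scale_one)
  qed
  moreover have "0 \<in> slice A (TP A X) x"
    using fn.subspace_0[OF A] fn.subspace_0[OF subspace_TP] by (simp add: slice_def tens_simps)
  ultimately show ?thesis unfolding slice_def by blast
qed

lemma dim_TP_insert:
  assumes A: "fn.subspace A" "fn.fin_gen A" and X: "fn.subspace X" "fn.fin_gen X" and x: "x \<notin> X"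
  shows "fn.dim (TP A (fn.span (insert x X))) = fn.dim (TP A X) + fn.dim A"
proof -
  have "x \<noteq> 0" using x fn.subspace_0[OF X(1)] by metis
  then show ?thesis
    using dim_add_col[OF A subspace_TP fin_gen_TP[OF A(2) X(2)], of x] slice_TP[OF A(1) X(1) x]
    by (simp add: TP_insert[OF X(1)] fn.dim_zero_space)
qed

lemma dim_kernel:
  assumes A: "fn.subspace A" "fn.fin_gen A" and y: "functional y" and f: "f \<in> A" "y f \<noteq> 0"
  shows "Suc (fn.dim {g \<in> A. y g = 0}) = fn.dim A"
proof -
  let ?K = "{g \<in> A. y g = 0}"
  have K: "fn.subspace ?K" using subspace_Int_kernel[OF A(1) y] .
  have "fn.fin_gen ?K" by (rule fn.fin_gen_subset[OF _ A(2)]) blast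
  then have "fn.dim (fn.span (insert f ?K)) = Suc (fn.dim ?K)"
    using fn.dim_insert_notin[OF K] f(2) by simp
  moreover have "fn.span (insert f ?K) = A"
  proof
    show "fn.span (insert f ?K) \<subseteq> A" by (rule fn.span_minimal[OF _ A(1)]) (use f in blast)
    show "A \<subseteq> fn.span (insert f ?K)"
    proof
      fix g assume g: "g \<in> A"
      have "g - sc (y g / y f) f \<in> ?K"
        using g f A(1) by (simp add: functional_simps[OF y] fn.subspace_diff fn.subspace_scale)
      then have "g - sc (y g / y f) f \<in> fn.span ?K" by (rule fn.span_base)
      then show "g \<in> fn.span (insert f ?K)" unfolding fn.span_insert by blast
    qed
  qed
  ultimately show ?thesis by simp
qed

lemma dim_contract:
  assumes "functional y" "fn.subspace W" "fn.fin_gen W"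
  shows "fn.dim W = fn.dim {N \<in> W. ctr y N = 0} + fn.dim (ctr y ` W)"
  by (rule ff.rank_nullity[OF linear_ctr[OF assms(1)] assms(2,3)])

lemma ctr_image_TP:
  assumes y: "functional y" and A: "fn.subspace A" and X: "fn.subspace X" and f: "f \<in> A" "y f \<noteq> 0"
  shows "ctr y ` TP A X = X"
proof
  show "ctr y ` TP A X \<subseteq> X" using ctr_TP[OF y _ X] by blast
  show "X \<subseteq> ctr y ` TP A X"
  proof
    fix u assume u: "u \<in> X"
    have "u = ctr y (tens f (sc (1 / y f) u))" using f(2) by (simp add: ctr_tens y)
    moreover have "tens f (sc (1 / y f) u) \<in> TP A X" using f(1) u X by (simp add: tens_in_TP fn.subspace_scale)
    ultimately show "u \<in> ctr y ` TP A X" by blast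
  qed
qed

lemma dim_TP_kernel:
  assumes y: "functional y" and A: "fn.subspace A" "fn.fin_gen A" and X: "fn.subspace X" "fn.fin_gen X"
    and f: "f \<in> A" "y f \<noteq> 0"
  shows "fn.dim (TP A X) = fn.dim (TP {g \<in> A. y g = 0} X) + fn.dim X"
  using dim_contract[OF y subspace_TP fin_gen_TP[OF A(2) X(2)]]
  by (simp add: ctr_image_TP[OF y A(1) X(1) f] TP_kernel[OF y A(1) X(1)])

text \<open>Rank one tensors over a basis of the first factor are independent modulo \<open>TP A X\<close>.\<close>

lemma dim_ge_rank_one:
  assumes A: "fn.fin_gen A" and A': "fn.subspace A'" "fn.fin_gen A'" and X: "fn.subspace X" "fn.fin_gen X"
    and W: "fn.subspace W" "fn.fin_gen W" "TP A X \<subseteq> W"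
    and h: "functional h" "\<exists>f\<in>A'. h f \<noteq> 0"
    and ex: "\<forall>f\<in>A'. h f \<noteq> 0 \<longrightarrow> (\<exists>u. u \<notin> X \<and> tens f u \<in> W)"
  shows "fn.dim (TP A X) + fn.dim A' \<le> fn.dim W"
    and "fn.dim W \<le> fn.dim (TP A X) + fn.dim A' \<Longrightarrow> functional y \<Longrightarrow> \<forall>f\<in>A'. y f = 0 \<Longrightarrow>
      N \<in> W \<Longrightarrow> ctr y N \<in> X"
proof -
  let ?S = "{f \<in> A'. h f \<noteq> 0}"
  obtain B where B: "B \<subseteq> ?S" "fn.independent B" "?S \<subseteq> fn.span B" "card B = fn.dim ?S"
    using fn.basis_exists by blast
  from h(2) obtain f0 where f0: "f0 \<in> A'" "h f0 \<noteq> 0" by blast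
  \<comment> \<open>The complement of a hyperplane spans: a kernel vector \<open>f\<close> is
    \<open>(f + f0) - f0\<close>, both terms outside the kernel. So a basis of \<open>A'\<close> can
    be chosen among the vectors that carry a rank one tensor.\<close>
  have "A' \<subseteq> fn.span ?S"
  proof
    fix f assume f: "f \<in> A'"
    show "f \<in> fn.span ?S"
    proof (cases "h f = 0")
      case True
      then have "f + f0 \<in> ?S" "f0 \<in> ?S"
        using f f0 A'(1) by (simp_all add: functional_simps[OF h(1)] fn.subspace_add)
      then have "(f + f0) - f0 \<in> fn.span ?S" by (intro fn.span_diff fn.span_base)
      then show ?thesis by simp
    next
      case False then show ?thesis using f by (intro fn.span_base) simp
    qed
  qed
  then have "fn.span ?S = A'" using fn.span_subspace[of ?S A'] A'(1) by blast
  then have cB: "card B = fn.dim A'" using B(4) fn.dim_span[of ?S] by simp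
  have fB: "finite B" using fn.independent_subset_fin_gen(1)[OF A'(2) B(2)] B(1) by blast
  have "\<forall>b\<in>B. \<exists>u. u \<notin> X \<and> tens b u \<in> W" using ex B(1) by blast
  then obtain u where u: "\<And>b. b \<in> B \<Longrightarrow> u b \<notin> X" "\<And>b. b \<in> B \<Longrightarrow> tens b (u b) \<in> W" by metis
  define T where "T E = fn.span (TP A X \<union> (\<lambda>b. tens b (u b)) ` E)" for E
  have T_ctr: "ctr y N \<in> X" if y: "functional y" "\<And>b. b \<in> E \<Longrightarrow> y b = 0" and N: "N \<in> T E" for E y N
  proof -
    have "T E \<subseteq> {N. ctr y N \<in> X}" unfolding T_def
    proof (rule fn.span_minimal[OF _ subspace_ctr_vimage[OF y(1) X(1)]])
      have "ctr y (tens b (u b)) \<in> X" if "b \<in> E" for b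
        using y that fn.subspace_0[OF X(1)] by (simp add: ctr_tens)
      then show "TP A X \<union> (\<lambda>b. tens b (u b)) ` E \<subseteq> {N. ctr y N \<in> X}"
        using ctr_TP[OF y(1) _ X(1)] by blast
    qed
    then show ?thesis using N by blast
  qed
  have fT: "fn.fin_gen (T E)" if "finite E" for E
    unfolding T_def using that
    by (intro fn.fin_gen_span fn.fin_gen_Un fin_gen_TP A X fn.fin_gen_finite) simp
  have dT: "fn.dim (T E) = fn.dim (TP A X) + card E" if "finite E" "E \<subseteq> B" for E
    using that
  proof (induction E rule: finite_induct)
    case empty show ?case by (simp add: T_def)
  next
    case (insert b E)
    from functional_extend[OF B(2), of "\<lambda>c. if c = b then 1 else 0"]
    obtain y where y: "functional y" "\<forall>c\<in>B. y c = (if c = b then 1 else 0)" by blast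
    have b: "b \<in> B" using insert.prems by simp
    \<comment> \<open>The functional dual to \<open>b\<close> contracts everything adjoined so far
      into \<open>X\<close>, but contracts this tensor to \<open>u b\<close>.\<close>
    have "tens b (u b) \<notin> T E"
    proof
      assume "tens b (u b) \<in> T E"
      moreover have "y c = 0" if "c \<in> E" for c
        using y(2) that insert.prems insert.hyps(2) by (metis insert_iff subsetD)
      ultimately have "ctr y (tens b (u b)) \<in> X" using T_ctr[OF y(1)] by blast
      then show False using u(1)[OF b] y(2) b by (simp add: ctr_tens y(1))
    qed
    then have "fn.dim (fn.span (insert (tens b (u b)) (T E))) = Suc (fn.dim (T E))"
      using fn.dim_insert_notin[of "T E"] fT[OF insert.hyps(1)] by (simp add: T_def)
    moreover have "fn.span (insert (tens b (u b)) (T E)) = T (insert b E)"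
      unfolding T_def by (simp add: fn.span_insert fn.span_span)
    ultimately show ?case using insert by simp
  qed
  have TW: "T B \<subseteq> W" unfolding T_def
    by (rule fn.span_minimal[OF _ W(1)]) (use W(3) u(2) in blast)
  have d: "fn.dim (T B) = fn.dim (TP A X) + fn.dim A'" using dT[OF fB] cB by simp
  then show "fn.dim (TP A X) + fn.dim A' \<le> fn.dim W" using fn.dim_mono_fin_gen[OF TW W(2)] by simp
  show "ctr y N \<in> X" if "fn.dim W \<le> fn.dim (TP A X) + fn.dim A'" "functional y"
    "\<forall>f\<in>A'. y f = 0" "N \<in> W"
  proof -
    have "T B = W" using fn.subspace_dim_eq_imp_eq[OF _ TW W(2)] that(1) d by (simp add: T_def)
    then show ?thesis using T_ctr[OF that(2), of B N] that(3,4) B(1) by blast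
  qed
qed

section \<open>Range-compatible maps\<close>

definition is_local :: "('i \<Rightarrow> 'a::field) set \<Rightarrow> ('j \<Rightarrow> 'a) set \<Rightarrow> ('i \<times> 'j \<Rightarrow> 'a) set \<Rightarrow>
    ((('i \<times> 'j \<Rightarrow> 'a) \<Rightarrow> 'a) \<Rightarrow> ('i \<Rightarrow> 'a) \<Rightarrow> 'a) \<Rightarrow> bool" where
  "is_local V U W F \<longleftrightarrow> (\<exists>u\<in>U. \<forall>s\<in>ann W. \<forall>f\<in>V. F s f = s (tens f u))"

text \<open>The entries of the matrix encoded by \<open>s\<close> are the values \<open>s (tens f u)\<close>; the quotient by
  \<open>X\<close> records the columns already known to vanish.\<close>

locale range_compatible =
  fixes V :: "('i \<Rightarrow> 'a::field) set" and U X :: "('j \<Rightarrow> 'a) set" and W :: "('i \<times> 'j \<Rightarrow> 'a) set"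
    and F :: "(('i \<times> 'j \<Rightarrow> 'a) \<Rightarrow> 'a) \<Rightarrow> ('i \<Rightarrow> 'a) \<Rightarrow> 'a"
  assumes V: "fn.subspace V" "fn.fin_gen V" and U: "fn.subspace U" "fn.fin_gen U"
    and X: "fn.subspace X" "X \<subseteq> U" and W: "fn.subspace W" "TP V X \<subseteq> W" "W \<subseteq> TP V U"
    and F_functional: "s \<in> ann W \<Longrightarrow> functional (F s)"
    and F_add: "s \<in> ann W \<Longrightarrow> t \<in> ann W \<Longrightarrow> f \<in> V \<Longrightarrow> F (s + t) f = F s f + F t f"
    and F_range: "s \<in> ann W \<Longrightarrow> f \<in> V \<Longrightarrow> (\<And>u. u \<in> U \<Longrightarrow> s (tens f u) = 0) \<Longrightarrow> F s f = 0"

lemma fin_gen_span_insert: "fn.fin_gen X \<Longrightarrow> fn.fin_gen (fn.span (insert x X))"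
  using fn.fin_gen_span[OF fn.fin_gen_Un[OF fn.fin_gen_finite[of "{x}"]]] by simp

lemma functional_proportional:
  assumes V: "fn.subspace V" and v: "functional v" and h: "functional h"
    and ker: "\<And>f. f \<in> V \<Longrightarrow> v f = 0 \<Longrightarrow> h f = 0"
  shows "\<exists>c. \<forall>f\<in>V. h f = c * v f"
proof (cases "\<exists>f\<in>V. v f \<noteq> 0")
  case True
  then obtain g where g: "g \<in> V" "v g \<noteq> 0" by blast
  have "h f = h g / v g * v f" if f: "f \<in> V" for f
  proof -
    have "h (f - sc (v f / v g) g) = 0"
      by (rule ker) (use f g V in \<open>simp_all add: functional_simps[OF v] fn.subspace_diff fn.subspace_scale\<close>)
    then show ?thesis by (simp add: functional_simps[OF h])
  qed
  then show ?thesis by blast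
next
  case False
  then have "\<forall>f\<in>V. h f = 0 * v f" using ker by simp
  then show ?thesis by blast
qed

lemma ann_dual_vectors:
  assumes "tens f x \<notin> fn.span (insert (tens g x) W)"
  shows "\<exists>s\<in>ann W. s (tens f x) = 1 \<and> s (tens g x) = 0"
proof -
  from functional_separate[OF fn.subspace_span assms]
  obtain s where s: "functional s" "\<forall>e\<in>fn.span (insert (tens g x) W). s e = 0" "s (tens f x) = 1" by blast
  then have "s \<in> ann W" "s (tens g x) = 0"
    using fn.span_base[of _ "insert (tens g x) W"] by (auto simp: ann_def)
  with s(3) show ?thesis by blast
qed

lemma exists_dual_vector:
  assumes V: "fn.subspace V" "fn.fin_gen V" and W: "fn.subspace W"
    and g: "g \<in> V" and d: "fn.dim (slice V W x) + 2 \<le> fn.dim V"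
  shows "\<exists>f\<in>V. \<exists>s\<in>ann W. s (tens f x) = 1 \<and> s (tens g x) = 0"
proof -
  let ?T = "fn.span (insert g (slice V W x))"
  have fs: "fn.fin_gen (slice V W x)" by (rule fin_gen_slice[OF V(2)])
  have "fn.dim ?T \<le> Suc (fn.dim (slice V W x))" by (rule fn.dim_span_insert_le[OF fs])
  then have "\<exists>f\<in>V. f \<notin> ?T" using d
    by (intro fn.exists_notin_smaller[OF V(2)] fn.subspace_span fin_gen_span_insert[OF fs]) simp
  then obtain f where f: "f \<in> V" "f \<notin> ?T" by blast
  have "tens f x \<notin> fn.span (insert (tens g x) W)"
  proof
    assume "tens f x \<in> fn.span (insert (tens g x) W)"
    moreover have "fn.span W = W" using W by simp
    ultimately obtain k where "tens f x - sc k (tens g x) \<in> W" unfolding fn.span_insert by blast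
    then have "f - sc k g \<in> slice V W x"
      using f(1) g V(1) by (simp add: slice_def tens_simps fn.subspace_diff fn.subspace_scale)
    then have "f - sc k g \<in> fn.span (slice V W x)" by (rule fn.span_base)
    then show False using f(2) unfolding fn.span_insert by blast
  qed
  from ann_dual_vectors[OF this] f(1) show ?thesis by blast
qed

lemma exists_dual_pair:
  assumes V: "fn.subspace V" "fn.fin_gen V" and W: "fn.subspace W"
    and d: "fn.dim (slice V W x) + 2 \<le> fn.dim V"
  shows "\<exists>f\<in>V. \<exists>g\<in>V. \<exists>s\<in>ann W. \<exists>t\<in>ann W. s (tens f x) = 1 \<and> s (tens g x) = 0 \<and>
    t (tens g x) = 1 \<and> t (tens f x) = 0"
proof -
  have "0 \<in> V" using V(1) by (rule fn.subspace_0)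
  from exists_dual_vector[OF V W this d]
  obtain f s where f: "f \<in> V" "s \<in> ann W" "s (tens f x) = 1" by blast
  from exists_dual_vector[OF V W f(1) d]
  obtain g t where g: "g \<in> V" "t \<in> ann W" "t (tens g x) = 1" "t (tens f x) = 0" by blast
  define r where "r = s - sc (s (tens g x)) t"
  have "r \<in> ann W" unfolding r_def using f(2) g(2) by (intro ann_minus ann_scale)
  moreover have "r (tens f x) = 1" "r (tens g x) = 0" using f g by (simp_all add: r_def sc_apply)
  ultimately show ?thesis using f g by blast
qed

text \<open>An additive map that sends every vector of a space of dimension at least two to a
  multiple of itself is a homothety; the vectors are here the columns \<open>s (tens . x)\<close>.
  On a line every additive map multiplies each vector by some factor, whence the bound on the
  slice.\<close>

lemma common_factor:
  assumes V: "fn.subspace V" "fn.fin_gen V" and W: "fn.subspace W"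
    and F_add: "\<And>s t f. s \<in> ann W \<Longrightarrow> t \<in> ann W \<Longrightarrow> f \<in> V \<Longrightarrow> F (s + t) f = F s f + F t f"
    and pr: "\<forall>s\<in>ann W. \<exists>c. \<forall>f\<in>V. F s f = c * s (tens f x)"
    and d: "fn.dim (slice V W x) + 2 \<le> fn.dim V"
  shows "\<exists>c. \<forall>s\<in>ann W. \<forall>f\<in>V. F s f = c * s (tens f x)"
proof -
  from exists_dual_pair[OF V W d] obtain f1 f2 s1 s2 where f: "f1 \<in> V" "f2 \<in> V" and s: "s1 \<in> ann W" "s2 \<in> ann W"
    and v: "s1 (tens f1 x) = 1" "s1 (tens f2 x) = 0" "s2 (tens f2 x) = 1" "s2 (tens f1 x) = 0" by blast
  obtain c1 c2 c3 where c: "\<forall>f\<in>V. F s1 f = c1 * s1 (tens f x)" "\<forall>f\<in>V. F s2 f = c2 * s2 (tens f x)"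
      "\<forall>f\<in>V. F (s1 + s2) f = c3 * (s1 + s2) (tens f x)"
    using bspec[OF pr, OF s(1)] bspec[OF pr, OF s(2)] bspec[OF pr, OF ann_plus[OF s]] by blast
  have "c1 = c3" using F_add[OF s f(1)] c f(1) v by simp
  moreover have "c2 = c3" using F_add[OF s f(2)] c f(2) v by simp
  ultimately have c12: "c2 = c1" by simp
  have "F s f = c1 * s (tens f x)" if sW: "s \<in> ann W" and fV: "f \<in> V" for s f
  proof -
    obtain d e1 e2 where d: "\<forall>f\<in>V. F s f = d * s (tens f x)"
      "\<forall>f\<in>V. F (s + s1) f = e1 * (s + s1) (tens f x)" "\<forall>f\<in>V. F (s + s2) f = e2 * (s + s2) (tens f x)"
      using bspec[OF pr, OF sW] bspec[OF pr, OF ann_plus[OF sW s(1)]] bspec[OF pr, OF ann_plus[OF sW s(2)]] by blast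
    \<comment> \<open>If the factor \<open>d\<close> of \<open>s\<close> differed from
      \<open>c1\<close>, these two relations would make the column of \<open>s\<close> a multiple of
      the column of \<open>s1\<close> and of that of \<open>s2\<close>, which are independent; so it
      would be zero and any factor would do.\<close>
    have 1: "(e1 - d) * s (tens f x) = (c1 - e1) * s1 (tens f x)" if "f \<in> V" for f
      using F_add[OF sW s(1) that] d c that by (simp add: algebra_simps)
    have 2: "(e2 - d) * s (tens f x) = (c1 - e2) * s2 (tens f x)" if "f \<in> V" for f
      using F_add[OF sW s(2) that] d c that c12 by (simp add: algebra_simps)
    show ?thesis
    proof (cases "d = c1")
      case True then show ?thesis using d(1) fV by simp
    next
      case False
      have "e1 \<noteq> d" using 1[OF f(1)] v False by auto
      have "e2 \<noteq> d" using 2[OF f(2)] v False by auto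
      have "s (tens f1 x) = 0" using 2[OF f(1)] v \<open>e2 \<noteq> d\<close> by simp
      then have "c1 = e1" using 1[OF f(1)] v by simp
      then have "s (tens f x) = 0" using 1[OF fV] \<open>e1 \<noteq> d\<close> by simp
      then show ?thesis using d(1) fV by simp
    qed
  qed
  then show ?thesis by blast
qed

context range_compatible
begin

lemma fin_gen_X: "fn.fin_gen X"
  by (rule fn.fin_gen_subset[OF X(2) U(2)])

lemma fin_gen_W: "fn.fin_gen W"
  by (rule fn.fin_gen_subset[OF W(3) fin_gen_TP[OF V(2) U(2)]])

lemma F_zero: "f \<in> V \<Longrightarrow> F 0 f = 0"
  using F_add[OF ann_zero ann_zero, of f] by (simp only: add_0_left add_cancel_right_right)

lemma F_diff:
  assumes "s \<in> ann W" "t \<in> ann W" "f \<in> V" shows "F (s - t) f = F s f - F t f"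
  using F_add[OF ann_minus[OF assms(1,2)] assms(2,3)] by simp

lemma F_cong:
  assumes "s \<in> ann W" "t \<in> ann W" "f \<in> V" "\<And>u. u \<in> U \<Longrightarrow> s (tens f u) = t (tens f u)"
  shows "F s f = F t f"
  using F_range[OF ann_minus[OF assms(1,2)] assms(3)] F_diff[OF assms(1-3)] assms(4) by simp

lemma TP_add_col:
  "TP V (fn.span (insert x X)) \<subseteq> add_col V W x"
  unfolding TP_insert[OF X(1)] using W(2) add_col_superset[of W V x]
  by (intro add_col_minimal tens_in_add_col) simp_all

text \<open>The map is unchanged. Fewer matrices are considered, and \<open>x\<close> joins the
  directions on which all of them vanish.\<close>

lemma range_compatible_add_col:
  assumes "x \<in> U"
  shows "range_compatible V U (fn.span (insert x X)) (add_col V W x) F"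
proof (unfold_locales)
  have "ann (add_col V W x) \<subseteq> ann W" by (rule ann_antimono[OF add_col_superset])
  then have a: "s \<in> ann (add_col V W x) \<Longrightarrow> s \<in> ann W" for s by blast
  show "functional (F s)" if "s \<in> ann (add_col V W x)" for s using F_functional a that .
  show "F (s + t) f = F s f + F t f" if "s \<in> ann (add_col V W x)" "t \<in> ann (add_col V W x)" "f \<in> V" for s t f
    using F_add[OF a[OF that(1)] a[OF that(2)] that(3)] .
  show "F s f = 0" if "s \<in> ann (add_col V W x)" "f \<in> V" "\<And>u. u \<in> U \<Longrightarrow> s (tens f u) = 0" for s f
    using F_range[OF a[OF that(1)] that(2,3)] .
  show "fn.span (insert x X) \<subseteq> U" by (rule fn.span_minimal[OF _ U(1)]) (use assms X(2) in simp)
  show "add_col V W x \<subseteq> TP V U"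
    by (rule add_col_minimal) (use W(3) assms in \<open>simp_all add: tens_in_TP\<close>)
  show "TP V (fn.span (insert x X)) \<subseteq> add_col V W x" by (rule TP_add_col)
qed (simp_all add: V U)

lemma range_compatible_minus_local:
  assumes "u \<in> U"
  shows "range_compatible V U X W (\<lambda>s f. F s f - s (tens f u))"
proof (unfold_locales)
  show "functional (\<lambda>f. F s f - s (tens f u))" if "s \<in> ann W" for s
    using functional_minus_fun[OF F_functional[OF that] functional_tens_left[OF annD(1)[OF that], of u]]
    by (simp add: fun_diff_def)
  show "F (s + t) f - (s + t) (tens f u) = F s f - s (tens f u) + (F t f - t (tens f u))"
    if "s \<in> ann W" "t \<in> ann W" "f \<in> V" for s t f
    using F_add[OF that] by simp
  show "F s f - s (tens f u) = 0" if "s \<in> ann W" "f \<in> V" "\<And>u. u \<in> U \<Longrightarrow> s (tens f u) = 0" for s f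
    using F_range[OF that(1,2)] that(3) assms by simp
qed (simp_all add: V U X W)

text \<open>Subtracting the first two equations: the excess \<open>dim W - dim (TP V X)\<close>
  drops by exactly \<open>dim (slice V W x)\<close> when \<open>x\<close> is added.\<close>

lemma dim_add_col_insert:
  assumes x: "x \<in> U" "x \<notin> X"
  shows "fn.dim (add_col V W x) + fn.dim (slice V W x) = fn.dim W + fn.dim V"
    and "fn.dim (TP V (fn.span (insert x X))) = fn.dim (TP V X) + fn.dim V"
    and "fn.dim (TP V X) + fn.dim (slice V W x) \<le> fn.dim W"
proof -
  have x0: "x \<noteq> 0" using x fn.subspace_0[OF X(1)] by metis
  show 1: "fn.dim (add_col V W x) + fn.dim (slice V W x) = fn.dim W + fn.dim V"
    by (rule dim_add_col[OF V W(1) fin_gen_W x0])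
  show 2: "fn.dim (TP V (fn.span (insert x X))) = fn.dim (TP V X) + fn.dim V"
    by (rule dim_TP_insert[OF V X(1) fin_gen_X x(2)])
  have "fn.dim (TP V (fn.span (insert x X))) \<le> fn.dim (add_col V W x)"
    by (rule fn.dim_mono_fin_gen[OF TP_add_col fin_gen_add_col[OF V(2) fin_gen_W]])
  then show "fn.dim (TP V X) + fn.dim (slice V W x) \<le> fn.dim W" using 1 2 by linarith
qed

text \<open>The row \<open>f\<close> of \<open>s\<close> can be killed without changing the column \<open>x\<close> of \<open>s\<close>.\<close>

lemma F_zero_if_row_free:
  assumes x: "x \<in> U" and F0: "\<forall>s\<in>ann (add_col V W x). \<forall>f\<in>V. F s f = 0"
    and s: "s \<in> ann W" and f: "f \<in> V" and sx: "s (tens f x) = 0"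
    and fib: "\<forall>u\<in>U. tens f u \<in> add_col V W x \<longrightarrow> u \<in> fn.span (insert x X)"
  shows "F s f = 0"
proof -
  let ?B = "(\<lambda>u. tens f u) ` U"
  have "Vector_Spaces.linear sc sc (\<lambda>u. tens f u)" by (simp add: linear_sc_iff tens_simps)
  then have B: "fn.subspace ?B" using ff.linear_subspace_image U(1) by blast
  have z: "s e = 0" if "e \<in> add_col V W x" "e \<in> ?B" for e
  proof -
    from that(2) obtain u where u: "e = tens f u" "u \<in> U" by blast
    then have "u \<in> fn.span (insert x X)" using fib that(1) by blast
    moreover have "fn.span X = X" using X(1) by simp
    ultimately obtain k where k: "u - sc k x \<in> X" unfolding fn.span_insert by blast
    then have "s (tens f (u - sc k x)) = 0" using annD(2)[OF s] W(2) tens_in_TP[OF f k] by blast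
    then show ?thesis using u(1) sx by (simp add: tens_simps functional_simps[OF annD(1)[OF s]])
  qed
  \<comment> \<open>\<open>t\<close> has a vanishing row \<open>f\<close>, so \<open>F_range\<close>
    applies to it, and \<open>s - t\<close> annihilates \<open>add_col V W x\<close>, so
    \<open>F0\<close> applies to it.\<close>
  obtain t where t: "functional t" "\<forall>e\<in>add_col V W x. t e = s e" "\<forall>e\<in>?B. t e = 0"
    using functional_agree_zero[OF subspace_add_col B annD(1)[OF s] z] by blast
  have tW: "t \<in> ann W" using t(1,2) s add_col_superset[of W V x] unfolding ann_def by auto
  have "F t f = 0" by (rule F_range[OF tW f]) (use t(3) in blast)
  moreover have "s - t \<in> ann (add_col V W x)"
    using t(1,2) functional_minus_fun[OF annD(1)[OF s] t(1)] by (simp add: ann_def)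
  then have "F (s - t) f = 0" using F0 f by blast
  ultimately show ?thesis using F_diff[OF s tW f] by simp
qed

lemma F_zero_or_rank_one:
  assumes x: "x \<in> U" and F0: "\<forall>s\<in>ann (add_col V W x). \<forall>f\<in>V. F s f = 0"
    and s: "s \<in> ann W" and f: "f \<in> V" and sx: "s (tens f x) = 0" and "F s f \<noteq> 0"
  shows "\<exists>u. u \<notin> fn.span (insert x X) \<and> tens f u \<in> add_col V W x"
proof (rule ccontr)
  assume "\<not> ?thesis"
  then have "\<forall>u\<in>U. tens f u \<in> add_col V W x \<longrightarrow> u \<in> fn.span (insert x X)" by blast
  from F_zero_if_row_free[OF x F0 s f sx this] assms(6) show False by simp
qed

text \<open>By \<open>F_zero_or_rank_one\<close> each \<open>f\<close> in the hyperplane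
  \<open>?K\<close> with \<open>F s f \<noteq> 0\<close> carries a rank one tensor outside
  \<open>TP V (fn.span (insert x X))\<close>. Hence \<open>dim_ge_rank_one\<close> applies to
  \<open>?K\<close>, of dimension \<open>dim V - 1\<close>, with \<open>h = F s\<close>. The second
  claim is its equality case.\<close>

lemma exceptional_bound:
  assumes x: "x \<in> U" and F0: "\<forall>s\<in>ann (add_col V W x). \<forall>f\<in>V. F s f = 0"
    and s: "s \<in> ann W" and f: "f \<in> V" and sx: "s (tens f x) = 0" and nz: "F s f \<noteq> 0"
  shows "fn.dim (TP V (fn.span (insert x X))) + fn.dim V \<le> Suc (fn.dim (add_col V W x))"
    and "fn.dim (add_col V W x) < fn.dim (TP V (fn.span (insert x X))) + fn.dim V \<Longrightarrow>
      N \<in> add_col V W x \<Longrightarrow> ctr (\<lambda>f. s (tens f x)) N \<in> fn.span (insert x X)"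
proof -
  let ?v = "\<lambda>f. s (tens f x)"
  let ?K = "{f \<in> V. ?v f = 0}"
  have v: "functional ?v" by (rule functional_tens_left[OF annD(1)[OF s]])
  have K: "fn.subspace ?K" "fn.fin_gen ?K"
    using subspace_Int_kernel[OF V(1) v] fn.fin_gen_subset[OF _ V(2), of ?K] by auto
  have "\<exists>g\<in>V. ?v g \<noteq> 0"
  proof (rule ccontr)
    assume "\<not> ?thesis"
    then have "s \<in> ann (add_col V W x)" using s by (simp add: mem_ann_add_col)
    then show False using F0 f nz by blast
  qed
  then obtain g where g: "g \<in> V" "?v g \<noteq> 0" by blast
  have dK: "Suc (fn.dim ?K) = fn.dim V" by (rule dim_kernel[where y = ?v, OF V v g])
  have ex: "\<forall>f\<in>?K. F s f \<noteq> 0 \<longrightarrow> (\<exists>u. u \<notin> fn.span (insert x X) \<and> tens f u \<in> add_col V W x)"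
  proof (intro ballI impI)
    fix f assume "f \<in> ?K" and nz: "F s f \<noteq> 0"
    then have "f \<in> V" "s (tens f x) = 0" by simp_all
    from F_zero_or_rank_one[OF x F0 s this nz]
    show "\<exists>u. u \<notin> fn.span (insert x X) \<and> tens f u \<in> add_col V W x" .
  qed
  have h: "\<exists>f\<in>?K. F s f \<noteq> 0" using f sx nz by blast
  note main = dim_ge_rank_one[where A = V and A' = ?K and X = "fn.span (insert x X)" and W = "add_col V W x"
      and h = "F s", OF V(2) K fn.subspace_span fin_gen_span_insert[OF fin_gen_X] subspace_add_col
      fin_gen_add_col[OF V(2) fin_gen_W] TP_add_col F_functional[OF s] h ex]
  show "fn.dim (TP V (fn.span (insert x X))) + fn.dim V \<le> Suc (fn.dim (add_col V W x))"
    using main(1) dK by simp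
  show "ctr ?v N \<in> fn.span (insert x X)"
    if "fn.dim (add_col V W x) < fn.dim (TP V (fn.span (insert x X))) + fn.dim V" "N \<in> add_col V W x"
    by (rule main(2)[OF _ v _ that(2)]) (use that(1) dK in simp_all)
qed

lemma proportional_if_small:
  assumes x: "x \<in> U" and F0: "\<forall>s\<in>ann (add_col V W x). \<forall>f\<in>V. F s f = 0"
    and d: "fn.dim (add_col V W x) + 2 \<le> fn.dim (TP V (fn.span (insert x X))) + fn.dim V"
    and s: "s \<in> ann W"
  shows "\<exists>c. \<forall>f\<in>V. F s f = c * s (tens f x)"
proof (rule functional_proportional[OF V(1) functional_tens_left[OF annD(1)[OF s]] F_functional[OF s]])
  fix f assume "f \<in> V" "s (tens f x) = 0"
  then show "F s f = 0" using exceptional_bound(1)[OF x F0 s] d by force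
qed

lemma local_if_proportional:
  assumes x: "x \<in> U" and pr: "\<forall>s\<in>ann W. \<exists>c. \<forall>f\<in>V. F s f = c * s (tens f x)"
    and d: "fn.dim (slice V W x) + 2 \<le> fn.dim V"
  shows "is_local V U W F"
proof -
  obtain c where c: "\<forall>s\<in>ann W. \<forall>f\<in>V. F s f = c * s (tens f x)"
    using common_factor[OF V W(1) F_add pr d] by blast
  have "\<forall>s\<in>ann W. \<forall>f\<in>V. F s f = s (tens f (sc c x))"
    using c by (simp add: tens_simps ann_def functional_def)
  then show ?thesis unfolding is_local_def using x U(1) fn.subspace_scale by blast
qed

text \<open>One dimension more than \<open>proportional_if_small\<close> allows. Call
  \<open>s\<close> exceptional if \<open>F s\<close> is not a multiple of its column
  \<open>x\<close>. Any two exceptional matrices have proportional columns, so a matrix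
  \<open>t\<close> with independent column can be added to \<open>s\<close> freely, and comparing
  several multiples of \<open>t\<close> shows that no \<open>s\<close> is exceptional.\<close>

lemma proportional_if_medium:
  assumes x: "x \<in> U" and F0: "\<forall>s\<in>ann (add_col V W x). \<forall>f\<in>V. F s f = 0"
    and d: "fn.dim (add_col V W x) < fn.dim (TP V (fn.span (insert x X))) + fn.dim V"
    and sl: "fn.dim (slice V W x) + 2 \<le> fn.dim V"
    and card: "\<exists>a::'a. a \<noteq> 0 \<and> a \<noteq> 1"
    and s: "s \<in> ann W"
  shows "\<exists>c. \<forall>f\<in>V. F s f = c * s (tens f x)"
proof -
  define ex where "ex s \<longleftrightarrow> (\<exists>f\<in>V. s (tens f x) = 0 \<and> F s f \<noteq> 0)" for s
  have nex: "\<exists>c. \<forall>f\<in>V. F s f = c * s (tens f x)" if "s \<in> ann W" "\<not> ex s" for s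
    by (rule functional_proportional[OF V(1) functional_tens_left[OF annD(1)[OF that(1)]] F_functional[OF that(1)]])
      (use that(2) in \<open>auto simp: ex_def\<close>)
  \<comment> \<open>A row of \<open>t\<close> witnessing exceptionality carries a tensor
    \<open>tens f u\<close> with \<open>u\<close> outside the span of \<open>x\<close> and
    \<open>X\<close>; by the equality case the column of \<open>s\<close> contracts it into that
    span, so the column of \<open>s\<close> vanishes at \<open>f\<close>. Such rows span the kernel
    of the column of \<open>t\<close>.\<close>
  have dep: "\<exists>c. \<forall>f\<in>V. s (tens f x) = c * t (tens f x)" if s: "s \<in> ann W" "ex s" and t: "t \<in> ann W" "ex t" for s t
  proof (rule functional_proportional[OF V(1)])
    show ft: "functional (\<lambda>f. t (tens f x))" by (rule functional_tens_left[OF annD(1)[OF t(1)]])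
    show fs: "functional (\<lambda>f. s (tens f x))" by (rule functional_tens_left[OF annD(1)[OF s(1)]])
    have 1: "s (tens f x) = 0" if f: "f \<in> V" "t (tens f x) = 0" "F t f \<noteq> 0" for f
    proof -
      obtain u where u: "u \<notin> fn.span (insert x X)" "tens f u \<in> add_col V W x"
        using F_zero_or_rank_one[OF x F0 t(1) f] by blast
      from s(2) obtain g where g: "g \<in> V" "s (tens g x) = 0" "F s g \<noteq> 0" unfolding ex_def by blast
      have "ctr (\<lambda>f. s (tens f x)) (tens f u) \<in> fn.span (insert x X)"
        by (rule exceptional_bound(2)[OF x F0 s(1) g d u(2)])
      then have "sc (s (tens f x)) u \<in> fn.span (insert x X)" by (simp add: ctr_tens[OF fs])
      then have "sc (1 / s (tens f x)) (sc (s (tens f x)) u) \<in> fn.span (insert x X)" by (rule fn.span_scale)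
      then show ?thesis using u(1) by (cases "s (tens f x) = 0") simp_all
    qed
    fix f assume f: "f \<in> V" "t (tens f x) = 0"
    from t(2) obtain g where g: "g \<in> V" "t (tens g x) = 0" "F t g \<noteq> 0" unfolding ex_def by blast
    show "s (tens f x) = 0"
    proof (cases "F t f = 0")
      case False then show ?thesis using 1 f by blast
    next
      case True
      have "f + g \<in> V" using f(1) g(1) V(1) by (simp add: fn.subspace_add)
      moreover have "t (tens (f + g) x) = 0" using functional_add[OF ft, of f g] f g by simp
      moreover have "F t (f + g) \<noteq> 0" using functional_add[OF F_functional[OF t(1)], of f g] True g by simp
      ultimately have "s (tens (f + g) x) = 0" by (rule 1)
      then show ?thesis using functional_add[OF fs, of f g] 1[OF g] by simp
    qed
  qed
  have "\<not> ex s" if s: "s \<in> ann W" for s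
  proof
    assume exs: "ex s"
    then obtain h where h: "h \<in> V" "s (tens h x) = 0" "F s h \<noteq> 0" unfolding ex_def by blast
    have "\<exists>g\<in>V. s (tens g x) \<noteq> 0"
    proof (rule ccontr)
      assume "\<not> ?thesis"
      then have "s \<in> ann (add_col V W x)" using s by (simp add: mem_ann_add_col)
      then show False using F0 h by blast
    qed
    then obtain g where g: "g \<in> V" "s (tens g x) \<noteq> 0" by blast
    from exists_dual_vector[OF V W(1) g(1) sl] obtain f t where f: "f \<in> V" and t: "t \<in> ann W"
      and ft: "t (tens f x) = 1" "t (tens g x) = 0" by blast
    \<comment> \<open>Neither \<open>sc m t\<close> nor \<open>s + sc m t\<close> is exceptional,
      because the column of \<open>s\<close> is not a multiple of the column of either. Subtracting
      expresses \<open>F s\<close> by the two independent columns.\<close>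
    have main: "\<exists>a b. (\<forall>f\<in>V. F (sc m t) f = a * t (tens f x)) \<and>
        (\<forall>f\<in>V. F s f = b * s (tens f x) + (b * m - a) * t (tens f x))" if m: "m \<noteq> 0" for m
    proof -
      have mt: "sc m t \<in> ann W" using t by (rule ann_scale)
      have "\<not> ex (sc m t)"
      proof
        assume "ex (sc m t)"
        from dep[OF s exs mt this] obtain c where "\<forall>f\<in>V. s (tens f x) = c * sc m t (tens f x)" by blast
        then show False using g ft by (simp add: sc_apply)
      qed
      then obtain a where a: "\<forall>f\<in>V. F (sc m t) f = a * sc m t (tens f x)" using nex[OF mt] by blast
      have "\<not> ex (s + sc m t)"
      proof
        assume "ex (s + sc m t)"
        from dep[OF s exs ann_plus[OF s mt] this] obtain c
          where c: "\<forall>f\<in>V. s (tens f x) = c * (s + sc m t) (tens f x)" by blast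
        then have "c = 1" using g ft by (auto simp: sc_apply)
        then show False using c f ft m by (auto simp: sc_apply)
      qed
      then obtain b where b: "\<forall>f\<in>V. F (s + sc m t) f = b * (s + sc m t) (tens f x)"
        using nex[OF ann_plus[OF s mt]] by blast
      have "F s f = b * s (tens f x) + (b * m - a * m) * t (tens f x)" if fV: "f \<in> V" for f
      proof -
        have eq: "F s f + a * (m * t (tens f x)) = b * (s (tens f x) + m * t (tens f x))"
          using F_add[OF s mt fV] bspec[OF a fV] bspec[OF b fV] by (simp add: sc_apply)
        have aux: "p = b * S + (b * m - a * m) * T" if "p + a * (m * T) = b * (S + m * T)" for p S T :: 'a
        proof -
          from that have "p = b * (S + m * T) - a * (m * T)" by (simp add: eq_diff_eq)
          also have "\<dots> = b * S + (b * m - a * m) * T"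
            by (simp only: distrib_left left_diff_distrib mult.assoc add_diff_eq)
          finally show ?thesis .
        qed
        show ?thesis by (rule aux[OF eq])
      qed
      moreover have "F (sc m t) f = (a * m) * t (tens f x)" if "f \<in> V" for f
        using a that by (simp add: sc_apply)
      ultimately show ?thesis by blast
    qed
    from card obtain q :: 'a where q: "q \<noteq> 0" "q \<noteq> 1" by blast
    \<comment> \<open>Both \<open>m\<close> and \<open>1 + m\<close> have to be nonzero; this is the
      use of a scalar other than 0 and 1.\<close>
    define m where "m = - q"
    have m: "m \<noteq> 0" "1 + m \<noteq> 0" using q by (simp_all add: m_def)
    obtain a1 b1 where 1: "\<forall>f\<in>V. F (sc 1 t) f = a1 * t (tens f x)"
      "\<forall>f\<in>V. F s f = b1 * s (tens f x) + (b1 * 1 - a1) * t (tens f x)" using main[of 1] by auto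
    obtain a2 b2 where 2: "\<forall>f\<in>V. F (sc m t) f = a2 * t (tens f x)"
      "\<forall>f\<in>V. F s f = b2 * s (tens f x) + (b2 * m - a2) * t (tens f x)" using main[OF m(1)] by auto
    obtain a3 b3 where 3: "\<forall>f\<in>V. F (sc (1 + m) t) f = a3 * t (tens f x)"
      "\<forall>f\<in>V. F s f = b3 * s (tens f x) + (b3 * (1 + m) - a3) * t (tens f x)" using main[OF m(2)] by auto
    have "b1 = b2" using bspec[OF 1(2) g(1)] bspec[OF 2(2) g(1)] g ft by simp
    moreover have "b1 = b3" using bspec[OF 1(2) g(1)] bspec[OF 3(2) g(1)] g ft by simp
    moreover have "sc (1 + m) t = sc 1 t + sc m t" by (rule fn.scale_left_distrib)
    then have "a3 = a1 + a2"
      using F_add[OF ann_scale[OF t, of 1] ann_scale[OF t, of m] f] 1(1) 2(1) 3(1) f ft by simp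
    moreover have "b1 * 1 - a1 = b2 * m - a2" using bspec[OF 1(2) f] bspec[OF 2(2) f] ft calculation(1) by simp
    moreover have "b1 * 1 - a1 = b3 * (1 + m) - a3" using bspec[OF 1(2) f] bspec[OF 3(2) f] ft calculation(2) by simp
    \<comment> \<open>With the common value \<open>b\<close> of the \<open>b1\<close>,
      \<open>b2\<close>, \<open>b3\<close>, the coefficient of the column of \<open>t\<close> in
      \<open>F s\<close> is \<open>b - a1\<close>, and \<open>b * m - a2\<close>, and
      \<open>b * (1 + m) - (a1 + a2)\<close>. The third is the sum of the first two, so the
      coefficient is zero.\<close>
    ultimately have "b1 - a1 = 0" by (simp add: algebra_simps)
    then show False using bspec[OF 1(2) h(1)] h by simp
  qed
  then show ?thesis using nex s by blast
qed

text \<open>Subtracting the vector that works on \<open>add_col V W x\<close> leaves a multiple of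
  the column \<open>x\<close>, but the factor may depend on \<open>s\<close>. Making it constant
  takes either \<open>common_factor\<close> or linearity.\<close>

lemma almost_local:
  assumes x: "x \<in> U" and loc: "is_local V U (add_col V W x) F"
    and d: "fn.dim (add_col V W x) + 2 \<le> fn.dim (TP V (fn.span (insert x X))) + fn.dim V"
  shows "\<exists>u\<in>U. \<forall>s\<in>ann W. \<exists>c. \<forall>f\<in>V. F s f = s (tens f u) + c * s (tens f x)"
proof -
  obtain u where u: "u \<in> U" "\<forall>s\<in>ann (add_col V W x). \<forall>f\<in>V. F s f = s (tens f u)"
    using loc unfolding is_local_def by blast
  interpret G: range_compatible V U X W "\<lambda>s f. F s f - s (tens f u)"
    by (rule range_compatible_minus_local[OF u(1)])
  have "\<exists>c. \<forall>f\<in>V. F s f = s (tens f u) + c * s (tens f x)" if s: "s \<in> ann W" for s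
  proof -
    obtain c where "\<forall>f\<in>V. F s f - s (tens f u) = c * s (tens f x)"
      using G.proportional_if_small[OF x _ d s] u(2) by auto
    then show ?thesis by (intro exI[of _ c]) (simp add: algebra_simps)
  qed
  then show ?thesis using u(1) by blast
qed

lemma local_step:
  assumes x: "x \<in> U" and loc: "is_local V U (add_col V W x) F"
    and d: "fn.dim (add_col V W x) + 2 \<le> fn.dim (TP V (fn.span (insert x X))) + fn.dim V \<or>
      fn.dim (add_col V W x) < fn.dim (TP V (fn.span (insert x X))) + fn.dim V \<and> (\<exists>a::'a. a \<noteq> 0 \<and> a \<noteq> 1)"
    and sl: "fn.dim (slice V W x) + 2 \<le> fn.dim V"
  shows "is_local V U W F"
proof -
  obtain u where u: "u \<in> U" "\<forall>s\<in>ann (add_col V W x). \<forall>f\<in>V. F s f = s (tens f u)"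
    using loc unfolding is_local_def by blast
  interpret G: range_compatible V U X W "\<lambda>s f. F s f - s (tens f u)"
    by (rule range_compatible_minus_local[OF u(1)])
  have "is_local V U W (\<lambda>s f. F s f - s (tens f u))"
  proof (rule G.local_if_proportional[OF x _ sl], rule ballI)
    fix s assume s: "s \<in> ann W"
    have F0: "\<forall>s\<in>ann (add_col V W x). \<forall>f\<in>V. F s f - s (tens f u) = 0" using u(2) by simp
    show "\<exists>c. \<forall>f\<in>V. F s f - s (tens f u) = c * s (tens f x)"
      using d
    proof
      assume "fn.dim (add_col V W x) + 2 \<le> fn.dim (TP V (fn.span (insert x X))) + fn.dim V"
      from G.proportional_if_small[OF x F0 this s] show ?thesis by simp
    next
      assume "fn.dim (add_col V W x) < fn.dim (TP V (fn.span (insert x X))) + fn.dim V \<and> (\<exists>a::'a. a \<noteq> 0 \<and> a \<noteq> 1)"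
      then have "fn.dim (add_col V W x) < fn.dim (TP V (fn.span (insert x X))) + fn.dim V"
        "\<exists>a::'a. a \<noteq> 0 \<and> a \<noteq> 1" by simp_all
      from G.proportional_if_medium[OF x F0 this(1) sl this(2) s] show ?thesis by simp
    qed
  qed
  then obtain w where w: "w \<in> U" "\<forall>s\<in>ann W. \<forall>f\<in>V. F s f - s (tens f u) = s (tens f w)"
    unfolding is_local_def by blast
  have "F s f = s (tens f (u + w))" if "s \<in> ann W" "f \<in> V" for s f
    using w(2) that by (simp add: tens_simps functional_add[OF annD(1)[OF that(1)]] algebra_simps)
  then show ?thesis unfolding is_local_def using u(1) w(1) U(1) fn.subspace_add by blast
qed

lemma local_if_full:
  assumes "X = U" shows "is_local V U W F"
proof -
  have "F s f = s (tens f 0)" if s: "s \<in> ann W" and f: "f \<in> V" for s f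
  proof -
    have "s (tens f u) = 0" if "u \<in> U" for u
      using annD(2)[OF s] W(2) tens_in_TP[OF f] that assms by blast
    then have "F s f = 0" using F_range[OF s f] by blast
    then show ?thesis by (simp add: tens_simps functional_0[OF annD(1)[OF s]])
  qed
  then show ?thesis unfolding is_local_def using fn.subspace_0[OF U(1)] by blast
qed

lemma dim_insert_less:
  assumes "x \<in> U" "x \<notin> X"
  shows "fn.dim U - fn.dim (fn.span (insert x X)) < fn.dim U - fn.dim X"
proof -
  have "fn.dim (fn.span (insert x X)) = Suc (fn.dim X)" by (rule fn.dim_insert_notin[OF X(1) fin_gen_X assms(2)])
  moreover have "fn.dim (fn.span (insert x X)) \<le> fn.dim U"
    by (rule fn.dim_mono_fin_gen[OF _ U(2)]) (rule fn.span_minimal[OF _ U(1)], use assms X(2) in simp)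
  ultimately show ?thesis by simp
qed

end

text \<open>Any \<open>x\<close> outside \<open>X\<close> can be added: its slice is bounded by the
  excess, hence by \<open>dim V - 2\<close>, and the excess does not grow. The induction stops at
  \<open>X = U\<close>, where all matrices vanish on \<open>U\<close>.\<close>

theorem local_small_codim:
  assumes "range_compatible V U X W F" and "fn.dim W + 2 \<le> fn.dim (TP V X) + fn.dim V"
  shows "is_local V U W F"
  using assms
proof (induction "fn.dim U - fn.dim X" arbitrary: X W rule: less_induct)
  case (less X W)
  interpret range_compatible V U X W F by (rule less.prems(1))
  show ?case
  proof (cases "X = U")
    case True then show ?thesis by (rule local_if_full)
  next
    case False
    then obtain x where x: "x \<in> U" "x \<notin> X" using X(2) by blast
    note d = dim_add_col_insert[OF x]
    have sl: "fn.dim (slice V W x) + 2 \<le> fn.dim V" using d(3) less.prems(2) by linarith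
    have d': "fn.dim (add_col V W x) + 2 \<le> fn.dim (TP V (fn.span (insert x X))) + fn.dim V"
      using d less.prems(2) by linarith
    have "is_local V U (add_col V W x) F"
      using less.hyps[of "fn.span (insert x X)" "add_col V W x"] dim_insert_less[OF x]
        range_compatible_add_col[OF x(1)] d' by simp
    from local_step[OF x(1) this disjI1[OF d'] sl] show ?thesis .
  qed
qed

section \<open>Contractions of rank at least two\<close>

text \<open>Spelled out for two tensors so that a failure yields at once a linear relation between
  their contractions modulo \<open>X\<close>, see \<open>dependent_mod\<close>.\<close>

definition ind2 :: "('j \<Rightarrow> 'a::field) set \<Rightarrow> ('i \<times> 'j \<Rightarrow> 'a) set \<Rightarrow> (('i \<Rightarrow> 'a) \<Rightarrow> 'a) \<Rightarrow> bool" where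
  "ind2 X W y \<longleftrightarrow> functional y \<and> (\<exists>M\<in>W. \<exists>N\<in>W. \<forall>a b. sc a (ctr y M) + sc b (ctr y N) \<in> X \<longrightarrow> a = 0 \<and> b = 0)"

lemma mem_span_insert:
  "fn.subspace X \<Longrightarrow> v \<in> fn.span (insert x X) \<longleftrightarrow> (\<exists>k. v - sc k x \<in> X)"
proof -
  assume "fn.subspace X"
  then have X: "fn.span X = X" by simp
  show ?thesis unfolding fn.span_insert X by simp
qed

lemma ind2_dim:
  assumes "ind2 X W y" and X: "fn.subspace X" "fn.fin_gen X" and W: "fn.subspace W" "fn.fin_gen W"
    and XW: "X \<subseteq> ctr y ` W"
  shows "fn.dim X + 2 \<le> fn.dim (ctr y ` W)"
proof -
  obtain M N where MN: "functional y" "M \<in> W" "N \<in> W"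
    and ind: "\<And>a b. sc a (ctr y M) + sc b (ctr y N) \<in> X \<Longrightarrow> a = 0 \<and> b = 0"
    using assms(1) unfolding ind2_def by blast
  let ?m = "ctr y M" and ?n = "ctr y N"
  let ?X1 = "fn.span (insert ?m X)"
  let ?X2 = "fn.span (insert ?n ?X1)"
  have sub: "fn.subspace (ctr y ` W)" by (rule ff.linear_subspace_image[OF linear_ctr[OF MN(1)] W(1)])
  have fd: "fn.fin_gen (ctr y ` W)" by (rule ff.fin_gen_image[OF linear_ctr[OF MN(1)] W(2)])
  have "?m \<notin> X"
  proof
    assume "?m \<in> X"
    then have "sc 1 ?m + sc 0 ?n \<in> X" by simp
    from ind[OF this] show False by simp
  qed
  then have 1: "fn.dim ?X1 = Suc (fn.dim X)" by (rule fn.dim_insert_notin[OF X])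
  have "?n \<notin> ?X1"
  proof
    assume "?n \<in> ?X1"
    then obtain k where "?n - sc k ?m \<in> X" by (auto simp: mem_span_insert[OF X(1)])
    then have "sc (- k) ?m + sc 1 ?n \<in> X" by simp
    from ind[OF this] show False by simp
  qed
  then have 2: "fn.dim ?X2 = Suc (fn.dim ?X1)"
    by (rule fn.dim_insert_notin[OF fn.subspace_span fin_gen_span_insert[OF X(2)]])
  have "?X1 \<subseteq> ctr y ` W" by (rule fn.span_minimal[OF _ sub]) (use XW MN in blast)
  then have "?X2 \<subseteq> ctr y ` W" by (intro fn.span_minimal[OF _ sub]) (use MN in blast)
  from fn.dim_mono_fin_gen[OF this fd] show ?thesis using 1 2 by simp
qed

lemma dependent_mod:
  assumes X: "fn.subspace X" and y: "functional y" "\<not> ind2 X W y" and MN: "M \<in> W" "N \<in> W" and M: "ctr y M \<notin> X"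
  shows "\<exists>c. ctr y N - sc c (ctr y M) \<in> X"
proof -
  obtain a b where ab: "sc a (ctr y M) + sc b (ctr y N) \<in> X" "\<not> (a = 0 \<and> b = 0)"
    using y MN unfolding ind2_def by blast
  have "b \<noteq> 0"
  proof
    assume b: "b = 0"
    then have "sc a (ctr y M) \<in> X" using ab(1) by simp
    then have "sc (1 / a) (sc a (ctr y M)) \<in> X" using X fn.subspace_scale by blast
    then show False using M ab(2) b by simp
  qed
  have "sc (1 / b) (sc a (ctr y M) + sc b (ctr y N)) \<in> X" using ab(1) X fn.subspace_scale by blast
  then have "ctr y N - sc (- (a / b)) (ctr y M) \<in> X"
    using \<open>b \<noteq> 0\<close> by (simp add: fn.scale_right_distrib fn.scale_minus_left add.commute)
  then show ?thesis by blast
qed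

text \<open>Induction on \<open>dim V\<close>: split off \<open>tens f (ctr y N)\<close>, which lies
  in \<open>TP V X\<close>, and continue in the kernel of \<open>y\<close>.\<close>

lemma mem_TP_if_ctr:
  assumes "fn.subspace V" "fn.fin_gen V" "fn.subspace U" "fn.subspace X" "N \<in> TP V U"
    and "\<And>y. functional y \<Longrightarrow> ctr y N \<in> X"
  shows "N \<in> TP V X"
  using assms
proof (induction "fn.dim V" arbitrary: V N)
  case 0
  then have "V = {0}" using fn.dim_0_imp by metis
  have "TP V U \<subseteq> {0}"
    by (rule TP_minimal) (simp_all add: \<open>V = {0}\<close> tens_simps fn.subspace_single_0)
  then show ?case using 0 fn.subspace_0[OF subspace_TP] by blast
next
  case (Suc n)
  have "\<exists>f\<in>V. f \<notin> {0}"
    by (rule fn.exists_notin_smaller)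
      (use Suc.hyps(2)[symmetric] Suc.prems(2) in \<open>simp_all add: fn.dim_zero_space fn.fin_gen_finite\<close>)
  then obtain f where f: "f \<in> V" "f \<notin> {0}" by blast
  from functional_separate[OF fn.subspace_single_0 f(2)] obtain y where y: "functional y" "y f = 1" by blast
  let ?V = "{g \<in> V. y g = 0}"
  let ?N = "N - tens f (ctr y N)"
  have "?N \<in> TP ?V X"
  proof (rule Suc.hyps(1))
    show "n = fn.dim ?V" using dim_kernel[OF Suc.prems(1,2) y(1) f(1)] y(2) Suc.hyps(2) by simp
    show "fn.subspace ?V" by (rule subspace_Int_kernel[OF Suc.prems(1) y(1)])
    show "fn.fin_gen ?V" by (rule fn.fin_gen_subset[OF _ Suc.prems(2)]) blast
    show "?N \<in> TP ?V U" by (rule TP_split[OF y(1) Suc.prems(1,3) f(1) y(2) Suc.prems(5)])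
    show "ctr z ?N \<in> X" if "functional z" for z
      using Suc.prems(6)[OF that] Suc.prems(6)[OF y(1)] Suc.prems(4)
      by (simp add: ctr_diff ctr_tens that fn.subspace_diff fn.subspace_scale)
  qed (use Suc.prems in simp_all)
  moreover have "TP ?V X \<subseteq> TP V X" by (rule TP_mono) blast+
  moreover have "tens f (ctr y N) \<in> TP V X" by (rule tens_in_TP[OF f(1) Suc.prems(6)[OF y(1)]])
  ultimately have "?N + tens f (ctr y N) \<in> TP V X" by (intro fn.subspace_add subspace_TP) blast+
  then show ?case by simp
qed

text \<open>Take coordinates \<open>r\<close>, \<open>s\<close> modulo \<open>X\<close> dual to the
  two independent contractions at \<open>z\<close>. Then \<open>q w\<close> is the 2 x 2 determinant
  of the contractions of \<open>M\<close> and \<open>N\<close> at \<open>w\<close>: it vanishes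
  where \<open>ind2\<close> fails and equals 1 at \<open>z\<close>. Expanding it at
  \<open>z + sc t w\<close> gives a quadratic polynomial in \<open>t\<close> whose linear
  coefficient is the trace \<open>p\<close>.\<close>

lemma ind2_quadratic:
  assumes X: "fn.subspace X" and z: "ind2 X W z"
  shows "\<exists>p q. (\<forall>w t. functional w \<longrightarrow> \<not> ind2 X W (z + sc t w) \<longrightarrow> 1 + t * p w + t * t * q w = 0) \<and>
    (\<forall>w. functional w \<longrightarrow> \<not> ind2 X W w \<longrightarrow> q w = 0) \<and> (\<forall>v w. p (v + w) = p v + p w)"
proof -
  obtain M N where MN: "functional z" "M \<in> W" "N \<in> W"
    and ind: "\<And>a b. sc a (ctr z M) + sc b (ctr z N) \<in> X \<Longrightarrow> a = 0 \<and> b = 0"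
    using z unfolding ind2_def by blast
  let ?m = "ctr z M" and ?n = "ctr z N"
  have "?m \<notin> fn.span (insert ?n X)"
  proof
    assume "?m \<in> fn.span (insert ?n X)"
    then obtain k where "?m - sc k ?n \<in> X" by (auto simp: mem_span_insert[OF X])
    then have "sc 1 ?m + sc (- k) ?n \<in> X" by (simp add: fn.scale_minus_left)
    from ind[OF this] show False by simp
  qed
  from functional_separate[OF fn.subspace_span this] obtain r where
    r: "functional r" "\<forall>x\<in>fn.span (insert ?n X). r x = 0" "r ?m = 1" by blast
  have "?n \<notin> fn.span (insert ?m X)"
  proof
    assume "?n \<in> fn.span (insert ?m X)"
    then obtain k where "?n - sc k ?m \<in> X" by (auto simp: mem_span_insert[OF X])
    then have "sc (- k) ?m + sc 1 ?n \<in> X" by (simp add: fn.scale_minus_left)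
    from ind[OF this] show False by simp
  qed
  from functional_separate[OF fn.subspace_span this] obtain s where
    s: "functional s" "\<forall>x\<in>fn.span (insert ?m X). s x = 0" "s ?n = 1" by blast
  have rs: "r ?n = 0" "s ?m = 0" "\<And>x. x \<in> X \<Longrightarrow> r x = 0" "\<And>x. x \<in> X \<Longrightarrow> s x = 0"
    using r(2) s(2) fn.span_base[of _ "insert ?n X"] fn.span_base[of _ "insert ?m X"] by auto
  define q where "q w = r (ctr w M) * s (ctr w N) - r (ctr w N) * s (ctr w M)" for w
  define p where "p w = r (ctr w M) + s (ctr w N)" for w
  have q0: "q w = 0" if w: "functional w" "\<not> ind2 X W w" for w
  proof -
    obtain a b where ab: "sc a (ctr w M) + sc b (ctr w N) \<in> X" "\<not> (a = 0 \<and> b = 0)"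
      using w MN(2,3) unfolding ind2_def by blast
    have 1: "a * r (ctr w M) + b * r (ctr w N) = 0" "a * s (ctr w M) + b * s (ctr w N) = 0"
      using rs(3)[OF ab(1)] rs(4)[OF ab(1)] by (simp_all add: functional_simps[OF r(1)] functional_simps[OF s(1)])
    have "a * q w = 0" "b * q w = 0" unfolding q_def using 1 by Groebner_Basis.algebra+
    then show ?thesis using ab(2) by auto
  qed
  have "q (z + sc t w) = 1 + t * p w + t * t * q w" for t w
    unfolding q_def p_def ctr_fun_add ctr_fun_sc
    by (simp add: functional_simps[OF r(1)] functional_simps[OF s(1)] r(3) s(3) rs algebra_simps)
  moreover have "p (v + w) = p v + p w" for v w
    unfolding p_def ctr_fun_add by (simp add: functional_simps[OF r(1)] functional_simps[OF s(1)])
  moreover have "functional (z + sc t w)" if "functional w" for t w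
    using functional_plus[OF MN(1) functional_scale[OF that]] .
  ultimately have main: "(\<forall>w t. functional w \<longrightarrow> \<not> ind2 X W (z + sc t w) \<longrightarrow> 1 + t * p w + t * t * q w = 0) \<and>
    (\<forall>w. functional w \<longrightarrow> \<not> ind2 X W w \<longrightarrow> q w = 0) \<and> (\<forall>v w. p (v + w) = p v + p w)"
    using q0 by metis
  show ?thesis by (rule exI[of _ p], rule exI[of _ q], rule main)
qed

context range_compatible
begin

lemma ind2_nonzero:
  assumes "ind2 X W y" shows "\<exists>f\<in>V. y f \<noteq> 0"
proof (rule ccontr)
  assume "\<not> ?thesis"
  then have eq: "{g \<in> V. y g = 0} = V" by blast
  obtain M N where MN: "functional y" "M \<in> W" "N \<in> W"
    and ind: "\<And>a b. sc a (ctr y M) + sc b (ctr y N) \<in> X \<Longrightarrow> a = 0 \<and> b = 0"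
    using assms unfolding ind2_def by blast
  have "ctr y P = 0" if "P \<in> W" for P
  proof (rule ctr_TP_kernel[OF MN(1)])
    show "P \<in> TP {g \<in> V. y g = 0} U" unfolding eq using W(3) that by blast
  qed
  from this[OF MN(2)] this[OF MN(3)]
  have "sc 1 (ctr y M) + sc 1 (ctr y N) \<in> X" using fn.subspace_0[OF X(1)] by simp
  from ind[OF this] show False by simp
qed

text \<open>Modulo \<open>X\<close>, the operators \<open>y \<mapsto> ctr y N\<close> for
  \<open>N\<close> in \<open>W\<close> have all their values at any given \<open>y\<close> on one
  line. As for spaces of matrices of rank at most one, either this line is the same for all
  \<open>y\<close>, or the space of operators is at most one-dimensional.\<close>

lemma rank_one_cases:
  assumes no: "\<And>y. \<not> ind2 X W y"
  shows "(\<exists>u\<in>U. u \<notin> X \<and> W \<subseteq> TP V (fn.span (insert u X))) \<or> fn.dim W \<le> Suc (fn.dim (TP V X))"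
proof (rule disjCI)
  assume big: "\<not> fn.dim W \<le> Suc (fn.dim (TP V X))"
  have fT: "fn.fin_gen (TP V X)" by (rule fin_gen_TP[OF V(2) fin_gen_X])
  have "\<exists>N\<in>W. N \<notin> TP V X"
    by (rule fn.exists_notin_smaller[OF fin_gen_W subspace_TP _ fT]) (use big in simp)
  then obtain N where N: "N \<in> W" "N \<notin> TP V X" by blast
  have WT: "M \<in> TP V U" if "M \<in> W" for M using W(3) that by blast
  have outside: "\<exists>y. functional y \<and> ctr y M \<notin> X" if M: "M \<in> W" "M \<notin> TP V X" for M
    using mem_TP_if_ctr[OF V U(1) X(1) WT[OF M(1)]] M(2) by blast
  from outside[OF N] obtain y where y: "functional y" "ctr y N \<notin> X" by blast
  let ?u = "ctr y N"
  let ?Xu = "fn.span (insert ?u X)"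
  have XXu: "x \<in> ?Xu" if "x \<in> X" for x using that by (intro fn.span_base) simp
  note dep = dependent_mod[OF X(1) _ no]
  have "\<exists>N'\<in>W. N' \<notin> fn.span (insert N (TP V X))"
    using fn.dim_span_insert_le[OF fT, of N] big
    by (intro fn.exists_notin_smaller[OF fin_gen_W fn.subspace_span _ fin_gen_span_insert[OF fT]]) simp
  then obtain N' where N': "N' \<in> W" "N' \<notin> fn.span (insert N (TP V X))" by blast
  from dep[OF y(1) N(1) N'(1) y(2)] obtain c where c: "ctr y N' - sc c ?u \<in> X" by blast
  \<comment> \<open>A second operator, independent of \<open>N\<close> and corrected so that it
    vanishes at \<open>y\<close> modulo \<open>X\<close>.\<close>
  define P where "P = N' - sc c N"
  have P: "P \<in> W" "ctr y P \<in> X" "P \<notin> TP V X"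
  proof -
    show "P \<in> W" unfolding P_def using N(1) N'(1) W(1) by (simp add: fn.subspace_diff fn.subspace_scale)
    show "ctr y P \<in> X" unfolding P_def using c by (simp add: ctr_diff ctr_sc y(1))
    show "P \<notin> TP V X" using N'(2) unfolding P_def mem_span_insert[OF subspace_TP] by blast
  qed
  \<comment> \<open>At \<open>w\<close> and at \<open>w + y\<close> the value of \<open>N\<close> is
    a multiple of the value of \<open>M\<close>, and \<open>M\<close> has the same value at both.
    The difference shows that \<open>?u\<close>, the value of \<open>N\<close> at \<open>y\<close>,
    is a multiple of \<open>?v\<close>, a nonzero one as \<open>?u\<close> is outside
    \<open>X\<close>.\<close>
  have claim: "ctr w M \<in> ?Xu \<and> ctr w N \<in> ?Xu"
    if M: "M \<in> W" "ctr y M \<in> X" and w: "functional w" "ctr w M \<notin> X" for M w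
  proof -
    let ?v = "ctr w M"
    obtain e where e: "ctr w N - sc e ?v \<in> X" using dep[OF w(1) M(1) N(1) w(2)] by blast
    have wy: "functional (w + y)" by (rule functional_plus[OF w(1) y(1)])
    have "ctr (w + y) M \<notin> X"
    proof
      assume "ctr (w + y) M \<in> X"
      then have "ctr (w + y) M - ctr y M \<in> X" using M(2) X(1) fn.subspace_diff by blast
      then show False using w(2) by (simp add: ctr_fun_add)
    qed
    from dep[OF wy M(1) N(1) this] obtain d where
      d: "ctr (w + y) N - sc d (ctr (w + y) M) \<in> X" by blast
    have "ctr (w + y) N - sc d (ctr (w + y) M) - (ctr w N - sc e ?v) + sc d (ctr y M) \<in> X"
      by (rule fn.subspace_add[OF X(1) fn.subspace_diff[OF X(1) d e] fn.subspace_scale[OF X(1) M(2)]])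
    moreover have "ctr (w + y) N - sc d (ctr (w + y) M) - (ctr w N - sc e ?v) + sc d (ctr y M)
        = ?u - sc (d - e) ?v"
      by (simp add: ctr_fun_add fn.scale_right_distrib fn.scale_left_diff_distrib)
    ultimately have u: "?u - sc (d - e) ?v \<in> X" by simp
    have "d - e \<noteq> 0"
    proof
      assume "d - e = 0" then show False using u y(2) by simp
    qed
    have "sc (- (1 / (d - e))) (?u - sc (d - e) ?v) \<in> X" using u X(1) fn.subspace_scale by blast
    then have "?v - sc (1 / (d - e)) ?u \<in> X"
      using \<open>d - e \<noteq> 0\<close> by (simp add: fn.scale_right_diff_distrib fn.scale_minus_left)
    then have v: "?v \<in> ?Xu" unfolding mem_span_insert[OF X(1)] by blast
    have "(ctr w N - sc e ?v) + sc e ?v \<in> ?Xu" using XXu[OF e] v by (intro fn.span_add fn.span_scale)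
    then show ?thesis using v by simp
  qed
  have M_in: "M \<in> TP V ?Xu" if M: "M \<in> W" "ctr y M \<in> X" for M
  proof (rule mem_TP_if_ctr[OF V U(1) fn.subspace_span WT[OF M(1)]])
    fix w :: "('i \<Rightarrow> 'a) \<Rightarrow> 'a" assume "functional w"
    then show "ctr w M \<in> ?Xu" using claim[OF M, of w] XXu by (cases "ctr w M \<in> X") simp_all
  qed
  from outside[OF P(1,3)] obtain y0 where y0: "functional y0" "ctr y0 P \<notin> X" by blast
  have N_in: "N \<in> TP V ?Xu"
  proof (rule mem_TP_if_ctr[OF V U(1) fn.subspace_span WT[OF N(1)]])
    fix w :: "('i \<Rightarrow> 'a) \<Rightarrow> 'a" assume w: "functional w"
    show "ctr w N \<in> ?Xu"
    proof (cases "ctr w P \<in> X")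
      case False then show ?thesis using claim[OF P(1,2) w] by simp
    next
      case True
      \<comment> \<open>Where \<open>P\<close> vanishes modulo \<open>X\<close> the claim says
        nothing about \<open>N\<close>; shifting by \<open>y0\<close>, at which \<open>P\<close>
        does not vanish, repairs this.\<close>
      have "ctr (w + y0) P \<notin> X"
      proof
        assume "ctr (w + y0) P \<in> X"
        then have "ctr (w + y0) P - ctr w P \<in> X" using True X(1) fn.subspace_diff by blast
        then show False using y0(2) by (simp add: ctr_fun_add)
      qed
      then have "ctr (w + y0) N \<in> ?Xu" using claim[OF P(1,2) functional_plus[OF w y0(1)]] by simp
      moreover have "ctr y0 N \<in> ?Xu" using claim[OF P(1,2) y0] by simp
      ultimately have "ctr (w + y0) N - ctr y0 N \<in> ?Xu" by (rule fn.span_diff)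
      then show ?thesis by (simp add: ctr_fun_add)
    qed
  qed
  have "W \<subseteq> TP V ?Xu"
  proof
    fix M assume M: "M \<in> W"
    from dep[OF y(1) N(1) M y(2)] obtain c where c: "ctr y M - sc c ?u \<in> X" by blast
    have "M - sc c N \<in> TP V ?Xu"
      by (rule M_in) (use M N(1) W(1) c in \<open>simp_all add: fn.subspace_diff fn.subspace_scale ctr_diff ctr_sc y(1)\<close>)
    then have "(M - sc c N) + sc c N \<in> TP V ?Xu" using N_in
      by (intro fn.subspace_add fn.subspace_scale subspace_TP)
    then show "M \<in> TP V ?Xu" by simp
  qed
  moreover have "?u \<in> U" by (rule ctr_TP[OF y(1) WT[OF N(1)] U(1)])
  ultimately show "\<exists>u\<in>U. u \<notin> X \<and> W \<subseteq> TP V (fn.span (insert u X))" using y(2) by blast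
qed

text \<open>If every functional nonzero on the kernel of \<open>z\<close> failed
  \<open>ind2\<close>, the quadratic relation at \<open>t = 1\<close> would give
  \<open>p = - 1\<close> for all of them. The kernel has dimension at least two, so some
  \<open>w\<close>, \<open>v\<close> and \<open>w + v\<close> are all nonzero on it, and additivity
  gives \<open>- 1 = - 1 - 1\<close>.\<close>

lemma second_ind2:
  assumes z: "ind2 X W z" and d: "3 \<le> fn.dim V"
  shows "\<exists>y. ind2 X W y \<and> (\<exists>f\<in>V. z f = 0 \<and> y f \<noteq> 0)"
proof (rule ccontr)
  assume no: "\<not> ?thesis"
  have fz: "functional z" using z by (simp add: ind2_def)
  obtain g where g: "g \<in> V" "z g \<noteq> 0" using ind2_nonzero[OF z] by blast
  let ?K = "{g \<in> V. z g = 0}"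
  have K: "fn.subspace ?K" "fn.fin_gen ?K"
    using subspace_Int_kernel[OF V(1) fz] fn.fin_gen_subset[OF _ V(2), of ?K] by auto
  have dK: "Suc (fn.dim ?K) = fn.dim V" by (rule dim_kernel[OF V fz g])
  have "\<exists>f\<in>?K. f \<notin> {0}"
    by (rule fn.exists_notin_smaller[OF K(2)]) (use dK d in \<open>simp_all add: fn.dim_zero_space fn.fin_gen_finite\<close>)
  then obtain f2 where f2: "f2 \<in> ?K" "f2 \<noteq> 0" by blast
  have "\<exists>f\<in>?K. f \<notin> fn.span {f2}"
    by (rule fn.exists_notin_smaller[OF K(2) fn.subspace_span])
      (use dK d fn.dim_le_card'[of "{f2}"] in \<open>simp_all add: fn.fin_gen_span fn.fin_gen_finite\<close>)
  then obtain f3 where f3: "f3 \<in> ?K" "f3 \<notin> fn.span {f2}" by blast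
  have ind: "fn.independent {f3, f2}" using f2(2) f3(2) by (intro fn.independent_insertI fn.independent_empty) simp_all
  have "f3 \<noteq> f2" using f3(2) fn.span_base[of f2 "{f2}"] by auto
  from functional_extend[OF ind, of "\<lambda>b. if b = f2 then 1 else 0"] obtain w where
    w: "functional w" "w f2 = 1" by auto
  from functional_extend[OF ind, of "\<lambda>b. if b = f3 then 1 else 0"] obtain v where
    v: "functional v" "v f3 = 1" "v f2 = 0" using \<open>f3 \<noteq> f2\<close> by auto
  obtain p q where pq: "\<forall>w t. functional w \<longrightarrow> \<not> ind2 X W (z + sc t w) \<longrightarrow> 1 + t * p w + t * t * q w = 0"
    "\<forall>w. functional w \<longrightarrow> \<not> ind2 X W w \<longrightarrow> q w = 0" "\<forall>v w. p (v + w) = p v + p w"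
    using ind2_quadratic[OF X(1) z] by blast
  have 1: "1 + p y = 0" if y: "functional y" "f \<in> ?K" "y f \<noteq> 0" for y f
  proof -
    have "\<not> ind2 X W y" using no y(2,3) by blast
    then have q0: "q y = 0" using pq(2) y(1) by blast
    have "z f = 0" "f \<in> V" using y(2) by simp_all
    then have "\<not> ind2 X W (z + sc 1 y)" using no y(3) by auto
    then have "1 + 1 * p y + 1 * 1 * q y = 0" using pq(1) y(1) by blast
    then show ?thesis using q0 by simp
  qed
  have "1 + p w = 0" using 1[OF w(1) f2(1)] w(2) by simp
  moreover have "1 + p v = 0" using 1[OF v(1) f3(1)] v(2) by simp
  moreover have "1 + p (w + v) = 0" using 1[OF functional_plus[OF w(1) v(1)] f2(1)] w(2) v(3) by simp
  moreover have "p (w + v) = p w + p v" using pq(3) by blast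
  ultimately have "(1::'a) = 0" by Groebner_Basis.algebra
  then show False by simp
qed

text \<open>If \<open>ind2\<close> failed for every functional nonzero at \<open>g\<close>, the
  quadratic term would vanish and \<open>1 + t * p w = 0\<close> would hold for all nonzero
  \<open>t\<close>; two different nonzero \<open>t\<close> contradict each other.\<close>

lemma third_ind2:
  assumes z: "ind2 X W z" and g: "g \<in> V" "z g = 0" "y g = 0" "g \<noteq> 0" and card: "\<exists>a::'a. a \<noteq> 0 \<and> a \<noteq> 1"
  shows "\<exists>w. ind2 X W w \<and> w g \<noteq> 0"
proof (rule ccontr)
  assume no: "\<not> ?thesis"
  have "g \<notin> {0}" using g(4) by simp
  from functional_separate[OF fn.subspace_single_0 this] obtain w where w: "functional w" "w g = 1" by blast
  obtain p q where pq: "\<forall>w t. functional w \<longrightarrow> \<not> ind2 X W (z + sc t w) \<longrightarrow> 1 + t * p w + t * t * q w = 0"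
    "\<forall>w. functional w \<longrightarrow> \<not> ind2 X W w \<longrightarrow> q w = 0"
    using ind2_quadratic[OF X(1) z] by blast
  have "q w = 0" using pq(2) no w by auto
  have eq: "1 + t * p w = 0" if "t \<noteq> 0" for t
  proof -
    have "(z + sc t w) g \<noteq> 0" using g(2) w(2) that by (simp add: sc_apply)
    then have "\<not> ind2 X W (z + sc t w)" using no by blast
    then show ?thesis using pq(1) w(1) \<open>q w = 0\<close> by fastforce
  qed
  from card obtain a :: 'a where a: "a \<noteq> 0" "a \<noteq> 1" by blast
  have "a = 1" using eq[OF a(1)] eq[of 1] by Groebner_Basis.algebra
  then show False using a(2) by simp
qed

end

section \<open>Restriction to hyperplanes\<close>

definition hyp :: "('i \<Rightarrow> 'a::field) set \<Rightarrow> (('i \<Rightarrow> 'a) \<Rightarrow> 'a) \<Rightarrow> ('i \<Rightarrow> 'a) set" where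
  "hyp V y = {g \<in> V. y g = 0}"

text \<open>By \<open>ctr_ker_TP\<close> this is the part of \<open>W\<close> supported on the
  hyperplane \<open>hyp V y\<close>. Its annihilator describes the matrices of \<open>ann W\<close>
  after restricting the row functionals to that hyperplane.\<close>

definition ctr_ker :: "('i \<times> 'j \<Rightarrow> 'a::field) set \<Rightarrow> (('i \<Rightarrow> 'a) \<Rightarrow> 'a) \<Rightarrow> ('i \<times> 'j \<Rightarrow> 'a) set" where
  "ctr_ker W y = {N \<in> W. ctr y N = 0}"

text \<open>Matrices of the restricted space extend to matrices annihilating \<open>W\<close>; by range compatibility the
  value does not depend on the chosen extension.\<close>

definition restrict_map :: "('i \<Rightarrow> 'a::field) set \<Rightarrow> ('j \<Rightarrow> 'a) set \<Rightarrow> ('i \<times> 'j \<Rightarrow> 'a) set \<Rightarrow>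
    ((('i \<times> 'j \<Rightarrow> 'a) \<Rightarrow> 'a) \<Rightarrow> ('i \<Rightarrow> 'a) \<Rightarrow> 'a) \<Rightarrow> (('i \<times> 'j \<Rightarrow> 'a) \<Rightarrow> 'a) \<Rightarrow> ('i \<Rightarrow> 'a) \<Rightarrow> 'a" where
  "restrict_map V' U W F t = F (SOME s. s \<in> ann W \<and> (\<forall>e\<in>TP V' U. s e = t e))"

definition linear_family :: "('i \<Rightarrow> 'a::field) set \<Rightarrow> ('i \<times> 'j \<Rightarrow> 'a) set \<Rightarrow>
    ((('i \<times> 'j \<Rightarrow> 'a) \<Rightarrow> 'a) \<Rightarrow> ('i \<Rightarrow> 'a) \<Rightarrow> 'a) \<Rightarrow> bool" where
  "linear_family V W F \<longleftrightarrow> (\<forall>s\<in>ann W. \<forall>c. \<forall>f\<in>V. F (sc c s) f = c * F s f)"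

lemma hyp_mem [simp]: "g \<in> hyp V y \<longleftrightarrow> g \<in> V \<and> y g = 0"
  by (simp add: hyp_def)

lemma subspace_hyp: "fn.subspace V \<Longrightarrow> functional y \<Longrightarrow> fn.subspace (hyp V y)"
  unfolding hyp_def by (rule subspace_Int_kernel)

lemma fin_gen_hyp: "fn.fin_gen V \<Longrightarrow> fn.fin_gen (hyp V y)"
  by (rule fn.fin_gen_subset[of _ V]) (simp_all add: hyp_def)

lemma dim_hyp:
  "fn.subspace V \<Longrightarrow> fn.fin_gen V \<Longrightarrow> functional y \<Longrightarrow> f \<in> V \<Longrightarrow> y f \<noteq> 0 \<Longrightarrow> Suc (fn.dim (hyp V y)) = fn.dim V"
  unfolding hyp_def by (rule dim_kernel)

context range_compatible
begin

lemma ctr_ker_TP: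
  assumes "functional y"
  shows "ctr_ker W y = W \<inter> TP (hyp V y) U"
  using W(3) unfolding hyp_def TP_kernel[OF assms V(1) U(1)] ctr_ker_def by blast

lemma extend_ann:
  assumes y: "functional y" and t: "t \<in> ann (ctr_ker W y)"
  shows "\<exists>s\<in>ann W. \<forall>e\<in>TP (hyp V y) U. s e = t e"
proof -
  have z: "t e = 0" if "e \<in> TP (hyp V y) U" "e \<in> W" for e
    using annD(2)[OF t] that ctr_ker_TP[OF y] by blast
  obtain s where "functional s" "\<forall>e\<in>TP (hyp V y) U. s e = t e" "\<forall>e\<in>W. s e = 0"
    using functional_agree_zero[OF subspace_TP W(1) annD(1)[OF t] z] by blast
  then show ?thesis by (auto simp: ann_def)
qed

lemma restrict_map_choice:
  assumes y: "functional y" and t: "t \<in> ann (ctr_ker W y)"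
  shows "\<exists>s\<in>ann W. restrict_map (hyp V y) U W F t = F s \<and> (\<forall>e\<in>TP (hyp V y) U. s e = t e)"
proof -
  let ?s = "SOME s. s \<in> ann W \<and> (\<forall>e\<in>TP (hyp V y) U. s e = t e)"
  have "?s \<in> ann W \<and> (\<forall>e\<in>TP (hyp V y) U. ?s e = t e)"
    using someI_ex[of "\<lambda>s. s \<in> ann W \<and> (\<forall>e\<in>TP (hyp V y) U. s e = t e)"] extend_ann[OF y t] by blast
  then show ?thesis unfolding restrict_map_def by blast
qed

lemma restrict_map_eq:
  assumes y: "functional y" and t: "t \<in> ann (ctr_ker W y)" and s: "s \<in> ann W" and f: "f \<in> V" "y f = 0"
    and eq: "\<And>u. u \<in> U \<Longrightarrow> s (tens f u) = t (tens f u)"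
  shows "restrict_map (hyp V y) U W F t f = F s f"
proof -
  obtain r where r: "r \<in> ann W" "restrict_map (hyp V y) U W F t = F r" "\<forall>e\<in>TP (hyp V y) U. r e = t e"
    using restrict_map_choice[OF y t] by blast
  have "F r f = F s f"
  proof (rule F_cong[OF r(1) s f(1)])
    fix u assume u: "u \<in> U"
    have "tens f u \<in> TP (hyp V y) U" using f u by (intro tens_in_TP) simp_all
    then show "r (tens f u) = s (tens f u)" using r(3) eq[OF u] by simp
  qed
  then show ?thesis using r(2) by simp
qed

lemma ann_ctr_ker: "s \<in> ann W \<Longrightarrow> s \<in> ann (ctr_ker W y)"
  by (simp add: ann_def ctr_ker_def)

lemma restrict_map_ann:
  "functional y \<Longrightarrow> s \<in> ann W \<Longrightarrow> f \<in> V \<Longrightarrow> y f = 0 \<Longrightarrow> restrict_map (hyp V y) U W F s f = F s f"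
  using restrict_map_eq[OF _ ann_ctr_ker] by blast

lemma range_compatible_restrict:
  assumes y: "functional y"
  shows "range_compatible (hyp V y) U X (ctr_ker W y) (restrict_map (hyp V y) U W F)"
proof (unfold_locales)
  show "fn.subspace (ctr_ker W y)" unfolding ctr_ker_TP[OF y] by (rule fn.subspace_inter[OF W(1) subspace_TP])
  show "ctr_ker W y \<subseteq> TP (hyp V y) U" unfolding ctr_ker_TP[OF y] by blast
  have "TP (hyp V y) X \<subseteq> TP V X" by (rule TP_mono) (simp_all add: hyp_def)
  moreover have "TP (hyp V y) X \<subseteq> TP (hyp V y) U" by (rule TP_mono[OF subset_refl X(2)])
  ultimately show "TP (hyp V y) X \<subseteq> ctr_ker W y" unfolding ctr_ker_TP[OF y] using W(2) by blast
  show "functional (restrict_map (hyp V y) U W F t)" if "t \<in> ann (ctr_ker W y)" for t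
    using restrict_map_choice[OF y that] F_functional by metis
  show "restrict_map (hyp V y) U W F (s + t) f = restrict_map (hyp V y) U W F s f + restrict_map (hyp V y) U W F t f"
    if s: "s \<in> ann (ctr_ker W y)" and t: "t \<in> ann (ctr_ker W y)" and f: "f \<in> hyp V y" for s t f
  proof -
    obtain s' where s': "s' \<in> ann W" "restrict_map (hyp V y) U W F s = F s'" "\<forall>e\<in>TP (hyp V y) U. s' e = s e"
      using restrict_map_choice[OF y s] by blast
    obtain t' where t': "t' \<in> ann W" "restrict_map (hyp V y) U W F t = F t'" "\<forall>e\<in>TP (hyp V y) U. t' e = t e"
      using restrict_map_choice[OF y t] by blast
    have "restrict_map (hyp V y) U W F (s + t) f = F (s' + t') f"
    proof (rule restrict_map_eq[OF y ann_plus[OF s t] ann_plus[OF s'(1) t'(1)]])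
      fix u assume u: "u \<in> U"
      have "tens f u \<in> TP (hyp V y) U" using f u by (rule tens_in_TP)
      then show "(s' + t') (tens f u) = (s + t) (tens f u)" using s'(3) t'(3) by simp
    qed (use f in simp_all)
    moreover have "f \<in> V" using f by simp
    ultimately show ?thesis using F_add[OF s'(1) t'(1)] s'(2) t'(2) by simp
  qed
  show "restrict_map (hyp V y) U W F t f = 0"
    if t: "t \<in> ann (ctr_ker W y)" and f: "f \<in> hyp V y" and z: "\<And>u. u \<in> U \<Longrightarrow> t (tens f u) = 0" for t f
  proof -
    have "restrict_map (hyp V y) U W F t f = F 0 f"
      by (rule restrict_map_eq[OF y t ann_zero]) (use f z in simp_all)
    also have "\<dots> = 0" using f by (simp add: F_zero)
    finally show ?thesis .
  qed
qed (simp_all add: V U X subspace_hyp fin_gen_hyp y)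

lemma linear_family_restrict:
  assumes y: "functional y" and lin: "linear_family V W F"
  shows "linear_family (hyp V y) (ctr_ker W y) (restrict_map (hyp V y) U W F)"
  unfolding linear_family_def
proof (intro ballI allI)
  fix t c f assume t: "t \<in> ann (ctr_ker W y)" and f: "f \<in> hyp V y"
  obtain s where s: "s \<in> ann W" "restrict_map (hyp V y) U W F t = F s" "\<forall>e\<in>TP (hyp V y) U. s e = t e"
    using restrict_map_choice[OF y t] by blast
  have "restrict_map (hyp V y) U W F (sc c t) f = F (sc c s) f"
  proof (rule restrict_map_eq[OF y ann_scale[OF t] ann_scale[OF s(1)]])
    fix u assume u: "u \<in> U"
    have "tens f u \<in> TP (hyp V y) U" using f u by (rule tens_in_TP)
    then show "sc c s (tens f u) = sc c t (tens f u)" using s(3) by (simp add: sc_apply)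
  qed (use f in simp_all)
  then show "restrict_map (hyp V y) U W F (sc c t) f = c * restrict_map (hyp V y) U W F t f"
    using lin s(1,2) f unfolding linear_family_def by simp
qed

text \<open>The contraction by \<open>y\<close> has rank at least two modulo \<open>X\<close>, so
  the excess drops by at least two while \<open>dim V\<close> drops by one. A bound of the shape
  \<open>2 * dim V - k\<close> thus passes to the hyperplane.\<close>

lemma dim_ctr_ker:
  assumes "ind2 X W y"
  shows "fn.dim (ctr_ker W y) + fn.dim (TP V X) + 2 \<le> fn.dim W + fn.dim (TP (hyp V y) X)"
proof -
  have y: "functional y" using assms by (simp add: ind2_def)
  obtain f where f: "f \<in> V" "y f \<noteq> 0" using ind2_nonzero[OF assms] by blast
  have "X \<subseteq> ctr y ` W" using ctr_image_TP[OF y V(1) X(1) f] W(2) by blast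
  then have "fn.dim X + 2 \<le> fn.dim (ctr y ` W)"
    by (rule ind2_dim[OF assms X(1) fin_gen_X W(1) fin_gen_W])
  moreover have "fn.dim W = fn.dim (ctr_ker W y) + fn.dim (ctr y ` W)"
    unfolding ctr_ker_def by (rule dim_contract[OF y W(1) fin_gen_W])
  moreover have "fn.dim (TP V X) = fn.dim (TP (hyp V y) X) + fn.dim X"
    unfolding hyp_def by (rule dim_TP_kernel[OF y V X(1) fin_gen_X f])
  ultimately show ?thesis by linarith
qed

lemma slice_restrict: "slice (hyp V y) (ctr_ker W y) x \<subseteq> slice V W x"
  by (auto simp: slice_def ctr_ker_def)

lemma dim_slice_restrict: "fn.dim (slice (hyp V y) (ctr_ker W y) x) \<le> fn.dim (slice V W x)"
  by (rule fn.dim_mono_fin_gen[OF slice_restrict fin_gen_slice[OF V(2)]])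

text \<open>The vectors \<open>u1\<close> and \<open>u2\<close> found on the two hyperplanes act
  alike on their intersection, which therefore lies in the slice at \<open>u1 - u2\<close>. It has
  dimension \<open>dim V - 2\<close>, too large unless \<open>u1 - u2\<close> is in
  \<open>X\<close>; then \<open>u1\<close> works on both hyperplanes, which together span
  \<open>V\<close>.\<close>

lemma local_if_two_restrictions_local:
  assumes y: "functional y1" "functional y2" and g: "g \<in> V" "y1 g = 0" "y2 g \<noteq> 0"
    and y1: "\<exists>f\<in>V. y1 f \<noteq> 0"
    and loc: "is_local (hyp V y1) U (ctr_ker W y1) (restrict_map (hyp V y1) U W F)"
      "is_local (hyp V y2) U (ctr_ker W y2) (restrict_map (hyp V y2) U W F)"
    and sl: "\<And>x. x \<in> U \<Longrightarrow> x \<notin> X \<Longrightarrow> fn.dim (slice V W x) + 3 \<le> fn.dim V"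
  shows "is_local V U W F"
proof -
  have ex: "\<exists>u\<in>U. \<forall>s\<in>ann W. \<forall>f\<in>V. y f = 0 \<longrightarrow> F s f = s (tens f u)"
    if y: "functional y" and loc: "is_local (hyp V y) U (ctr_ker W y) (restrict_map (hyp V y) U W F)" for y
  proof -
    obtain u where u: "u \<in> U"
      "\<forall>s\<in>ann (ctr_ker W y). \<forall>f\<in>hyp V y. restrict_map (hyp V y) U W F s f = s (tens f u)"
      using loc unfolding is_local_def by blast
    have "F s f = s (tens f u)" if "s \<in> ann W" "f \<in> V" "y f = 0" for s f
      using restrict_map_ann[OF y that] u(2) ann_ctr_ker[OF that(1), of y] that(2,3) by simp
    then show ?thesis using u(1) by blast
  qed
  obtain u1 u2 where u: "u1 \<in> U" "u2 \<in> U"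
    and u1: "\<And>s f. s \<in> ann W \<Longrightarrow> f \<in> V \<Longrightarrow> y1 f = 0 \<Longrightarrow> F s f = s (tens f u1)"
    and u2: "\<And>s f. s \<in> ann W \<Longrightarrow> f \<in> V \<Longrightarrow> y2 f = 0 \<Longrightarrow> F s f = s (tens f u2)"
    using ex[OF y(1) loc(1)] ex[OF y(2) loc(2)] by blast
  let ?x = "u1 - u2"
  have in_slice: "f \<in> slice V W ?x" if f: "f \<in> hyp (hyp V y1) y2" for f
  proof -
    have f': "f \<in> V" "y1 f = 0" "y2 f = 0" using f by simp_all
    have "s (tens f ?x) = 0" if s: "s \<in> ann W" for s
      using u1[OF s f'(1,2)] u2[OF s f'(1,3)] by (simp add: tens_simps functional_diff[OF annD(1)[OF s]])
    then have "tens f ?x \<in> W" using mem_iff_ann[OF W(1)] by blast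
    then show ?thesis using f by (simp add: slice_def)
  qed
  have xX: "?x \<in> X"
  proof (rule ccontr)
    assume "?x \<notin> X"
    moreover have "?x \<in> U" using u U(1) fn.subspace_diff by blast
    ultimately have "fn.dim (slice V W ?x) + 3 \<le> fn.dim V" using sl by blast
    moreover have "fn.dim (hyp (hyp V y1) y2) \<le> fn.dim (slice V W ?x)"
      by (rule fn.dim_mono_fin_gen[OF _ fin_gen_slice[OF V(2)]]) (use in_slice in blast)
    moreover obtain f where "f \<in> V" "y1 f \<noteq> 0" using y1 by blast
    then have "Suc (fn.dim (hyp V y1)) = fn.dim V" by (rule dim_hyp[OF V y(1)])
    moreover have "Suc (fn.dim (hyp (hyp V y1) y2)) = fn.dim (hyp V y1)"
      by (rule dim_hyp[OF subspace_hyp[OF V(1) y(1)] fin_gen_hyp[OF V(2)] y(2), of g]) (use g in simp_all)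
    ultimately show False by linarith
  qed
  have u2': "F s f = s (tens f u1)" if s: "s \<in> ann W" and f: "f \<in> V" "y2 f = 0" for s f
  proof -
    have "tens f ?x \<in> W" using W(2) tens_in_TP[OF f(1) xX] by blast
    then have "s (tens f ?x) = 0" using annD(2)[OF s] by blast
    then show ?thesis using u2[OF s f] by (simp add: tens_simps functional_diff[OF annD(1)[OF s]])
  qed
  have "F s f = s (tens f u1)" if s: "s \<in> ann W" and f: "f \<in> V" for s f
  proof -
    let ?c = "y2 f / y2 g"
    have "f - sc ?c g \<in> V" using f g V(1) by (simp add: fn.subspace_diff fn.subspace_scale)
    moreover have "y2 (f - sc ?c g) = 0" using g by (simp add: functional_simps[OF y(2)])
    ultimately have "F s (f - sc ?c g) = s (tens (f - sc ?c g) u1)" by (rule u2'[OF s])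
    moreover have "F s g = s (tens g u1)" using u1[OF s g(1,2)] .
    ultimately show ?thesis
      by (simp add: functional_simps[OF F_functional[OF s]] tens_simps functional_simps[OF annD(1)[OF s]])
  qed
  then show ?thesis unfolding is_local_def using u(1) by blast
qed

text \<open>Adding the column \<open>u\<close> stays inside
  \<open>TP V (fn.span (insert u X))\<close>, so no excess is left: the slice at \<open>u\<close>
  accounts for all of it.\<close>

lemma slice_if_rank_one:
  assumes u: "u \<in> U" "u \<notin> X" and WT: "W \<subseteq> TP V (fn.span (insert u X))"
  shows "fn.dim W \<le> fn.dim (TP V X) + fn.dim (slice V W u)"
proof -
  have uX: "u \<in> fn.span (insert u X)" by (intro fn.span_base) simp
  have "add_col V W u \<subseteq> TP V (fn.span (insert u X))"
    by (rule add_col_minimal[OF WT tens_in_TP[OF _ uX] subspace_TP])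
  then have "fn.dim (add_col V W u) \<le> fn.dim (TP V (fn.span (insert u X)))"
    by (rule fn.dim_mono_fin_gen[OF _ fin_gen_TP[OF V(2) fin_gen_span_insert[OF fin_gen_X]]])
  then show ?thesis using dim_add_col_insert(1,2)[OF u] by linarith
qed

text \<open>Otherwise \<open>rank_one_cases\<close> gives either a slice as large as the excess,
  hence of dimension at least \<open>dim V - 1\<close>, or an excess of at most 1, while it is at
  least \<open>dim V - 1 \<ge> 2\<close>.\<close>

lemma exists_ind2:
  assumes d: "fn.dim (TP V X) + fn.dim V < fn.dim W + 2" and V3: "3 \<le> fn.dim V"
    and sl: "\<And>x. x \<in> U \<Longrightarrow> x \<notin> X \<Longrightarrow> fn.dim (slice V W x) + 3 \<le> fn.dim V"
  shows "\<exists>y. ind2 X W y"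
proof (rule ccontr)
  assume "\<not> ?thesis"
  then have "\<And>y. \<not> ind2 X W y" by blast
  from rank_one_cases[OF this] show False
  proof
    assume "\<exists>u\<in>U. u \<notin> X \<and> W \<subseteq> TP V (fn.span (insert u X))"
    then obtain u where u: "u \<in> U" "u \<notin> X" "W \<subseteq> TP V (fn.span (insert u X))" by blast
    from slice_if_rank_one[OF u] sl[OF u(1,2)] d show False by linarith
  next
    assume "fn.dim W \<le> Suc (fn.dim (TP V X))"
    then show False using d V3 by linarith
  qed
qed

text \<open>Complement to \<open>common_factor\<close>: here the columns \<open>x\<close> lie on one
  line, spanned by the column of \<open>t\<close>, and homogeneity carries the factor of
  \<open>t\<close> over to every matrix.\<close>

lemma local_if_linear_line:
  assumes x: "x \<in> U" and lin: "linear_family V W F"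
    and pr: "\<forall>s\<in>ann W. \<exists>c. \<forall>f\<in>V. F s f = c * s (tens f x)"
    and sl: "fn.dim V \<le> Suc (fn.dim (slice V W x))"
  shows "is_local V U W F"
proof (cases "slice V W x = V")
  case True
  have "F s f = s (tens f 0)" if s: "s \<in> ann W" and f: "f \<in> V" for s f
  proof -
    have "tens f x \<in> W" using f True by (auto simp: slice_def)
    then have "s (tens f x) = 0" by (rule annD(2)[OF s])
    then show ?thesis using pr s f by (auto simp: tens_simps functional_0[OF annD(1)[OF s]])
  qed
  then show ?thesis unfolding is_local_def using fn.subspace_0[OF U(1)] by blast
next
  case False
  have sub: "slice V W x \<subseteq> V" by (auto simp: slice_def)
  obtain g where g: "g \<in> V" "g \<notin> slice V W x" using False sub by blast
  have span: "fn.span (insert g (slice V W x)) = V"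
  proof (rule fn.subspace_dim_eq_imp_eq[OF fn.subspace_span _ V(2)])
    show "fn.span (insert g (slice V W x)) \<subseteq> V" by (rule fn.span_minimal[OF _ V(1)]) (use g sub in blast)
    show "fn.dim V \<le> fn.dim (fn.span (insert g (slice V W x)))"
      using fn.dim_insert_notin[OF subspace_slice[OF V(1) W(1)] fin_gen_slice[OF V(2)] g(2)] sl by simp
  qed
  have "tens g x \<notin> W" using g by (simp add: slice_def)
  from ann_separate[OF W(1) this] obtain t where t: "t \<in> ann W" "t (tens g x) = 1" by blast
  obtain c where c: "\<forall>f\<in>V. F t f = c * t (tens f x)" using pr t(1) by blast
  have "F s f = s (tens f (sc c x))" if s: "s \<in> ann W" and f: "f \<in> V" for s f
  proof -
    let ?b = "s (tens g x)"
    define r where "r = s - sc ?b t"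
    have r: "r \<in> ann W" unfolding r_def by (intro ann_minus s ann_scale t(1))
    have fr: "functional (\<lambda>f. r (tens f x))" by (rule functional_tens_left[OF annD(1)[OF r]])
    have r0: "r (tens f x) = 0"
    proof (rule functional_span_zero[OF fr])
      show "f \<in> fn.span (insert g (slice V W x))" using f span by simp
      show "r (tens h x) = 0" if "h \<in> insert g (slice V W x)" for h
        using that t(2) annD(2)[OF r] by (auto simp: r_def sc_apply slice_def)
    qed
    then have "s (tens f x) = ?b * t (tens f x)" by (simp add: r_def sc_apply)
    moreover have "F r f = 0" using pr r f r0 by auto
    then have "F s f = F (sc ?b t) f" using F_diff[OF s ann_scale[OF t(1)] f] by (simp add: r_def)
    moreover have "F (sc ?b t) f = ?b * F t f" using lin t(1) f by (simp add: linear_family_def)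
    ultimately show ?thesis using c f
      by (simp add: tens_simps functional_sc[OF annD(1)[OF s]])
  qed
  then show ?thesis unfolding is_local_def using x U(1) fn.subspace_scale by blast
qed

lemma local_if_linear_almost_local:
  assumes x: "x \<in> U" and lin: "linear_family V W F"
    and al: "\<exists>u\<in>U. \<forall>s\<in>ann W. \<exists>c. \<forall>f\<in>V. F s f = s (tens f u) + c * s (tens f x)"
    and sl: "fn.dim V \<le> Suc (fn.dim (slice V W x))"
  shows "is_local V U W F"
proof -
  obtain u where u: "u \<in> U" "\<forall>s\<in>ann W. \<exists>c. \<forall>f\<in>V. F s f = s (tens f u) + c * s (tens f x)"
    using al by blast
  interpret G: range_compatible V U X W "\<lambda>s f. F s f - s (tens f u)"
    by (rule range_compatible_minus_local[OF u(1)])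
  have "is_local V U W (\<lambda>s f. F s f - s (tens f u))"
  proof (rule G.local_if_linear_line[OF x _ _ sl])
    show "linear_family V W (\<lambda>s f. F s f - s (tens f u))"
      using lin by (simp add: linear_family_def sc_apply right_diff_distrib)
    show "\<forall>s\<in>ann W. \<exists>c. \<forall>f\<in>V. F s f - s (tens f u) = c * s (tens f x)"
    proof
      fix s assume "s \<in> ann W"
      then obtain c where "\<forall>f\<in>V. F s f = s (tens f u) + c * s (tens f x)" using u(2) by blast
      then show "\<exists>c. \<forall>f\<in>V. F s f - s (tens f u) = c * s (tens f x)" by (intro exI[of _ c]) simp
    qed
  qed
  then obtain w where w: "w \<in> U" "\<forall>s\<in>ann W. \<forall>f\<in>V. F s f - s (tens f u) = s (tens f w)"
    unfolding is_local_def by blast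
  have "F s f = s (tens f (u + w))" if "s \<in> ann W" "f \<in> V" for s f
    using w(2) that by (simp add: tens_simps functional_add[OF annD(1)[OF that(1)]] algebra_simps)
  then show ?thesis unfolding is_local_def using u(1) w(1) U(1) fn.subspace_add by blast
qed

lemma linear_family_add_col: "linear_family V W F \<Longrightarrow> linear_family V (add_col V W x) F"
  unfolding linear_family_def by (simp add: mem_ann_add_col)

end

text \<open>For merely additive \<open>F\<close> a column whose values form at most a line cannot be
  cleared, since an additive map of a line need not be a homothety. It is returned as the second
  alternative, with \<open>F\<close> known up to a factor on that column.\<close>

theorem local_or_special_column:
  assumes "range_compatible V U X W F" and "fn.dim W + 4 \<le> fn.dim (TP V X) + 2 * fn.dim V"
  shows "is_local V U W F \<or> (\<exists>x\<in>U. x \<notin> X \<and> fn.dim V \<le> Suc (fn.dim (slice V W x)) \<and>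
    (\<exists>u\<in>U. \<forall>s\<in>ann W. \<exists>c. \<forall>f\<in>V. F s f = s (tens f u) + c * s (tens f x)))"
  using assms
proof (induction "fn.dim V" arbitrary: V W F rule: less_induct)
  case (less V W F)
  interpret range_compatible V U X W F by (rule less.prems(1))
  show ?case
  \<comment> \<open>A slice of dimension at least \<open>dim V - 2\<close> brings the excess from
    \<open>2 * dim V - 4\<close> down to \<open>dim V - 2\<close>, where
    \<open>local_small_codim\<close> applies.\<close>
  proof (cases "\<exists>x\<in>U. x \<notin> X \<and> fn.dim V \<le> fn.dim (slice V W x) + 2")
    case True
    then obtain x where x: "x \<in> U" "x \<notin> X" and sl: "fn.dim V \<le> fn.dim (slice V W x) + 2" by blast
    note d = dim_add_col_insert[OF x]
    have d': "fn.dim (add_col V W x) + 2 \<le> fn.dim (TP V (fn.span (insert x X))) + fn.dim V"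
      using d(1,2) less.prems(2) sl by linarith
    have loc: "is_local V U (add_col V W x) F"
      by (rule local_small_codim[OF range_compatible_add_col[OF x(1)] d'])
    show ?thesis
    proof (cases "fn.dim (slice V W x) + 2 \<le> fn.dim V")
      case True
      from local_step[OF x(1) loc disjI1[OF d'] True] show ?thesis by blast
    next
      case False
      then have "fn.dim V \<le> Suc (fn.dim (slice V W x))" by simp
      then show ?thesis using x almost_local[OF x(1) loc d'] by blast
    qed
  next
    case False
    then have sl: "fn.dim (slice V W x) + 3 \<le> fn.dim V" if "x \<in> U" "x \<notin> X" for x
      using that by fastforce
    show ?thesis
    proof (cases "X = U \<or> fn.dim W + 2 \<le> fn.dim (TP V X) + fn.dim V")
      case True
      then show ?thesis using local_if_full local_small_codim[OF less.prems(1)] by blast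
    next
      case big: False
      then obtain x where "x \<in> U" "x \<notin> X" using X(2) by blast
      then have V3: "3 \<le> fn.dim V" using sl by fastforce
      have big': "fn.dim (TP V X) + fn.dim V < fn.dim W + 2" using big by simp
      obtain y1 where y1: "ind2 X W y1" using exists_ind2[OF big' V3 sl] by blast
      obtain y2 g where y2: "ind2 X W y2" and g: "g \<in> V" "y1 g = 0" "y2 g \<noteq> 0"
        using second_ind2[OF y1 V3] by blast
      have loc: "is_local (hyp V y) U (ctr_ker W y) (restrict_map (hyp V y) U W F)" if y: "ind2 X W y" for y
      proof -
        have fy: "functional y" using y by (simp add: ind2_def)
        obtain f where f: "f \<in> V" "y f \<noteq> 0" using ind2_nonzero[OF y] by blast
        have dh: "Suc (fn.dim (hyp V y)) = fn.dim V" by (rule dim_hyp[OF V fy f])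
        have "fn.dim (ctr_ker W y) + 4 \<le> fn.dim (TP (hyp V y) X) + 2 * fn.dim (hyp V y)"
          using dim_ctr_ker[OF y] less.prems(2) dh by linarith
        from less.hyps[OF _ range_compatible_restrict[OF fy] this] dh
        consider "is_local (hyp V y) U (ctr_ker W y) (restrict_map (hyp V y) U W F)"
          | x where "x \<in> U" "x \<notin> X" "fn.dim (hyp V y) \<le> Suc (fn.dim (slice (hyp V y) (ctr_ker W y) x))" by auto
        then show ?thesis
        proof cases
          case 1 then show ?thesis .
        next
          \<comment> \<open>A special column of the restriction would have a slice of dimension at
            least \<open>dim V - 2\<close>, but the slices here are at most
            \<open>dim V - 3\<close>.\<close>
          case (2 x)
          then show ?thesis using sl[OF 2(1,2)] dim_slice_restrict[of y x] dh by linarith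
        qed
      qed
      have "functional y1" "functional y2" using y1 y2 by (simp_all add: ind2_def)
      from local_if_two_restrictions_local[OF this g ind2_nonzero[OF y1] loc[OF y1] loc[OF y2] sl]
      show ?thesis by blast
    qed
  qed
qed

lemma bound_transfer:
  "a + 4 \<le> b \<or> a + 3 \<le> b \<and> P \<Longrightarrow> c + b \<le> a + d \<Longrightarrow> c + 4 \<le> d \<or> c + 3 \<le> d \<and> P" for a b c d :: nat
  by auto

text \<open>Three ranges of slices. From \<open>dim V - 1\<close> on: the excess falls to
  \<open>dim V - 2\<close> and linearity finishes. Exactly \<open>dim V - 2\<close>: the excess
  after adding \<open>x\<close> is at most \<open>dim V - 1\<close>, or \<open>dim V - 2\<close>
  under the stronger bound, which are the two cases of \<open>local_step\<close>. Below: two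
  hyperplanes. Adding \<open>x\<close> lowers \<open>dim U - dim X\<close> and restricting lowers
  \<open>dim V\<close>, so the sum is the induction measure.\<close>

theorem linear_local:
  assumes "range_compatible V U X W F" and "linear_family V W F"
    and "fn.dim W + 4 \<le> fn.dim (TP V X) + 2 * fn.dim V \<or>
      fn.dim W + 3 \<le> fn.dim (TP V X) + 2 * fn.dim V \<and> (\<exists>a::'a::field. a \<noteq> 0 \<and> a \<noteq> 1)"
  shows "is_local (V :: ('i \<Rightarrow> 'a) set) U W F"
  using assms
proof (induction "fn.dim V + (fn.dim U - fn.dim X)" arbitrary: V X W F rule: less_induct)
  case (less V X W F)
  interpret range_compatible V U X W F by (rule less.prems(1))
  note lin = less.prems(2)
  have bound: "fn.dim W + 3 \<le> fn.dim (TP V X) + 2 * fn.dim V" using less.prems(3) by linarith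
  show ?case
  proof (cases "\<exists>x\<in>U. x \<notin> X \<and> fn.dim V \<le> fn.dim (slice V W x) + 2")
    case True
    then obtain x where x: "x \<in> U" "x \<notin> X" and sl: "fn.dim V \<le> fn.dim (slice V W x) + 2" by blast
    note d = dim_add_col_insert[OF x]
    show ?thesis
    proof (cases "fn.dim V \<le> Suc (fn.dim (slice V W x))")
      case True
      have d': "fn.dim (add_col V W x) + 2 \<le> fn.dim (TP V (fn.span (insert x X))) + fn.dim V"
        using d(1,2) bound True by linarith
      have loc: "is_local V U (add_col V W x) F"
        by (rule local_small_codim[OF range_compatible_add_col[OF x(1)] d'])
      show ?thesis by (rule local_if_linear_almost_local[OF x(1) lin almost_local[OF x(1) loc d'] True])
    next
      case False
      then have sl2: "fn.dim (slice V W x) + 2 = fn.dim V" using sl by linarith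
      have "is_local V U (add_col V W x) F"
      proof (rule less.hyps[OF _ range_compatible_add_col[OF x(1)] linear_family_add_col[OF lin]])
        show "fn.dim V + (fn.dim U - fn.dim (fn.span (insert x X))) < fn.dim V + (fn.dim U - fn.dim X)"
          using dim_insert_less[OF x] by simp
        show "fn.dim (add_col V W x) + 4 \<le> fn.dim (TP V (fn.span (insert x X))) + 2 * fn.dim V \<or>
          fn.dim (add_col V W x) + 3 \<le> fn.dim (TP V (fn.span (insert x X))) + 2 * fn.dim V \<and> (\<exists>a::'a. a \<noteq> 0 \<and> a \<noteq> 1)"
          by (rule bound_transfer[OF less.prems(3)]) (use d(1,2) in linarith)
      qed
      moreover have "fn.dim (add_col V W x) + 2 \<le> fn.dim (TP V (fn.span (insert x X))) + fn.dim V \<or>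
        fn.dim (add_col V W x) < fn.dim (TP V (fn.span (insert x X))) + fn.dim V \<and> (\<exists>a::'a. a \<noteq> 0 \<and> a \<noteq> 1)"
        using bound_transfer[OF less.prems(3), of "fn.dim (add_col V W x)"
            "fn.dim (TP V (fn.span (insert x X))) + fn.dim V + 2"] d(1,2) sl2 by auto
      ultimately show ?thesis using local_step[OF x(1)] sl2 by simp
    qed
  next
    case False
    then have sl: "fn.dim (slice V W x) + 3 \<le> fn.dim V" if "x \<in> U" "x \<notin> X" for x
      using that by fastforce
    show ?thesis
    proof (cases "X = U \<or> fn.dim W + 2 \<le> fn.dim (TP V X) + fn.dim V")
      case True
      then show ?thesis using local_if_full local_small_codim[OF less.prems(1)] by blast
    next
      case big: False
      then obtain x where "x \<in> U" "x \<notin> X" using X(2) by blast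
      then have V3: "3 \<le> fn.dim V" using sl by fastforce
      have big': "fn.dim (TP V X) + fn.dim V < fn.dim W + 2" using big by simp
      obtain y1 where y1: "ind2 X W y1" using exists_ind2[OF big' V3 sl] by blast
      obtain y2 g where y2: "ind2 X W y2" and g: "g \<in> V" "y1 g = 0" "y2 g \<noteq> 0"
        using second_ind2[OF y1 V3] by blast
      have loc: "is_local (hyp V y) U (ctr_ker W y) (restrict_map (hyp V y) U W F)" if y: "ind2 X W y" for y
      proof -
        have fy: "functional y" using y by (simp add: ind2_def)
        obtain f where f: "f \<in> V" "y f \<noteq> 0" using ind2_nonzero[OF y] by blast
        have dh: "Suc (fn.dim (hyp V y)) = fn.dim V" by (rule dim_hyp[OF V fy f])
        show ?thesis
        proof (rule less.hyps[OF _ range_compatible_restrict[OF fy] linear_family_restrict[OF fy lin]])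
          show "fn.dim (hyp V y) + (fn.dim U - fn.dim X) < fn.dim V + (fn.dim U - fn.dim X)" using dh by linarith
          show "fn.dim (ctr_ker W y) + 4 \<le> fn.dim (TP (hyp V y) X) + 2 * fn.dim (hyp V y) \<or>
            fn.dim (ctr_ker W y) + 3 \<le> fn.dim (TP (hyp V y) X) + 2 * fn.dim (hyp V y) \<and> (\<exists>a::'a. a \<noteq> 0 \<and> a \<noteq> 1)"
            by (rule bound_transfer[OF less.prems(3)]) (use dim_ctr_ker[OF y] dh in linarith)
        qed
      qed
      have "functional y1" "functional y2" using y1 y2 by (simp_all add: ind2_def)
      from local_if_two_restrictions_local[OF this g ind2_nonzero[OF y1] loc[OF y1] loc[OF y2] sl]
      show ?thesis .
    qed
  qed
qed

text \<open>Comparing the relation at \<open>t\<close>, \<open>1\<close> and \<open>t + 1\<close> eliminates \<open>K\<close> and \<open>E\<close>.\<close>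

lemma quadratic_relation_first:
  fixes K B D E :: "'a::field \<Rightarrow> 'a"
  assumes add: "\<And>a b. B (a + b) = B a + B b" "\<And>a b. D (a + b) = D a + D b" "\<And>a b. E (a + b) = E a + E b"
    and rel: "\<And>t m. t * (K m + D (m * t)) = B (m * t * t) + E (m * t)"
  shows "D (m * t) = t * D m"
proof -
  have two: "D (m * t) + t * D m = B (m * t) + B (m * t)" for m t
  proof -
    have r1: "K m + D m = B m + E m" using rel[of 1 m] by simp
    have r2: "t * (K m + D (m * t)) = B (m * t * t) + E (m * t)" by (rule rel)
    have e1: "m * (t + 1) = m * t + m" by (simp add: algebra_simps)
    have e2: "(m * t + m) * (t + 1) = m * t * t + (m * t + m * t) + m" by (simp add: algebra_simps)
    have r3: "(t + 1) * (K m + (D (m * t) + D m)) = B (m * t * t) + (B (m * t) + B (m * t)) + B m + (E (m * t) + E m)"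
      using rel[of "t + 1" m] unfolding e1 e2 add .
    have aux: "d1 + t * d0 = b1 + b1"
      if "k + d0 = b0 + e0" "t * (k + d1) = b2 + e1" "(t + 1) * (k + (d1 + d0)) = b2 + (b1 + b1) + b0 + (e1 + e0)"
      for k d0 d1 b0 b1 b2 e0 e1 :: 'a
      using that by Groebner_Basis.algebra
    show ?thesis by (rule aux[OF r1 r2 r3])
  qed
  have "D (m * t) + D (m * t) = B (m * t) + B (m * t)" 
    using two[of "m * t" 1] by (simp only: mult_1_left mult_1_right)
  then have "D (m * t) + t * D m = D (m * t) + D (m * t)" using two[of m t] by (simp only:)
  then show ?thesis by (simp only: add_left_cancel)
qed

text \<open>Replacing \<open>m\<close> by \<open>m * t * t\<close> and \<open>t\<close> by
  \<open>1 / t\<close> exchanges \<open>K\<close> with \<open>B\<close> and \<open>D\<close> with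
  \<open>E\<close>, so the previous lemma also makes \<open>E\<close> homogeneous.\<close>

lemma quadratic_relation:
  fixes K B D E :: "'a::field \<Rightarrow> 'a"
  assumes add: "\<And>a b. K (a + b) = K a + K b" "\<And>a b. B (a + b) = B a + B b"
      "\<And>a b. D (a + b) = D a + D b" "\<And>a b. E (a + b) = E a + E b"
    and rel: "\<And>t m. t * (K m + D (m * t)) = B (m * t * t) + E (m * t)"
  shows "D (m * t) = t * D m" and "E (m * t) = t * E m"
proof -
  show D: "D (m * t) = t * D m" for m t by (rule quadratic_relation_first[OF add(2-4) rel])
  have zero: "K 0 = 0" "D 0 = 0" 
    using add(1)[of 0 0] add(3)[of 0 0] by (simp_all only: add_0_left add_cancel_right_right)
  have "t * (B m + E (m * t)) = K (m * t * t) + D (m * t)" for t m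
  proof (cases "t = 0")
    case True then show ?thesis by (simp add: zero)
  next
    case False
    have "1 / t * (K (m * t * t) + D (m * t * t * (1 / t))) = B (m * t * t * (1 / t) * (1 / t)) + E (m * t * t * (1 / t))"
      by (rule rel)
    then have "1 / t * (K (m * t * t) + D (m * t)) = B m + E (m * t)" using False by simp
    then show ?thesis using False by (simp add: field_simps)
  qed
  from quadratic_relation_first[OF add(1,4,3) this] show "E (m * t) = t * E m" .
qed

section \<open>The defect of homogeneity\<close>

definition defect :: "'a::field \<Rightarrow> ((('i \<times> 'j \<Rightarrow> 'a) \<Rightarrow> 'a) \<Rightarrow> ('i \<Rightarrow> 'a) \<Rightarrow> 'a) \<Rightarrow>
    (('i \<times> 'j \<Rightarrow> 'a) \<Rightarrow> 'a) \<Rightarrow> ('i \<Rightarrow> 'a) \<Rightarrow> 'a" where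
  "defect c F s f = F (sc c s) f - c * F s f"

text \<open>For every \<open>s\<close> in \<open>ann W\<close> the bilinear form
  \<open>s (tens f (h g))\<close> on \<open>V\<close> is then symmetric.\<close>

definition sym_form :: "('i \<Rightarrow> 'a::field) set \<Rightarrow> ('j \<Rightarrow> 'a) set \<Rightarrow> ('i \<times> 'j \<Rightarrow> 'a) set \<Rightarrow> (('i \<Rightarrow> 'a) \<Rightarrow> ('j \<Rightarrow> 'a)) \<Rightarrow> bool" where
  "sym_form V U W h \<longleftrightarrow> Vector_Spaces.linear sc sc h \<and> (\<forall>f\<in>V. h f \<in> U) \<and>
    (\<forall>f\<in>V. \<forall>g\<in>V. tens f (h g) - tens g (h f) \<in> W)"

text \<open>In characteristic 2 the diagonal \<open>s (tens f (h f))\<close> of a symmetric form is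
  additive in \<open>f\<close> and homogeneous of degree two. An additive \<open>b\<close> with
  \<open>b (m * t * t) = t * b m\<close>, which is the kind that arises, turns it into a linear
  function of \<open>f\<close>.\<close>

definition root_form :: "('i \<Rightarrow> 'a::field) set \<Rightarrow> ('i \<times> 'j \<Rightarrow> 'a) set \<Rightarrow> ((('i \<times> 'j \<Rightarrow> 'a) \<Rightarrow> 'a) \<Rightarrow> ('i \<Rightarrow> 'a) \<Rightarrow> 'a) \<Rightarrow>
    (('i \<Rightarrow> 'a) \<Rightarrow> ('j \<Rightarrow> 'a)) \<Rightarrow> ('a \<Rightarrow> 'a) \<Rightarrow> bool" where
  "root_form V W G h b \<longleftrightarrow> (\<forall>s\<in>ann W. \<forall>f\<in>V. G s f = b (s (tens f (h f)))) \<and>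
    (\<forall>p q. b (p + q) = b p + b q) \<and> (1::'a) + 1 = 0 \<and> (\<exists>p. b p \<noteq> 0)"

context range_compatible
begin

lemma range_compatible_defect: "range_compatible V U X W (defect c F)"
proof (unfold_locales)
  show "functional (defect c F s)" if s: "s \<in> ann W" for s
    using functional_minus_fun[OF F_functional[OF ann_scale[OF s]] functional_scale[OF F_functional[OF s]], of c c]
    by (simp add: fun_diff_def sc_def defect_def[abs_def])
  show "defect c F (s + t) f = defect c F s f + defect c F t f" if "s \<in> ann W" "t \<in> ann W" "f \<in> V" for s t f
    using that by (simp add: defect_def fn.scale_right_distrib F_add ann_scale algebra_simps)
  show "defect c F s f = 0" if "s \<in> ann W" "f \<in> V" "\<And>u. u \<in> U \<Longrightarrow> s (tens f u) = 0" for s f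
    using F_range[OF that] F_range[OF ann_scale[OF that(1)] that(2)] that(3) by (simp add: defect_def sc_apply)
qed (simp_all add: V U X W)

lemma defect_local:
  assumes "is_local V U W F" "s \<in> ann W" "f \<in> V" shows "defect c F s f = 0"
proof -
  obtain u where "\<forall>s\<in>ann W. \<forall>f\<in>V. F s f = s (tens f u)" using assms(1) unfolding is_local_def by blast
  then show ?thesis using assms(2,3) ann_scale[OF assms(2), of c] by (simp add: defect_def sc_apply)
qed

text \<open>Were \<open>h\<close> of rank one modulo \<open>X\<close>, then
  \<open>tens f (h g)\<close> would lie in \<open>W\<close> for all \<open>g\<close> in a
  hyperplane; by symmetry so would \<open>tens g (h f)\<close>, and the slice at \<open>h f\<close>
  would have dimension at least \<open>dim V - 1\<close>.\<close>

lemma sym_rank_two: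
  assumes h: "sym_form V U W h" and f: "f \<in> V" "h f \<notin> X"
    and sl: "\<And>x. x \<in> U \<Longrightarrow> x \<notin> X \<Longrightarrow> fn.dim (slice V W x) + 2 \<le> fn.dim V"
  shows "\<exists>g\<in>V. h g \<notin> fn.span (insert (h f) X)"
proof (rule ccontr)
  assume "\<not> ?thesis"
  then have all: "\<exists>k. h g - sc k (h f) \<in> X" if "g \<in> V" for g
    using that by (auto simp: mem_span_insert[OF X(1)])
  have lin: "h (p + q) = h p + h q" "h (sc c p) = sc c (h p)" for p q c
    using h by (simp_all add: sym_form_def linear_sc_iff)
  obtain r where r: "functional r" "\<forall>x\<in>X. r x = 0" "r (h f) = 1"
    using functional_separate[OF X(1) f(2)] by blast
  have fr: "functional (\<lambda>g. r (h g))"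
    by (rule functionalI) (simp_all add: lin functional_simps[OF r(1)])
  have "hyp V (\<lambda>g. r (h g)) \<subseteq> slice V W (h f)"
  proof
    fix g assume g: "g \<in> hyp V (\<lambda>g. r (h g))"
    then have gV: "g \<in> V" "r (h g) = 0" by simp_all
    obtain k where k: "h g - sc k (h f) \<in> X" using all[OF gV(1)] by blast
    then have "r (h g - sc k (h f)) = 0" using r(2) by blast
    then have "k = 0" using gV(2) r(3) by (simp add: functional_simps[OF r(1)])
    then have "tens f (h g) \<in> W" using k W(2) tens_in_TP[OF f(1)] by auto
    moreover have "tens f (h g) - tens g (h f) \<in> W" using h f(1) gV(1) by (simp add: sym_form_def)
    ultimately have "tens f (h g) - (tens f (h g) - tens g (h f)) \<in> W" using W(1) fn.subspace_diff by blast
    then show "g \<in> slice V W (h f)" using gV(1) by (simp add: slice_def)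
  qed
  then have "fn.dim (hyp V (\<lambda>g. r (h g))) \<le> fn.dim (slice V W (h f))"
    by (rule fn.dim_mono_fin_gen[OF _ fin_gen_slice[OF V(2)]])
  moreover have "Suc (fn.dim (hyp V (\<lambda>g. r (h g)))) = fn.dim V"
    by (rule dim_hyp[OF V fr f(1)]) (use r(3) in simp)
  moreover have "h f \<in> U" using h f(1) by (simp add: sym_form_def)
  ultimately show False using sl[OF _ f(2)] by fastforce
qed

text \<open>The symmetry relations of \<open>f\<close> and of \<open>g\<close> with the other basis
  vectors are independent modulo \<open>T\<close>: the functional dual to \<open>j\<close> contracts
  those of \<open>j\<close> to \<open>- h f\<close> and \<open>- h g\<close>, independent modulo
  \<open>X\<close>, and everything else into \<open>X\<close>. There are
  \<open>2 * (dim V - 2)\<close> of them, which explains the constant 4.\<close>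

lemma sym_form_dim:
  assumes h: "sym_form V U W h" and B: "finite B" "fn.independent B" "fn.span B = V"
    and fg: "f \<in> B" "g \<in> B" "f \<noteq> g" "h f \<notin> X" "h g \<notin> fn.span (insert (h f) X)"
    and T0: "fn.subspace T" "T \<subseteq> W" "\<And>y N. functional y \<Longrightarrow> y f = 0 \<Longrightarrow> y g = 0 \<Longrightarrow> N \<in> T \<Longrightarrow> ctr y N \<in> X"
  shows "fn.dim T + 2 * fn.dim V \<le> fn.dim W + 4"
    and "fn.dim W + 4 \<le> fn.dim T + 2 * fn.dim V \<Longrightarrow>
      W = fn.span (T \<union> ((\<lambda>b. tens f (h b) - tens b (h f)) ` (B - {f, g}) \<union> (\<lambda>b. tens g (h b) - tens b (h g)) ` (B - {f, g})))"
proof -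
  define R where "R a b = tens a (h b) - tens b (h a)" for a b
  define S where "S E = fn.span (T \<union> (R f ` E \<union> R g ` E))" for E
  have BV: "b \<in> V" if "b \<in> B" for b using that B(3) fn.span_base by blast
  have RW: "R a b \<in> W" if "a \<in> B" "b \<in> B" for a b using h BV[OF that(1)] BV[OF that(2)] by (simp add: sym_form_def R_def)
  have SW: "S E \<subseteq> W" if "E \<subseteq> B" for E
    unfolding S_def by (rule fn.span_minimal[OF _ W(1)]) (use that T0(2) RW fg(1,2) in blast)
  have fS: "fn.fin_gen (S E)" if "E \<subseteq> B" for E by (rule fn.fin_gen_subset[OF SW[OF that] fin_gen_W])
  have ctr_R: "ctr y (R a b) = sc (y a) (h b) - sc (y b) (h a)" if "functional y" for y a b
    using that by (simp add: R_def ctr_diff ctr_tens)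
  have dS: "fn.dim (S E) = fn.dim T + 2 * card E" if "finite E" "E \<subseteq> B - {f, g}" for E
    using that
  proof (induction E rule: finite_induct)
    case empty
    have "fn.span T = T" using T0(1) by simp
    then show ?case by (simp add: S_def)
  next
    case (insert j E)
    from functional_extend[OF B(2), of "\<lambda>c. if c = j then 1 else 0"]
    obtain y where y: "functional y" "\<forall>c\<in>B. y c = (if c = j then 1 else 0)" by blast
    have j: "j \<in> B" "j \<noteq> f" "j \<noteq> g" and E: "E \<subseteq> B" using insert.prems by blast+
    have y0: "y f = 0" "y g = 0" "y j = 1" "\<And>b. b \<in> E \<Longrightarrow> y b = 0"
      using y(2) fg(1,2) j E insert.hyps(2) by auto
    have cS: "ctr y N \<in> X" if "N \<in> S E" for N
    proof -
      have "S E \<subseteq> {N. ctr y N \<in> X}" unfolding S_def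
      proof (rule fn.span_minimal[OF _ subspace_ctr_vimage[OF y(1) X(1)]])
        have "ctr y (R a b) \<in> X" if "a \<in> {f, g}" "b \<in> E" for a b
          using that y0 fn.subspace_0[OF X(1)] by (auto simp: ctr_R[OF y(1)])
        then show "T \<union> (R f ` E \<union> R g ` E) \<subseteq> {N. ctr y N \<in> X}" using T0(3)[OF y(1) y0(1,2)] by blast
      qed
      then show ?thesis using that by blast
    qed
    have cf: "ctr y (R f j) = - h f" and cg: "ctr y (R g j) = - h g" using y0 by (simp_all add: ctr_R[OF y(1)])
    have "R f j \<notin> S E"
    proof
      assume "R f j \<in> S E"
      then have "- h f \<in> X" using cS cf by metis
      then have "- (- h f) \<in> X" using X(1) fn.subspace_neg by blast
      then show False using fg(4) by simp
    qed
    then have d1: "fn.dim (fn.span (insert (R f j) (S E))) = Suc (fn.dim (S E))"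
      by (intro fn.dim_insert_notin fS[OF E]) (simp add: S_def)
    have "R g j \<notin> fn.span (insert (R f j) (S E))"
    proof
      assume "R g j \<in> fn.span (insert (R f j) (S E))"
      moreover have "fn.subspace (S E)" by (simp add: S_def)
      ultimately obtain k where "R g j - sc k (R f j) \<in> S E" by (auto simp: mem_span_insert)
      then have "ctr y (R g j - sc k (R f j)) \<in> X" by (rule cS)
      then have "- h g - sc k (- h f) \<in> X" by (simp add: ctr_diff ctr_sc y(1) cf cg)
      then have "- (- h g - sc k (- h f)) \<in> X" using X(1) fn.subspace_neg by blast
      then have "h g - sc k (h f) \<in> X" by (simp add: fn.scale_minus_right)
      then show False using fg(5) by (auto simp: mem_span_insert[OF X(1)])
    qed
    then have d2: "fn.dim (fn.span (insert (R g j) (fn.span (insert (R f j) (S E))))) = Suc (Suc (fn.dim (S E)))"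
      using d1 fn.dim_insert_notin[OF fn.subspace_span fin_gen_span_insert[OF fS[OF E]]] by simp
    have "fn.span (insert (R g j) (fn.span (insert (R f j) (S E)))) = S (insert j E)"
    proof
      have "insert (R f j) (S E) \<subseteq> S (insert j E)"
        using fn.span_mono[of "T \<union> (R f ` E \<union> R g ` E)" "T \<union> (R f ` insert j E \<union> R g ` insert j E)"]
          fn.span_base[of "R f j" "T \<union> (R f ` insert j E \<union> R g ` insert j E)"]
        unfolding S_def by blast
      then have "fn.span (insert (R f j) (S E)) \<subseteq> S (insert j E)"
        by (rule fn.span_minimal) (simp add: S_def)
      moreover have "R g j \<in> S (insert j E)" unfolding S_def by (rule fn.span_base) blast
      ultimately show "fn.span (insert (R g j) (fn.span (insert (R f j) (S E)))) \<subseteq> S (insert j E)"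
        by (intro fn.span_minimal) (simp_all add: S_def)
    next
      let ?Z = "fn.span (insert (R g j) (fn.span (insert (R f j) (S E))))"
      have "S E \<subseteq> ?Z" "R f j \<in> ?Z" "R g j \<in> ?Z"
        using fn.span_superset[of "insert (R f j) (S E)"]
          fn.span_superset[of "insert (R g j) (fn.span (insert (R f j) (S E)))"] by blast+
      moreover have "T \<union> (R f ` E \<union> R g ` E) \<subseteq> S E" unfolding S_def by (rule fn.span_superset)
      ultimately show "S (insert j E) \<subseteq> ?Z"
        unfolding S_def[of "insert j E"] by (intro fn.span_minimal fn.subspace_span) blast
    qed
    then have "fn.dim (S (insert j E)) = Suc (Suc (fn.dim (S E)))" using d2 by simp
    then show "fn.dim (S (insert j E)) = fn.dim T + 2 * card (insert j E)"
      using insert.IH insert.prems insert.hyps by simp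
  qed
  have cB: "card B = fn.dim V" using fn.dim_span_eq_card_independent[OF B(2)] B(3) by simp
  have "card (B - {f, g}) = card B - 2" using fg(1-3) B(1) by (simp add: card_Diff_subset)
  moreover have "2 \<le> card B" using card_mono[OF B(1), of "{f, g}"] fg(1-3) by simp
  ultimately have c2: "card (B - {f, g}) + 2 = fn.dim V" using cB by simp
  have d: "fn.dim (S (B - {f, g})) + 4 = fn.dim T + 2 * fn.dim V"
    using dS[of "B - {f, g}"] B(1) c2 by simp
  have le: "fn.dim (S (B - {f, g})) \<le> fn.dim W"
    by (rule fn.dim_mono_fin_gen[OF SW fin_gen_W]) blast
  then show "fn.dim T + 2 * fn.dim V \<le> fn.dim W + 4" using d by linarith
  assume "fn.dim W + 4 \<le> fn.dim T + 2 * fn.dim V"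
  then have "fn.dim W \<le> fn.dim (S (B - {f, g}))" using d by linarith
  then have "S (B - {f, g}) = W"
    by (intro fn.subspace_dim_eq_imp_eq[OF _ SW fin_gen_W]) (auto simp: S_def)
  then show "W = fn.span (T \<union> ((\<lambda>b. tens f (h b) - tens b (h f)) ` (B - {f, g}) \<union> (\<lambda>b. tens g (h b) - tens b (h g)) ` (B - {f, g})))"
    by (simp add: S_def R_def)
qed

lemma basis_through:
  assumes "fn.independent C" "C \<subseteq> V"
  obtains B where "C \<subseteq> B" "finite B" "fn.independent B" "fn.span B = V"
proof -
  obtain B where B: "C \<subseteq> B" "B \<subseteq> V" "fn.independent B" "V \<subseteq> fn.span B"
    using fn.maximal_independent_subset_extend[OF assms(2,1)] by blast
  have "fn.span B = V" using fn.span_subspace[OF B(2,4) V(1)] .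
  moreover have "finite B" by (rule fn.independent_subset_fin_gen(1)[OF V(2) B(3,2)])
  ultimately show ?thesis using that B(1,3) by blast
qed

lemma sym_independent:
  assumes h: "sym_form V U W h" and fg: "h f \<notin> X" "h g \<notin> fn.span (insert (h f) X)"
  shows "fn.independent {g, f}" "f \<noteq> g"
proof -
  have lin: "h (sc c p) = sc c (h p)" for p c using h by (simp add: sym_form_def linear_sc_iff)
  have "g \<notin> fn.span {f}"
  proof
    assume "g \<in> fn.span {f}"
    then obtain c where "g = sc c f" by (auto simp: fn.span_singleton)
    then have "h g = sc c (h f)" by (simp add: lin)
    moreover have "sc c (h f) \<in> fn.span (insert (h f) X)" by (intro fn.span_scale fn.span_base) simp
    ultimately show False using fg(2) by simp
  qed
  moreover have "f \<noteq> 0"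
  proof
    assume "f = 0"
    then have "h f = 0" using lin[of 0 0] by simp
    then show False using fg(1) fn.subspace_0[OF X(1)] by simp
  qed
  ultimately show "fn.independent {g, f}" by (intro fn.independent_insertI fn.independent_empty) simp_all
  show "f \<noteq> g" using \<open>g \<notin> fn.span {f}\<close> fn.span_base[of f "{f}"] by auto
qed

lemma sym_base:
  assumes h: "sym_form V U W h" and f: "f \<in> V" "g \<in> V" and fg: "h f \<notin> X" "h g \<notin> fn.span (insert (h f) X)"
  defines "e \<equiv> tens f (h g) - tens g (h f)"
  shows "e \<in> W" "e \<notin> TP V X" "functional y \<Longrightarrow> y f = 0 \<Longrightarrow> y g = 0 \<Longrightarrow> ctr y e = 0"
proof -
  show "e \<in> W" using h f by (simp add: e_def sym_form_def)
  have ce: "ctr y e = sc (y f) (h g) - sc (y g) (h f)" if "functional y" for y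
    using that by (simp add: e_def ctr_diff ctr_tens)
  show "functional y \<Longrightarrow> y f = 0 \<Longrightarrow> y g = 0 \<Longrightarrow> ctr y e = 0" by (simp add: ce)
  note ind = sym_independent[OF h fg]
  from functional_extend[OF ind(1), of "\<lambda>b. if b = g then 1 else 0"] ind(2)
  obtain y where y: "functional y" "y g = 1" "y f = 0" by auto
  show "e \<notin> TP V X"
  proof
    assume "e \<in> TP V X"
    then have "ctr y e \<in> X" by (rule ctr_TP[OF y(1) _ X(1)])
    then have "- (- h f) \<in> X" using y X(1) fn.subspace_neg[OF X(1), of "- h f"] by (simp add: ce)
    then show False using fg(1) by simp
  qed
qed

text \<open>If \<open>u\<close> were outside \<open>X\<close>, then \<open>tens f u\<close> and the
  relation \<open>?e\<close> of \<open>f\<close> with \<open>g\<close> would span two dimensions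
  over \<open>TP V X\<close>, and \<open>sym_form_dim\<close> would force an excess of at least
  \<open>2 * dim V - 2\<close>.\<close>

lemma sym_row_free:
  assumes h: "sym_form V U W h" and f: "f \<in> V" "h f \<notin> X" and g: "g \<in> V" "h g \<notin> fn.span (insert (h f) X)"
    and bound: "fn.dim W + 3 \<le> fn.dim (TP V X) + 2 * fn.dim V"
    and u: "tens f u \<in> W"
  shows "u \<in> X"
proof (rule ccontr)
  assume uX: "u \<notin> X"
  let ?e = "tens f (h g) - tens g (h f)"
  let ?T = "fn.span (insert (tens f u) (fn.span (insert ?e (TP V X))))"
  note ind = sym_independent[OF h f(2) g(2)]
  note base = sym_base[OF h f(1) g(1) f(2) g(2)]
  obtain B where B: "{g, f} \<subseteq> B" "finite B" "fn.independent B" "fn.span B = V"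
    by (rule basis_through[OF ind(1)]) (use f(1) g(1) in blast)
  have fT: "fn.fin_gen (TP V X)" by (rule fin_gen_TP[OF V(2) fin_gen_X])
  have d1: "fn.dim (fn.span (insert ?e (TP V X))) = Suc (fn.dim (TP V X))"
    by (rule fn.dim_insert_notin[OF subspace_TP fT base(2)])
  have "tens f u \<notin> fn.span (insert ?e (TP V X))"
  proof
    assume "tens f u \<in> fn.span (insert ?e (TP V X))"
    then obtain k where k: "tens f u - sc k ?e \<in> TP V X" by (auto simp: mem_span_insert)
    from functional_extend[OF ind(1), of "\<lambda>b. if b = g then 1 else 0"] ind(2)
    obtain y where y: "functional y" "y g = 1" "y f = 0" by auto
    have "ctr y (tens f u - sc k ?e) \<in> X" by (rule ctr_TP[OF y(1) k X(1)])
    then have khf: "sc k (h f) \<in> X" using y by (simp add: ctr_diff ctr_sc ctr_tens fn.scale_minus_right)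
    have "k = 0"
    proof (rule ccontr)
      assume "k \<noteq> 0"
      have "sc (1 / k) (sc k (h f)) \<in> X" by (rule fn.subspace_scale[OF X(1) khf])
      then show False using f(2) \<open>k \<noteq> 0\<close> by simp
    qed
    from functional_extend[OF ind(1), of "\<lambda>b. if b = f then 1 else 0"] ind(2)
    obtain z where z: "functional z" "z f = 1" by auto
    have "ctr z (tens f u - sc k ?e) \<in> X" by (rule ctr_TP[OF z(1) k X(1)])
    then show False using uX z \<open>k = 0\<close> by (simp add: ctr_tens)
  qed
  then have d2: "fn.dim ?T = Suc (Suc (fn.dim (TP V X)))"
    using d1 fn.dim_insert_notin[OF fn.subspace_span fin_gen_span_insert[OF fT]] by simp
  have sub: "fn.span (insert ?e (TP V X)) \<subseteq> W"
    by (rule fn.span_minimal[OF _ W(1)]) (use base(1) W(2) in blast)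
  have TW: "?T \<subseteq> W" by (rule fn.span_minimal[OF _ W(1)]) (use sub u in blast)
  have T0: "ctr y N \<in> X" if y: "functional y" "y f = 0" "y g = 0" and N: "N \<in> ?T" for y N
  proof -
    have X0: "0 \<in> X" by (rule fn.subspace_0[OF X(1)])
    have "fn.span (insert ?e (TP V X)) \<subseteq> {N. ctr y N \<in> X}"
      by (rule fn.span_minimal[OF _ subspace_ctr_vimage[OF y(1) X(1)]])
        (use base(3)[OF y] ctr_TP[OF y(1) _ X(1)] X0 in auto)
    then have "?T \<subseteq> {N. ctr y N \<in> X}"
      by (intro fn.span_minimal[OF _ subspace_ctr_vimage[OF y(1) X(1)]])
        (use y X0 in \<open>auto simp: ctr_tens\<close>)
    then show ?thesis using N by blast
  qed
  have "fn.dim ?T + 2 * fn.dim V \<le> fn.dim W + 4"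
    by (rule sym_form_dim(1)[OF h B(2-4) _ _ ind(2) f(2) g(2) fn.subspace_span TW T0]) (use B(1) in simp_all)
  then show False using d2 bound by linarith
qed

end

lemma functional_sum2:
  "functional y \<Longrightarrow> functional z \<Longrightarrow> Vector_Spaces.linear sc sc (\<lambda>f. sc (y f) u + sc (z f) v)"
  by (simp add: linear_sc_iff functional_add[of y] functional_add[of z] functional_sc[of y] functional_sc[of z]
      fn.scale_left_distrib fn.scale_right_distrib)

section \<open>Two special columns and the symmetric 2 x 2 block\<close>

context range_compatible
begin

text \<open>The tensors \<open>tens f x'\<close> with \<open>f\<close> in the slice, added to
  \<open>TP V (fn.span (insert x X))\<close>, already reach the largest dimension that
  \<open>dW\<close> allows, so they fill \<open>add_col V W x\<close>.\<close>

lemma special_column_TP: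
  assumes x': "x' \<notin> fn.span (insert x X)"
    and slx': "fn.dim V \<le> Suc (fn.dim (slice V (add_col V W x) x'))"
    and dW: "fn.dim (add_col V W x) < fn.dim (TP V (fn.span (insert x X))) + fn.dim V"
  shows "add_col V W x \<subseteq> TP V (fn.span (insert x' (fn.span (insert x X))))"
proof -
  let ?X1 = "fn.span (insert x X)" and ?W1 = "add_col V W x"
  let ?P = "slice V ?W1 x'"
  have P: "fn.subspace ?P" "fn.fin_gen ?P" by (rule subspace_slice[OF V(1) subspace_add_col], rule fin_gen_slice[OF V(2)])
  have PV: "?P \<subseteq> V" by (auto simp: slice_def)
  have fT: "fn.fin_gen (TP V ?X1)" by (rule fin_gen_TP[OF V(2) fin_gen_span_insert[OF fin_gen_X]])
  have x0: "x' \<noteq> 0" using x' fn.span_zero by metis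
  have "slice ?P (TP V ?X1) x' \<subseteq> slice V (TP V ?X1) x'" using PV by (auto simp: slice_def)
  then have "slice ?P (TP V ?X1) x' \<subseteq> {0}" using slice_TP[OF V(1) fn.subspace_span x'] by simp
  then have "fn.dim (slice ?P (TP V ?X1) x') \<le> fn.dim {0 :: 'i \<Rightarrow> 'a}"
    by (rule fn.dim_mono_fin_gen[OF _ fn.fin_gen_finite]) simp
  then have d: "fn.dim (add_col ?P (TP V ?X1) x') = fn.dim (TP V ?X1) + fn.dim ?P"
    using dim_add_col[OF P subspace_TP fT x0] by (simp add: fn.dim_zero_space)
  have "add_col ?P (TP V ?X1) x' = ?W1"
  proof (rule fn.subspace_dim_eq_imp_eq[OF subspace_add_col _ fin_gen_add_col[OF V(2) fin_gen_W]])
    show "add_col ?P (TP V ?X1) x' \<subseteq> ?W1"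
      by (rule add_col_minimal[OF TP_add_col _ subspace_add_col]) (simp add: slice_def)
    show "fn.dim ?W1 \<le> fn.dim (add_col ?P (TP V ?X1) x')" using d dW slx' by linarith
  qed
  moreover have "add_col ?P (TP V ?X1) x' \<subseteq> TP V (fn.span (insert x' ?X1))"
  proof (rule add_col_minimal[OF _ _ subspace_TP])
    show "TP V ?X1 \<subseteq> TP V (fn.span (insert x' ?X1))"
      by (rule TP_mono[OF subset_refl]) (use fn.span_superset[of "insert x' ?X1"] in blast)
    have "x' \<in> fn.span (insert x' ?X1)" by (intro fn.span_base) simp
    then show "tens f x' \<in> TP V (fn.span (insert x' ?X1))" if "f \<in> ?P" for f
      using that PV tens_in_TP by blast
  qed
  ultimately show ?thesis by simp
qed

text \<open>The row-killing argument with a larger prescribed part: \<open>t\<close> agrees with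
  \<open>s\<close> on all of \<open>TP V ?D\<close> and vanishes on the row \<open>f\<close>. The
  two are compatible because \<open>s\<close> vanishes on the row \<open>f\<close> over
  \<open>X\<close>, \<open>x\<close> and \<open>x'\<close>, which span \<open>?D\<close>.\<close>

lemma F_zero_if_two_columns_zero:
  assumes WD: "add_col V W x \<subseteq> TP V (fn.span (insert x' (fn.span (insert x X))))"
    and pr: "\<forall>s\<in>ann (add_col V W x). \<exists>c. \<forall>f\<in>V. F s f = c * s (tens f x')"
    and s: "s \<in> ann W" and f: "f \<in> V" and z: "s (tens f x) = 0" "s (tens f x') = 0"
  shows "F s f = 0"
proof (cases "f = 0")
  case True then show ?thesis using functional_0[OF F_functional[OF s]] by simp
next
  case False
  then have "f \<notin> {0}" by simp
  from functional_separate[OF fn.subspace_single_0 this] obtain y where y: "functional y" "y f = 1" by blast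
  let ?D = "fn.span (insert x' (fn.span (insert x X)))"
  let ?B = "(\<lambda>u. tens f u) ` U"
  have fs: "functional s" by (rule annD(1)[OF s])
  have "Vector_Spaces.linear sc sc (\<lambda>u. tens f u)" by (simp add: linear_sc_iff tens_simps)
  then have B: "fn.subspace ?B" using ff.linear_subspace_image U(1) by blast
  have zz: "s e = 0" if e: "e \<in> TP V ?D" "e \<in> ?B" for e
  proof -
    from e(2) obtain u where u: "e = tens f u" by blast
    have "ctr y e \<in> ?D" by (rule ctr_TP[OF y(1) e(1) fn.subspace_span])
    then have "u \<in> ?D" using y by (simp add: u ctr_tens)
    then obtain k where "u - sc k x' \<in> fn.span (insert x X)" by (auto simp: mem_span_insert)
    then obtain l where l: "u - sc k x' - sc l x \<in> X" by (auto simp: mem_span_insert[OF X(1)])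
    then have "s (tens f (u - sc k x' - sc l x)) = 0" using annD(2)[OF s] W(2) tens_in_TP[OF f] by blast
    then show ?thesis using z by (simp add: u tens_simps functional_simps[OF fs])
  qed
  obtain t where t: "functional t" "\<forall>e\<in>TP V ?D. t e = s e" "\<forall>e\<in>?B. t e = 0"
    using functional_agree_zero[OF subspace_TP B fs zz] by blast
  have "W \<subseteq> TP V ?D" using WD add_col_superset[of W V x] by blast
  then have tW: "t \<in> ann W" using t(1,2) annD(2)[OF s] unfolding ann_def by auto
  have "F t f = 0" by (rule F_range[OF tW f]) (use t(3) in blast)
  moreover have st: "s - t \<in> ann (add_col V W x)"
    using t(2) WD functional_minus_fun[OF fs t(1)] unfolding ann_def by auto
  have "x' \<in> ?D" by (intro fn.span_base) simp
  then have "tens f x' \<in> TP V ?D" by (rule tens_in_TP[OF f])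
  then have "t (tens f x') = s (tens f x')" using t(2) by blast
  then have "(s - t) (tens f x') = 0" by simp
  then have "F (s - t) f = 0" using pr st f by fastforce
  ultimately show ?thesis using F_diff[OF s tW f] by simp
qed

text \<open>The columns \<open>x\<close> and \<open>x'\<close> turn out to be governed by two rows
  \<open>g1\<close>, \<open>g2\<close>, and after the change of column to
  \<open>x1 = x' - l x\<close> the resulting 2 x 2 blocks are symmetric up to a scalar
  \<open>nu\<close>. Evaluating \<open>F\<close> on symmetric blocks of rank one then produces the
  functional equation of \<open>quadratic_relation\<close>, from which the defect is
  computed.\<close>

lemma special_pair_form:
  assumes x: "x \<in> U" "x \<notin> X" and x': "x' \<in> U" "x' \<notin> fn.span (insert x X)"
    and sl: "\<And>z. z \<in> U \<Longrightarrow> z \<notin> X \<Longrightarrow> fn.dim (slice V W z) + 2 \<le> fn.dim V"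
    and slx: "fn.dim V \<le> fn.dim (slice V W x) + 2"
    and slx': "fn.dim V \<le> Suc (fn.dim (slice V (add_col V W x) x'))"
    and dW: "fn.dim (add_col V W x) < fn.dim (TP V (fn.span (insert x X))) + fn.dim V"
    and nloc: "\<not> is_local V U (add_col V W x) F"
    and pr: "\<forall>s\<in>ann (add_col V W x). \<exists>c. \<forall>f\<in>V. F s f = c * s (tens f x')"
  shows "\<exists>h. sym_form V U W h \<and>
    (\<forall>c. (\<forall>s\<in>ann W. \<forall>f\<in>V. defect c F s f = 0) \<or> (\<exists>b. root_form V W (defect c F) h b))"
proof -
  let ?W1 = "add_col V W x" and ?P = "slice V (add_col V W x) x'" and ?L = "slice V W x"
  note two = F_zero_if_two_columns_zero[OF special_column_TP[OF x'(2) slx' dW] pr]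
  have annW: "s \<in> ann W" if "s \<in> ann ?W1" for s using that by (simp add: mem_ann_add_col)
  have fx: "s (tens f x) = 0" if "s \<in> ann ?W1" "f \<in> V" for s f using that by (simp add: mem_ann_add_col)
  have L: "fn.subspace ?L" "fn.fin_gen ?L" "?L \<subseteq> V"
    using subspace_slice[OF V(1) W(1)] fin_gen_slice[OF V(2)] by (auto simp: slice_def)
  have P: "fn.subspace ?P" "fn.fin_gen ?P" "?P \<subseteq> V"
    using subspace_slice[OF V(1) subspace_add_col] fin_gen_slice[OF V(2)] by (auto simp: slice_def)
  have Lx: "s (tens f x) = 0" if "s \<in> ann W" "f \<in> ?L" for s f using that annD(2) by (auto simp: slice_def)
  have outX: "x' - sc c x \<in> U" "x' - sc c x \<notin> X" for c
  proof -
    show "x' - sc c x \<in> U" using x(1) x'(1) U(1) by (simp add: fn.subspace_diff fn.subspace_scale)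
    show "x' - sc c x \<notin> X" using x'(2) by (auto simp: mem_span_insert[OF X(1)])
  qed
  have "\<exists>g\<in>V. g \<notin> ?P"
  proof (rule ccontr)
    assume "\<not> ?thesis"
    then have "?P = V" using P(3) by blast
    have "F s f = s (tens f 0)" if s: "s \<in> ann ?W1" and f: "f \<in> V" for s f
    proof -
      have "tens f x' \<in> ?W1" using f \<open>?P = V\<close> by (auto simp: slice_def)
      then have "s (tens f x') = 0" by (rule annD(2)[OF s])
      then show ?thesis using pr s f by (auto simp: tens_simps functional_0[OF annD(1)[OF s]])
    qed
    then show False using nloc fn.subspace_0[OF U(1)] unfolding is_local_def by blast
  qed
  then obtain g1 where g1: "g1 \<in> V" "g1 \<notin> ?P" by blast
  then have "tens g1 x' \<notin> ?W1" by (simp add: slice_def)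
  from ann_separate[OF subspace_add_col this] obtain s0 where s0: "s0 \<in> ann ?W1" "s0 (tens g1 x') = 1" by blast
  note s0W = annW[OF s0(1)]
  define y where "y f = s0 (tens f x')" for f
  have y: "functional y" using functional_tens_left[OF annD(1)[OF s0(1)], of x'] by (simp add: y_def[abs_def])
  have yg1: "y g1 = 1" using s0(2) by (simp add: y_def)
  have yP: "y f = 0" if "f \<in> ?P" for f using that annD(2)[OF s0(1)] by (simp add: y_def slice_def)
  have dhyp: "Suc (fn.dim (hyp V y)) = fn.dim V" by (rule dim_hyp[OF V y g1(1)]) (simp add: yg1)
  have hypP: "?P = hyp V y"
    by (rule fn.subspace_dim_eq_imp_eq[OF P(1) _ fin_gen_hyp[OF V(2)]])
      (use yP P(3) dhyp slx' in \<open>auto simp: hyp_def\<close>)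
  have inP: "tens f x' \<in> ?W1" if "f \<in> V" "y f = 0" for f
  proof -
    have "f \<in> ?P" unfolding hypP using that by simp
    then show ?thesis by (simp add: slice_def)
  qed
  have ann1: "r (tens f x') = r (tens g1 x') * y f" if r: "r \<in> ann ?W1" and f: "f \<in> V" for r f
  proof -
    have "\<exists>c. \<forall>f\<in>V. r (tens f x') = c * y f"
      by (rule functional_proportional[OF V(1) y functional_tens_left[OF annD(1)[OF r]]])
        (use inP annD(2)[OF r] in blast)
    then obtain c where c: "\<forall>f\<in>V. r (tens f x') = c * y f" by blast
    then show ?thesis using g1(1) yg1 f by simp
  qed
  \<comment> \<open>On \<open>ann ?W1\<close> the column \<open>x'\<close> ranges over the line of
    \<open>y\<close>, spanned by that of \<open>s0\<close>; \<open>kappa\<close> describes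
    \<open>F\<close> on this line. Were \<open>kappa\<close> homogeneous, \<open>F\<close> would be
    local there.\<close>
  define kappa where "kappa c = F (sc c s0) g1" for c
  have kappa: "F (sc c s0) f = kappa c * y f" if f: "f \<in> V" for c f
  proof -
    obtain d where d: "\<forall>f\<in>V. F (sc c s0) f = d * sc c s0 (tens f x')" using pr ann_scale[OF s0(1), of c] by blast
    then have "kappa c = d * c" using g1(1) yg1 by (simp add: kappa_def sc_apply y_def)
    then show ?thesis using d f by (simp add: sc_apply y_def)
  qed
  have kappa0: "kappa 0 = 0" using F_zero[OF g1(1)] by (simp add: kappa_def)
  have nonlin: "\<exists>c. kappa c \<noteq> c * kappa 1"
  proof (rule ccontr)
    assume "\<not> ?thesis"
    then have lin: "kappa c = c * kappa 1" for c by blast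
    have "F s f = s (tens f (sc (kappa 1) x'))" if s: "s \<in> ann ?W1" and f: "f \<in> V" for s f
    proof -
      let ?b = "s (tens g1 x')"
      define r where "r = s - sc ?b s0"
      have r: "r \<in> ann ?W1" unfolding r_def by (intro ann_minus s ann_scale s0(1))
      have "r (tens f x') = 0" using ann1[OF s f] by (simp add: r_def sc_apply y_def)
      then have "F r f = 0" using pr r f by fastforce
      then have "F s f = F (sc ?b s0) f" using F_diff[OF annW[OF s] ann_scale[OF s0W] f] by (simp add: r_def)
      also have "\<dots> = kappa 1 * s (tens f x')" using kappa[OF f, of ?b] lin[of ?b] ann1[OF s f] by simp
      finally show ?thesis by (simp add: tens_simps functional_sc[OF annD(1)[OF s]])
    qed
    moreover have "sc (kappa 1) x' \<in> U" using x'(1) U(1) fn.subspace_scale by blast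
    ultimately show False using nloc unfolding is_local_def by blast
  qed
  \<comment> \<open>Otherwise, for every \<open>c\<close> some row \<open>chi = p + tau q\<close>
    makes both columns of \<open>s + c s0\<close> vanish. Then \<open>F\<close> vanishes there too,
    which expresses \<open>kappa c\<close> as an affine function of \<open>c\<close>; as
    \<open>kappa 0 = 0\<close>, it would be homogeneous.\<close>
  have star: "s (tens q x') = 0"
    if s: "s \<in> ann W" and p: "p \<in> V" "s (tens p x) = 0" "y p = 1" and q: "q \<in> V" "y q = 0" "s (tens q x) = 0" for s p q
  proof (rule ccontr)
    assume w: "s (tens q x') \<noteq> 0"
    let ?w = "s (tens q x')"
    have fs: "functional s" by (rule annD(1)[OF s])
    have "kappa c = c * (F s q / ?w) + (s (tens p x') / ?w * F s q - F s p)" for c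
    proof -
      define tau where "tau = - (c + s (tens p x')) / ?w"
      define chi where "chi = p + sc tau q"
      have chi: "chi \<in> V" using p(1) q(1) V(1) by (simp add: chi_def fn.subspace_add fn.subspace_scale)
      have r: "s + sc c s0 \<in> ann W" by (intro ann_plus s ann_scale s0W)
      have ychi: "y chi = 1" by (simp add: chi_def functional_simps[OF y] p(3) q(2))
      have "s (tens chi x) = 0" by (simp add: chi_def tens_simps functional_simps[OF fs] p(2) q(3))
      then have 1: "(s + sc c s0) (tens chi x) = 0" using fx[OF s0(1) chi] by (simp add: sc_apply)
      have "s (tens chi x') = - c" using w
        by (simp add: chi_def tens_simps functional_simps[OF fs] tau_def field_simps)
      then have 2: "(s + sc c s0) (tens chi x') = 0" using ychi by (simp add: sc_apply y_def)
      have "F (s + sc c s0) chi = 0" by (rule two[OF r chi 1 2])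
      then have "F s chi + kappa c = 0" using F_add[OF s ann_scale[OF s0W] chi] kappa[OF chi] ychi by simp
      moreover have "F s chi = F s p + tau * F s q" by (simp add: chi_def functional_simps[OF F_functional[OF s]])
      ultimately have "kappa c = - F s p - tau * F s q" by (simp add: eq_neg_iff_add_eq_0 algebra_simps)
      then show ?thesis using w by (simp add: tau_def field_simps)
    qed
    note k = this
    have "s (tens p x') / ?w * F s q - F s p = 0" using k[of 0] kappa0 by simp
    then have k': "kappa c = c * (F s q / ?w)" for c using k[of c] by simp
    have "kappa c = c * kappa 1" for c using k'[of c] k'[of 1] by simp
    then show False using nonlin by blast
  qed
  have dL: "fn.dim ?L + 2 = fn.dim V" using slx sl[OF x] by linarith
  \<comment> \<open>A row \<open>p\<close> in \<open>?L\<close> with \<open>y p = 1\<close> would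
    let \<open>star\<close> apply to every \<open>s\<close>: on the hyperplane \<open>y = 0\<close>
    the column \<open>x'\<close> would be a multiple of the column \<open>x\<close>, with one factor
    \<open>c\<close> for all \<open>s\<close>, and the slice at \<open>x' - c x\<close> would
    contain that hyperplane.\<close>
  have yL: "y f = 0" if f: "f \<in> ?L" for f
  proof (rule ccontr)
    assume yf: "y f \<noteq> 0"
    define p where "p = sc (1 / y f) f"
    have pL: "p \<in> ?L" unfolding p_def by (rule fn.subspace_scale[OF L(1) f])
    have p: "p \<in> V" "y p = 1" using pL L(3) yf by (auto simp: p_def functional_sc[OF y])
    have prp: "\<forall>s\<in>ann W. \<exists>c. \<forall>q\<in>hyp V y. s (tens q x') = c * s (tens q x)"
    proof
      fix s assume s: "s \<in> ann W"
      show "\<exists>c. \<forall>q\<in>hyp V y. s (tens q x') = c * s (tens q x)"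
      proof (rule functional_proportional[OF subspace_hyp[OF V(1) y] functional_tens_left[OF annD(1)[OF s]]
            functional_tens_left[OF annD(1)[OF s]]])
        fix q assume "q \<in> hyp V y" "s (tens q x) = 0"
        then show "s (tens q x') = 0" using star[OF s p(1) Lx[OF s pL] p(2)] by simp
      qed
    qed
    have "slice (hyp V y) W x \<subseteq> hyp ?L y" by (auto simp: slice_def)
    then have "fn.dim (slice (hyp V y) W x) \<le> fn.dim (hyp ?L y)"
      by (rule fn.dim_mono_fin_gen[OF _ fin_gen_hyp[OF L(2)]])
    moreover have "Suc (fn.dim (hyp ?L y)) = fn.dim ?L" by (rule dim_hyp[OF L(1,2) y f yf])
    ultimately have "fn.dim (slice (hyp V y) W x) + 2 \<le> fn.dim (hyp V y)" using dL dhyp by linarith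
    from common_factor[where F = "\<lambda>s q. s (tens q x')", OF subspace_hyp[OF V(1) y] fin_gen_hyp[OF V(2)] W(1) _ prp this]
    obtain c where c: "\<forall>s\<in>ann W. \<forall>q\<in>hyp V y. s (tens q x') = c * s (tens q x)" by auto
    have "hyp V y \<subseteq> slice V W (x' - sc c x)"
    proof
      fix q assume q: "q \<in> hyp V y"
      have "s (tens q (x' - sc c x)) = 0" if s: "s \<in> ann W" for s
        using c s q by (simp add: tens_simps functional_simps[OF annD(1)[OF s]])
      then have "tens q (x' - sc c x) \<in> W" using mem_iff_ann[OF W(1)] by blast
      then show "q \<in> slice V W (x' - sc c x)" using q by (simp add: slice_def)
    qed
    then have "fn.dim (hyp V y) \<le> fn.dim (slice V W (x' - sc c x))"
      by (rule fn.dim_mono_fin_gen[OF _ fin_gen_slice[OF V(2)]])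
    then show False using sl[OF outX, of c] dhyp by linarith
  qed
  have "\<exists>g\<in>hyp V y. g \<notin> ?L"
    by (rule fn.exists_notin_smaller[OF fin_gen_hyp[OF V(2)] L(1) _ L(2)]) (use dL dhyp in linarith)
  then obtain g2 where g2: "g2 \<in> V" "y g2 = 0" "g2 \<notin> ?L" by auto
  have "tens g1 x \<notin> fn.span (insert (tens g2 x) W)"
  proof
    assume "tens g1 x \<in> fn.span (insert (tens g2 x) W)"
    then obtain k where "tens g1 x - sc k (tens g2 x) \<in> W" by (auto simp: mem_span_insert[OF W(1)])
    then have "g1 - sc k g2 \<in> ?L" using g1(1) g2(1) V(1)
      by (simp add: slice_def tens_simps fn.subspace_diff fn.subspace_scale)
    from yL[OF this] show False by (simp add: functional_simps[OF y] yg1 g2(2))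
  qed
  from ann_dual_vectors[OF this] obtain s1 where
    s1: "s1 \<in> ann W" "s1 (tens g1 x) = 1" "s1 (tens g2 x) = 0" by blast
  have "tens g2 x \<notin> fn.span (insert (tens g1 x) W)"
  proof
    assume "tens g2 x \<in> fn.span (insert (tens g1 x) W)"
    then obtain k where "tens g2 x - sc k (tens g1 x) \<in> W" by (auto simp: mem_span_insert[OF W(1)])
    then have k: "g2 - sc k g1 \<in> ?L" using g1(1) g2(1) V(1)
      by (simp add: slice_def tens_simps fn.subspace_diff fn.subspace_scale)
    from yL[OF k] have "k = 0" by (simp add: functional_simps[OF y] yg1 g2(2))
    then show False using k g2(3) by simp
  qed
  from ann_dual_vectors[OF this] obtain s2 where
    s2: "s2 \<in> ann W" "s2 (tens g2 x) = 1" "s2 (tens g1 x) = 0" by blast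
  \<comment> \<open>\<open>y\<close> and \<open>z\<close> are the coordinates of \<open>V\<close>
    modulo \<open>?L\<close> dual to \<open>g1\<close> and \<open>g2\<close>.\<close>
  define z where "z f = s2 (tens f x)" for f
  have z: "functional z" using functional_tens_left[OF annD(1)[OF s2(1)], of x] by (simp add: z_def[abs_def])
  have zg: "z g1 = 0" "z g2 = 1" using s2 by (simp_all add: z_def)
  have "?L = hyp (hyp V y) z"
  proof (rule fn.subspace_dim_eq_imp_eq[OF L(1) _ fin_gen_hyp[OF fin_gen_hyp[OF V(2)]]])
    show "?L \<subseteq> hyp (hyp V y) z" using L(3) yL Lx[OF s2(1)] by (auto simp: z_def)
    have "Suc (fn.dim (hyp (hyp V y) z)) = fn.dim (hyp V y)"
      by (rule dim_hyp[OF subspace_hyp[OF V(1) y] fin_gen_hyp[OF V(2)] z, of g2]) (use g2 zg in simp_all)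
    then show "fn.dim (hyp (hyp V y) z) \<le> fn.dim ?L" using dL dhyp by linarith
  qed
  then have memL: "f \<in> ?L" if "f \<in> V" "y f = 0" "z f = 0" for f using that by simp
  have dec: "r f = y f * r g1 + z f * r g2" if r: "functional r" "\<forall>f\<in>?L. r f = 0" and f: "f \<in> V" for r f
  proof -
    have "f - sc (y f) g1 - sc (z f) g2 \<in> ?L"
      by (rule memL) (use f g1 g2 V(1) yg1 zg in
        \<open>simp_all add: fn.subspace_diff fn.subspace_scale functional_simps[OF y] functional_simps[OF z]\<close>)
    then have "r (f - sc (y f) g1 - sc (z f) g2) = 0" using r(2) by blast
    then show ?thesis by (simp add: functional_simps[OF r(1)] algebra_simps)
  qed
  have dec_x: "s (tens f x) = y f * s (tens g1 x) + z f * s (tens g2 x)" if s: "s \<in> ann W" and f: "f \<in> V" for s f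
    using dec[OF functional_tens_left[OF annD(1)[OF s], of x] _ f] Lx[OF s] by simp
  have split: "s - sc (s (tens g1 x)) s1 - sc (s (tens g2 x)) s2 \<in> ann ?W1" if s: "s \<in> ann W" for s
  proof -
    let ?r = "s - sc (s (tens g1 x)) s1 - sc (s (tens g2 x)) s2"
    have r: "?r \<in> ann W" by (intro ann_minus s ann_scale s1(1) s2(1))
    have "?r (tens f x) = 0" if f: "f \<in> V" for f
      unfolding dec_x[OF r f] using s1 s2 by (simp add: sc_apply)
    then show ?thesis using r by (simp add: mem_ann_add_col)
  qed
  have s2L: "s2 (tens q x') = 0" if q: "q \<in> ?L" for q
    by (rule star[OF s2(1) g1(1) s2(3) yg1 _ yL[OF q] Lx[OF s2(1) q]]) (use q L(3) in blast)
  \<comment> \<open>The column \<open>x\<close> of \<open>s1\<close> is \<open>y\<close> itself, so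
    no row with \<open>y p = 1\<close> is available for \<open>star\<close>. For
    \<open>s1 + s2\<close> the row \<open>g1 - g2\<close> serves.\<close>
  have s1L: "s1 (tens q x') = 0" if q: "q \<in> ?L" for q
  proof -
    have "(s1 + s2) (tens q x') = 0"
    proof (rule star[OF ann_plus[OF s1(1) s2(1)], of "g1 - g2"])
      show "g1 - g2 \<in> V" using g1 g2 V(1) fn.subspace_diff by blast
      show "(s1 + s2) (tens (g1 - g2) x) = 0"
        using s1 s2 by (simp add: tens_simps functional_diff[OF annD(1)[OF s1(1)]] functional_diff[OF annD(1)[OF s2(1)]])
      show "y (g1 - g2) = 1" by (simp add: functional_diff[OF y] yg1 g2(2))
    qed (use q L(3) yL[OF q] Lx[OF ann_plus[OF s1(1) s2(1)] q] in auto)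
    then show ?thesis using s2L[OF q] by simp
  qed
  have sL: "s (tens q x') = 0" if s: "s \<in> ann W" and q: "q \<in> ?L" for s q
  proof -
    have "q \<in> V" using q L(3) by blast
    from ann1[OF split[OF s] this] yL[OF q] s1L[OF q] s2L[OF q] show ?thesis by (simp add: sc_apply)
  qed
  \<comment> \<open>The entry of \<open>s\<close> at \<open>g2\<close>, \<open>x'\<close> is
    \<open>nu\<close> times the one at \<open>g1\<close>, \<open>x\<close> plus \<open>l\<close>
    times the one at \<open>g2\<close>, \<open>x\<close>. Subtracting \<open>l x\<close> leaves only
    the first term, which becomes the symmetry of the block.\<close>
  define l where "l = s2 (tens g2 x')"
  define x1 where "x1 = x' - sc l x"
  define nu where "nu = s1 (tens g2 x')"
  have x1: "s (tens f x1) = s (tens f x') - l * s (tens f x)" if s: "s \<in> ann W" for s f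
    by (simp add: x1_def tens_simps functional_simps[OF annD(1)[OF s]])
  have dec_x1: "s (tens f x1) = y f * s (tens g1 x1) + z f * s (tens g2 x1)" if s: "s \<in> ann W" and f: "f \<in> V" for s f
    using dec[OF functional_tens_left[OF annD(1)[OF s], of x1] _ f] x1[OF s] sL[OF s] Lx[OF s] by simp
  have form: "s (tens g2 x1) = nu * s (tens g1 x)" if s: "s \<in> ann W" for s
    using ann1[OF split[OF s] g2(1)] x1[OF s, of g2] by (simp add: g2(2) sc_apply l_def nu_def algebra_simps)
  have nu: "nu \<noteq> 0"
  proof
    assume "nu = 0"
    have "hyp V y \<subseteq> slice V W x1"
    proof
      fix q assume q: "q \<in> hyp V y"
      then have qV: "q \<in> V" by simp
      have "s (tens q x1) = 0" if s: "s \<in> ann W" for s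
        using dec_x1[OF s qV] form[OF s] q \<open>nu = 0\<close> by simp
      then have "tens q x1 \<in> W" using mem_iff_ann[OF W(1)] by blast
      then show "q \<in> slice V W x1" using q by (simp add: slice_def)
    qed
    then have "fn.dim (hyp V y) \<le> fn.dim (slice V W x1)"
      by (rule fn.dim_mono_fin_gen[OF _ fin_gen_slice[OF V(2)]])
    then show False using sl[OF outX, of l] dhyp unfolding x1_def by linarith
  qed
  \<comment> \<open>In rows \<open>g1\<close>, \<open>g2\<close> and columns \<open>x1\<close>,
    \<open>nu x\<close> the off-diagonal entries of \<open>s\<close> agree by \<open>form\<close>.
    Accordingly \<open>h\<close> sends \<open>g1\<close> to \<open>x1\<close>, \<open>g2\<close> to
    \<open>nu x\<close> and \<open>?L\<close> to 0.\<close>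
  define h where "h f = sc (y f) x1 + sc (z f) (sc nu x)" for f
  have h_val: "s (tens f (h g)) = y g * s (tens f x1) + z g * (nu * s (tens f x))" if s: "s \<in> ann W" for s f g
    by (simp add: h_def tens_simps functional_simps[OF annD(1)[OF s]])
  have sym: "sym_form V U W h"
    unfolding sym_form_def
  proof (intro conjI ballI)
    show "Vector_Spaces.linear sc sc h" unfolding h_def[abs_def] by (rule functional_sum2[OF y z])
    show "h f \<in> U" for f using outX(1)[of l] x(1) U(1)
      by (simp add: h_def x1_def fn.subspace_add fn.subspace_scale del: fn.scale_scale)
    fix f g assume f: "f \<in> V" and g: "g \<in> V"
    have "s (tens f (h g) - tens g (h f)) = 0" if s: "s \<in> ann W" for s
      unfolding functional_diff[OF annD(1)[OF s]] h_val[OF s] dec_x1[OF s f] dec_x1[OF s g] dec_x[OF s f] dec_x[OF s g] form[OF s]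
      by (simp add: algebra_simps)
    then show "tens f (h g) - tens g (h f) \<in> W" using mem_iff_ann[OF W(1)] by blast
  qed
  \<comment> \<open>Together with \<open>s0\<close> these realise the basis of symmetric 2 x 2
    blocks: upper diagonal entry, off-diagonal pair, lower diagonal entry.\<close>
  define t1 where "t1 = sc (1 / nu) (s1 - sc (s1 (tens g1 x1)) s0)"
  define t2 where "t2 = sc (1 / nu) (s2 - sc (s2 (tens g1 x1)) s0)"
  have tW: "t1 \<in> ann W" "t2 \<in> ann W"
    unfolding t1_def t2_def by (intro ann_scale ann_minus s1(1) s2(1) s0W)+
  have s0v: "s0 (tens f x) = 0" "s0 (tens f x1) = y f" if "f \<in> V" for f
    using fx[OF s0(1) that] x1[OF s0W, of f] by (simp_all add: y_def)
  have val: "s0 (tens g1 x) = 0" "s0 (tens g2 x) = 0" "s0 (tens g1 x1) = 1"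
    "t1 (tens g1 x) = 1 / nu" "t1 (tens g2 x) = 0" "t1 (tens g1 x1) = 0"
    "t2 (tens g1 x) = 0" "t2 (tens g2 x) = 1 / nu" "t2 (tens g1 x1) = 0"
    using s0v[OF g1(1)] s0v[OF g2(1)] s1 s2 yg1 by (simp_all add: t1_def t2_def sc_apply)
  have zero: "F s f = 0" if s: "s \<in> ann W" and f: "f \<in> V" and "s (tens f x) = 0" "s (tens f x1) = 0" for s f
    by (rule two[OF s f that(3)]) (use x1[OF s, of f] that(3,4) in simp)
  define K where "K c = F (sc c s0) g1" for c
  define D1 where "D1 c = F (sc c t1) g1" for c
  define D2 where "D2 c = F (sc c t1) g2" for c
  define B where "B c = F (sc c t2) g2" for c
  have addK: "K (a + b) = K a + K b" and addB: "B (a + b) = B a + B b"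
    and addD1: "D1 (a + b) = D1 a + D1 b" and addD2: "D2 (a + b) = D2 a + D2 b" for a b
    by (simp_all add: K_def B_def D1_def D2_def fn.scale_left_distrib F_add ann_scale s0W tW g1(1) g2(1))
  have F0g2: "F (sc c s0) g2 = 0" for c
    by (rule zero[OF ann_scale[OF s0W] g2(1)]) (use s0v[OF g2(1)] g2(2) in \<open>simp_all add: sc_apply\<close>)
  have F2g1: "F (sc c t2) g1 = 0" for c
    by (rule zero[OF ann_scale[OF tW(2)] g1(1)]) (use val in \<open>simp_all add: sc_apply\<close>)
  have Fg: "F s g1 = K (s (tens g1 x1)) + D1 (nu * s (tens g1 x))" "F s g2 = D2 (nu * s (tens g1 x)) + B (nu * s (tens g2 x))"
    if s: "s \<in> ann W" for s
  proof -
    let ?c = "s (tens g1 x1)" and ?a = "nu * s (tens g1 x)" and ?b = "nu * s (tens g2 x)"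
    define q where "q = sc ?c s0 + (sc ?a t1 + sc ?b t2)"
    have q: "q \<in> ann W" unfolding q_def by (intro ann_plus ann_scale s0W tW)
    have sq: "s - q \<in> ann W" by (rule ann_minus[OF s q])
    have v: "(s - q) (tens g1 x) = 0" "(s - q) (tens g2 x) = 0" "(s - q) (tens g1 x1) = 0"
      using val nu by (simp_all add: q_def sc_apply)
    have "(s - q) (tens g2 x1) = 0" using form[OF sq] v(1) by simp
    then have "F (s - q) g1 = 0" "F (s - q) g2 = 0" using zero[OF sq] g1(1) g2(1) v by blast+
    then have Fs: "F s g1 = F q g1" "F s g2 = F q g2" using F_diff[OF s q] g1(1) g2(1) by simp_all
    have Fq: "F q f = F (sc ?c s0) f + (F (sc ?a t1) f + F (sc ?b t2) f)" if f: "f \<in> V" for f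
      unfolding q_def using f by (simp add: F_add ann_plus ann_scale s0W tW)
    show "F s g1 = K ?c + D1 ?a" using Fs(1) Fq[OF g1(1)] F2g1 by (simp add: K_def D1_def)
    show "F s g2 = D2 ?a + B ?b" using Fs(2) Fq[OF g2(1)] F0g2 by (simp add: B_def D2_def)
  qed
  \<comment> \<open>The block with entries \<open>m\<close>, \<open>m * t\<close>,
    \<open>m * t * t\<close> has rank one and kills the row \<open>t g1 - g2\<close>, so
    \<open>F\<close> vanishes on that row.\<close>
  have rel: "t * (K m + D1 (m * t)) = B (m * t * t) + D2 (m * t)" for t m
  proof -
    define s where "s = sc m s0 + (sc (m * t) t1 + sc (m * t * t) t2)"
    have s: "s \<in> ann W" unfolding s_def by (intro ann_plus ann_scale s0W tW)
    have v: "s (tens g1 x1) = m" "nu * s (tens g1 x) = m * t" "nu * s (tens g2 x) = m * t * t"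
      using val nu by (simp_all add: s_def sc_apply)
    let ?chi = "sc t g1 - g2"
    have chi: "?chi \<in> V" using g1 g2 V(1) by (simp add: fn.subspace_diff fn.subspace_scale)
    have "nu * s (tens ?chi x) = 0"
      using v(2,3) by (simp add: tens_simps functional_simps[OF annD(1)[OF s]] algebra_simps)
    then have 1: "s (tens ?chi x) = 0" using nu by simp
    have 2: "s (tens ?chi x1) = 0"
      using v form[OF s] by (simp add: tens_simps functional_simps[OF annD(1)[OF s]] algebra_simps)
    have "F s ?chi = 0" by (rule zero[OF s chi 1 2])
    then have "t * F s g1 = F s g2" by (simp add: functional_simps[OF F_functional[OF s]])
    then show ?thesis unfolding Fg[OF s] v by (simp add: add.commute)
  qed
  have hom: "D1 (m * t) = t * D1 m" "D2 (m * t) = t * D2 m" for m t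
    using quadratic_relation[OF addK addB addD1 addD2 rel] by blast+
  have main: "(\<forall>s\<in>ann W. \<forall>f\<in>V. defect c F s f = 0) \<or> (\<exists>b. root_form V W (defect c F) h b)" for c
  proof -
    interpret G: range_compatible V U X W "defect c F" by (rule range_compatible_defect)
    \<comment> \<open>The off-diagonal contributions \<open>D1\<close> and \<open>D2\<close> are
      homogeneous, so only the diagonal ones, \<open>K\<close> and \<open>B\<close>, have a defect.
      By \<open>rel'\<close> the two defects coincide and satisfy
      \<open>b (m * t * t) = t * b m\<close>.\<close>
    define b where "b m = K (c * m) - c * K m" for m
    have rel': "t * b m = B (c * (m * t * t)) - c * B (m * t * t)" for t m
    proof -
      have h1: "D1 (c * m * t) = c * D1 (m * t)" "D2 (c * m * t) = c * D2 (m * t)"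
        using hom(1)[of "m * t" c] hom(2)[of "m * t" c] by (simp_all add: mult.commute mult.left_commute)
      have "c * (m * t * t) = c * m * t * t" by (simp add: mult.assoc)
      then have r1: "t * (K (c * m) + c * D1 (m * t)) = B (c * (m * t * t)) + c * D2 (m * t)"
        using rel[of t "c * m"] h1 by (simp only:)
      have aux: "t * (kc - c * k) = bc - c * b0" if "t * (kc + c * d) = bc + c * e" "t * (k + d) = b0 + e"
        for kc k d e bc b0 :: 'a
        using that by Groebner_Basis.algebra
      show ?thesis unfolding b_def by (rule aux[OF r1 rel])
    qed
    have bB: "b m = B (c * m) - c * B m" for m using rel'[of 1 m] by simp
    have b_sq: "t * b m = b (m * t * t)" for t m using rel' bB by simp
    have b_add: "b (p + q) = b p + b q" for p q
      by (simp add: b_def addK distrib_left algebra_simps)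
    \<comment> \<open>At \<open>t = 1 + 1\<close> this law gives twice \<open>b p\<close> where
      additivity gives four times \<open>b p\<close>. A nonzero \<open>b\<close> thus forces
      characteristic 2.\<close>
    have b_two: "b (p + p) = 0" for p
    proof -
      have "p * (1 + 1) * (1 + 1) = (p + p) + (p + p)" by (simp add: algebra_simps)
      then have "(1 + 1) * b p = (b p + b p) + (b p + b p)" using b_sq[of "1 + 1" p] by (simp only: b_add)
      then have "(b p + b p) = (b p + b p) + (b p + b p)" by (simp only: distrib_right mult_1_left)
      then have "b p + b p = 0" by (simp only: add_cancel_right_right)
      then show ?thesis by (simp only: b_add)
    qed
    have Gg: "defect c F s g1 = b (s (tens g1 x1))" "defect c F s g2 = b (nu * s (tens g2 x))" if s: "s \<in> ann W" for s
    proof -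
      have e: "nu * sc c s (tens g1 x) = nu * s (tens g1 x) * c" "nu * sc c s (tens g2 x) = c * (nu * s (tens g2 x))"
        by (simp_all add: sc_apply mult_ac)
      show "defect c F s g1 = b (s (tens g1 x1))"
        unfolding defect_def Fg[OF s] Fg[OF ann_scale[OF s]] e hom b_def
        by (simp add: sc_apply right_diff_distrib distrib_left)
      show "defect c F s g2 = b (nu * s (tens g2 x))"
        unfolding defect_def Fg[OF s] Fg[OF ann_scale[OF s]] e hom bB
        by (simp add: distrib_left)
    qed
    have GL: "\<forall>f\<in>?L. defect c F s f = 0" if s: "s \<in> ann W" for s
    proof
      fix f assume f: "f \<in> ?L"
      then have fV: "f \<in> V" using L(3) by blast
      have "s (tens f x) = 0" "s (tens f x1) = 0" using Lx[OF s f] sL[OF s f] x1[OF s, of f] by simp_all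
      then show "defect c F s f = 0"
        using zero[OF s fV] zero[OF ann_scale[OF s] fV] by (simp add: defect_def sc_apply)
    qed
    have Gf: "defect c F s f = y f * b (s (tens g1 x1)) + z f * b (nu * s (tens g2 x))" if s: "s \<in> ann W" and f: "f \<in> V" for s f
      using dec[OF G.F_functional[OF s] GL[OF s] f] Gg[OF s] by simp
    show ?thesis
    proof (cases "\<forall>p. b p = 0")
      case True then show ?thesis using Gf by simp
    next
      case False
      then obtain p where p: "b p \<noteq> 0" by blast
      have "(1 + 1) * b p = 0" using b_two[of p] by (simp only: b_add distrib_right mult_1_left)
      then have char2: "(1::'a) + 1 = 0" using p by simp
      have "defect c F s f = b (s (tens f (h f)))" if s: "s \<in> ann W" and f: "f \<in> V" for s f
      proof -
        let ?C = "s (tens g1 x1)" and ?a = "s (tens g1 x)" and ?b = "s (tens g2 x)"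
        \<comment> \<open>The cross terms occur twice and disappear under \<open>b\<close>; the
          squares of the coordinates come out as first powers.\<close>
        have "s (tens f (h f)) = ?C * y f * y f + (y f * z f * nu * ?a + y f * z f * nu * ?a) + nu * ?b * z f * z f"
          unfolding h_val[OF s] dec_x1[OF s f] dec_x[OF s f] form[OF s] by (simp add: algebra_simps)
        then have "b (s (tens f (h f))) = b (?C * y f * y f) + b (nu * ?b * z f * z f)"
          by (simp only: b_add[of "_ + _"] b_add[of "?C * y f * y f"] b_two add_0_right)
        then show ?thesis using Gf[OF s f] b_sq by simp
      qed
      then have "root_form V W (defect c F) h b"
        unfolding root_form_def using b_add char2 p by blast
      then show ?thesis by blast
    qed
  qed
  show ?thesis by (intro exI[of _ h] conjI sym allI main)
qed

end

section \<open>Gluing\<close>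

text \<open>The last two clauses serve gluing: freeness of the rows with
  \<open>h f \<notin> X\<close> determines \<open>h\<close> modulo \<open>X\<close> up to a scalar,
  and the final clause, which says that \<open>h\<close> has rank at least two modulo
  \<open>X\<close>, provides such rows in the intersection with another hyperplane.\<close>

definition root_on :: "('i \<Rightarrow> 'a::field) set \<Rightarrow> ('j \<Rightarrow> 'a) set \<Rightarrow> ('j \<Rightarrow> 'a) set \<Rightarrow> ('i \<times> 'j \<Rightarrow> 'a) set \<Rightarrow>
    ((('i \<times> 'j \<Rightarrow> 'a) \<Rightarrow> 'a) \<Rightarrow> ('i \<Rightarrow> 'a) \<Rightarrow> 'a) \<Rightarrow> (('i \<Rightarrow> 'a) \<Rightarrow> ('j \<Rightarrow> 'a)) \<Rightarrow> ('a \<Rightarrow> 'a) \<Rightarrow> bool" where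
  "root_on A U X W G h b \<longleftrightarrow> sym_form A U W h \<and> root_form A W G h b \<and>
    (\<forall>f\<in>A. \<forall>u. h f \<notin> X \<longrightarrow> tens f u \<in> W \<longrightarrow> u \<in> X) \<and> (\<forall>z. functional z \<longrightarrow> (\<exists>f\<in>A. z f = 0 \<and> h f \<notin> X))"

lemma root_onD:
  assumes "root_on A U X W G h b"
  shows "h (f + g) = h f + h g" "h (sc c f) = sc c (h f)" "f \<in> A \<Longrightarrow> h f \<in> U"
    "f \<in> A \<Longrightarrow> g \<in> A \<Longrightarrow> tens f (h g) - tens g (h f) \<in> W"
    "s \<in> ann W \<Longrightarrow> f \<in> A \<Longrightarrow> G s f = b (s (tens f (h f)))" "b (p + q) = b p + b q" "(1::'a::field) + 1 = 0"
    "\<exists>p. b p \<noteq> 0" "f \<in> A \<Longrightarrow> h f \<notin> X \<Longrightarrow> tens f u \<in> W \<Longrightarrow> u \<in> X"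
    "functional z \<Longrightarrow> \<exists>f\<in>A. z f = 0 \<and> h f \<notin> (X :: ('j \<Rightarrow> 'a) set)"
  using assms by (simp_all add: root_on_def sym_form_def root_form_def linear_sc_iff)

lemma scaled_zero_imp_zero:
  fixes b :: "'a::field \<Rightarrow> 'a"
  assumes "\<exists>p. b p \<noteq> 0" "\<And>c. b (c * m) = 0" shows "m = 0"
proof (rule ccontr)
  assume m: "m \<noteq> 0"
  obtain p where "b p \<noteq> 0" using assms(1) by blast
  then show False using assms(2)[of "p / m"] m by simp
qed

lemma ann_separate_mod:
  assumes W: "fn.subspace W" and z: "\<And>s. s \<in> ann W \<Longrightarrow> s e' = 0 \<Longrightarrow> s e = 0"
  shows "\<exists>c. e - sc c e' \<in> W"
proof (rule ccontr)
  assume "\<not> ?thesis"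
  then have "e \<notin> fn.span (insert e' W)" by (auto simp: mem_span_insert[OF W])
  from functional_separate[OF fn.subspace_span this] obtain s where
    s: "functional s" "\<forall>x\<in>fn.span (insert e' W). s x = 0" "s e = 1" by blast
  then have "s \<in> ann W" "s e' = 0" using fn.span_base[of _ "insert e' W"] by (auto simp: ann_def)
  then show False using z s(3) by fastforce
qed

text \<open>Applying the two expressions for \<open>G\<close> to all multiples of \<open>s\<close>
  shows that \<open>s (tens f (h f))\<close> and \<open>s (tens f (k f))\<close> vanish together.
  The tensors are then proportional modulo \<open>W\<close>, and freeness of the row cancels
  \<open>f\<close>. The factor is determined by \<open>b (c * m) = d m\<close>, hence the same for
  all \<open>f\<close>.\<close>

lemma root_on_compare:
  assumes X: "fn.subspace X" and W: "fn.subspace W" "TP V X \<subseteq> W"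
    and V: "A \<subseteq> V" "B \<subseteq> V"
    and A: "root_on A U X W G h b" and B: "root_on B U X W G k d" and ex: "\<exists>f\<in>A \<inter> B. k f \<notin> X"
  shows "\<exists>c. (\<forall>f\<in>A \<inter> B. h f - sc c (k f) \<in> X) \<and> (\<forall>m. b (c * m) = d m)"
proof -
  have zero: "b 0 = 0" "d 0 = 0" using root_onD(6)[OF A, of 0 0] root_onD(6)[OF B, of 0 0]
    by (simp_all only: add_0_left add_cancel_right_right)
  have eq: "b (s (tens f (h f))) = d (s (tens f (k f)))" if "s \<in> ann W" "f \<in> A" "f \<in> B" for s f
    using root_onD(5)[OF A that(1,2)] root_onD(5)[OF B that(1,3)] by simp
  have z1: "s (tens f (h f)) = 0" if "s \<in> ann W" "f \<in> A" "f \<in> B" "s (tens f (k f)) = 0" for s f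
    by (rule scaled_zero_imp_zero[OF root_onD(8)[OF A]])
      (use eq[OF ann_scale[OF that(1)] that(2,3)] that(4) zero in \<open>simp add: sc_apply\<close>)
  have z2: "s (tens f (k f)) = 0" if "s \<in> ann W" "f \<in> A" "f \<in> B" "s (tens f (h f)) = 0" for s f
    by (rule scaled_zero_imp_zero[OF root_onD(8)[OF B]])
      (use eq[OF ann_scale[OF that(1)] that(2,3), symmetric] that(4) zero in \<open>simp add: sc_apply\<close>)
  have XW: "s (tens f x) = 0" if "s \<in> ann W" "f \<in> A" "x \<in> X" for s f x
    using annD(2)[OF that(1)] W(2) tens_in_TP[OF _ that(3)] that(2) V(1) by blast
  have hk: "k f \<in> X" if f: "f \<in> A" "f \<in> B" and "h f \<in> X" for f
  proof (rule ccontr)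
    assume kf: "k f \<notin> X"
    have "tens f (k f) \<in> W" using mem_iff_ann[OF W(1)] z2 f XW[OF _ f(1) \<open>h f \<in> X\<close>] by blast
    then show False using root_onD(9)[OF B f(2) kf] kf by blast
  qed
  have pw: "\<exists>c. h f - sc c (k f) \<in> X \<and> (\<forall>m. b (c * m) = d m)" if f: "f \<in> A" "f \<in> B" and kf: "k f \<notin> X" for f
  proof -
    have "h f \<notin> X" using hk f kf by blast
    note rf = root_onD(9)[OF A f(1) this]
    obtain c where c: "tens f (h f) - sc c (tens f (k f)) \<in> W"
      using ann_separate_mod[OF W(1), of "tens f (k f)" "tens f (h f)"] z1 f by blast
    then have "tens f (h f - sc c (k f)) \<in> W" by (simp add: tens_simps)
    then have "h f - sc c (k f) \<in> X" by (rule rf)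
    moreover have "b (c * m) = d m" for m
    proof -
      have "tens f (k f) \<notin> W" using root_onD(9)[OF B f(2) kf] kf by blast
      then obtain s where s: "s \<in> ann W" "s (tens f (k f)) = 1" using ann_separate[OF W(1)] by blast
      have "s (tens f (h f)) = c" using annD(2)[OF s(1) c] s(2) by (simp add: functional_simps[OF annD(1)[OF s(1)]])
      then show ?thesis using eq[OF ann_scale[OF s(1), of m] f] s(2) by (simp add: sc_apply mult.commute)
    qed
    ultimately show ?thesis by blast
  qed
  obtain f0 where f0: "f0 \<in> A" "f0 \<in> B" "k f0 \<notin> X" using ex by blast
  obtain c where c: "\<forall>m. b (c * m) = d m" using pw[OF f0] by blast
  have "h f - sc c (k f) \<in> X" if f: "f \<in> A" "f \<in> B" for f
  proof (cases "k f \<in> X")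
    case False
    then obtain c' where c': "h f - sc c' (k f) \<in> X" "\<forall>m. b (c' * m) = d m" using pw[OF f] by blast
    have "c - c' = 0"
    proof (rule scaled_zero_imp_zero[OF root_onD(8)[OF A]])
      fix m
      have "b (c * m) = b (m * (c - c')) + b (c' * m)" 
        by (simp add: root_onD(6)[OF A, symmetric] algebra_simps)
      then show "b (m * (c - c')) = 0" using c c'(2) by simp
    qed
    then show ?thesis using c'(1) by simp
  next
    case True
    have "h f \<in> X"
    proof (rule ccontr)
      assume hf: "h f \<notin> X"
      have "tens f (h f) \<in> W" using mem_iff_ann[OF W(1)] z1 f XW[OF _ f(1) True] by blast
      then show False using root_onD(9)[OF A f(1) hf] hf by blast
    qed
    then show ?thesis using True X by (simp add: fn.subspace_diff fn.subspace_scale)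
  qed
  then show ?thesis using c by blast
qed

lemma root_on_not_zero:
  assumes W: "fn.subspace W" and B: "root_on B U X W G k d" and f: "f \<in> B" "k f \<notin> X" and G: "\<And>s. s \<in> ann W \<Longrightarrow> G s f = 0"
  shows False
proof -
  have "s (tens f (k f)) = 0" if s: "s \<in> ann W" for s
    by (rule scaled_zero_imp_zero[OF root_onD(8)[OF B]])
      (use root_onD(5)[OF B ann_scale[OF s] f(1)] G[OF ann_scale[OF s]] in \<open>simp add: sc_apply\<close>)
  then have "tens f (k f) \<in> W" using mem_iff_ann[OF W] by blast
  then show False using root_onD(9)[OF B f] f(2) by blast
qed

text \<open>A scalar can be moved from the additive map to \<open>h\<close>, so forms on different
  hyperplanes can be given the same \<open>b\<close>.\<close>

lemma root_on_rescale:
  assumes X: "fn.subspace X" and U: "fn.subspace U" and W: "fn.subspace W"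
    and B: "root_on B U X W G k d" and b: "\<exists>p. b p \<noteq> 0" "\<And>p q. b (p + q) = b p + b q"
    and c: "\<And>m. b (c * m) = d m"
  shows "root_on B U X W G (\<lambda>f. sc c (k f)) b"
proof -
  have b0: "b 0 = 0" using b(2)[of 0 0] by (simp only: add_0_left add_cancel_right_right)
  have c0: "c \<noteq> 0"
  proof
    assume "c = 0"
    then show False using root_onD(8)[OF B] c b0 by (metis mult_zero_left)
  qed
  have X': "sc c x \<in> X \<longleftrightarrow> x \<in> X" for x
    using fn.subspace_scale[OF X, of x c] fn.subspace_scale[OF X, of "sc c x" "1 / c"] c0 by auto
  note l = root_onD(1,2)[OF B]
  have "sym_form B U W (\<lambda>f. sc c (k f))" unfolding sym_form_def
  proof (intro conjI ballI)
    show "Vector_Spaces.linear sc sc (\<lambda>f. sc c (k f))"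
      by (simp add: linear_sc_iff l fn.scale_right_distrib mult.commute)
    show "sc c (k f) \<in> U" if "f \<in> B" for f by (rule fn.subspace_scale[OF U root_onD(3)[OF B that]])
    show "tens f (sc c (k g)) - tens g (sc c (k f)) \<in> W" if "f \<in> B" "g \<in> B" for f g
      using fn.subspace_scale[OF W root_onD(4)[OF B that], of c] by (simp add: tens_simps fn.scale_right_diff_distrib)
  qed
  moreover have "root_form B W G (\<lambda>f. sc c (k f)) b" unfolding root_form_def
  proof (intro conjI ballI allI)
    show "G s f = b (s (tens f (sc c (k f))))" if "s \<in> ann W" "f \<in> B" for s f
      by (simp add: root_onD(5)[OF B that] tens_simps functional_sc[OF annD(1)[OF that(1)]] c)
    show "b (p + q) = b p + b q" for p q by (rule b(2))
  qed (use b(1) root_onD(7)[OF B] in simp_all)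
  ultimately show ?thesis unfolding root_on_def X' using root_onD(9,10)[OF B] by blast
qed

context range_compatible
begin

text \<open>Symmetry is a condition on pairs of vectors, and vectors taken from two different
  hyperplanes need not share one; this is why two hyperplanes do not suffice here.\<close>

lemma root_on_glue:
  assumes y: "functional y1" "functional y2" "functional y3"
    and p: "p1 \<in> V" "p2 \<in> V" "p3 \<in> V" "y1 p1 = 1" "y2 p1 = 0" "y3 p1 = 0" "y1 p2 = 0" "y2 p2 = 1" "y3 p2 = 0"
      "y1 p3 = 0" "y2 p3 = 0" "y3 p3 = 1"
    and h: "root_on (hyp V y1) U X W F h1 b" "root_on (hyp V y2) U X W F h2 b" "root_on (hyp V y3) U X W F h3 b"
    and eq: "\<And>f. f \<in> V \<Longrightarrow> y1 f = 0 \<Longrightarrow> y2 f = 0 \<Longrightarrow> h1 f - h2 f \<in> X"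
      "\<And>f. f \<in> V \<Longrightarrow> y1 f = 0 \<Longrightarrow> y3 f = 0 \<Longrightarrow> h1 f - h3 f \<in> X"
      "\<And>f. f \<in> V \<Longrightarrow> y2 f = 0 \<Longrightarrow> y3 f = 0 \<Longrightarrow> h2 f - h3 f \<in> X"
  shows "\<exists>h. sym_form V U W h \<and> root_form V W F h b"
proof -
  \<comment> \<open>Equal to \<open>h1\<close> on \<open>y1 = 0\<close>. The missing direction
    \<open>p1\<close> lies in both other hyperplanes, where \<open>h2\<close> and \<open>h3\<close>
    agree modulo \<open>X\<close>.\<close>
  define h where "h f = h1 (f - sc (y1 f) p1) + sc (y1 f) (h2 p1)" for f
  note l1 = root_onD(1,2)[OF h(1)] and l2 = root_onD(1,2)[OF h(2)] and l3 = root_onD(1,2)[OF h(3)]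
  have d: "k (f - g) = k f - k g" if "\<And>f g. k (f + g) = k f + k g" for f g and k :: "('i \<Rightarrow> 'a) \<Rightarrow> ('j \<Rightarrow> 'a)"
    using that[of "f - g" g] by simp
  have ld: "h1 (f - g) = h1 f - h1 g" "h2 (f - g) = h2 f - h2 g" "h3 (f - g) = h3 f - h3 g" for f g
    using d[of h1] d[of h2] d[of h3] l1(1) l2(1) l3(1) by simp_all
  have lin: "Vector_Spaces.linear sc sc h"
    by (simp add: linear_sc_iff h_def functional_simps[OF y(1)] l1 ld fn.scale_left_distrib fn.scale_right_distrib
        fn.scale_right_diff_distrib algebra_simps)
  have q: "f - sc (y1 f) p1 \<in> V" "y1 (f - sc (y1 f) p1) = 0" if "f \<in> V" for f
    using that p V(1) by (simp_all add: fn.subspace_diff fn.subspace_scale functional_simps[OF y(1)])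
  have hU: "h f \<in> U" if f: "f \<in> V" for f
    unfolding h_def
    by (rule fn.subspace_add[OF U(1) root_onD(3)[OF h(1)] fn.subspace_scale[OF U(1) root_onD(3)[OF h(2)]]])
      (use q[OF f] p in simp_all)
  have e1: "h f - h1 f \<in> X" if "y1 f = 0" for f
    using that fn.subspace_0[OF X(1)] by (simp add: h_def)
  have e2: "h f - h2 f \<in> X" if f: "f \<in> V" "y2 f = 0" for f
  proof -
    have "h1 (f - sc (y1 f) p1) - h2 (f - sc (y1 f) p1) \<in> X"
      by (rule eq(1)) (use q[OF f(1)] f p in \<open>simp_all add: functional_simps[OF y(2)]\<close>)
    moreover have "h f - h2 f = h1 (f - sc (y1 f) p1) - h2 (f - sc (y1 f) p1)"
      by (simp add: h_def ld l2 algebra_simps)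
    ultimately show ?thesis by simp
  qed
  have e3: "h f - h3 f \<in> X" if f: "f \<in> V" "y3 f = 0" for f
  proof -
    have "h1 (f - sc (y1 f) p1) - h3 (f - sc (y1 f) p1) \<in> X"
      by (rule eq(2)) (use q[OF f(1)] f p in \<open>simp_all add: functional_simps[OF y(3)]\<close>)
    moreover have "sc (y1 f) (h2 p1 - h3 p1) \<in> X"
      by (rule fn.subspace_scale[OF X(1) eq(3)]) (use p in simp_all)
    ultimately have "h1 (f - sc (y1 f) p1) - h3 (f - sc (y1 f) p1) + sc (y1 f) (h2 p1 - h3 p1) \<in> X"
      by (rule fn.subspace_add[OF X(1)])
    moreover have "h f - h3 f = h1 (f - sc (y1 f) p1) - h3 (f - sc (y1 f) p1) + sc (y1 f) (h2 p1 - h3 p1)"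
      by (simp add: h_def ld l3 fn.scale_right_diff_distrib algebra_simps)
    ultimately show ?thesis by simp
  qed
  have XW: "tens f x \<in> W" if "f \<in> V" "x \<in> X" for f x using W(2) tens_in_TP[OF that] by blast
  define R where "R f g = tens f (h g) - tens g (h f)" for f g
  have R: "R f g \<in> W" if "root_on (hyp V z) U X W F k b" "\<And>f. f \<in> V \<Longrightarrow> z f = 0 \<Longrightarrow> h f - k f \<in> X"
    "f \<in> V" "g \<in> V" "z f = 0" "z g = 0" for z k f g
  proof -
    have "tens f (k g) - tens g (k f) \<in> W" using root_onD(4)[OF that(1)] that(3-6) by simp
    moreover have "tens f (h g - k g) \<in> W" "tens g (h f - k f) \<in> W" using that XW by simp_all
    ultimately have "tens f (k g) - tens g (k f) + tens f (h g - k g) - tens g (h f - k f) \<in> W"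
      using W(1) by (simp only: fn.subspace_diff fn.subspace_add)
    then show ?thesis by (simp add: R_def tens_simps)
  qed
  have FR: "F s f = b (s (tens f (h f)))" if "root_on (hyp V z) U X W F k b" "\<And>f. f \<in> V \<Longrightarrow> z f = 0 \<Longrightarrow> h f - k f \<in> X"
    "s \<in> ann W" "f \<in> V" "z f = 0" for z k s f
  proof -
    have "s (tens f (h f - k f)) = 0" by (rule annD(2)[OF that(3) XW]) (use that in simp_all)
    then have "s (tens f (h f)) = s (tens f (k f))" by (simp add: tens_simps functional_simps[OF annD(1)[OF that(3)]])
    then show ?thesis using root_onD(5)[OF that(1,3)] that(4,5) by simp
  qed
  let ?B = "{f \<in> V. y1 f = 0 \<and> y2 f = 0} \<union> {f \<in> V. y1 f = 0 \<and> y3 f = 0} \<union> {f \<in> V. y2 f = 0 \<and> y3 f = 0}"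
  note R1 = R[OF h(1) e1] and R2 = R[OF h(2) e2] and R3 = R[OF h(3) e3]
  have VB: "V \<subseteq> fn.span ?B"
  proof
    fix f assume f: "f \<in> V"
    let ?g = "f - sc (y1 f) p1 - sc (y2 f) p2"
    have "?g \<in> ?B" using f p V(1)
      by (simp add: fn.subspace_diff fn.subspace_scale functional_simps[OF y(1)] functional_simps[OF y(2)])
    moreover have "p1 \<in> ?B" "p2 \<in> ?B" using p by simp_all
    ultimately have "?g + sc (y2 f) p2 + sc (y1 f) p1 \<in> fn.span ?B"
      by (intro fn.span_add fn.span_scale fn.span_base)
    then show "f \<in> fn.span ?B" by (simp add: algebra_simps)
  qed
  have hs: "h (f + g) = h f + h g" "h (sc c f) = sc c (h f)" "h 0 = 0" for f g c
    using lin ff.linear_0[OF lin] by (simp_all add: linear_sc_iff)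
  \<comment> \<open>elements of \<open>?B\<close> lie in two of the three hyperplanes, hence any two of them in a common one\<close>
  have RB: "R f g \<in> W" if "f \<in> ?B" "g \<in> ?B" for f g
    using that R1[of f g] R2[of f g] R3[of f g] by blast
  have RV: "R f g \<in> W" if fV: "f \<in> V" and gV: "g \<in> V" for f g
  proof -
    have sub1: "fn.subspace {f. R f g \<in> W}" for g
    proof (rule fn.subspaceI; clarify)
      show "R 0 g \<in> W" using fn.subspace_0[OF W(1)] by (simp add: R_def tens_simps hs)
      show "R (f + f') g \<in> W" if "R f g \<in> W" "R f' g \<in> W" for f f'
      proof -
        have "R (f + f') g = R f g + R f' g" by (simp add: R_def tens_simps hs algebra_simps)
        then show ?thesis using fn.subspace_add[OF W(1) that] by simp
      qed
      show "R (sc c f) g \<in> W" if "R f g \<in> W" for c f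
      proof -
        have "R (sc c f) g = sc c (R f g)" by (simp add: R_def tens_simps hs fn.scale_right_diff_distrib)
        then show ?thesis using fn.subspace_scale[OF W(1) that] by simp
      qed
    qed
    have sym: "R g f \<in> W" if "R f g \<in> W" for f g
    proof -
      have "R g f = - R f g" by (simp add: R_def)
      then show ?thesis using fn.subspace_neg[OF W(1) that] by simp
    qed
    have "R b' f \<in> W" if "b' \<in> ?B" for b'
    proof -
      have "V \<subseteq> {f. R f b' \<in> W}"
        by (rule order_trans[OF VB fn.span_minimal[OF _ sub1]]) (use RB[OF _ that] in blast)
      then show ?thesis using fV sym by blast
    qed
    then have "V \<subseteq> {g. R g f \<in> W}"
      by (intro order_trans[OF VB fn.span_minimal[OF _ sub1]]) blast
    then show ?thesis using gV sym by blast
  qed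
  have sf: "sym_form V U W h" using lin hU RV by (simp add: sym_form_def R_def)
  have b2: "b m + b m = 0" for m
  proof -
    have "m + m = m * (1 + 1)" by (simp add: distrib_left)
    then have "m + m = 0" using root_onD(7)[OF h(1)] by simp
    then have "b (m + m) = b 0" by (simp only:)
    then have "b m + b m = b 0" by (simp only: root_onD(6)[OF h(1)])
    then show ?thesis using root_onD(6)[OF h(1), of 0 0] by (simp only: add_0_left add_cancel_right_right)
  qed
  have "F s f = b (s (tens f (h f)))" if s: "s \<in> ann W" and f: "f \<in> V" for s f
  proof -
    have fs: "functional s" by (rule annD(1)[OF s])
    \<comment> \<open>By symmetry the two mixed terms coincide, so they cancel under
      \<open>b\<close>: the identity is additive in the row and only has to be checked on
      \<open>?B\<close>.\<close>
    have q: "F s (f + g) = b (s (tens (f + g) (h (f + g))))" 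
      if "f \<in> V" "g \<in> V" "F s f = b (s (tens f (h f)))" "F s g = b (s (tens g (h g)))" for f g
    proof -
      have "s (R f g) = 0" by (rule annD(2)[OF s RV[OF that(1,2)]])
      then have "s (tens f (h g)) = s (tens g (h f))" by (simp add: R_def functional_simps[OF fs])
      then have "s (tens (f + g) (h (f + g))) = (s (tens f (h f)) + s (tens g (h g))) + (s (tens g (h f)) + s (tens g (h f)))"
        by (simp add: hs tens_simps functional_simps[OF fs])
      then have "b (s (tens (f + g) (h (f + g)))) = b (s (tens f (h f))) + b (s (tens g (h g)))"
        by (simp only: root_onD(6)[OF h(1)] b2 add_0_right)
      then show ?thesis using that(3,4) by (simp add: functional_simps[OF F_functional[OF s]])
    qed
    have r: "F s f = b (s (tens f (h f)))" if "f \<in> ?B" for f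
      using that FR[OF h(1) e1 s, of f] FR[OF h(2) e2 s, of f] by blast
    let ?g = "f - sc (y1 f) p1 - sc (y2 f) p2"
    have B: "?g \<in> ?B" "sc (y2 f) p2 \<in> ?B" "sc (y1 f) p1 \<in> ?B" using f p V(1)
      by (simp_all add: fn.subspace_diff fn.subspace_scale functional_simps[OF y(1)] functional_simps[OF y(2)]
          functional_simps[OF y(3)])
    then have Vs: "?g \<in> V" "sc (y2 f) p2 \<in> V" "sc (y1 f) p1 \<in> V" by blast+
    have "?g + sc (y2 f) p2 \<in> V" by (rule fn.subspace_add[OF V(1) Vs(1,2)])
    from q[OF this Vs(3) q[OF Vs(1,2) r r] r] B
    have "F s (?g + sc (y2 f) p2 + sc (y1 f) p1) = b (s (tens (?g + sc (y2 f) p2 + sc (y1 f) p1) (h (?g + sc (y2 f) p2 + sc (y1 f) p1))))" by blast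
    moreover have "?g + sc (y2 f) p2 + sc (y1 f) p1 = f" by simp
    ultimately show ?thesis by simp
  qed
  then have "root_form V W F h b" unfolding root_form_def
    by (intro conjI ballI allI root_onD(6,7,8)[OF h(1)])
  then show ?thesis using sf by blast
qed

text \<open>A local map has no defect, so subtracting one reduces the present hypothesis to that of
  \<open>special_pair_form\<close> without changing the conclusion.\<close>

lemma special_pair_homogeneous_or_root:
  assumes x: "x \<in> U" "x \<notin> X" and x': "x' \<in> U" "x' \<notin> fn.span (insert x X)"
    and sl: "\<And>z. z \<in> U \<Longrightarrow> z \<notin> X \<Longrightarrow> fn.dim (slice V W z) + 2 \<le> fn.dim V"
    and slx: "fn.dim V \<le> fn.dim (slice V W x) + 2"
    and slx': "fn.dim V \<le> Suc (fn.dim (slice V (add_col V W x) x'))"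
    and dW: "fn.dim (add_col V W x) < fn.dim (TP V (fn.span (insert x X))) + fn.dim V"
    and nloc: "\<not> is_local V U (add_col V W x) F"
    and pr: "\<exists>u\<in>U. \<forall>s\<in>ann (add_col V W x). \<exists>c. \<forall>f\<in>V. F s f = s (tens f u) + c * s (tens f x')"
  shows "(\<forall>s\<in>ann W. \<forall>f\<in>V. defect c F s f = 0) \<or> (\<exists>h b. sym_form V U W h \<and> root_form V W (defect c F) h b)"
proof -
  obtain u where u: "u \<in> U" "\<forall>s\<in>ann (add_col V W x). \<exists>c. \<forall>f\<in>V. F s f = s (tens f u) + c * s (tens f x')"
    using pr by blast
  let ?G = "\<lambda>s f. F s f - s (tens f u)"
  have nl: "\<not> is_local V U (add_col V W x) ?G"
  proof
    assume "is_local V U (add_col V W x) ?G"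
    then obtain v where v: "v \<in> U" "\<forall>s\<in>ann (add_col V W x). \<forall>f\<in>V. F s f - s (tens f u) = s (tens f v)"
      unfolding is_local_def by blast
    have "F s f = s (tens f (u + v))" if "s \<in> ann (add_col V W x)" "f \<in> V" for s f
      using v(2) that by (simp add: tens_simps functional_simps[OF annD(1)[OF that(1)]] diff_eq_eq add.commute)
    then show False using nloc fn.subspace_add[OF U(1) u(1) v(1)] unfolding is_local_def by blast
  qed
  have pr': "\<forall>s\<in>ann (add_col V W x). \<exists>c. \<forall>f\<in>V. ?G s f = c * s (tens f x')"
  proof
    fix s assume "s \<in> ann (add_col V W x)"
    then obtain c where "\<forall>f\<in>V. F s f = s (tens f u) + c * s (tens f x')" using u(2) by blast
    then have "\<forall>f\<in>V. ?G s f = c * s (tens f x')" by simp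
    then show "\<exists>c. \<forall>f\<in>V. ?G s f = c * s (tens f x')" by blast
  qed
  have eq: "defect c ?G s f = defect c F s f" for c s f
    by (simp add: defect_def sc_apply algebra_simps)
  from range_compatible.special_pair_form[OF range_compatible_minus_local[OF u(1)] x x' sl slx slx' dW nl pr']
  obtain h where "sym_form V U W h" "(\<forall>s\<in>ann W. \<forall>f\<in>V. defect c ?G s f = 0) \<or> (\<exists>b. root_form V W (defect c ?G) h b)"
    by blast
  then show ?thesis unfolding root_form_def eq by blast
qed

text \<open>For \<open>dim V = 2\<close> the bound of \<open>local_or_special_column\<close> is
  missed by one after adding a column. The two columns are instead read off from the single tensor
  of \<open>W\<close> outside \<open>TP V X\<close>, written as \<open>tens p x + tens q x'\<close>;
  dependence of \<open>x'\<close> on \<open>x\<close> modulo \<open>X\<close> would put a nonzero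
  vector in the slice at \<open>x\<close>.\<close>

lemma plane_special_pair:
  assumes V2: "fn.dim V = 2" and dW: "fn.dim W = Suc (fn.dim (TP V X))"
    and sl: "\<And>z. z \<in> U \<Longrightarrow> z \<notin> X \<Longrightarrow> fn.dim (slice V W z) + 2 \<le> fn.dim V"
  shows "\<exists>x\<in>U. x \<notin> X \<and> (\<exists>x'\<in>U. x' \<notin> fn.span (insert x X) \<and> 1 \<le> fn.dim (slice V (add_col V W x) x'))"
proof -
  have "\<exists>N\<in>W. N \<notin> TP V X"
    by (rule fn.exists_notin_smaller[OF fin_gen_W subspace_TP _ fin_gen_TP[OF V(2) fin_gen_X]]) (use dW in simp)
  then obtain N where N: "N \<in> W" "N \<notin> TP V X" by blast
  then have NU: "N \<in> TP V U" using W(3) by blast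
  then obtain y where y: "functional y" "ctr y N \<notin> X"
    using mem_TP_if_ctr[OF V U(1) X(1)] N(2) by blast
  let ?x = "ctr y N"
  have x: "?x \<in> U" by (rule ctr_TP[OF y(1) NU U(1)])
  have "\<exists>f\<in>V. y f \<noteq> 0"
  proof (rule ccontr)
    assume "\<not> ?thesis"
    then have "TP V U \<subseteq> {N. ctr y N \<in> X}"
      using fn.subspace_0[OF X(1)] by (intro TP_minimal subspace_ctr_vimage[OF y(1) X(1)]) (simp add: ctr_tens y(1))
    then show False using NU y(2) by blast
  qed
  then obtain f where f: "f \<in> V" "y f \<noteq> 0" by blast
  define p where "p = sc (1 / y f) f"
  have p: "p \<in> V" "y p = 1" using f V(1) by (simp_all add: p_def fn.subspace_scale functional_sc[OF y(1)])
  have "fn.dim (hyp V y) = 1" using dim_hyp[OF V y(1) f] V2 by simp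
  then have "hyp V y \<noteq> {0}" by (metis fn.dim_zero_space zero_neq_one)
  moreover have "0 \<in> hyp V y" by (rule fn.subspace_0[OF subspace_hyp[OF V(1) y(1)]])
  ultimately obtain q where "q \<in> hyp V y" "q \<noteq> 0" by blast
  then have q: "q \<in> V" "y q = 0" "q \<noteq> 0" by simp_all
  have "hyp V y = fn.span {q}"
  proof (rule fn.subspace_dim_eq_imp_eq[OF fn.subspace_span, symmetric])
    show "fn.span {q} \<subseteq> hyp V y" by (rule fn.span_minimal) (use q subspace_hyp[OF V(1) y(1)] in simp_all)
    have "fn.dim (fn.span {q}) = 1" using fn.dim_span_eq_card_independent[of "{q}"] q(3) by simp
    then show "fn.dim (hyp V y) \<le> fn.dim (fn.span {q})" using \<open>fn.dim (hyp V y) = 1\<close> by simp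
  qed (rule fin_gen_hyp[OF V(2)])
  let ?K = "N - tens p ?x"
  have "?K \<in> TP V U" by (rule fn.subspace_diff[OF subspace_TP NU tens_in_TP[OF p(1) x]])
  moreover have "ctr y ?K = 0" by (simp add: ctr_diff ctr_tens y(1) p(2))
  ultimately have K: "?K \<in> TP (hyp V y) U" using TP_kernel[OF y(1) V(1) U(1)] by (auto simp: hyp_def)
  have "TP (hyp V y) U \<subseteq> (\<lambda>u. tens q u) ` U"
  proof (rule TP_minimal)
    have "Vector_Spaces.linear sc sc (\<lambda>u. tens q u)" by (simp add: linear_sc_iff tens_simps)
    then show "fn.subspace ((\<lambda>u. tens q u) ` U)" using ff.linear_subspace_image U(1) by blast
    show "tens g u \<in> (\<lambda>u. tens q u) ` U" if g: "g \<in> hyp V y" and u: "u \<in> U" for g u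
    proof -
      obtain k where "g = sc k q" using g \<open>hyp V y = fn.span {q}\<close> by (auto simp: fn.span_singleton)
      then have "tens g u = tens q (sc k u)" by (simp add: tens_simps)
      then show ?thesis using u U(1) fn.subspace_scale by blast
    qed
  qed
  then obtain x' where x': "x' \<in> U" "?K = tens q x'" using K by blast
  have "x' \<notin> fn.span (insert ?x X)"
  proof
    assume "x' \<in> fn.span (insert ?x X)"
    then obtain k where k: "x' - sc k ?x \<in> X" by (auto simp: mem_span_insert[OF X(1)])
    have "tens q (x' - sc k ?x) \<in> W" using W(2) tens_in_TP[OF q(1) k] by blast
    then have "N - tens q (x' - sc k ?x) \<in> W" by (rule fn.subspace_diff[OF W(1) N(1)])
    moreover have "N - tens q (x' - sc k ?x) = tens (p + sc k q) ?x"
      using x'(2) by (simp add: tens_simps algebra_simps)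
    ultimately have "tens (p + sc k q) ?x \<in> W" by metis
    then have sl1: "p + sc k q \<in> slice V W ?x" using p q V(1) by (simp add: slice_def fn.subspace_add fn.subspace_scale)
    have "fn.dim (slice V W ?x) = 0" using sl[OF x y(2)] V2 by simp
    then have "slice V W ?x = {0}"
      by (rule fn.dim_0_imp[OF subspace_slice[OF V(1) W(1)] fin_gen_slice[OF V(2)]])
    then have "p + sc k q = 0" using sl1 by blast
    then have "y (p + sc k q) = 0" by (simp add: functional_0[OF y(1)])
    then show False using p(2) q(2) by (simp add: functional_simps[OF y(1)])
  qed
  moreover have "1 \<le> fn.dim (slice V (add_col V W ?x) x')"
  proof -
    have "N - tens p ?x \<in> add_col V W ?x"
      by (rule fn.subspace_diff[OF subspace_add_col]) (use add_col_superset[of W V] N(1) tens_in_add_col[OF p(1)] in blast)+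
    then have qs: "q \<in> slice V (add_col V W ?x) x'" using x'(2) q(1) by (simp add: slice_def)
    show ?thesis
    proof (rule ccontr)
      assume "\<not> ?thesis"
      then have "fn.dim (slice V (add_col V W ?x) x') = 0" by simp
      then have "slice V (add_col V W ?x) x' = {0}"
        by (rule fn.dim_0_imp[OF subspace_slice[OF V(1) subspace_add_col] fin_gen_slice[OF V(2)]])
      then show False using qs q(3) by blast
    qed
  qed
  ultimately show ?thesis using x y(2) x'(1) by blast
qed

text \<open>On the hyperplane the codimension bound persists and the slices still miss two
  dimensions, so \<open>sym_rank_two\<close> and \<open>sym_row_free\<close> supply the last two
  clauses of \<open>root_on\<close>. If \<open>h\<close> maps the hyperplane into \<open>X\<close>,
  the defect is zero there.\<close>

lemma root_on_restriction:
  assumes y: "ind2 X W y" and bound: "fn.dim W + 3 \<le> fn.dim (TP V X) + 2 * fn.dim V"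
    and sl: "\<And>z. z \<in> U \<Longrightarrow> z \<notin> X \<Longrightarrow> fn.dim (slice V W z) + 3 \<le> fn.dim V"
    and r: "(\<forall>s\<in>ann (ctr_ker W y). \<forall>f\<in>hyp V y. defect c (restrict_map (hyp V y) U W F) s f = 0) \<or>
      (\<exists>h b. sym_form (hyp V y) U (ctr_ker W y) h \<and> root_form (hyp V y) (ctr_ker W y) (defect c (restrict_map (hyp V y) U W F)) h b)"
  shows "(\<forall>s\<in>ann W. \<forall>f\<in>hyp V y. defect c F s f = 0) \<or> (\<exists>h b. root_on (hyp V y) U X W (defect c F) h b)"
proof -
  have fy: "functional y" using y by (simp add: ind2_def)
  obtain f0 where f0: "f0 \<in> V" "y f0 \<noteq> 0" using ind2_nonzero[OF y] by blast
  have dh: "Suc (fn.dim (hyp V y)) = fn.dim V" by (rule dim_hyp[OF V fy f0])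
  let ?R = "restrict_map (hyp V y) U W F"
  have dR: "defect c ?R s f = defect c F s f" if "s \<in> ann W" "f \<in> hyp V y" for s f
    using that restrict_map_ann[OF fy that(1), of f] restrict_map_ann[OF fy ann_scale[OF that(1)], of f c]
    by (simp add: defect_def)
  note rcR = range_compatible_restrict[OF fy]
  note aW = ann_ctr_ker
  have sl': "fn.dim (slice (hyp V y) (ctr_ker W y) z) + 2 \<le> fn.dim (hyp V y)" if "z \<in> U" "z \<notin> X" for z
    using sl[OF that] dim_slice_restrict[of y z] dh by linarith
  have bound': "fn.dim (ctr_ker W y) + 3 \<le> fn.dim (TP (hyp V y) X) + 2 * fn.dim (hyp V y)"
    using dim_ctr_ker[OF y] bound dh by linarith
  from r show ?thesis
  proof
    assume z: "\<forall>s\<in>ann (ctr_ker W y). \<forall>f\<in>hyp V y. defect c ?R s f = 0"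
    have "defect c F s f = 0" if "s \<in> ann W" "f \<in> hyp V y" for s f using z dR[OF that] aW[OF that(1)] that(2) by fastforce
    then show ?thesis by blast
  next
    assume "\<exists>h b. sym_form (hyp V y) U (ctr_ker W y) h \<and> root_form (hyp V y) (ctr_ker W y) (defect c ?R) h b"
    then obtain h b where h: "sym_form (hyp V y) U (ctr_ker W y) h" and rf: "root_form (hyp V y) (ctr_ker W y) (defect c ?R) h b"
      by blast
    have rfF: "defect c F s f = b (s (tens f (h f)))" if "s \<in> ann W" "f \<in> hyp V y" for s f
      using rf that dR[OF that] aW[OF that(1)] unfolding root_form_def by metis
    have b: "\<forall>p q. b (p + q) = b p + b q" "(1::'a) + 1 = 0" "\<exists>p. b p \<noteq> 0" using rf by (simp_all add: root_form_def)
    have b0: "b 0 = 0" using spec[OF spec[OF b(1)], of 0 0] by (simp only: add_0_left add_cancel_right_right)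
    show ?thesis
    proof (cases "\<exists>f\<in>hyp V y. h f \<notin> X")
      case False
      have "defect c F s f = 0" if "s \<in> ann W" "f \<in> hyp V y" for s f
      proof -
        have "tens f (h f) \<in> W" using W(2) tens_in_TP[of f V "h f" X] False that(2) by auto
        then show ?thesis using rfF[OF that] annD(2)[OF that(1)] b0 by simp
      qed
      then show ?thesis by blast
    next
      case True
      note rk = range_compatible.sym_rank_two[OF rcR h _ _ sl']
      have "u \<in> X" if f: "f \<in> hyp V y" "h f \<notin> X" and u: "tens f u \<in> W" for f u
      proof -
        obtain g where g: "g \<in> hyp V y" "h g \<notin> fn.span (insert (h f) X)" using rk[OF f] by blast
        have "tens f u \<in> ctr_ker W y" using u f(1) by (simp add: ctr_ker_def ctr_tens fy)
        then show ?thesis by (rule range_compatible.sym_row_free[OF rcR h f g bound'])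
      qed
      moreover have "\<exists>f\<in>hyp V y. z f = 0 \<and> h f \<notin> X" if z: "functional z" for z
      proof (rule ccontr)
        assume n: "\<not> ?thesis"
        obtain f where f: "f \<in> hyp V y" "h f \<notin> X" using True by blast
        obtain g where g: "g \<in> hyp V y" "h g \<notin> fn.span (insert (h f) X)" using rk[OF f] by blast
        have zf: "z f \<noteq> 0" using n f by blast
        let ?g = "g - sc (z g / z f) f"
        have "?g \<in> hyp V y" using f(1) g(1) subspace_hyp[OF V(1) fy] fn.subspace_diff fn.subspace_scale by blast
        moreover have "z ?g = 0" using zf by (simp add: functional_simps[OF z])
        ultimately have "h ?g \<in> X" using n by blast
        moreover have lin: "h (p + q) = h p + h q" "h (sc c p) = sc c (h p)" for p q c
          using h by (simp_all add: sym_form_def linear_sc_iff)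
        have "h ?g = h g - sc (z g / z f) (h f)" using lin(1)[of ?g "sc (z g / z f) f"] lin(2) by simp
        ultimately show False using g(2) by (auto simp: mem_span_insert[OF X(1)])
      qed
      moreover have "sym_form (hyp V y) U W h" using h by (auto simp: sym_form_def ctr_ker_def)
      moreover have "root_form (hyp V y) W (defect c F) h b" using rfF b unfolding root_form_def by blast
      ultimately have "root_on (hyp V y) U X W (defect c F) h b" unfolding root_on_def by blast
      then show ?thesis by blast
    qed
  qed
qed

lemma dual_triple:
  assumes y: "functional y1" "functional y2" "functional y3"
    and f: "f1 \<in> V" "f2 \<in> V" "f3 \<in> V" "y1 f1 \<noteq> 0" "y1 f2 = 0" "y2 f2 \<noteq> 0" "y1 f3 = 0" "y2 f3 = 0" "y3 f3 \<noteq> 0"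
  shows "\<exists>p1\<in>V. \<exists>p2\<in>V. \<exists>p3\<in>V. y1 p1 = 1 \<and> y2 p1 = 0 \<and> y3 p1 = 0 \<and> y1 p2 = 0 \<and> y2 p2 = 1 \<and> y3 p2 = 0 \<and>
    y1 p3 = 0 \<and> y2 p3 = 0 \<and> y3 p3 = 1"
proof -
  define p3 where "p3 = sc (1 / y3 f3) f3"
  define p2 where "p2 = sc (1 / y2 f2) (f2 - sc (y3 f2) p3)"
  define p1 where "p1 = sc (1 / y1 f1) (f1 - sc (y2 f1) p2 - sc (y3 f1) p3)"
  note s = functional_simps[OF y(1)] functional_simps[OF y(2)] functional_simps[OF y(3)]
  have 3: "p3 \<in> V" "y1 p3 = 0" "y2 p3 = 0" "y3 p3 = 1" using f V(1) by (simp_all add: p3_def fn.subspace_scale s)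
  have 2: "p2 \<in> V" "y1 p2 = 0" "y2 p2 = 1" "y3 p2 = 0"
    using f V(1) 3 by (simp_all add: p2_def fn.subspace_scale fn.subspace_diff s)
  have 1: "p1 \<in> V" "y1 p1 = 1" "y2 p1 = 0" "y3 p1 = 0"
    using f V(1) 2 3 by (simp_all add: p1_def fn.subspace_scale fn.subspace_diff s)
  show ?thesis using 1 2 3 by blast
qed

text \<open>A root form on one hyperplane excludes vanishing on another, since it is nonzero at some
  row common to both. So either \<open>F\<close> vanishes on the hyperplanes, which span
  \<open>V\<close>, or there are three root forms. Rescaling gives them one \<open>b\<close>; the
  remaining factor \<open>c\<close> between the second and the third satisfies
  \<open>b (c * m) = b m\<close>, whence \<open>c = 1\<close>.\<close>

lemma root_if_three_restrictions:
  assumes y: "functional y1" "functional y2" "functional y3"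
    and f: "f1 \<in> V" "f2 \<in> V" "f3 \<in> V" "y1 f1 \<noteq> 0" "y1 f2 = 0" "y2 f2 \<noteq> 0" "y1 f3 = 0" "y2 f3 = 0" "y3 f3 \<noteq> 0"
    and r: "\<And>y. y \<in> {y1, y2, y3} \<Longrightarrow> (\<forall>s\<in>ann W. \<forall>f\<in>hyp V y. F s f = 0) \<or> (\<exists>h b. root_on (hyp V y) U X W F h b)"
  shows "(\<forall>s\<in>ann W. \<forall>f\<in>V. F s f = 0) \<or> (\<exists>h b. sym_form V U W h \<and> root_form V W F h b)"
proof -
  obtain p1 p2 p3 where p: "p1 \<in> V" "p2 \<in> V" "p3 \<in> V" "y1 p1 = 1" "y2 p1 = 0" "y3 p1 = 0" "y1 p2 = 0" "y2 p2 = 1" "y3 p2 = 0"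
      "y1 p3 = 0" "y2 p3 = 0" "y3 p3 = 1"
    using dual_triple[OF y f] by blast
  have excl: "\<not> (\<forall>s\<in>ann W. \<forall>f\<in>hyp V z. F s f = 0)" if r: "root_on (hyp V w) U X W F h b" and fz: "functional z" for w z h b
  proof
    assume z: "\<forall>s\<in>ann W. \<forall>f\<in>hyp V z. F s f = 0"
    obtain f where "f \<in> hyp V w" "z f = 0" "h f \<notin> X" using root_onD(10)[OF r fz] by blast
    then show False using root_on_not_zero[OF W(1) r, of f] z by simp
  qed
  show ?thesis
  proof (cases "\<exists>h b. root_on (hyp V y1) U X W F h b")
    case False
    then have z1: "\<forall>s\<in>ann W. \<forall>f\<in>hyp V y1. F s f = 0" using r by blast
    then have "\<nexists>h b. root_on (hyp V y2) U X W F h b" using excl y(1) by blast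
    then have z2: "\<forall>s\<in>ann W. \<forall>f\<in>hyp V y2. F s f = 0" using r by blast
    have "F s f = 0" if s: "s \<in> ann W" and f: "f \<in> V" for s f
    proof -
      have 1: "F s (f - sc (y1 f) p1) = 0" using z1 s f p V(1)
        by (simp add: fn.subspace_diff fn.subspace_scale functional_simps[OF y(1)])
      have "F s p1 = 0" using z2 s p by simp
      then show ?thesis using 1 by (simp add: functional_simps[OF F_functional[OF s]])
    qed
    then show ?thesis by blast
  next
    case True
    then obtain h1 b where h1: "root_on (hyp V y1) U X W F h1 b" by blast
    obtain k2 d2 where k2: "root_on (hyp V y2) U X W F k2 d2" using r excl[OF h1 y(2)] by blast
    obtain k3 d3 where k3: "root_on (hyp V y3) U X W F k3 d3" using r excl[OF h1 y(3)] by blast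
    have sub: "hyp V y \<subseteq> V" for y by auto
    have "\<exists>f\<in>hyp V y1 \<inter> hyp V y2. k2 f \<notin> X" using root_onD(10)[OF k2 y(1)] by auto
    from root_on_compare[OF X(1) W(1,2) sub sub h1 k2 this] obtain c2 where
      c2: "\<forall>f\<in>hyp V y1 \<inter> hyp V y2. h1 f - sc c2 (k2 f) \<in> X" "\<And>m. b (c2 * m) = d2 m" by blast
    have "\<exists>f\<in>hyp V y1 \<inter> hyp V y3. k3 f \<notin> X" using root_onD(10)[OF k3 y(1)] by auto
    from root_on_compare[OF X(1) W(1,2) sub sub h1 k3 this] obtain c3 where
      c3: "\<forall>f\<in>hyp V y1 \<inter> hyp V y3. h1 f - sc c3 (k3 f) \<in> X" "\<And>m. b (c3 * m) = d3 m" by blast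
    note resc = root_on_rescale[OF X(1) U(1) W(1) _ root_onD(8)[OF h1] root_onD(6)[OF h1]]
    have h2: "root_on (hyp V y2) U X W F (\<lambda>f. sc c2 (k2 f)) b" by (rule resc[OF k2 c2(2)])
    have h3: "root_on (hyp V y3) U X W F (\<lambda>f. sc c3 (k3 f)) b" by (rule resc[OF k3 c3(2)])
    have "\<exists>f\<in>hyp V y2 \<inter> hyp V y3. sc c3 (k3 f) \<notin> X" using root_onD(10)[OF h3 y(2)] by auto
    from root_on_compare[OF X(1) W(1,2) sub sub h2 h3 this] obtain c where
      c: "\<forall>f\<in>hyp V y2 \<inter> hyp V y3. sc c2 (k2 f) - sc c (sc c3 (k3 f)) \<in> X" "\<And>m. b (c * m) = b m" by blast
    have "c - 1 = 0"
    proof (rule scaled_zero_imp_zero[OF root_onD(8)[OF h1]])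
      fix m
      have "b (c * m) = b (m * (c - 1)) + b m"
        by (simp add: root_onD(6)[OF h1, symmetric] algebra_simps)
      then show "b (m * (c - 1)) = 0" using c(2)[of m] by simp
    qed
    then have "c = 1" by simp
    have "\<exists>h. sym_form V U W h \<and> root_form V W F h b"
      by (rule root_on_glue[OF y p h1 h2 h3]) (use c2(1) c3(1) c(1) \<open>c = 1\<close> in simp_all)
    then show ?thesis by blast
  qed
qed

end

text \<open>The slices are at most \<open>dim V - 2\<close> here, so the only column to be added is
  one with equality. If \<open>F\<close> is not local after adding it, a second special column
  exists and \<open>special_pair_homogeneous_or_root\<close> computes the defect; otherwise
  \<open>local_step\<close> makes \<open>F\<close> local. Smaller slices lead to three
  hyperplanes.\<close>

theorem homogeneous_or_root:
  assumes "range_compatible V U X W F" and "fn.dim W + 3 \<le> fn.dim (TP V X) + 2 * fn.dim V"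
    and card: "\<exists>a::'a::field. a \<noteq> 0 \<and> a \<noteq> 1"
    and "\<forall>x\<in>U. x \<notin> X \<longrightarrow> fn.dim (slice V W x) + 2 \<le> fn.dim V"
  shows "(\<forall>s\<in>ann W. \<forall>f\<in>V. defect c F s f = 0) \<or>
    (\<exists>h b. sym_form (V :: ('i \<Rightarrow> 'a) set) U W h \<and> root_form V W (defect c F) h b)"
  using assms(1,2,4)
proof (induction "fn.dim V" arbitrary: V W F rule: less_induct)
  case (less V W F)
  interpret range_compatible V U X W F by (rule less.prems(1))
  note bound = less.prems(2)
  have sl: "fn.dim (slice V W x) + 2 \<le> fn.dim V" if "x \<in> U" "x \<notin> X" for x using less.prems(3) that by blast
  show ?case
  proof (cases "is_local V U W F")
    case True
    then show ?thesis using defect_local by blast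
  next
    case nl: False
    then have "X \<noteq> U" using local_if_full by blast
    then obtain x0 where x0: "x0 \<in> U" "x0 \<notin> X" using X(2) by blast
    have big: "fn.dim (TP V X) + fn.dim V < fn.dim W + 2"
      using nl local_small_codim[OF less.prems(1)] by linarith
    show ?thesis
    proof (cases "\<exists>x\<in>U. x \<notin> X \<and> fn.dim V \<le> fn.dim (slice V W x) + 2")
      case True
      have dd: "fn.dim (add_col V W x) = fn.dim W + 2" "fn.dim (add_col V W x) < fn.dim (TP V (fn.span (insert x X))) + fn.dim V"
        "\<not> is_local V U (add_col V W x) F"
        if x: "x \<in> U" "x \<notin> X" and slx: "fn.dim V \<le> fn.dim (slice V W x) + 2" for x
      proof -
        show 1: "fn.dim (add_col V W x) = fn.dim W + 2" using dim_add_col_insert(1)[OF x] slx sl[OF x] by linarith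
        show 2: "fn.dim (add_col V W x) < fn.dim (TP V (fn.span (insert x X))) + fn.dim V"
          using 1 dim_add_col_insert(2)[OF x] bound by linarith
        show "\<not> is_local V U (add_col V W x) F"
          using local_step[OF x(1) _ _ sl[OF x]] 2 card nl by blast
      qed
      show ?thesis
      proof (cases "3 \<le> fn.dim V")
        case V3: True
        obtain x where x: "x \<in> U" "x \<notin> X" and slx: "fn.dim V \<le> fn.dim (slice V W x) + 2" using True by blast
        note d = dd[OF x slx]
        have "fn.dim (add_col V W x) + 4 \<le> fn.dim (TP V (fn.span (insert x X))) + 2 * fn.dim V"
          using d(1) dim_add_col_insert(2)[OF x] bound V3 by linarith
        from local_or_special_column[OF range_compatible_add_col[OF x(1)] this] d(3)
        obtain x' where x': "x' \<in> U" "x' \<notin> fn.span (insert x X)" "fn.dim V \<le> Suc (fn.dim (slice V (add_col V W x) x'))"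
          "\<exists>u\<in>U. \<forall>s\<in>ann (add_col V W x). \<exists>c. \<forall>f\<in>V. F s f = s (tens f u) + c * s (tens f x')" by blast
        show ?thesis by (rule special_pair_homogeneous_or_root[OF x x'(1,2) sl slx x'(3) d(2,3) x'(4)])
      next
        case False
        then have V2: "fn.dim V = 2" using sl[OF x0] by linarith
        have dW: "fn.dim W = Suc (fn.dim (TP V X))" using big bound V2 by linarith
        from plane_special_pair[OF V2 dW sl] obtain x x' where x: "x \<in> U" "x \<notin> X"
          and x': "x' \<in> U" "x' \<notin> fn.span (insert x X)" "1 \<le> fn.dim (slice V (add_col V W x) x')" by blast
        have slx: "fn.dim V \<le> fn.dim (slice V W x) + 2" using V2 by simp
        note d = dd[OF x slx]
        interpret A: range_compatible V U "fn.span (insert x X)" "add_col V W x" F by (rule range_compatible_add_col[OF x(1)])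
        have d': "fn.dim (add_col V (add_col V W x) x') + 2 \<le> fn.dim (TP V (fn.span (insert x' (fn.span (insert x X))))) + fn.dim V"
          using A.dim_add_col_insert(1,2)[OF x'(1,2)] d(1) dim_add_col_insert(2)[OF x] x'(3) V2 dW by linarith
        have "is_local V U (add_col V (add_col V W x) x') F"
          by (rule local_small_codim[OF A.range_compatible_add_col[OF x'(1)] d'])
        note al = A.almost_local[OF x'(1) this d']
        have slx': "fn.dim V \<le> Suc (fn.dim (slice V (add_col V W x) x'))" using x'(3) V2 by simp
        show ?thesis by (rule special_pair_homogeneous_or_root[OF x x'(1,2) sl slx slx' d(2,3) al])
      qed
    next
      case False
      then have sl3: "fn.dim (slice V W x) + 3 \<le> fn.dim V" if "x \<in> U" "x \<notin> X" for x
        using that by fastforce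
      have V3: "3 \<le> fn.dim V" using sl3[OF x0] by simp
      obtain y1 where y1: "ind2 X W y1" using exists_ind2[OF big V3 sl3] by blast
      obtain y2 f2 where y2: "ind2 X W y2" and f2: "f2 \<in> V" "y1 f2 = 0" "y2 f2 \<noteq> 0"
        using second_ind2[OF y1 V3] by blast
      obtain f1 where f1: "f1 \<in> V" "y1 f1 \<noteq> 0" using ind2_nonzero[OF y1] by blast
      have fy: "functional y1" "functional y2" using y1 y2 by (simp_all add: ind2_def)
      have "Suc (fn.dim (hyp V y1)) = fn.dim V" by (rule dim_hyp[OF V fy(1) f1])
      moreover have "Suc (fn.dim (hyp (hyp V y1) y2)) = fn.dim (hyp V y1)"
        by (rule dim_hyp[OF subspace_hyp[OF V(1) fy(1)] fin_gen_hyp[OF V(2)] fy(2), of f2]) (use f2 in simp_all)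
      ultimately have "fn.dim (hyp (hyp V y1) y2) \<noteq> 0" using V3 by linarith
      then have "hyp (hyp V y1) y2 \<noteq> {0}" by (metis fn.dim_zero_space)
      moreover have "0 \<in> hyp (hyp V y1) y2" by (intro fn.subspace_0 subspace_hyp V(1) fy)
      ultimately obtain f3 where "f3 \<in> hyp (hyp V y1) y2" "f3 \<noteq> 0" by blast
      then have f3: "f3 \<in> V" "y1 f3 = 0" "y2 f3 = 0" "f3 \<noteq> 0" by simp_all
      \<comment> \<open>\<open>f3\<close> is killed by \<open>y1\<close> and \<open>y2\<close> but
        not by \<open>y3\<close>, so the three functionals are independent on
        \<open>V\<close>.\<close>
      obtain y3 where y3: "ind2 X W y3" "y3 f3 \<noteq> 0" using third_ind2[of y1 f3 y2, OF y1 f3 card] by blast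
      have fy3: "functional y3" using y3 by (simp add: ind2_def)
      have res: "(\<forall>s\<in>ann W. \<forall>f\<in>hyp V y. defect c F s f = 0) \<or> (\<exists>h b. root_on (hyp V y) U X W (defect c F) h b)"
        if "y \<in> {y1, y2, y3}" for y
      proof -
        have y: "ind2 X W y" using that y1 y2 y3 by blast
        then have fy: "functional y" by (simp add: ind2_def)
        obtain f where f: "f \<in> V" "y f \<noteq> 0" using ind2_nonzero[OF y] by blast
        have dh: "Suc (fn.dim (hyp V y)) = fn.dim V" by (rule dim_hyp[OF V fy f])
        show ?thesis
        proof (rule root_on_restriction[OF y bound sl3 less.hyps[OF _ range_compatible_restrict[OF fy]]])
          show "fn.dim (hyp V y) < fn.dim V" using dh by simp
          show "fn.dim (ctr_ker W y) + 3 \<le> fn.dim (TP (hyp V y) X) + 2 * fn.dim (hyp V y)"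
            using dim_ctr_ker[OF y] bound dh by linarith
          show "\<forall>x\<in>U. x \<notin> X \<longrightarrow> fn.dim (slice (hyp V y) (ctr_ker W y) x) + 2 \<le> fn.dim (hyp V y)"
          proof (intro ballI impI)
            fix x assume "x \<in> U" "x \<notin> X"
            then show "fn.dim (slice (hyp V y) (ctr_ker W y) x) + 2 \<le> fn.dim (hyp V y)"
              using sl3[of x] dim_slice_restrict[of y x] dh by linarith
          qed
        qed
      qed
      show ?thesis
        by (rule range_compatible.root_if_three_restrictions[OF range_compatible_defect fy fy3 f1(1) f2(1) f3(1) f1(2) f2(2,3) f3(2,3) y3(2) res])
    qed
  qed
qed

section \<open>Normal forms of the exceptional spaces\<close>

text \<open>In the bases \<open>bs\<close> and \<open>xs\<close> its annihilator consists of the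
  matrices with a symmetric leading \<open>r\<close> x \<open>r\<close> block and zeros below that
  block.\<close>

definition sym_space :: "nat \<Rightarrow> ('i \<Rightarrow> 'a::field) list \<Rightarrow> ('j \<Rightarrow> 'a) list \<Rightarrow> ('i \<times> 'j \<Rightarrow> 'a) set" where
  "sym_space r bs xs = fn.span ({tens (bs ! i) (xs ! j) - tens (bs ! j) (xs ! i) |i j. i < r \<and> j < r} \<union>
     {tens (bs ! i) (xs ! j) |i j. r \<le> i \<and> i < length bs \<and> j < r})"

definition basis_list :: "('i \<Rightarrow> 'a::field) set \<Rightarrow> ('i \<Rightarrow> 'a) list \<Rightarrow> bool" where
  "basis_list V bs \<longleftrightarrow> distinct bs \<and> fn.independent (set bs) \<and> fn.span (set bs) = V"

lemma basis_list_length: "basis_list V bs \<Longrightarrow> length bs = fn.dim V"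
  unfolding basis_list_def using fn.dim_span_eq_card_independent[of "set bs"] distinct_card by metis

lemma basis_list_extend:
  assumes V: "fn.subspace V" "fn.fin_gen V" and xs: "distinct xs" "fn.independent (set xs)" "set xs \<subseteq> V"
  shows "\<exists>ys. basis_list V (xs @ ys)"
proof -
  obtain B where B: "set xs \<subseteq> B" "B \<subseteq> V" "fn.independent B" "V \<subseteq> fn.span B"
    using fn.maximal_independent_subset_extend[OF xs(3,2)] by blast
  have s: "fn.span B = V" by (rule fn.span_subspace[OF B(2,4) V(1)])
  have "finite B" by (rule fn.independent_subset_fin_gen(1)[OF V(2) B(3,2)])
  then obtain ys where ys: "set ys = B - set xs" "distinct ys" using finite_distinct_list[of "B - set xs"] by auto
  then have "set (xs @ ys) = B" "distinct (xs @ ys)" using B(1) xs(1) by auto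
  then show ?thesis using B(3) s unfolding basis_list_def by metis
qed

lemma independent_pair:
  assumes "v \<noteq> 0" "w \<notin> fn.span {v}"
  shows "fn.independent {v, w}" "v \<noteq> w"
proof -
  have "fn.independent {w, v}" using assms by (intro fn.independent_insertI fn.independent_empty) simp_all
  then show "fn.independent {v, w}" by (simp add: insert_commute)
  show "v \<noteq> w" using assms(2) fn.span_base[of v "{v}"] by auto
qed

lemma mem_span_pair:
  "v \<in> fn.span {a, b} \<longleftrightarrow> (\<exists>k l. v = sc k a + sc l b)"
proof -
  have "v - sc k a = w \<longleftrightarrow> v = sc k a + w" for k w by (simp add: diff_eq_eq add.commute)
  then show ?thesis unfolding fn.span_insert[of a] fn.span_singleton by auto
qed

text \<open>\<open>W\<close> is exhausted by the relations of \<open>f\<close> and \<open>g\<close>.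
  If \<open>h\<close> has rank two, a basis of its kernel completes \<open>f\<close>,
  \<open>g\<close> and the normal form is visible. If some \<open>h k\<close> is independent of
  \<open>h f\<close>, \<open>h g\<close>, a fourth basis vector \<open>l\<close> is impossible: the
  relation of \<open>k\<close> with \<open>l\<close> contracts to \<open>- h k\<close>, whereas all
  of \<open>W\<close> contracts into the span of \<open>h f\<close> and \<open>h g\<close>.\<close>

theorem sym_form_normal:
  assumes rc: "range_compatible V U {0} W F" and h: "sym_form V U W h" and f: "f \<in> V" "h f \<noteq> 0"
    and sl: "\<And>x. x \<in> U \<Longrightarrow> x \<noteq> 0 \<Longrightarrow> fn.dim (slice V W x) + 2 \<le> fn.dim V"
    and bound: "fn.dim W + 3 \<le> 2 * fn.dim V"
  shows "\<exists>r bs xs. basis_list V bs \<and> basis_list U xs \<and> r \<le> length bs \<and> r \<le> length xs \<and>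
    (r = 2 \<or> r = 3 \<and> length bs = 3) \<and> W = sym_space r bs xs"
proof -
  interpret range_compatible V U "{0}" W F by (rule rc)
  have lin: "Vector_Spaces.linear sc sc h" using h by (simp add: sym_form_def)
  have hs: "h (p + q) = h p + h q" "h (sc c p) = sc c (h p)" "h 0 = 0" "h (p - q) = h p - h q" for p q c
    using lin ff.linear_0[OF lin] ff.linear_diff[OF lin] by (simp_all add: linear_sc_iff)
  have hU: "h v \<in> U" if "v \<in> V" for v using h that by (simp add: sym_form_def)
  define R where "R a b = tens a (h b) - tens b (h a)" for a b
  have RW: "R a b \<in> W" if "a \<in> V" "b \<in> V" for a b using h that by (simp add: sym_form_def R_def)
  have ctr_R: "ctr y (R a b) = sc (y a) (h b) - sc (y b) (h a)" if "functional y" for y a b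
    using that by (simp add: R_def ctr_diff ctr_tens)
  have f': "h f \<notin> {0}" using f(2) by simp
  obtain g where g: "g \<in> V" "h g \<notin> fn.span (insert (h f) {0})" using sym_rank_two[OF h f(1) f' sl] by auto
  have hg: "h g \<notin> fn.span {h f}" using g(2) fn.span_mono[of "{h f}" "insert (h f) {0}"] by blast
  note ind = sym_independent[OF h f' g(2)]
  have TP0: "TP V {0} = {0}"
  proof
    show "TP V {0} \<subseteq> {0}" by (rule TP_minimal) (simp_all add: tens_simps)
    show "{0} \<subseteq> TP V {0}" using fn.subspace_0[OF subspace_TP, of V "{0}"] by simp
  qed
  have e: "R f g \<noteq> 0" using sym_base(2)[OF h f(1) g(1) f' g(2)] by (simp add: R_def TP0)
  have dT: "fn.dim (fn.span {R f g}) = 1" using fn.dim_span_eq_card_independent[of "{R f g}"] e by simp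
  \<comment> \<open>\<open>dim W \<le> 2 * dim V - 3\<close> is exactly
    \<open>1 + 2 * (dim V - 2)\<close>, the number of relations of \<open>f\<close> and
    \<open>g\<close>: the equality case of \<open>sym_form_dim\<close>.\<close>
  have desc: "W = fn.span (fn.span {R f g} \<union> (R f ` (B - {f, g}) \<union> R g ` (B - {f, g})))"
    if B: "finite B" "fn.independent B" "fn.span B = V" "f \<in> B" "g \<in> B" for B
  proof -
    have TW: "fn.span {R f g} \<subseteq> W" by (rule fn.span_minimal[OF _ W(1)]) (use RW f g in simp)
    have T0: "ctr y N \<in> {0}" if y: "functional y" "y f = 0" "y g = 0" and N: "N \<in> fn.span {R f g}" for y N
      using N y by (auto simp: fn.span_singleton ctr_sc ctr_R)
    have le: "fn.dim W + 4 \<le> fn.dim (fn.span {R f g}) + 2 * fn.dim V" using bound dT by simp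
    show ?thesis unfolding R_def
      by (rule sym_form_dim(2)[OF h B ind(2) f' g(2) fn.subspace_span TW[unfolded R_def] T0 le[unfolded R_def], unfolded R_def])
  qed
  show ?thesis
  proof (cases "\<exists>k\<in>V. h k \<notin> fn.span {h f, h g}")
    case True
    then obtain k where k: "k \<in> V" "h k \<notin> fn.span {h f, h g}" by blast
    have img: "h v \<in> fn.span {h f, h g}" if v: "v \<in> fn.span {f, g}" for v
    proof -
      obtain a b where "v = sc a f + sc b g" using v unfolding mem_span_pair by blast
      then have "h v = sc a (h f) + sc b (h g)" by (simp only: hs)
      then show ?thesis unfolding mem_span_pair by blast
    qed
    have kfg: "k \<notin> fn.span {f, g}" using img k(2) by blast
    have ind3: "fn.independent {k, f, g}"
      by (rule fn.independent_insertI[OF kfg]) (use ind(1) in \<open>simp add: insert_commute\<close>)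
    have ne: "f \<noteq> g" "k \<noteq> f" "k \<noteq> g" using ind(2) kfg fn.span_base[of _ "{f, g}"] by auto
    obtain B where B: "{k, f, g} \<subseteq> B" "finite B" "fn.independent B" "fn.span B = V"
      by (rule basis_through[OF ind3]) (use f g k in blast)
    have B3: "B = {f, g, k}"
    proof (rule ccontr)
      assume "B \<noteq> {f, g, k}"
      then obtain l where l: "l \<in> B" "l \<noteq> f" "l \<noteq> g" "l \<noteq> k" using B(1) by blast
      from functional_extend[OF B(3), of "\<lambda>b. if b = l then 1 else 0"]
      obtain y where y: "functional y" "\<forall>b\<in>B. y b = (if b = l then 1 else 0)" by blast
      have y0: "y f = 0" "y g = 0" "y k = 0" "y l = 1" using y(2) B(1) l by auto
      let ?D = "fn.span {h f, h g}"
      have D: "sc c (h f) \<in> ?D" "sc c (h g) \<in> ?D" for c by (intro fn.span_scale fn.span_base; simp)+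
      note Z = subspace_ctr_vimage[OF y(1) fn.subspace_span, of "{h f, h g}"]
      have "fn.span {R f g} \<subseteq> {N. ctr y N \<in> ?D}"
        by (rule fn.span_minimal[OF _ Z]) (use y0 fn.span_zero in \<open>simp add: ctr_R[OF y(1)]\<close>)
      moreover have "ctr y (R f b) \<in> ?D" "ctr y (R g b) \<in> ?D" for b
        using fn.span_neg[OF D(1)[of "y b"]] fn.span_neg[OF D(2)[of "y b"]] y0 by (simp_all add: ctr_R[OF y(1)])
      ultimately have "fn.span (fn.span {R f g} \<union> (R f ` (B - {f, g}) \<union> R g ` (B - {f, g}))) \<subseteq> {N. ctr y N \<in> ?D}"
        by (intro fn.span_minimal[OF _ Z]) blast
      moreover have "W = fn.span (fn.span {R f g} \<union> (R f ` (B - {f, g}) \<union> R g ` (B - {f, g})))"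
        by (rule desc[OF B(2-4)]) (use B(1) in blast)+
      ultimately have "W \<subseteq> {N. ctr y N \<in> ?D}" by simp
      moreover have "l \<in> V" using l(1) B(4) fn.span_base by blast
      ultimately have "ctr y (R k l) \<in> ?D" using RW[OF k(1)] by blast
      then have "- h k \<in> ?D" using y0 by (simp add: ctr_R[OF y(1)])
      then show False using k(2) fn.span_neg[of "- h k"] by simp
    qed
    have W3: "W = fn.span (fn.span {R f g} \<union> {R f k, R g k})"
      using desc[OF B(2-4)] B(1) ne by (simp add: B3 insert_Diff_if insert_commute)
    have ind3h: "fn.independent {h k, h f, h g}"
      by (rule fn.independent_insertI[OF k(2) independent_pair(1)[OF f(2) hg]])
    have neh: "h f \<noteq> h g" "h k \<noteq> h f" "h k \<noteq> h g"
      using independent_pair(2)[OF f(2) hg] k(2) fn.span_base[of _ "{h f, h g}"] by auto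
    obtain ys where ys: "basis_list U ([h f, h g, h k] @ ys)"
      using basis_list_extend[OF U, of "[h f, h g, h k]"] ind3h neh hU f(1) g(1) k(1) by (auto simp: insert_commute)
    have bl: "basis_list V [f, g, k]" using B(3,4) ne by (auto simp: basis_list_def B3)
    let ?S = "sym_space 3 [f, g, k] ([h f, h g, h k] @ ys)"
    have mem: "R ([f, g, k] ! i) ([f, g, k] ! j) \<in> ?S" if "i < 3" "j < 3" for i j
      unfolding sym_space_def R_def
    proof (rule fn.span_base, rule UnI1, rule CollectI, intro exI conjI)
      have "([h f, h g, h k] @ ys) ! l = h ([f, g, k] ! l)" if "l < 3" for l
        using that by (auto simp: less_Suc_eq numeral_3_eq_3)
      then show "tens ([f, g, k] ! i) (h ([f, g, k] ! j)) - tens ([f, g, k] ! j) (h ([f, g, k] ! i)) =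
        tens ([f, g, k] ! i) (([h f, h g, h k] @ ys) ! j) - tens ([f, g, k] ! j) (([h f, h g, h k] @ ys) ! i)"
        using that by simp
    qed (use that in auto)
    have "W = ?S"
    proof
      have "R f g \<in> ?S" "R f k \<in> ?S" "R g k \<in> ?S" using mem[of 0 1] mem[of 0 2] mem[of 1 2] by simp_all
      then show "W \<subseteq> ?S" unfolding W3
        by (intro fn.span_minimal) (auto simp: sym_space_def intro: fn.span_minimal[THEN subsetD])
      show "?S \<subseteq> W" unfolding sym_space_def
      proof (rule fn.span_minimal[OF _ W(1)], rule Un_least; clarify)
        fix i j :: nat assume ij: "i < 3" "j < 3"
        have x: "([h f, h g, h k] @ ys) ! l = h ([f, g, k] ! l)" "[f, g, k] ! l \<in> V" if "l < 3" for l
          using that f(1) g(1) k(1) by (auto simp: less_Suc_eq numeral_3_eq_3)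
        show "tens ([f, g, k] ! i) (([h f, h g, h k] @ ys) ! j) - tens ([f, g, k] ! j) (([h f, h g, h k] @ ys) ! i) \<in> W"
          using RW[OF x(2)[OF ij(1)] x(2)[OF ij(2)]] by (simp only: x(1)[OF ij(1)] x(1)[OF ij(2)] R_def)
      qed simp
    qed
    then show ?thesis using bl ys
      by (intro exI[of _ 3] exI[of _ "[f, g, k]"] exI[of _ "[h f, h g, h k] @ ys"]) simp
  next
    case False
    let ?K = "{v \<in> V. h v = 0}"
    have K: "fn.subspace ?K" using V(1) by (auto simp: fn.subspace_def hs)
    have fK: "fn.fin_gen ?K" by (rule fn.fin_gen_subset[OF _ V(2)]) blast
    obtain C where C: "finite C" "fn.independent C" "fn.span C = ?K" by (rule fn.fin_gen_basis[OF K fK])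
    have CK: "c \<in> V" "h c = 0" if "c \<in> C" for c using that C(3) fn.span_base[of c C] by blast+
    have fC: "f \<notin> fn.span C" using f(2) C(3) by simp
    have gC: "g \<notin> fn.span (insert f C)"
    proof
      assume "g \<in> fn.span (insert f C)"
      then obtain a where "g - sc a f \<in> ?K" unfolding fn.span_insert C(3) by blast
      then have "h g = sc a (h f)" by (simp add: hs)
      then show False using hg unfolding fn.span_singleton by blast
    qed
    let ?B = "insert g (insert f C)"
    have iB: "fn.independent ?B" by (intro fn.independent_insertI fC gC C(2))
    have sB: "fn.span ?B = V"
    proof (rule fn.span_subspace[OF _ _ V(1)])
      show "?B \<subseteq> V" using f g CK by blast
      show "V \<subseteq> fn.span ?B"
      proof
        fix v assume v: "v \<in> V"
        then obtain a b where ab: "h v = sc a (h f) + sc b (h g)" using False by (auto simp: mem_span_pair)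
        have "v - sc b g - sc a f \<in> ?K" using v f g V(1) ab by (simp add: hs fn.subspace_diff fn.subspace_scale)
        then show "v \<in> fn.span ?B" unfolding fn.span_insert[of g] fn.span_insert[of f] C(3) by blast
      qed
    qed
    have nC: "f \<notin> C" "g \<notin> C" "f \<noteq> g" using fC gC fn.span_base[of _ C] fn.span_base[of g "insert f C"] ind(2) by auto
    then have BC: "?B - {f, g} = C" by auto
    have W2: "W = fn.span (fn.span {R f g} \<union> (R f ` C \<union> R g ` C))"
      using desc[OF _ iB sB] C(1) unfolding BC by simp
    obtain cs where cs: "set cs = C" "distinct cs" using finite_distinct_list[OF C(1)] by blast
    let ?bs = "f # g # cs"
    have bl: "basis_list V ?bs"
    proof -
      have "set ?bs = ?B" using cs(1) by auto
      then show ?thesis using iB sB nC cs unfolding basis_list_def by auto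
    qed
    obtain ys where "basis_list U ([h f, h g] @ ys)"
      using basis_list_extend[OF U, of "[h f, h g]"] independent_pair[OF f(2) hg] hU f(1) g(1) by auto
    then have ys: "basis_list U (h f # h g # ys)" by simp
    let ?xs = "h f # h g # ys"
    let ?S = "sym_space 2 ?bs ?xs"
    have 2: "i < 2 \<longleftrightarrow> i = 0 \<or> i = 1" for i :: nat by auto
    have "W = ?S"
    proof
      have S: "fn.subspace ?S" by (simp add: sym_space_def)
      have "R f g = tens (?bs ! 0) (?xs ! 1) - tens (?bs ! 1) (?xs ! 0)" by (simp add: R_def)
      then have "R f g \<in> ?S" unfolding sym_space_def
        by (intro fn.span_base UnI1 CollectI exI[of _ "0::nat"] exI[of _ "1::nat"]) simp
      then have 1: "fn.span {R f g} \<subseteq> ?S" using S by (intro fn.span_minimal) simp_all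
      have t: "tens c (?xs ! j) \<in> ?S" if "c \<in> C" and j: "j < 2" for c j
      proof -
        obtain i where i: "i < length cs" "cs ! i = c" using \<open>c \<in> C\<close> cs(1) by (metis in_set_conv_nth)
        then have "?bs ! (i + 2) = c" "i + 2 < length ?bs" by simp_all
        then show ?thesis unfolding sym_space_def using j
          by (intro fn.span_base UnI2 CollectI exI[of _ "i + 2"] exI[of _ j]) simp
      qed
      have "R f c \<in> ?S" "R g c \<in> ?S" if c: "c \<in> C" for c
        using fn.subspace_neg[OF S t[OF c, of 0]] fn.subspace_neg[OF S t[OF c, of 1]] CK(2)[OF c] by (simp_all add: R_def tens_simps)
      then show "W \<subseteq> ?S" unfolding W2 by (intro fn.span_minimal[OF _ S] Un_least 1) blast+
      show "?S \<subseteq> W" unfolding sym_space_def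
      proof (rule fn.span_minimal[OF _ W(1)], rule Un_least; clarify)
        fix i j :: nat assume ij: "i < 2" "j < 2"
        have "?xs ! l = h (?bs ! l)" "?bs ! l \<in> V" if "l < 2" for l using that f(1) g(1) unfolding 2 by auto
        then show "tens (?bs ! i) (?xs ! j) - tens (?bs ! j) (?xs ! i) \<in> W"
          using RW[of "?bs ! i" "?bs ! j"] ij unfolding R_def by metis
      next
        fix i j :: nat assume i: "2 \<le> i" "i < length ?bs" and j: "j < 2"
        obtain i' where i': "i = i' + 2" using i(1) by (metis add.commute le_Suc_ex)
        then have "?bs ! i \<in> C" using i(2) cs(1) by (simp add: nth_mem flip: cs(1))
        then have c: "?bs ! i \<in> V" "h (?bs ! i) = 0" using CK by blast+
        obtain a where a: "a \<in> V" "?xs ! j = h a" using j f(1) g(1) unfolding 2 by auto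
        show "tens (?bs ! i) (?xs ! j) \<in> W" using RW[OF c(1) a(1)] by (simp only: R_def c(2) a(2) tens_simps diff_zero)
      qed
    qed
    then show ?thesis using bl ys
      by (intro exI[of _ 2] exI[of _ ?bs] exI[of _ ?xs]) simp
  qed
qed

theorem columns_span:
  fixes V :: "('i \<Rightarrow> 'a::field) set" and U :: "('j \<Rightarrow> 'a) set"
  assumes V: "fn.subspace V" "fn.fin_gen V" and U: "fn.subspace U" "fn.fin_gen U"
    and W: "fn.subspace W" "W \<subseteq> TP V U" and C: "C \<subseteq> U"
    and eq: "\<And>s f. s \<in> ann W \<Longrightarrow> f \<in> V \<Longrightarrow> (\<forall>u\<in>C. s (tens f u) = 0) \<Longrightarrow> (\<forall>u\<in>U. s (tens f u) = 0)"
    and bound: "fn.dim W + 4 \<le> 2 * fn.dim V \<or> fn.dim W + 3 \<le> 2 * fn.dim V \<and> (\<exists>a::'a. a \<noteq> 0 \<and> a \<noteq> 1)"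
    and nondeg: "\<And>x. x \<in> U \<Longrightarrow> (\<And>f. f \<in> V \<Longrightarrow> tens f x \<in> W) \<Longrightarrow> x = 0"
  shows "U \<subseteq> fn.span C"
proof
  fix x assume x: "x \<in> U"
  let ?H = "fn.span C" and ?T = "TP V (fn.span C)"
  have H: "?H \<subseteq> U" by (rule fn.span_minimal[OF C U(1)])
  let ?W = "W \<inter> ?T"
  \<comment> \<open>Functionals vanishing on \<open>?W\<close> agree on \<open>?T\<close> with
    matrices annihilating \<open>W\<close>. By \<open>eq\<close> the column \<open>x\<close> of such
    a matrix depends only on its values on \<open>?T\<close>, so evaluation at \<open>x\<close>
    descends to the smaller space even though \<open>x\<close> need not lie in
    \<open>?H\<close>.\<close>
  define ext where "ext s = (SOME t. t \<in> ann W \<and> (\<forall>e\<in>?T. t e = s e))" for s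
  have ext: "ext s \<in> ann W \<and> (\<forall>e\<in>?T. ext s e = s e)" if s: "s \<in> ann ?W" for s
  proof -
    have "\<exists>t. functional t \<and> (\<forall>e\<in>?T. t e = s e) \<and> (\<forall>e\<in>W. t e = 0)"
      by (rule functional_agree_zero[OF subspace_TP W(1) annD(1)[OF s]]) (use annD(2)[OF s] in blast)
    then have "\<exists>t. t \<in> ann W \<and> (\<forall>e\<in>?T. t e = s e)" by (auto simp: ann_def)
    then show ?thesis unfolding ext_def by (rule someI_ex)
  qed
  have sub: "s \<in> ann ?W" if "s \<in> ann W" for s using that ann_antimono[of ?W W] by blast
  have vanish: "s (tens f x) = 0" if s: "s \<in> ann W" and f: "f \<in> V" and z: "\<forall>u\<in>?H. s (tens f u) = 0" for s f
    using eq[OF s f] z fn.span_base[of _ C] x by blast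
  have same: "s (tens f x) = t (tens f x)" if s: "s \<in> ann W" "t \<in> ann W" and f: "f \<in> V"
    and z: "\<forall>e\<in>?T. s e = t e" for s t f
  proof -
    have "(s - t) (tens f u) = 0" if "u \<in> ?H" for u using z tens_in_TP[OF f that] by simp
    then show ?thesis using vanish[OF ann_minus[OF s] f] by simp
  qed
  define G where "G s f = ext s (tens f x)" for s f
  have G: "G s f = t (tens f x)" if "s \<in> ann ?W" "t \<in> ann W" "f \<in> V" "\<forall>e\<in>?T. t e = s e" for s t f
    unfolding G_def using same[of "ext s" t f] ext[OF that(1)] that(2-4) by simp
  have rc: "range_compatible V ?H {0} ?W G"
  proof
    show "fn.subspace V" "fn.fin_gen V" by (fact V)+
    show "fn.subspace ?H" "fn.subspace {0::'j\<Rightarrow>'a}" "{0} \<subseteq> ?H" "?W \<subseteq> ?T" by (auto simp: fn.span_zero)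
    show "fn.fin_gen ?H" by (rule fn.fin_gen_subset[OF H U(2)])
    show "fn.subspace ?W" by (rule fn.subspace_inter[OF W(1) subspace_TP])
    show "TP V {0} \<subseteq> ?W"
      by (rule TP_minimal[OF _ \<open>fn.subspace ?W\<close>]) (simp add: tens_simps fn.subspace_0[OF W(1)] fn.subspace_0[OF subspace_TP])
    show "functional (G s)" if "s \<in> ann ?W" for s
      unfolding G_def[abs_def] by (rule functional_tens_left) (use ext[OF that] annD(1) in blast)
    show "G (s + t) f = G s f + G t f" if s: "s \<in> ann ?W" "t \<in> ann ?W" and f: "f \<in> V" for s t f
      using G[OF ann_plus[OF s] ann_plus[of "ext s" W "ext t"] f] ext[OF s(1)] ext[OF s(2)] by (simp add: G_def)
    show "G s f = 0" if s: "s \<in> ann ?W" and f: "f \<in> V" and z: "\<And>u. u \<in> ?H \<Longrightarrow> s (tens f u) = 0" for s f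
    proof -
      have "ext s (tens f u) = 0" if "u \<in> ?H" for u using ext[OF s] z[OF that] tens_in_TP[OF f that] by simp
      then show ?thesis unfolding G_def using vanish[of "ext s" f] ext[OF s] f by blast
    qed
  qed
  have lin: "linear_family V ?W G" unfolding linear_family_def
  proof (intro ballI allI)
    show "G (sc c s) f = c * G s f" if s: "s \<in> ann ?W" and f: "f \<in> V" for s c f
      using G[OF ann_scale[OF s] ann_scale[of "ext s" W c] f] ext[OF s] by (simp add: G_def sc_apply)
  qed
  have "fn.dim ?W \<le> fn.dim W"
    by (rule fn.dim_mono_fin_gen[OF _ fn.fin_gen_subset[OF W(2) fin_gen_TP[OF V(2) U(2)]]]) blast
  then have "fn.dim ?W + 4 \<le> fn.dim (TP V {0::'j\<Rightarrow>'a}) + 2 * fn.dim V \<or>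
      fn.dim ?W + 3 \<le> fn.dim (TP V {0::'j\<Rightarrow>'a}) + 2 * fn.dim V \<and> (\<exists>a::'a. a \<noteq> 0 \<and> a \<noteq> 1)"
    using bound by auto
  from linear_local[OF rc lin this] obtain u where u: "u \<in> ?H" "\<forall>s\<in>ann ?W. \<forall>f\<in>V. G s f = s (tens f u)"
    unfolding is_local_def by blast
  have "x - u = 0"
  proof (rule nondeg)
    show "x - u \<in> U" using x u(1) H U(1) fn.subspace_diff by blast
    show "tens f (x - u) \<in> W" if f: "f \<in> V" for f
    proof -
      have "s (tens f (x - u)) = 0" if s: "s \<in> ann W" for s
        using G[OF sub[OF s] s f] u(2) sub[OF s] f by (simp add: tens_simps functional_simps[OF annD(1)[OF s]])
      then show ?thesis using mem_iff_ann[OF W(1)] by blast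
    qed
  qed
  then show "x \<in> ?H" using u(1) by simp
qed

section \<open>Matrices as functionals\<close>

text \<open>Vectors of length \<open>n\<close> as functions on the naturals, so that lengths are
  terms and the theory over arbitrary index types applies.\<close>

definition fsup :: "nat \<Rightarrow> (nat \<Rightarrow> 'a::field) set" where
  "fsup n = {f. \<forall>i\<ge>n. f i = 0}"

definition unitv :: "nat \<Rightarrow> nat \<Rightarrow> 'a::field" where
  "unitv k = (\<lambda>i. if i = k then 1 else 0)"

lemma subspace_fsup: "fn.subspace (fsup n)"
  by (auto simp: fn.subspace_def fsup_def sc_apply)

lemma unitv_in_fsup: "k < n \<Longrightarrow> unitv k \<in> fsup n"
  by (auto simp: fsup_def unitv_def)

lemma fsup_Suc: "(fsup (Suc n) :: (nat \<Rightarrow> 'a::field) set) = fn.span (insert (unitv n) (fsup n))"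
proof (intro equalityI subsetI)
  fix f :: "nat \<Rightarrow> 'a" assume "f \<in> fsup (Suc n)"
  then have "f - sc (f n) (unitv n) \<in> fsup n"
    by (auto simp: fsup_def unitv_def sc_apply Suc_le_eq dest: le_neq_implies_less)
  then show "f \<in> fn.span (insert (unitv n) (fsup n))"
    by (auto simp: mem_span_insert[OF subspace_fsup])
next
  fix f :: "nat \<Rightarrow> 'a" assume "f \<in> fn.span (insert (unitv n) (fsup n))"
  moreover have "fn.span (insert (unitv n) (fsup n)) \<subseteq> (fsup (Suc n) :: (nat \<Rightarrow> 'a) set)"
    by (rule fn.span_minimal[OF _ subspace_fsup]) (auto simp: fsup_def unitv_def)
  ultimately show "f \<in> fsup (Suc n)" by blast
qed

lemma unitv_notin_fsup: "(unitv n :: nat \<Rightarrow> 'a::field) \<notin> fsup n"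
  by (auto simp: fsup_def unitv_def)

lemma fsup_0: "fsup 0 = {0}"
  by (auto simp: fsup_def)

lemma fin_gen_fsup: "fn.fin_gen (fsup n)"
proof (induction n)
  case 0
  show ?case by (simp add: fsup_0 fn.fin_gen_finite)
next
  case (Suc n)
  then show ?case unfolding fsup_Suc by (rule fin_gen_span_insert)
qed

lemma dim_fsup: "fn.dim (fsup n :: (nat \<Rightarrow> 'a::field) set) = n"
proof (induction n)
  case 0
  show ?case by (simp add: fsup_0 fn.dim_zero_space)
next
  case (Suc n)
  show ?case unfolding fsup_Suc
    by (subst fn.dim_insert_notin[OF subspace_fsup fin_gen_fsup unitv_notin_fsup]) (simp add: Suc.IH)
qed

lemma dim_TP_fsup: "fn.dim (TP (fsup n) (fsup p) :: (nat \<times> nat \<Rightarrow> 'a::field) set) = n * p"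
proof (induction p)
  case 0
  have "TP (fsup n) (fsup 0) \<subseteq> ({0} :: (nat \<times> nat \<Rightarrow> 'a) set)"
    by (rule TP_minimal) (simp_all add: fsup_0 tens_simps)
  then have "TP (fsup n) (fsup 0) = ({0} :: (nat \<times> nat \<Rightarrow> 'a) set)"
    using fn.subspace_0[OF subspace_TP, of "fsup n" "fsup 0"] by blast
  then show ?case by (simp add: fn.dim_zero_space)
next
  case (Suc p)
  show ?case unfolding fsup_Suc
    by (subst dim_TP_insert[OF subspace_fsup fin_gen_fsup subspace_fsup fin_gen_fsup unitv_notin_fsup])
      (simp add: Suc.IH dim_fsup)
qed

lemma functional_sum: "functional s \<Longrightarrow> s (\<Sum>i\<in>A. g i) = (\<Sum>i\<in>A. s (g i))"
  by (induction A rule: infinite_finite_induct) (simp_all add: functional_0 functional_add)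

lemma sum_fun_apply: "(\<Sum>i\<in>A. g i) x = (\<Sum>i\<in>A. g i x)" for g :: "'c \<Rightarrow> 'd \<Rightarrow> 'a::field"
  by (induction A rule: infinite_finite_induct) simp_all

lemma sum_unitv_left: "(\<Sum>k<n. g k * unitv k i) = (if i < n then g i else 0)"
proof -
  have "(\<Sum>k<n. g k * unitv k i) = (\<Sum>k<n. if k = i then g k else 0)"
    by (rule sum.cong) (auto simp: unitv_def)
  then show ?thesis by (simp add: sum.delta)
qed

lemma sum_unitv_right: "i < n \<Longrightarrow> (\<Sum>k<n. g k * unitv i k) = g i"
proof -
  assume "i < n"
  moreover have "(\<Sum>k<n. g k * unitv i k) = (\<Sum>k<n. if k = i then g k else 0)"
    by (rule sum.cong) (auto simp: unitv_def)
  ultimately show ?thesis by (simp add: sum.delta)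
qed

lemma mem_TP_fsup:
  "N \<in> TP (fsup n) (fsup p) \<longleftrightarrow> (\<forall>i j. n \<le> i \<or> p \<le> j \<longrightarrow> N (i, j) = 0)"
proof
  have "TP (fsup n) (fsup p) \<subseteq> {N. \<forall>i j. n \<le> i \<or> p \<le> j \<longrightarrow> N (i, j) = 0}"
    by (rule TP_minimal) (auto simp: tens_def fsup_def fn.subspace_def sc_apply)
  then show "N \<in> TP (fsup n) (fsup p) \<Longrightarrow> \<forall>i j. n \<le> i \<or> p \<le> j \<longrightarrow> N (i, j) = 0" by blast
  assume N: "\<forall>i j. n \<le> i \<or> p \<le> j \<longrightarrow> N (i, j) = 0"
  have "N = (\<Sum>i<n. tens (unitv i) (\<lambda>j. N (i, j)))"
  proof
    fix x :: "nat \<times> nat"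
    obtain i j where x: "x = (i, j)" by (cases x)
    have "(\<Sum>k<n. tens (unitv k) (\<lambda>j. N (k, j))) x = (\<Sum>k<n. N (k, j) * unitv k i)"
      by (simp add: sum_fun_apply x tens_def mult.commute)
    then show "N x = (\<Sum>i<n. tens (unitv i) (\<lambda>j. N (i, j))) x" using N by (simp add: x sum_unitv_left)
  qed
  moreover have "(\<Sum>i<n. tens (unitv i) (\<lambda>j. N (i, j))) \<in> TP (fsup n) (fsup p)"
    by (intro fn.subspace_sum subspace_TP tens_in_TP unitv_in_fsup) (use N in \<open>auto simp: fsup_def\<close>)
  ultimately show "N \<in> TP (fsup n) (fsup p)" by simp
qed

definition mat_of :: "nat \<Rightarrow> nat \<Rightarrow> ((nat \<times> nat \<Rightarrow> 'a::field) \<Rightarrow> 'a) \<Rightarrow> 'a mat" where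
  "mat_of n p s = mat n p (\<lambda>(i, j). s (tens (unitv i) (unitv j)))"

definition fun_of :: "nat \<Rightarrow> nat \<Rightarrow> 'a::field mat \<Rightarrow> (nat \<times> nat \<Rightarrow> 'a)" where
  "fun_of n p M = (\<lambda>(i, j). if i < n \<and> j < p then M $$ (i, j) else 0)"

text \<open>The trace form of \<open>n\<close> x \<open>p\<close> matrices. It identifies matrices
  with functionals on \<open>TP (fsup n) (fsup p)\<close>, see
  \<open>functional_eq_pair\<close>.\<close>

definition pair :: "nat \<Rightarrow> nat \<Rightarrow> (nat \<times> nat \<Rightarrow> 'a::field) \<Rightarrow> (nat \<times> nat \<Rightarrow> 'a) \<Rightarrow> 'a" where
  "pair n p M N = (\<Sum>i<n. \<Sum>j<p. M (i, j) * N (i, j))"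

lemma pair_commute: "pair n p M N = pair n p N M"
  by (simp add: pair_def mult.commute)

lemma functional_pair: "functional (pair n p M)"
  by (rule functionalI) (simp_all add: pair_def sc_apply distrib_left sum.distrib sum_distrib_left mult.left_commute)

lemma mat_of_carrier: "mat_of n p s \<in> carrier_mat n p"
  by (simp add: mat_of_def)

lemma mat_of_add: "mat_of n p (s + t) = mat_of n p s + mat_of n p t"
  by (rule eq_matI) (simp_all add: mat_of_def)

lemma mat_of_sc: "mat_of n p (sc c s) = c \<cdot>\<^sub>m mat_of n p s"
  by (rule eq_matI) (simp_all add: mat_of_def sc_apply)

lemma TP_fsup_decomp:
  assumes "N \<in> TP (fsup n) (fsup p)"
  shows "N = (\<Sum>i<n. \<Sum>j<p. sc (N (i, j)) (tens (unitv i) (unitv j)))"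
proof
  fix x :: "nat \<times> nat"
  obtain i j where x: "x = (i, j)" by (cases x)
  have "(\<Sum>k<n. \<Sum>l<p. sc (N (k, l)) (tens (unitv k) (unitv l))) x = (\<Sum>k<n. (\<Sum>l<p. N (k, l) * unitv l j) * unitv k i)"
    by (simp add: sum_fun_apply x tens_def sc_apply sum_distrib_left sum_distrib_right ac_simps)
  then show "N x = (\<Sum>k<n. \<Sum>l<p. sc (N (k, l)) (tens (unitv k) (unitv l))) x"
    using assms by (auto simp: x sum_unitv_left mem_TP_fsup)
qed

lemma pair_unitv: "i < n \<Longrightarrow> j < p \<Longrightarrow> pair n p M (tens (unitv i) (unitv j)) = M (i, j)"
proof -
  assume ij: "i < n" "j < p"
  have "pair n p M (tens (unitv i) (unitv j)) = (\<Sum>k<n. (\<Sum>l<p. M (k, l) * unitv j l) * unitv i k)"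
    by (simp add: pair_def tens_def sum_distrib_left sum_distrib_right ac_simps)
  then show ?thesis using ij by (simp add: sum_unitv_right)
qed

lemma functional_eq_pair:
  assumes "functional s" "N \<in> TP (fsup n) (fsup p)"
  shows "s N = pair n p (fun_of n p (mat_of n p s)) N"
proof -
  have "s N = s (\<Sum>i<n. \<Sum>j<p. sc (N (i, j)) (tens (unitv i) (unitv j)))" using TP_fsup_decomp[OF assms(2)] by simp
  also have "\<dots> = pair n p (fun_of n p (mat_of n p s)) N"
    unfolding pair_def functional_sum[OF assms(1)]
    by (intro sum.cong) (simp_all add: functional_sc[OF assms(1)] fun_of_def mat_of_def mult.commute)
  finally show ?thesis .
qed

lemma mat_of_pair: "M \<in> carrier_mat n p \<Longrightarrow> mat_of n p (pair n p (fun_of n p M)) = M"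
proof (rule eq_matI)
  fix i j assume M: "M \<in> carrier_mat n p" and ij: "i < dim_row M" "j < dim_col M"
  then show "mat_of n p (pair n p (fun_of n p M)) $$ (i, j) = M $$ (i, j)"
    by (simp add: mat_of_def pair_unitv fun_of_def)
qed (simp_all add: mat_of_def)

lemma mat_of_fun_of: "M \<in> carrier_mat n p \<Longrightarrow> mat n p (fun_of n p M) = M"
  by (rule eq_matI) (auto simp: fun_of_def)

lemma fun_of_TP: "fun_of n p M \<in> TP (fsup n) (fsup p)"
  by (auto simp: mem_TP_fsup fun_of_def)

lemma fun_of_add: "A \<in> carrier_mat n p \<Longrightarrow> B \<in> carrier_mat n p \<Longrightarrow> fun_of n p (A + B) = fun_of n p A + fun_of n p B"
  by (rule ext) (auto simp: fun_of_def)

lemma fun_of_smult: "A \<in> carrier_mat n p \<Longrightarrow> fun_of n p (c \<cdot>\<^sub>m A) = sc c (fun_of n p A)"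
  by (rule ext) (auto simp: fun_of_def sc_apply)

lemma pair_nondegenerate:
  assumes "M \<in> TP (fsup n) (fsup p)" "\<And>N. N \<in> TP (fsup n) (fsup p) \<Longrightarrow> pair n p M N = 0"
  shows "M = 0"
proof
  fix x :: "nat \<times> nat"
  obtain i j where x: "x = (i, j)" by (cases x)
  show "M x = 0 x"
  proof (cases "i < n \<and> j < p")
    case True
    have "pair n p M (tens (unitv i) (unitv j)) = 0" using True by (intro assms(2) tens_in_TP unitv_in_fsup) simp_all
    then show ?thesis using True by (simp add: x pair_unitv)
  next
    case False
    then have "n \<le> i \<or> p \<le> j" by auto
    then show ?thesis using assms(1) unfolding mem_TP_fsup x by auto
  qed
qed

section \<open>A matrix space as the annihilator of its orthogonal space\<close>

locale mat_space =
  fixes S :: "'a::field mat set" and n p :: nat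
  assumes subsp: "subspace (class_ring :: 'a ring) S (module_mat TYPE('a) n p)"
begin

lemma carrier: "M \<in> S \<Longrightarrow> M \<in> carrier_mat n p"
  and zero_mem: "0\<^sub>m n p \<in> S"
  and add_mem: "A \<in> S \<Longrightarrow> B \<in> S \<Longrightarrow> A + B \<in> S"
  and smult_mem: "A \<in> S \<Longrightarrow> c \<cdot>\<^sub>m A \<in> S"
proof -
  have "submodule class_ring S (module_mat TYPE('a) n p)" using subsp by (simp add: subspace_def)
  from submodule.subset[OF this] submodule.zero_closed[OF this] submodule.m_closed[OF this] submodule.smult_closed[OF this]
  show "M \<in> S \<Longrightarrow> M \<in> carrier_mat n p" "0\<^sub>m n p \<in> S"
    "A \<in> S \<Longrightarrow> B \<in> S \<Longrightarrow> A + B \<in> S" "A \<in> S \<Longrightarrow> c \<cdot>\<^sub>m A \<in> S"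
    by (auto simp: module_mat_simps class_ring_simps)
qed

definition W :: "(nat \<times> nat \<Rightarrow> 'a) set" where
  "W = {N \<in> TP (fsup n) (fsup p). \<forall>M\<in>S. pair n p (fun_of n p M) N = 0}"

lemma subspace_W: "fn.subspace W" and W_TP: "W \<subseteq> TP (fsup n) (fsup p)"
proof -
  show "fn.subspace W" unfolding W_def
    by (rule fn.subspaceI) (auto simp: functional_0[OF functional_pair] functional_add[OF functional_pair]
        functional_sc[OF functional_pair] fn.subspace_0 fn.subspace_add fn.subspace_scale)
  show "W \<subseteq> TP (fsup n) (fsup p)" by (auto simp: W_def)
qed

lemma subspace_fun_of_S: "fn.subspace (fun_of n p ` S)"
proof (rule fn.subspaceI)
  have "fun_of n p (0\<^sub>m n p) = 0" by (rule ext) (auto simp: fun_of_def)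
  then show "0 \<in> fun_of n p ` S" using zero_mem by (metis image_eqI)
  show "x + y \<in> fun_of n p ` S" if xy: "x \<in> fun_of n p ` S" "y \<in> fun_of n p ` S" for x y
  proof -
    obtain A B where "A \<in> S" "x = fun_of n p A" "B \<in> S" "y = fun_of n p B" using xy by blast
    then show ?thesis using fun_of_add[of A n p B] carrier add_mem by (intro image_eqI[of _ _ "A + B"]) simp_all
  qed
  show "sc c x \<in> fun_of n p ` S" if x: "x \<in> fun_of n p ` S" for c x
  proof -
    obtain A where "A \<in> S" "x = fun_of n p A" using x by blast
    then show ?thesis using fun_of_smult[of A n p c] carrier smult_mem by (intro image_eqI[of _ _ "c \<cdot>\<^sub>m A"]) simp_all
  qed
qed

lemma pair_ann: "M \<in> S \<Longrightarrow> pair n p (fun_of n p M) \<in> ann W"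
  by (simp add: ann_def functional_pair W_def)

text \<open>Double annihilator: a matrix outside \<open>S\<close> is separated from \<open>S\<close>
  by a functional whose own matrix \<open>?N\<close> then lies in \<open>W\<close>, but
  \<open>s\<close> vanishes on \<open>W\<close>.\<close>

lemma mat_of_mem:
  assumes s: "s \<in> ann W" shows "mat_of n p s \<in> S"
proof (rule ccontr)
  assume n: "mat_of n p s \<notin> S"
  let ?M = "mat_of n p s"
  have "fun_of n p ?M \<notin> fun_of n p ` S"
  proof
    assume "fun_of n p ?M \<in> fun_of n p ` S"
    then obtain M where M: "M \<in> S" "fun_of n p ?M = fun_of n p M" by blast
    then have "?M = M" using mat_of_fun_of[OF carrier[OF M(1)]] mat_of_fun_of[OF mat_of_carrier, of n p s] by simp
    then show False using n M(1) by simp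
  qed
  from functional_separate[OF subspace_fun_of_S this] obtain t where
    t: "functional t" "\<forall>x\<in>fun_of n p ` S. t x = 0" "t (fun_of n p ?M) = 1" by blast
  let ?N = "fun_of n p (mat_of n p t)"
  have "pair n p (fun_of n p M) ?N = 0" if "M \<in> S" for M
    using functional_eq_pair[OF t(1) fun_of_TP, of n p M] t(2) that by (simp add: pair_commute)
  then have "?N \<in> W" by (simp add: W_def fun_of_TP)
  then have "s ?N = 0" by (rule annD(2)[OF s])
  then have "pair n p (fun_of n p ?M) ?N = 0" using functional_eq_pair[OF annD(1)[OF s] fun_of_TP] by simp
  then show False using functional_eq_pair[OF t(1) fun_of_TP, of n p ?M] t(3) by (simp add: pair_commute)
qed

text \<open>Bridge between two notions of dimension. The module library takes the least size of a
  generating set, and a basis of the encoded space provides one; with \<open>dim_W_le\<close> the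
  codimension hypothesis becomes a bound on \<open>dim W\<close>.\<close>

lemma mat_subspace_dim_le: "mat_subspace_dim n p S \<le> fn.dim (fun_of n p ` S)"
proof -
  let ?I = "fun_of n p ` S"
  let ?V = "(module_mat TYPE('a) n p)\<lparr>carrier := S\<rparr>"
  interpret V: vectorspace "class_ring :: 'a ring" ?V
    using vectorspace.subspace_is_vs[OF _ subsp] subsp by (simp add: subspace_def)
  have fI: "fn.fin_gen ?I"
    by (rule fn.fin_gen_subset[OF _ fin_gen_TP[OF fin_gen_fsup fin_gen_fsup, of n p]]) (use fun_of_TP in blast)
  obtain B where B: "finite B" "fn.independent B" "fn.span B = ?I" "card B = fn.dim ?I" "B \<subseteq> ?I"
    by (rule fn.fin_gen_basis[OF subspace_fun_of_S fI])
  let ?A = "mat n p ` B"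
  have AS: "?A \<subseteq> S"
  proof
    fix M assume "M \<in> ?A"
    then obtain M' where "M' \<in> S" "M = mat n p (fun_of n p M')" using B(5) by blast
    then show "M \<in> S" using mat_of_fun_of[OF carrier] by simp
  qed
  have sub: "submodule class_ring (V.span ?A) ?V" by (rule V.span_is_submodule) (use AS in simp)
  note cl = submodule.zero_closed[OF sub] submodule.m_closed[OF sub] submodule.smult_closed[OF sub]
  have "fn.subspace {N. mat n p N \<in> V.span ?A}"
  proof (rule fn.subspaceI; clarify)
    have "mat n p (0 :: nat \<times> nat \<Rightarrow> 'a) = 0\<^sub>m n p" by (rule eq_matI) simp_all
    then show "mat n p 0 \<in> V.span ?A" using cl(1) by (simp add: module_mat_simps)
    fix x y :: "nat \<times> nat \<Rightarrow> 'a" and c :: 'a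
    assume x: "mat n p x \<in> V.span ?A"
    have "mat n p (sc c x) = c \<cdot>\<^sub>m mat n p x" by (rule eq_matI) (simp_all add: sc_apply)
    then show "mat n p (sc c x) \<in> V.span ?A" using cl(3)[OF _ x, of c] by (simp add: module_mat_simps class_ring_simps)
    assume y: "mat n p y \<in> V.span ?A"
    have "mat n p (x + y) = mat n p x + mat n p y" by (rule eq_matI) simp_all
    then show "mat n p (x + y) \<in> V.span ?A" using cl(2)[OF x y] by (simp add: module_mat_simps)
  qed
  moreover have "?A \<subseteq> V.span ?A" by (rule V.in_own_span) (use AS in simp)
  then have "B \<subseteq> {N. mat n p N \<in> V.span ?A}" by blast
  ultimately have "?I \<subseteq> {N. mat n p N \<in> V.span ?A}" using fn.span_minimal[of B] B(3) by blast
  then have "S \<subseteq> V.span ?A" using mat_of_fun_of[OF carrier] by fastforce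
  moreover have "V.span ?A \<subseteq> carrier ?V" by (rule V.span_is_subset2) (use AS in simp)
  ultimately have "V.gen_set ?A" by auto
  then have "V.dim \<le> card ?A" unfolding V.dim_def using AS B(1) by (intro Least_le exI[of _ ?A]) simp
  also have "\<dots> \<le> fn.dim ?I" using card_image_le[OF B(1), of "mat n p"] B(4) by simp
  finally show ?thesis by (simp add: mat_subspace_dim_def)
qed

text \<open>A basis of \<open>W\<close> is completed to one of all tensors by vectors
  \<open>cs\<close>. An element of the encoded \<open>S\<close> pairs to zero with \<open>W\<close>,
  so its pairings with \<open>cs\<close> determine it.\<close>

lemma dim_W_le: "fn.dim W + fn.dim (fun_of n p ` S) \<le> n * p"
proof -
  let ?E = "TP (fsup n) (fsup p) :: (nat \<times> nat \<Rightarrow> 'a) set" and ?I = "fun_of n p ` S"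
  have fE: "fn.fin_gen ?E" by (rule fin_gen_TP[OF fin_gen_fsup fin_gen_fsup])
  obtain B where B: "finite B" "fn.independent B" "fn.span B = W" "card B = fn.dim W"
    by (rule fn.fin_gen_basis[OF subspace_W fn.fin_gen_subset[OF W_TP fE]])
  obtain bs where bs: "set bs = B" "distinct bs" using finite_distinct_list[OF B(1)] by blast
  have "set bs \<subseteq> ?E" using bs(1) B(3) fn.span_superset[of B] W_TP by blast
  then obtain cs where cs: "basis_list ?E (bs @ cs)"
    using basis_list_extend[OF subspace_TP fE bs(2)] bs(1) B(2) by blast
  have len: "length bs + length cs = n * p" using basis_list_length[OF cs] by (simp add: dim_TP_fsup)
  have lb: "length bs = fn.dim W" using bs B(4) distinct_card by metis
  define L where "L M = (\<lambda>k. if k < length cs then pair n p M (cs ! k) else 0)" for M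
  have fp: "functional (\<lambda>M. pair n p M N)" for N 
  proof -
    have "(\<lambda>M. pair n p M N) = pair n p N" by (rule ext) (rule pair_commute)
    then show ?thesis by (simp add: functional_pair)
  qed
  have linL: "Vector_Spaces.linear sc sc L"
    unfolding linear_sc_iff L_def
    by (auto simp: fun_eq_iff sc_apply functional_add[OF fp] functional_sc[OF fp])
  have IE: "?I \<subseteq> ?E" using fun_of_TP by blast
  have inj: "M = 0" if M: "M \<in> ?I" "L M = 0" for M
  proof (rule pair_nondegenerate)
    show "M \<in> ?E" using M(1) IE by blast
    have "bs \<noteq> bs \<or> pair n p M N = 0" if N: "N \<in> set (bs @ cs)" for N
    proof (cases "N \<in> set bs")
      case True
      then have "N \<in> W" using bs(1) B(3) fn.span_base by blast
      then show ?thesis using M(1) by (auto simp: W_def)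
    next
      case False
      then obtain k where k: "k < length cs" "cs ! k = N" using N by (auto simp: in_set_conv_nth)
      then have "pair n p M N = L M k" by (simp add: L_def)
      then show ?thesis using M(2) by simp
    qed
    then have "pair n p M N = 0" if "N \<in> fn.span (set (bs @ cs))" for N
      using functional_span_zero[OF functional_pair _ that] by blast
    then show "pair n p M N = 0" if "N \<in> ?E" for N using that cs unfolding basis_list_def by blast
  qed
  have "fn.dim ?I = fn.dim (L ` ?I)"
    by (rule ff.dim_inj_image[OF linL subspace_fun_of_S fn.fin_gen_subset[OF IE fE] inj, symmetric])
  also have "\<dots> \<le> fn.dim (fsup (length cs) :: (nat \<Rightarrow> 'a) set)"
    by (rule fn.dim_mono_fin_gen[OF _ fin_gen_fsup]) (auto simp: L_def fsup_def)
  also have "\<dots> = length cs" by (rule dim_fsup)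
  finally show ?thesis using len lb by simp
qed

end

section \<open>Invertibility and ranges of concrete matrices\<close>

lemma span_image_sum:
  fixes u :: "nat \<Rightarrow> ('i \<Rightarrow> 'a::field)"
  assumes "v \<in> fn.span (u ` {..<q})"
  shows "\<exists>c. v = (\<Sum>j<q. sc (c j) (u j))"
proof -
  define g where "g c = (\<Sum>j<q. sc (c j) (u j))" for c
  have "fn.subspace (range g)"
  proof (rule fn.subspaceI)
    have "g (\<lambda>_. 0) = 0" by (simp add: g_def)
    then show "0 \<in> range g" by (metis rangeI)
    show "x + y \<in> range g" if xy: "x \<in> range g" "y \<in> range g" for x y
    proof -
      obtain c d where "x = g c" "y = g d" using xy by blast
      then have "x + y = g (\<lambda>j. c j + d j)" by (simp add: g_def fn.scale_left_distrib sum.distrib)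
      then show ?thesis by simp
    qed
    show "sc k x \<in> range g" if x: "x \<in> range g" for k x
    proof -
      obtain c where "x = g c" using x by blast
      then have "sc k x = g (\<lambda>j. k * c j)" by (simp add: g_def fn.scale_sum_right)
      then show ?thesis by simp
    qed
  qed
  moreover have "u ` {..<q} \<subseteq> range g"
  proof
    fix x assume "x \<in> u ` {..<q}"
    then obtain i where i: "i < q" "x = u i" by blast
    have "g (\<lambda>j. if j = i then 1 else 0) = (\<Sum>j<q. if j = i then u j else 0)"
      unfolding g_def by (rule sum.cong) auto
    also have "\<dots> = x" using i by (simp add: sum.delta)
    finally show "x \<in> range g" by (metis rangeI)
  qed
  ultimately have "v \<in> range g" using fn.span_minimal[of "u ` {..<q}" "range g"] assms by blast
  then show ?thesis unfolding g_def by blast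
qed

lemma right_inverse_if_span:
  assumes u: "fsup p \<subseteq> fn.span (u ` {..<q})"
  shows "\<exists>Z\<in>carrier_mat q p. mat p q (\<lambda>(k, j). u j k) * Z = (1\<^sub>m p :: 'a::field mat)"
proof -
  have "\<forall>k. \<exists>c. k < p \<longrightarrow> unitv k = (\<Sum>j<q. sc (c j) (u j))"
    using span_image_sum u unitv_in_fsup by blast
  then obtain c where c: "\<And>k. k < p \<Longrightarrow> unitv k = (\<Sum>j<q. sc (c k j) (u j))" by metis
  let ?Z = "mat q p (\<lambda>(j, k). c k j)"
  have "mat p q (\<lambda>(k, j). u j k) * ?Z = 1\<^sub>m p"
  proof (rule eq_matI)
    fix i k assume ik: "i < dim_row (1\<^sub>m p :: 'a mat)" "k < dim_col (1\<^sub>m p :: 'a mat)"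
    then have "(mat p q (\<lambda>(k, j). u j k) * ?Z) $$ (i, k) = (\<Sum>j<q. sc (c k j) (u j)) i"
      by (simp add: scalar_prod_def sum_fun_apply sc_apply lessThan_atLeast0 mult.commute)
    also have "\<dots> = unitv k i" using c[of k] ik by simp
    finally show "(mat p q (\<lambda>(k, j). u j k) * ?Z) $$ (i, k) = 1\<^sub>m p $$ (i, k)" using ik by (simp add: unitv_def)
  qed simp_all
  then show ?thesis by (intro bexI[of _ ?Z]) simp_all
qed

lemma invertible_matI:
  assumes "A \<in> carrier_mat n n" "B \<in> carrier_mat n n" "A * B = (1\<^sub>m n :: 'a::field mat)"
  shows "invertible_mat A"
  unfolding invertible_mat_def inverts_mat_def
  using assms mat_mult_left_right_inverse[OF assms] by (intro conjI exI[of _ B]) auto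

lemma invertible_matE:
  assumes "invertible_mat A" "A \<in> carrier_mat n n"
  obtains B where "B \<in> carrier_mat n n" "A * B = 1\<^sub>m n" "B * A = 1\<^sub>m n"
proof -
  obtain B where B: "A * B = 1\<^sub>m (dim_row A)" "B * A = 1\<^sub>m (dim_row B)"
    using assms(1) unfolding invertible_mat_def inverts_mat_def by blast
  have "dim_col B = n" using arg_cong[OF B(1), of dim_col] assms(2) by simp
  moreover have "dim_row B = n" using arg_cong[OF B(2), of dim_col] assms(2) by simp
  ultimately show ?thesis using that[of B] B assms(2) by auto
qed

lemma basis_list_invertible:
  assumes bs: "basis_list (fsup n) bs"
  shows "invertible_mat (mat n n (\<lambda>(i, j). (bs ! j) i))" "invertible_mat (mat n n (\<lambda>(i, j). (bs ! i) j))"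
proof -
  let ?A = "mat n n (\<lambda>(i, j). (bs ! j) i)" and ?B = "mat n n (\<lambda>(i, j). (bs ! i) j)"
  have len: "length bs = n" using basis_list_length[OF bs] by (simp add: dim_fsup)
  have "set bs = (!) bs ` {..<n}" using len by (auto simp: set_conv_nth)
  then have "fsup n \<subseteq> fn.span ((!) bs ` {..<n})" using bs by (simp add: basis_list_def)
  then obtain Z where Z: "Z \<in> carrier_mat n n" "?A * Z = 1\<^sub>m n" using right_inverse_if_span by blast
  then show "invertible_mat ?A" by (intro invertible_matI[of _ n Z]) simp_all
  have AB: "?B = transpose_mat ?A" by (rule eq_matI) simp_all
  have "Z * ?A = 1\<^sub>m n" by (rule mat_mult_left_right_inverse[OF _ Z]) simp
  then have "transpose_mat (Z * ?A) = 1\<^sub>m n" by simp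
  then have "?B * transpose_mat Z = 1\<^sub>m n" using transpose_mult[OF Z(1), of ?A n] AB by simp
  then show "invertible_mat ?B" using Z(1) by (intro invertible_matI[of _ n "transpose_mat Z"]) simp_all
qed

lemma im_mat_eq:
  assumes "M \<in> carrier_mat n q" shows "im_mat M = (*\<^sub>v) M ` carrier_vec q"
proof -
  show ?thesis using vec_space.col_space_eq[OF assms] assms by (auto simp: im_mat_def)
qed

text \<open>Only the first \<open>p\<close> rows of \<open>Q\<close> act. A standard map is thus
  \<open>M \<mapsto> M * Y\<close> for a matrix \<open>Y\<close> that can be completed to an
  invertible one.\<close>

lemma pad_zero_cols_mult:
  assumes M: "M \<in> carrier_mat n p" and Q: "Q \<in> carrier_mat q q" and pq: "p \<le> q"
  shows "pad_zero_cols q M * Q = M * mat p q (\<lambda>(i, j). Q $$ (i, j))"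
proof (rule eq_matI)
  have pad: "pad_zero_cols q M = mat n q (\<lambda>(i, j). if j < p then M $$ (i, j) else 0)"
    unfolding pad_zero_cols_def using M pq by (intro eq_matI) auto
  show "dim_row (pad_zero_cols q M * Q) = dim_row (M * mat p q (\<lambda>(i, j). Q $$ (i, j)))"
    "dim_col (pad_zero_cols q M * Q) = dim_col (M * mat p q (\<lambda>(i, j). Q $$ (i, j)))"
    using M Q by (simp_all add: pad)
  fix i j assume ij: "i < dim_row (M * mat p q (\<lambda>(i, j). Q $$ (i, j)))" "j < dim_col (M * mat p q (\<lambda>(i, j). Q $$ (i, j)))"
  have "(pad_zero_cols q M * Q) $$ (i, j) = (\<Sum>k\<in>{0..<q}. (if k < p then M $$ (i, k) else 0) * Q $$ (k, j))"
    using ij M Q by (simp add: pad scalar_prod_def)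
  also have "\<dots> = (\<Sum>k\<in>{0..<p}. M $$ (i, k) * Q $$ (k, j))"
    using pq by (intro sum.mono_neutral_cong_right) auto
  finally show "(pad_zero_cols q M * Q) $$ (i, j) = (M * mat p q (\<lambda>(i, j). Q $$ (i, j))) $$ (i, j)"
    using ij M Q by (simp add: scalar_prod_def)
qed

text \<open>A linear form given by \<open>f\<close> that kills the range of \<open>M\<close> kills
  the smaller range of \<open>A\<close>.\<close>

lemma pairing_zero_im:
  fixes A M :: "'a::field mat"
  assumes A: "A \<in> carrier_mat n q" and M: "M \<in> carrier_mat n p" and im: "im_mat A \<subseteq> im_mat M"
    and z: "\<And>u. u \<in> fsup p \<Longrightarrow> (\<Sum>i<n. f i * (M *\<^sub>v vec p u) $ i) = 0"
  shows "(\<Sum>i<n. f i * (A *\<^sub>v vec q v) $ i) = 0"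
proof -
  have "A *\<^sub>v vec q v \<in> im_mat M" using im im_mat_eq[OF A] by auto
  then obtain x where x: "x \<in> carrier_vec p" "A *\<^sub>v vec q v = M *\<^sub>v x" using im_mat_eq[OF M] by auto
  define u where "u j = (if j < p then x $ j else 0)" for j
  have "vec p u = x" using x(1) by (intro eq_vecI) (auto simp: u_def)
  then show ?thesis using z[of u] x(2) by (auto simp: fsup_def u_def)
qed

lemma functional_tens_mat:
  assumes s: "functional s" and f: "f \<in> fsup n" and u: "u \<in> fsup p"
  shows "s (tens f u) = (\<Sum>i<n. f i * (mat_of n p s *\<^sub>v vec p u) $ i)"
proof -
  have "s (tens f u) = pair n p (fun_of n p (mat_of n p s)) (tens f u)"
    by (rule functional_eq_pair[OF s tens_in_TP[OF f u]])
  also have "\<dots> = (\<Sum>i<n. f i * (mat_of n p s *\<^sub>v vec p u) $ i)"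
    unfolding pair_def
  proof (rule sum.cong[OF refl])
    fix i assume "i \<in> {..<n}"
    then show "(\<Sum>j<p. fun_of n p (mat_of n p s) (i, j) * tens f u (i, j)) = f i * (mat_of n p s *\<^sub>v vec p u) $ i"
      by (simp add: fun_of_def mat_of_def tens_def scalar_prod_def lessThan_atLeast0 sum_distrib_left ac_simps)
  qed
  finally show ?thesis .
qed

lemma functional_unitv_mat:
  assumes s: "functional s" and u: "u \<in> fsup p" and i: "i < n"
  shows "s (tens (unitv i) u) = (mat_of n p s *\<^sub>v vec p u) $ i"
proof -
  have "s (tens (unitv i) u) = (\<Sum>k<n. (mat_of n p s *\<^sub>v vec p u) $ k * unitv i k)"
    using functional_tens_mat[OF s unitv_in_fsup[OF i] u] by (simp add: mult.commute)
  also have "\<dots> = (mat_of n p s *\<^sub>v vec p u) $ i" by (rule sum_unitv_right[OF i])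
  finally show ?thesis .
qed

text \<open>Dimension is a least cardinality of generating sets: \<open>{v}\<close> is one of size
  1, and size 0 would leave only the zero vector.\<close>

lemma (in vectorspace) dim_eq_1I:
  assumes v: "v \<in> carrier V" "v \<noteq> \<zero>\<^bsub>V\<^esub>" and g: "\<And>w. w \<in> carrier V \<Longrightarrow> \<exists>c\<in>carrier K. w = c \<odot>\<^bsub>V\<^esub> v"
  shows "dim = 1"
proof -
  have vc: "{v} \<subseteq> carrier V" using v(1) by simp
  have sub: "submodule K (span {v}) V" by (rule span_is_submodule[OF vc])
  have "v \<in> span {v}" using in_own_span[OF vc] by simp
  then have "carrier V \<subseteq> span {v}" using g submodule.smult_closed[OF sub] by blast
  then have g1: "gen_set {v}" using span_is_subset2[OF vc] by blast
  let ?P = "\<lambda>k. \<exists>A. finite A \<and> card A = k \<and> A \<subseteq> carrier V \<and> gen_set A"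
  have P1: "?P 1" using g1 vc by (intro exI[of _ "{v}"]) simp
  have "1 \<le> k" if P: "?P k" for k
  proof (rule ccontr)
    assume "\<not> 1 \<le> k"
    then have "k = 0" by simp
    then obtain A where "finite A" "card A = 0" "gen_set A" using P by blast
    then have "gen_set {}" by simp
    moreover have "span {} \<subseteq> {\<zero>\<^bsub>V\<^esub>}" by (auto simp: span_def lincomb_def)
    ultimately show False using v by blast
  qed
  then show ?thesis unfolding dim_def by (intro Least_equality P1)
qed

lemma vec_subspace_dim_line:
  fixes v :: "'a::field vec"
  assumes v: "v \<in> carrier_vec n" "v \<noteq> 0\<^sub>v n"
  shows "vec_subspace_dim n {c \<cdot>\<^sub>v v |c. True} = 1"
proof -
  let ?M = "module_vec TYPE('a) n"
  define L where "L = {c \<cdot>\<^sub>v v |c. True}"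
  have vs: "vectorspace class_ring ?M" by (rule vec_vs)
  then have m: "Module.module class_ring ?M" by (simp add: vectorspace_def)
  have "submodule class_ring L ?M"
  proof (rule submodule.intro[OF m])
    show "L \<subseteq> carrier ?M" using v by (auto simp: L_def module_vec_simps)
    show "x \<oplus>\<^bsub>?M\<^esub> y \<in> L" if xy: "x \<in> L" "y \<in> L" for x y
    proof -
      obtain c d where "x = c \<cdot>\<^sub>v v" "y = d \<cdot>\<^sub>v v" using xy unfolding L_def by blast
      then have "x \<oplus>\<^bsub>?M\<^esub> y = (c + d) \<cdot>\<^sub>v v" using v by (simp add: add_smult_distrib_vec module_vec_simps)
      then show ?thesis unfolding L_def by blast
    qed
    have "\<zero>\<^bsub>?M\<^esub> = 0 \<cdot>\<^sub>v v" using v by (intro eq_vecI) (auto simp: module_vec_simps)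
    then show "\<zero>\<^bsub>?M\<^esub> \<in> L" unfolding L_def by blast
    show "c \<odot>\<^bsub>?M\<^esub> x \<in> L" if x: "x \<in> L" for c x
    proof -
      obtain d where "x = d \<cdot>\<^sub>v v" using x unfolding L_def by blast
      then have "c \<odot>\<^bsub>?M\<^esub> x = (c * d) \<cdot>\<^sub>v v" by (simp add: smult_smult_assoc module_vec_simps)
      then show ?thesis unfolding L_def by blast
    qed
  qed
  then have "subspace class_ring L ?M" using vs by (simp add: subspace_def)
  then have vsL: "vectorspace class_ring (?M\<lparr>carrier := L\<rparr>)" by (rule vectorspace.subspace_is_vs[OF vs])
  have "v = 1 \<cdot>\<^sub>v v" by simp
  then have vL: "v \<in> L" unfolding L_def by blast
  have "vectorspace.dim class_ring (?M\<lparr>carrier := L\<rparr>) = 1"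
  proof (rule vectorspace.dim_eq_1I[OF vsL, where v = v])
    show "v \<in> carrier (?M\<lparr>carrier := L\<rparr>)" using vL by simp
    show "v \<noteq> \<zero>\<^bsub>?M\<lparr>carrier := L\<rparr>\<^esub>" using v(2) by (simp add: module_vec_simps)
    show "\<exists>c\<in>carrier class_ring. w = c \<odot>\<^bsub>?M\<lparr>carrier := L\<rparr>\<^esub> v" if "w \<in> carrier (?M\<lparr>carrier := L\<rparr>)" for w
      using that by (auto simp: L_def module_vec_simps class_ring_simps)
  qed
  then show ?thesis by (simp add: vec_subspace_dim_def L_def)
qed

section \<open>Range-preserving maps column by column\<close>

context mat_space
begin

text \<open>The form \<open>f\<close> applied to column \<open>j\<close> of the image matrix.
  Treating columns separately reduces matrix-valued maps to the range-compatible maps above.\<close>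

definition column_map :: "('a mat \<Rightarrow> 'a mat) \<Rightarrow> nat \<Rightarrow> ((nat \<times> nat \<Rightarrow> 'a) \<Rightarrow> 'a) \<Rightarrow> (nat \<Rightarrow> 'a) \<Rightarrow> 'a" where
  "column_map F j s f = (\<Sum>i<n. f i * F (mat_of n p s) $$ (i, j))"

lemma column_map_unitv: "i < n \<Longrightarrow> column_map F j s (unitv i) = F (mat_of n p s) $$ (i, j)"
proof -
  assume i: "i < n"
  have "column_map F j s (unitv i) = (\<Sum>k<n. F (mat_of n p s) $$ (k, j) * unitv i k)"
    by (simp add: column_map_def mult.commute)
  then show ?thesis using sum_unitv_right[OF i] by simp
qed

lemma column_eq_mult: "A \<in> carrier_mat n q \<Longrightarrow> i < n \<Longrightarrow> j < q \<Longrightarrow> A $$ (i, j) = (A *\<^sub>v vec q (unitv j)) $ i"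
proof -
  assume A: "A \<in> carrier_mat n q" "i < n" "j < q"
  then have "(A *\<^sub>v vec q (unitv j)) $ i = (\<Sum>k<q. A $$ (i, k) * unitv j k)"
    by (simp add: scalar_prod_def lessThan_atLeast0)
  then show ?thesis using sum_unitv_right[OF A(3), of "\<lambda>k. A $$ (i, k)"] by simp
qed

text \<open>If \<open>f\<close> kills the range of \<open>M\<close>, it kills the range of
  \<open>F M\<close>, which contains column \<open>j\<close>; additivity is inherited
  entrywise.\<close>

lemma range_compatible_column:
  assumes F: "additive_on S F" "range_preserving n q S F" and j: "j < q"
  shows "range_compatible (fsup n) (fsup p) {0} W (column_map F j)"
proof
  show "fn.subspace (fsup n :: (nat \<Rightarrow> 'a) set)" "fn.fin_gen (fsup n :: (nat \<Rightarrow> 'a) set)"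
    "fn.subspace (fsup p :: (nat \<Rightarrow> 'a) set)" "fn.fin_gen (fsup p :: (nat \<Rightarrow> 'a) set)"
    by (simp_all add: subspace_fsup fin_gen_fsup)
  show "fn.subspace {0 :: nat \<Rightarrow> 'a}" "{0 :: nat \<Rightarrow> 'a} \<subseteq> fsup p" by (auto simp: fsup_def)
  show "fn.subspace W" "W \<subseteq> TP (fsup n) (fsup p)" by (rule subspace_W W_TP)+
  show "TP (fsup n) {0} \<subseteq> W"
    by (rule TP_minimal[OF _ subspace_W]) (simp add: tens_simps fn.subspace_0[OF subspace_W])
  have Fc: "F M \<in> carrier_mat n q" "im_mat (F M) = im_mat M" if "M \<in> S" for M
    using F(2) that by (simp_all add: range_preserving_def)
  show "functional (column_map F j s)" if "s \<in> ann W" for s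
    by (rule functionalI) (simp_all add: column_map_def sc_apply distrib_right sum.distrib sum_distrib_left mult.assoc)
  show "column_map F j (s + t) f = column_map F j s f + column_map F j t f" if st: "s \<in> ann W" "t \<in> ann W" for s t f
  proof -
    have "F (mat_of n p (s + t)) = F (mat_of n p s) + F (mat_of n p t)"
      using F(1) mat_of_mem[OF st(1)] mat_of_mem[OF st(2)] by (simp add: mat_of_add additive_on_def)
    then show ?thesis using Fc(1)[OF mat_of_mem[OF st(1)]] Fc(1)[OF mat_of_mem[OF st(2)]] j
      by (simp add: column_map_def distrib_left sum.distrib)
  qed
  show "column_map F j s f = 0" if s: "s \<in> ann W" and f: "f \<in> fsup n" and z: "\<And>u. u \<in> fsup p \<Longrightarrow> s (tens f u) = 0" for s f
  proof -
    let ?M = "mat_of n p s"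
    note M = mat_of_mem[OF s]
    have "(\<Sum>i<n. f i * (F ?M *\<^sub>v vec q (unitv j)) $ i) = 0"
      by (rule pairing_zero_im[OF Fc(1)[OF M] mat_of_carrier])
        (use Fc(2)[OF M] z functional_tens_mat[OF annD(1)[OF s] f] in auto)
    then show ?thesis unfolding column_map_def using column_eq_mult[OF Fc(1)[OF M] _ j] by simp
  qed
qed

lemma linear_family_column:
  assumes F: "linear_on S F" "range_preserving n q S F" and j: "j < q"
  shows "linear_family (fsup n) W (column_map F j)"
  unfolding linear_family_def
proof (intro ballI allI)
  fix s c f assume s: "s \<in> ann W"
  note M = mat_of_mem[OF s]
  have "F (mat_of n p s) \<in> carrier_mat n q" using F(2) M by (simp add: range_preserving_def)
  moreover have "F (mat_of n p (sc c s)) = c \<cdot>\<^sub>m F (mat_of n p s)" using F(1) M by (simp add: mat_of_sc linear_on_def)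
  ultimately show "column_map F j (sc c s) f = c * column_map F j s f"
    using j by (simp add: column_map_def sum_distrib_left mult.left_commute)
qed

text \<open>The upper \<open>p\<close> rows \<open>Y\<close> of \<open>Q\<close> and the left
  \<open>p\<close> columns \<open>Z\<close> of its inverse satisfy
  \<open>Y * Z = 1\<^sub>m p\<close>, so \<open>M * Y\<close> and \<open>M\<close> have the same
  range.\<close>

lemma standard_imp_linear_range_preserving:
  assumes "standard_map_on p q S F"
  shows "linear_on S F" "range_preserving n q S F"
proof -
  obtain Q where pq: "p \<le> q" and Q: "Q \<in> carrier_mat q q" "invertible_mat Q"
    and F: "\<And>M. M \<in> S \<Longrightarrow> F M = pad_zero_cols q M * Q" using assms by (auto simp: standard_map_on_def)
  define Y where "Y = mat p q (\<lambda>(i, j). Q $$ (i, j))"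
  have Y: "Y \<in> carrier_mat p q" by (simp add: Y_def)
  have FM: "F M = M * Y" if "M \<in> S" for M
    using F[OF that] pad_zero_cols_mult[OF carrier[OF that] Q(1) pq] by (simp add: Y_def)
  obtain Q' where Q': "Q' \<in> carrier_mat q q" "Q * Q' = 1\<^sub>m q" using invertible_matE[OF Q(2,1)] by blast
  define Z where "Z = mat q p (\<lambda>(i, j). Q' $$ (i, j))"
  have Z: "Z \<in> carrier_mat q p" by (simp add: Z_def)
  have YZ: "Y * Z = 1\<^sub>m p"
  proof (rule eq_matI)
    fix i j assume ij: "i < dim_row (1\<^sub>m p :: 'a mat)" "j < dim_col (1\<^sub>m p :: 'a mat)"
    have "(Y * Z) $$ (i, j) = (Q * Q') $$ (i, j)" using ij pq Q(1) Q'(1) by (simp add: Y_def Z_def scalar_prod_def)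
    then show "(Y * Z) $$ (i, j) = 1\<^sub>m p $$ (i, j)" using ij pq Q'(2) by simp
  qed (simp_all add: Y_def Z_def)
  show "linear_on S F" unfolding linear_on_def
  proof (intro conjI ballI allI)
    show "F (A + B) = F A + F B" if "A \<in> S" "B \<in> S" for A B
      using that FM add_mem add_mult_distrib_mat[OF carrier carrier Y] by simp
    show "F (c \<cdot>\<^sub>m A) = c \<cdot>\<^sub>m F A" if "A \<in> S" for c A
      using that FM smult_mem mult_smult_assoc_mat[OF carrier Y] by simp
  qed
  show "range_preserving n q S F" unfolding range_preserving_def
  proof (intro ballI conjI)
    fix M assume M: "M \<in> S"
    note Mc = carrier[OF M]
    show FMc: "F M \<in> carrier_mat n q" using FM[OF M] Mc Y by simp
    show "im_mat (F M) = im_mat M" unfolding im_mat_eq[OF FMc] im_mat_eq[OF Mc] unfolding FM[OF M]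
    proof (intro equalityI subsetI)
      fix y assume "y \<in> (*\<^sub>v) (M * Y) ` carrier_vec q"
      then obtain x where x: "x \<in> carrier_vec q" "y = M * Y *\<^sub>v x" by blast
      then have "y = M *\<^sub>v (Y *\<^sub>v x)" using Mc Y by simp
      then show "y \<in> (*\<^sub>v) M ` carrier_vec p" using x(1) Y by (intro image_eqI[of _ _ "Y *\<^sub>v x"]) simp_all
    next
      fix y assume "y \<in> (*\<^sub>v) M ` carrier_vec p"
      then obtain x where x: "x \<in> carrier_vec p" "y = M *\<^sub>v x" by blast
      have "M * Y *\<^sub>v (Z *\<^sub>v x) = M *\<^sub>v ((Y * Z) *\<^sub>v x)" using x(1) Mc Y Z by simp
      then show "y \<in> (*\<^sub>v) (M * Y) ` carrier_vec q" using x YZ Z by (intro image_eqI[of _ _ "Z *\<^sub>v x"]) simp_all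
    qed
  qed
qed

text \<open>Locality of every column gives \<open>F M = M * ?Y\<close>. If \<open>f\<close> kills
  all columns of \<open>F M\<close>, it kills the range of \<open>M\<close>: this is the hypothesis
  of \<open>columns_span\<close>. Hence \<open>?Y\<close> has a right inverse, its rows are
  independent, and they extend to a basis whose matrix is \<open>Q\<close>.\<close>

lemma linear_imp_standard:
  assumes F: "linear_on S F" "range_preserving n q S F"
    and bound: "fn.dim W + 4 \<le> 2 * n \<or> fn.dim W + 3 \<le> 2 * n \<and> (\<exists>a::'a. a \<noteq> 0 \<and> a \<noteq> 1)"
    and nondeg: "\<forall>x\<in>carrier_vec p. (\<forall>M\<in>S. M *\<^sub>v x = 0\<^sub>v n) \<longrightarrow> x = 0\<^sub>v p"
  shows "standard_map_on p q S F"
proof -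
  have add: "additive_on S F" using F(1) by (simp add: linear_on_def additive_on_def)
  have Fc: "F M \<in> carrier_mat n q" "im_mat (F M) = im_mat M" if "M \<in> S" for M
    using F(2) that by (simp_all add: range_preserving_def)
  have "\<exists>u\<in>fsup p. \<forall>s\<in>ann W. \<forall>f\<in>fsup n. column_map F j s f = s (tens f u)" if j: "j < q" for j
  proof -
    have "is_local (fsup n) (fsup p) W (column_map F j)"
      by (rule linear_local[OF range_compatible_column[OF add F(2) j] linear_family_column[OF F j]])
        (use bound in \<open>auto simp: dim_fsup\<close>)
    then show ?thesis by (simp add: is_local_def)
  qed
  then obtain u where u: "\<And>j. j < q \<Longrightarrow> u j \<in> fsup p"
    "\<And>j s f. j < q \<Longrightarrow> s \<in> ann W \<Longrightarrow> f \<in> fsup n \<Longrightarrow> column_map F j s f = s (tens f (u j))" by metis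
  let ?Y = "mat p q (\<lambda>(k, j). u j k)"
  have FM: "F M = M * ?Y" if M: "M \<in> S" for M
  proof (rule eq_matI)
    let ?s = "pair n p (fun_of n p M)"
    have Ms: "mat_of n p ?s = M" by (rule mat_of_pair[OF carrier[OF M]])
    fix i j assume "i < dim_row (M * ?Y)" "j < dim_col (M * ?Y)"
    then have ij: "i < n" "j < q" using carrier[OF M] by simp_all
    have "F M $$ (i, j) = ?s (tens (unitv i) (u j))"
      using u(2)[OF ij(2) pair_ann[OF M] unitv_in_fsup[OF ij(1)]] column_map_unitv[OF ij(1), of F j ?s] Ms by simp
    also have "\<dots> = (M *\<^sub>v vec p (u j)) $ i" using functional_unitv_mat[OF functional_pair u(1)[OF ij(2)] ij(1)] Ms by metis
    also have "\<dots> = (M * ?Y) $$ (i, j)" using ij carrier[OF M] by (simp add: scalar_prod_def)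
    finally show "F M $$ (i, j) = (M * ?Y) $$ (i, j)" .
  qed (use Fc(1)[OF M] carrier[OF M] in simp_all)
  have "fsup p \<subseteq> fn.span (u ` {..<q})"
  proof (rule columns_span[OF subspace_fsup fin_gen_fsup subspace_fsup fin_gen_fsup subspace_W W_TP])
    show "u ` {..<q} \<subseteq> fsup p" using u(1) by auto
    show "fn.dim W + 4 \<le> 2 * fn.dim (fsup n :: (nat \<Rightarrow> 'a) set) \<or>
      fn.dim W + 3 \<le> 2 * fn.dim (fsup n :: (nat \<Rightarrow> 'a) set) \<and> (\<exists>a::'a. a \<noteq> 0 \<and> a \<noteq> 1)"
      using bound by (simp add: dim_fsup)
    show "\<forall>v\<in>fsup p. s (tens f v) = 0" if s: "s \<in> ann W" and f: "f \<in> fsup n" and z: "\<forall>v\<in>u ` {..<q}. s (tens f v) = 0" for s f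
    proof
      fix v :: "nat \<Rightarrow> 'a" assume v: "v \<in> fsup p"
      let ?M = "mat_of n p s"
      note M = mat_of_mem[OF s]
      have "(\<Sum>i<n. f i * (F ?M *\<^sub>v vec q w) $ i) = 0" if "w \<in> fsup q" for w
      proof -
        have "(\<Sum>i<n. f i * (F ?M *\<^sub>v vec q w) $ i) = (\<Sum>i<n. \<Sum>j<q. f i * (F ?M $$ (i, j) * w j))"
          using Fc(1)[OF M] by (intro sum.cong) (simp_all add: scalar_prod_def lessThan_atLeast0 sum_distrib_left)
        also have "\<dots> = (\<Sum>j<q. w j * column_map F j s f)"
          by (subst sum.swap) (simp add: column_map_def sum_distrib_left ac_simps)
        also have "\<dots> = 0" using u(2)[OF _ s f] z by simp
        finally show ?thesis .
      qed
      then have "(\<Sum>i<n. f i * (?M *\<^sub>v vec p v) $ i) = 0"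
        by (intro pairing_zero_im[OF mat_of_carrier Fc(1)[OF M]]) (use Fc(2)[OF M] in simp_all)
      then show "s (tens f v) = 0" using functional_tens_mat[OF annD(1)[OF s] f v] by simp
    qed
    show "x = 0" if x: "x \<in> fsup p" and z: "\<And>f. f \<in> fsup n \<Longrightarrow> tens f x \<in> W" for x
    proof -
      have "M *\<^sub>v vec p x = 0\<^sub>v n" if M: "M \<in> S" for M
      proof (rule eq_vecI)
        fix i assume "i < dim_vec (0\<^sub>v n :: 'a vec)"
        then have i: "i < n" by simp
        have "pair n p (fun_of n p M) (tens (unitv i) x) = 0"
          by (rule annD(2)[OF pair_ann[OF M] z[OF unitv_in_fsup[OF i]]])
        moreover have "pair n p (fun_of n p M) (tens (unitv i) x) =
            (mat_of n p (pair n p (fun_of n p M)) *\<^sub>v vec p x) $ i"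
          by (rule functional_unitv_mat[OF functional_pair x i])
        ultimately show "(M *\<^sub>v vec p x) $ i = 0\<^sub>v n $ i"
          using mat_of_pair[OF carrier[OF M]] i by simp
      qed (use carrier[OF M] in simp)
      then have "vec p x = 0\<^sub>v p" using nondeg by simp
      then have "x i = 0" if "i < p" for i using that by (metis index_vec index_zero_vec(1))
      then show ?thesis using x by (auto simp: fsup_def fun_eq_iff not_less[symmetric])
    qed
  qed
  then obtain Z where Z: "Z \<in> carrier_mat q p" "?Y * Z = 1\<^sub>m p" using right_inverse_if_span by blast
  \<comment> \<open>The \<open>r i\<close> are the rows of \<open>?Y\<close>; the columns of
    \<open>Z\<close> give functionals \<open>z k\<close> dual to them, which proves
    independence.\<close>
  define r where "r i = (\<lambda>j. if j < q then u j i else 0)" for i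
  define z where "z k v = (\<Sum>j<q. v j * Z $$ (j, k))" for k and v :: "nat \<Rightarrow> 'a"
  have fz: "functional (z k)" for k
    by (rule functionalI) (simp_all add: z_def sc_apply distrib_right sum.distrib sum_distrib_left mult.assoc)
  have zr: "z k (r i) = (if i = k then 1 else 0)" if "i < p" "k < p" for i k
  proof -
    have "z k (r i) = (?Y * Z) $$ (i, k)" using that Z(1) by (simp add: z_def r_def scalar_prod_def lessThan_atLeast0)
    then show ?thesis using Z(2) that by simp
  qed
  let ?rs = "map r [0..<p]"
  have inj: "inj_on r {..<p}"
  proof (rule inj_onI)
    fix i k assume "i \<in> {..<p}" "k \<in> {..<p}" "r i = r k"
    then show "i = k" using zr[of i k] zr[of k k] by (auto split: if_splits)
  qed
  have rs: "distinct ?rs" "set ?rs = r ` {..<p}" using inj by (auto simp: distinct_map lessThan_atLeast0)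
  have "fn.independent (set ?rs)" unfolding rs(2) fn.dependent_def
  proof
    assume "\<exists>a\<in>r ` {..<p}. a \<in> fn.span (r ` {..<p} - {a})"
    then obtain i where i: "i < p" "r i \<in> fn.span (r ` {..<p} - {r i})" by blast
    have "z i (r i) = 0"
      by (rule functional_span_zero[OF fz _ i(2)]) (use zr i(1) in auto)
    then show False using zr[OF i(1) i(1)] by simp
  qed
  moreover have "set ?rs \<subseteq> fsup q" by (auto simp: r_def fsup_def)
  ultimately obtain ys where ys: "basis_list (fsup q) (?rs @ ys)"
    using basis_list_extend[OF subspace_fsup fin_gen_fsup rs(1)] by blast
  let ?Q = "mat q q (\<lambda>(i, j). ((?rs @ ys) ! i) j)"
  have pq: "p \<le> q" using basis_list_length[OF ys] by (simp add: dim_fsup)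
  have Q: "?Q \<in> carrier_mat q q" "invertible_mat ?Q" using basis_list_invertible(2)[OF ys] by simp_all
  have Y: "?Y = mat p q (\<lambda>(i, j). ?Q $$ (i, j))"
    using pq by (intro eq_matI) (auto simp: nth_append r_def)
  have "F M = pad_zero_cols q M * ?Q" if "M \<in> S" for M
    using FM[OF that] Y pad_zero_cols_mult[OF carrier[OF that] Q(1) pq] by simp
  then show ?thesis using pq Q unfolding standard_map_on_def by blast
qed

end

section \<open>The three types\<close>

text \<open>Entrywise form shared by Type 2 (\<open>r = 2\<close>) and Type 3
  (\<open>r = n = 3\<close>, where the zero part is empty).\<close>

definition sym_mat_space :: "nat \<Rightarrow> nat \<Rightarrow> nat \<Rightarrow> 'a::field mat set" where
  "sym_mat_space r n p = {A \<in> carrier_mat n p. (\<forall>i<r. \<forall>j<r. A $$ (i, j) = A $$ (j, i)) \<and>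
     (\<forall>i<n. \<forall>j<r. r \<le> i \<longrightarrow> A $$ (i, j) = 0)}"

lemma sym_mat_space_blocks:
  assumes r: "r \<le> n" "r \<le> p"
  shows "sym_mat_space r n p = {four_block_mat A C (0\<^sub>m (n - r) r) B | A B C.
    A \<in> sym_mats r \<and> B \<in> carrier_mat (n - r) (p - r) \<and> C \<in> carrier_mat r (p - r)}" (is "_ = ?R")
proof (intro equalityI subsetI)
  fix M :: "'a mat" assume M: "M \<in> sym_mat_space r n p"
  then have Mc: "M \<in> carrier_mat n p" and s: "\<And>i j. i < r \<Longrightarrow> j < r \<Longrightarrow> M $$ (i, j) = M $$ (j, i)"
    and z: "\<And>i j. i < n \<Longrightarrow> j < r \<Longrightarrow> r \<le> i \<Longrightarrow> M $$ (i, j) = 0" by (auto simp: sym_mat_space_def)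
  define A where "A = mat r r (\<lambda>(i, j). M $$ (i, j))"
  define C where "C = mat r (p - r) (\<lambda>(i, j). M $$ (i, j + r))"
  define B where "B = mat (n - r) (p - r) (\<lambda>(i, j). M $$ (i + r, j + r))"
  have "transpose_mat A = A"
  proof (rule eq_matI)
    fix i j assume "i < dim_row A" "j < dim_col A"
    then show "transpose_mat A $$ (i, j) = A $$ (i, j)" using s[of j i] by (simp add: A_def)
  next
    show "dim_row (transpose_mat A) = dim_row A" "dim_col (transpose_mat A) = dim_col A" by (simp_all add: A_def)
  qed
  then have "A \<in> sym_mats r" by (simp add: sym_mats_def A_def)
  moreover have "M = four_block_mat A C (0\<^sub>m (n - r) r) B"
  proof (rule eq_matI)
    fix i j assume "i < dim_row (four_block_mat A C (0\<^sub>m (n - r) r) B)" "j < dim_col (four_block_mat A C (0\<^sub>m (n - r) r) B)"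
    then have ij: "i < n" "j < p" using r by (simp_all add: A_def B_def)
    then show "M $$ (i, j) = four_block_mat A C (0\<^sub>m (n - r) r) B $$ (i, j)"
      using r z[of i j] by (simp add: A_def B_def C_def)
  next
    show "dim_row M = dim_row (four_block_mat A C (0\<^sub>m (n - r) r) B)"
      "dim_col M = dim_col (four_block_mat A C (0\<^sub>m (n - r) r) B)"
      using carrier_matD[OF Mc] r by (simp_all add: A_def B_def)
  qed
  moreover have "B \<in> carrier_mat (n - r) (p - r)" "C \<in> carrier_mat r (p - r)" by (simp_all add: B_def C_def)
  ultimately show "M \<in> ?R" by blast
next
  fix M :: "'a mat" assume "M \<in> ?R"
  then obtain A B C where M: "M = four_block_mat A C (0\<^sub>m (n - r) r) B" and A: "A \<in> sym_mats r"
    and B: "B \<in> carrier_mat (n - r) (p - r)" and C: "C \<in> carrier_mat r (p - r)" by blast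
  have Ac: "A \<in> carrier_mat r r" and At: "transpose_mat A = A" using A by (simp_all add: sym_mats_def)
  show "M \<in> sym_mat_space r n p" unfolding sym_mat_space_def
  proof (intro CollectI conjI allI impI)
    show "M \<in> carrier_mat n p" using Ac B r by (intro carrier_matI) (simp_all add: M)
    show "M $$ (i, j) = M $$ (j, i)" if ij: "i < r" "j < r" for i j
    proof -
      have "transpose_mat A $$ (i, j) = A $$ (j, i)" using ij Ac by simp
      then show ?thesis using ij Ac B by (simp add: M At)
    qed
    show "M $$ (i, j) = 0" if "i < n" "j < r" "r \<le> i" for i j using that Ac B r by (simp add: M)
  qed
qed

lemma sym_mat_space_3:
  assumes "3 \<le> p"
  shows "sym_mat_space 3 3 p = {four_block_mat A B (0\<^sub>m 0 3) (0\<^sub>m 0 (p - 3)) | A B.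
    A \<in> sym_mats 3 \<and> B \<in> carrier_mat 3 (p - 3)}"
  (is "_ = ?R")
proof -
  have eq: "sym_mat_space 3 3 p = {four_block_mat A C (0\<^sub>m (3 - 3) 3) B | A B C.
    A \<in> sym_mats 3 \<and> B \<in> carrier_mat (3 - 3) (p - 3) \<and> C \<in> carrier_mat 3 (p - 3)}"
    by (rule sym_mat_space_blocks[OF order_refl assms])
  have B0: "B = 0\<^sub>m 0 (p - 3)" if B: "B \<in> carrier_mat (3 - 3) (p - 3)" for B :: "'a mat"
    by (rule eq_matI) (use B in auto)
  show ?thesis
  proof (intro equalityI subsetI)
    fix M :: "'a mat" assume "M \<in> sym_mat_space 3 3 p"
    then show "M \<in> ?R" unfolding eq
    proof (elim CollectE exE conjE)
      fix A B C assume "M = four_block_mat A C (0\<^sub>m (3 - 3) 3) B" and A: "A \<in> sym_mats 3"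
        and B: "B \<in> carrier_mat (3 - 3) (p - 3)" and C: "C \<in> carrier_mat 3 (p - 3)"
      then have "M = four_block_mat A C (0\<^sub>m 0 3) (0\<^sub>m 0 (p - 3))" using B0[OF B] by simp
      then show "M \<in> ?R" using A C by (intro CollectI exI[of _ A] exI[of _ C] conjI)
    qed
  next
    fix M :: "'a mat" assume "M \<in> ?R"
    then show "M \<in> sym_mat_space 3 3 p" unfolding eq
    proof (elim CollectE exE conjE)
      fix A C assume "M = four_block_mat A C (0\<^sub>m 0 3) (0\<^sub>m 0 (p - 3))" "A \<in> sym_mats 3" "C \<in> carrier_mat 3 (p - 3)"
      then show "M \<in> {four_block_mat A C (0\<^sub>m (3 - 3) 3) B | A B C.
          A \<in> sym_mats 3 \<and> B \<in> carrier_mat (3 - 3) (p - 3) \<and> C \<in> carrier_mat 3 (p - 3)}"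
        by (intro CollectI exI[of _ A] exI[of _ "0\<^sub>m 0 (p - 3)"] exI[of _ C] conjI) simp_all
    qed
  qed
qed

context mat_space
begin

text \<open>With the vectors of \<open>bs\<close> as rows of \<open>P\<close> and those of
  \<open>xs\<close> as columns of \<open>R\<close>, the entry \<open>(i, j)\<close> of
  \<open>P * M * R\<close> is the pairing of \<open>M\<close> with
  \<open>tens (bs ! i) (xs ! j)\<close>. The generators of \<open>W\<close> therefore become the
  symmetry and vanishing conditions on entries.\<close>

lemma image_sym_mat_space:
  assumes bs: "basis_list (fsup n) bs" and xs: "basis_list (fsup p) xs" and r: "r \<le> n" "r \<le> p"
    and W: "W = sym_space r bs xs"
  shows "\<exists>P R. P \<in> carrier_mat n n \<and> invertible_mat P \<and> R \<in> carrier_mat p p \<and> invertible_mat R \<and>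
    (\<lambda>M. P * M * R) ` S = sym_mat_space r n p"
proof -
  define P where "P = mat n n (\<lambda>(i, j). (bs ! i) j)"
  define R where "R = mat p p (\<lambda>(i, j). (xs ! j) i)"
  have P: "P \<in> carrier_mat n n" "invertible_mat P" and R: "R \<in> carrier_mat p p" "invertible_mat R"
    using basis_list_invertible(2)[OF bs] basis_list_invertible(1)[OF xs] by (simp_all add: P_def R_def)
  obtain P' where P': "P' \<in> carrier_mat n n" "P * P' = 1\<^sub>m n" "P' * P = 1\<^sub>m n" using invertible_matE[OF P(2,1)] .
  obtain R' where R': "R' \<in> carrier_mat p p" "R * R' = 1\<^sub>m p" "R' * R = 1\<^sub>m p" using invertible_matE[OF R(2,1)] .
  have lb: "length bs = n" and lx: "length xs = p"
    using basis_list_length[OF bs] basis_list_length[OF xs] by (simp_all add: dim_fsup)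
  have PMR: "(P * M * R) $$ (i, j) = pair n p (fun_of n p M) (tens (bs ! i) (xs ! j))"
    if M: "M \<in> carrier_mat n p" and ij: "i < n" "j < p" for M i j
  proof -
    have "P * M * R = P * (M * R)" by (rule assoc_mult_mat[OF P(1) M R(1)])
    then have "(P * M * R) $$ (i, j) = (\<Sum>k<n. \<Sum>l<p. (bs ! i) k * (M $$ (k, l) * (xs ! j) l))"
      using ij M R(1) by (simp add: P_def R_def scalar_prod_def lessThan_atLeast0 sum_distrib_left)
    also have "\<dots> = pair n p (fun_of n p M) (tens (bs ! i) (xs ! j))"
      unfolding pair_def by (intro sum.cong) (simp_all add: fun_of_def tens_def mult.left_commute)
    finally show ?thesis .
  qed
  have "(\<lambda>M. P * M * R) ` S = sym_mat_space r n p"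
  proof (intro equalityI subsetI)
    fix A assume "A \<in> (\<lambda>M. P * M * R) ` S"
    then obtain M where M: "M \<in> S" "A = P * M * R" by blast
    let ?s = "pair n p (fun_of n p M)"
    have s0: "?s e = 0" if "e \<in> W" for e by (rule annD(2)[OF pair_ann[OF M(1)] that])
    have "A $$ (i, j) = A $$ (j, i)" if ij: "i < r" "j < r" for i j
    proof -
      have "?s (tens (bs ! i) (xs ! j) - tens (bs ! j) (xs ! i)) = 0"
        by (rule s0) (use ij in \<open>auto simp: W sym_space_def intro!: fn.span_base\<close>)
      then show ?thesis using ij r by (simp add: M(2) PMR[OF carrier[OF M(1)]] functional_diff[OF functional_pair])
    qed
    moreover have "A $$ (i, j) = 0" if ij: "i < n" "r \<le> i" "j < r" for i j
    proof -
      have "?s (tens (bs ! i) (xs ! j)) = 0"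
        by (rule s0) (use ij lb in \<open>auto simp: W sym_space_def intro!: fn.span_base\<close>)
      then show ?thesis using ij r by (simp add: M(2) PMR[OF carrier[OF M(1)]])
    qed
    ultimately show "A \<in> sym_mat_space r n p"
      using P(1) R(1) carrier[OF M(1)] by (simp add: sym_mat_space_def M(2))
  next
    fix A :: "'a mat" assume A: "A \<in> sym_mat_space r n p"
    then have Ac: "A \<in> carrier_mat n p" by (simp add: sym_mat_space_def)
    let ?M = "P' * A * R'"
    have Mc: "?M \<in> carrier_mat n p" using P'(1) Ac R'(1) by simp
    have "P * ?M = A * R'"
    proof -
      have "P * ?M = P * (P' * (A * R'))" using assoc_mult_mat[OF P'(1) Ac R'(1)] by simp
      also have "\<dots> = (P * P') * (A * R')"
        by (rule assoc_mult_mat[OF P(1) P'(1) mult_carrier_mat[OF Ac R'(1)], symmetric])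
      finally show ?thesis using P'(2) Ac R'(1) by simp
    qed
    then have "P * ?M * R = A * (R' * R)" using assoc_mult_mat[OF Ac R'(1) R(1)] by simp
    then have eq: "P * ?M * R = A" using R'(3) Ac by simp
    let ?s = "pair n p (fun_of n p ?M)"
    have sA: "?s (tens (bs ! i) (xs ! j)) = A $$ (i, j)" if "i < n" "j < p" for i j
      using PMR[OF Mc that] eq by simp
    have "?s e = 0" if "e \<in> W" for e
    proof (rule functional_span_zero[OF functional_pair _ that[unfolded W sym_space_def]])
      fix e assume "e \<in> {tens (bs ! i) (xs ! j) - tens (bs ! j) (xs ! i) |i j. i < r \<and> j < r} \<union>
        {tens (bs ! i) (xs ! j) |i j. r \<le> i \<and> i < length bs \<and> j < r}"
      then consider i j where "e = tens (bs ! i) (xs ! j) - tens (bs ! j) (xs ! i)" "i < r" "j < r"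
        | i j where "e = tens (bs ! i) (xs ! j)" "r \<le> i" "i < n" "j < r" using lb by blast
      then show "?s e = 0"
      proof cases
        case 1
        then have "?s e = A $$ (i, j) - A $$ (j, i)" using sA r by (simp add: functional_diff[OF functional_pair])
        then show ?thesis using 1 A by (simp add: sym_mat_space_def)
      next
        case 2
        then have "?s e = A $$ (i, j)" using sA r by simp
        then show ?thesis using 2 A by (simp add: sym_mat_space_def)
      qed
    qed
    then have "?s \<in> ann W" by (simp add: ann_def functional_pair)
    then have "?M \<in> S" using mat_of_mem mat_of_pair[OF Mc] by metis
    then show "A \<in> (\<lambda>M. P * M * R) ` S" using eq by (intro image_eqI[of _ _ ?M]) simp_all
  qed
  then show ?thesis using P R by blast
qed

lemma type23_if_sym_space:
  assumes bs: "basis_list (fsup n) bs" and xs: "basis_list (fsup p) xs" and r: "r \<le> length bs" "r \<le> length xs"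
    and r23: "r = 2 \<or> r = 3 \<and> length bs = 3" and W: "W = sym_space r bs xs" and char: "(1 :: 'a) + 1 = 0"
  shows "type2 n p S \<or> type3 n p S"
proof -
  have lb: "length bs = n" and lx: "length xs = p"
    using basis_list_length[OF bs] basis_list_length[OF xs] by (simp_all add: dim_fsup)
  have "of_nat 2 = (0 :: 'a)" using char by simp
  then have "CHAR('a) dvd 2" by (simp only: of_nat_eq_0_iff_char_dvd)
  then have "CHAR('a) = 1 \<or> CHAR('a) = 2" using two_is_prime_nat unfolding prime_nat_iff by blast
  then have char2: "CHAR('a) = 2" by simp
  obtain P R where PR: "P \<in> carrier_mat n n" "invertible_mat P" "R \<in> carrier_mat p p" "invertible_mat R"
    "(\<lambda>M. P * M * R) ` S = sym_mat_space r n p"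
    using image_sym_mat_space[OF bs xs _ _ W] r lb lx by blast
  from r23 show ?thesis
  proof
    assume "r = 2"
    then have np: "2 \<le> n" "2 \<le> p" using r lb lx by simp_all
    have "type2 n p S" unfolding type2_def sym_mat_space_blocks[OF np, symmetric]
      using PR \<open>r = 2\<close> np char2 by blast
    then show ?thesis ..
  next
    assume r3: "r = 3 \<and> length bs = 3"
    then have np: "n = 3" "3 \<le> p" using r lb lx by simp_all
    have "type3 n p S" unfolding type3_def sym_mat_space_3[OF np(2), symmetric]
      using PR r3 np char2 by blast
    then show ?thesis ..
  qed
qed

text \<open>Nondegeneracy keeps the slice from being everything, so it is a hyperplane, and the
  vectors \<open>M x\<close> form the line annihilated by it. The line is nonzero because
  \<open>s (tens f x) = 1\<close> for some matrix.\<close>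

lemma type1_if_large_slice:
  assumes x: "x \<in> fsup p" "x \<noteq> 0" and d: "n \<le> Suc (fn.dim (slice (fsup n) W x))"
    and nondeg: "\<forall>x\<in>carrier_vec p. (\<forall>M\<in>S. M *\<^sub>v x = 0\<^sub>v n) \<longrightarrow> x = 0\<^sub>v p"
  shows "type1 n p S"
proof -
  let ?L = "slice (fsup n) W x"
  have L: "fn.subspace ?L" "fn.fin_gen ?L" "?L \<subseteq> fsup n"
    using subspace_slice[OF subspace_fsup subspace_W] fin_gen_slice[OF fin_gen_fsup] by (auto simp: slice_def)
  have entry: "pair n p (fun_of n p M) (tens (unitv i) x) = (M *\<^sub>v vec p x) $ i" if M: "M \<in> S" and i: "i < n" for M i
  proof -
    have "pair n p (fun_of n p M) (tens (unitv i) x) = (mat_of n p (pair n p (fun_of n p M)) *\<^sub>v vec p x) $ i"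
      by (rule functional_unitv_mat[OF functional_pair x(1) i])
    then show ?thesis using mat_of_pair[OF carrier[OF M]] by simp
  qed
  have "\<exists>f\<in>fsup n. f \<notin> ?L"
  proof (rule ccontr)
    assume a: "\<not> ?thesis"
    have "M *\<^sub>v vec p x = 0\<^sub>v n" if M: "M \<in> S" for M
    proof (rule eq_vecI)
      fix i assume "i < dim_vec (0\<^sub>v n :: 'a vec)"
      then have i: "i < n" by simp
      then have "tens (unitv i) x \<in> W" using a unitv_in_fsup[OF i] by (auto simp: slice_def)
      then show "(M *\<^sub>v vec p x) $ i = 0\<^sub>v n $ i" using entry[OF M i] annD(2)[OF pair_ann[OF M]] i by simp
    qed (use carrier[OF M] in simp)
    then have "vec p x = 0\<^sub>v p" using nondeg by simp
    then have "x i = 0" if "i < p" for i using that by (metis index_vec index_zero_vec(1))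
    then have "x = 0" using x(1) by (auto simp: fsup_def fun_eq_iff not_less[symmetric])
    then show False using x(2) by simp
  qed
  then obtain f where f: "f \<in> fsup n" "f \<notin> ?L" by blast
  then have "tens f x \<notin> W" by (simp add: slice_def)
  then obtain s where s: "s \<in> ann W" "s (tens f x) = 1" using ann_separate[OF subspace_W] by blast
  let ?N = "mat_of n p s"
  define v where "v = ?N *\<^sub>v vec p x"
  have N: "?N \<in> S" by (rule mat_of_mem[OF s(1)])
  have vc: "v \<in> carrier_vec n" using carrier[OF N] by (simp add: v_def)
  have v0: "v \<noteq> 0\<^sub>v n"
  proof
    assume "v = 0\<^sub>v n"
    then have "s (tens f x) = 0" using functional_tens_mat[OF annD(1)[OF s(1)] f(1) x(1)] by (simp add: v_def)
    then show False using s(2) by simp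
  qed
  have full: "fn.span (insert f ?L) = fsup n"
  proof (rule fn.subspace_dim_eq_imp_eq[OF fn.subspace_span _ fin_gen_fsup])
    show "fn.span (insert f ?L) \<subseteq> fsup n" by (rule fn.span_minimal[OF _ subspace_fsup]) (use f L in blast)
    show "fn.dim (fsup n :: (nat \<Rightarrow> 'a) set) \<le> fn.dim (fn.span (insert f ?L))"
      unfolding fn.dim_insert_notin[OF L(1,2) f(2)] dim_fsup by (rule d)
  qed
  \<comment> \<open>Modulo the slice every unit functional is a multiple of \<open>f\<close>, so all
    coordinates of \<open>M x\<close> are determined by the one value at \<open>f\<close>.\<close>
  have line: "M *\<^sub>v vec p x = pair n p (fun_of n p M) (tens f x) \<cdot>\<^sub>v v" if M: "M \<in> S" for M
  proof (rule eq_vecI)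
    fix i assume "i < dim_vec (pair n p (fun_of n p M) (tens f x) \<cdot>\<^sub>v v)"
    then have i: "i < n" using vc by simp
    have "unitv i \<in> fn.span (insert f ?L)" using full unitv_in_fsup[OF i] by simp
    then obtain k where "unitv i - sc k f \<in> ?L" by (auto simp: mem_span_insert[OF L(1)])
    then have e: "tens (unitv i - sc k f) x \<in> W" by (simp add: slice_def)
    have k: "t (tens (unitv i) x) = k * t (tens f x)" if t: "t \<in> ann W" for t
      using annD(2)[OF t e] by (simp add: tens_simps functional_simps[OF annD(1)[OF t]])
    have "v $ i = k" using functional_unitv_mat[OF annD(1)[OF s(1)] x(1) i] k[OF s(1)] s(2) by (simp add: v_def)
    moreover have "(M *\<^sub>v vec p x) $ i = k * pair n p (fun_of n p M) (tens f x)"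
      using entry[OF M i] k[OF pair_ann[OF M]] by simp
    ultimately show "(M *\<^sub>v vec p x) $ i = (pair n p (fun_of n p M) (tens f x) \<cdot>\<^sub>v v) $ i"
      using i vc by (simp add: mult.commute)
  qed (use carrier[OF M] vc in simp)
  have "{M *\<^sub>v vec p x |M. M \<in> S} = {c \<cdot>\<^sub>v v |c. True}"
  proof (intro equalityI subsetI)
    fix w assume "w \<in> {M *\<^sub>v vec p x |M. M \<in> S}"
    then show "w \<in> {c \<cdot>\<^sub>v v |c. True}" using line by blast
  next
    fix w assume "w \<in> {c \<cdot>\<^sub>v v |c. True}"
    then obtain c where "w = c \<cdot>\<^sub>v v" by blast
    moreover have "c \<cdot>\<^sub>v v = (c \<cdot>\<^sub>m ?N) *\<^sub>v vec p x"
      unfolding v_def using carrier[OF N] by (intro eq_vecI) (auto simp: scalar_prod_def sum_distrib_left mult.assoc)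
    ultimately have "w = (c \<cdot>\<^sub>m ?N) *\<^sub>v vec p x" by simp
    then show "w \<in> {M *\<^sub>v vec p x |M. M \<in> S}" using smult_mem[OF N] by blast
  qed
  then have "vec_subspace_dim n {M *\<^sub>v vec p x |M. M \<in> S} = 1" using vec_subspace_dim_line[OF vc v0] by simp
  then show ?thesis unfolding type1_def by (intro bexI[of _ "vec p x"]) simp_all
qed

lemma additive_imp_linear_two_elements:
  assumes F: "additive_on S F" "range_preserving n q S F" and two: "\<And>c :: 'a. c = 0 \<or> c = 1"
  shows "linear_on S F"
  unfolding linear_on_def
proof (intro conjI ballI allI)
  show "F (A + B) = F A + F B" if "A \<in> S" "B \<in> S" for A B using F(1) that by (simp add: additive_on_def)
  fix c :: 'a and A assume A: "A \<in> S"
  have Fc: "F M \<in> carrier_mat n q" if "M \<in> S" for M using F(2) that by (simp add: range_preserving_def)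
  show "F (c \<cdot>\<^sub>m A) = c \<cdot>\<^sub>m F A"
  proof (cases "c = 0")
    case True
    have "0\<^sub>m n p + 0\<^sub>m n p = (0\<^sub>m n p :: 'a mat)" by simp
    then have e: "F (0\<^sub>m n p) = F (0\<^sub>m n p) + F (0\<^sub>m n p)" using F(1) zero_mem by (metis additive_on_def)
    have "F (0\<^sub>m n p) = 0\<^sub>m n q"
    proof (rule eq_matI)
      fix i j assume ij: "i < dim_row (0\<^sub>m n q :: 'a mat)" "j < dim_col (0\<^sub>m n q :: 'a mat)"
      have "(F (0\<^sub>m n p) + F (0\<^sub>m n p)) $$ (i, j) = F (0\<^sub>m n p) $$ (i, j) + F (0\<^sub>m n p) $$ (i, j)"
        using ij Fc[OF zero_mem] by simp
      then have "F (0\<^sub>m n p) $$ (i, j) = 0" unfolding e[symmetric] by (simp only: add_cancel_right_right)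
      then show "F (0\<^sub>m n p) $$ (i, j) = 0\<^sub>m n q $$ (i, j)" using ij by simp
    qed (use Fc[OF zero_mem] in simp_all)
    moreover have "0 \<cdot>\<^sub>m A = 0\<^sub>m n p" using carrier[OF A] by (intro eq_matI) auto
    moreover have "0 \<cdot>\<^sub>m F A = 0\<^sub>m n q" using Fc[OF A] by (intro eq_matI) auto
    ultimately show ?thesis using True by simp
  next
    case False
    then have "c = 1" using two by blast
    moreover have "1 \<cdot>\<^sub>m M = M" for M :: "'a mat" by (intro eq_matI) auto
    ultimately show ?thesis by simp
  qed
qed

text \<open>Excluding Type 1 is the slice condition of \<open>homogeneous_or_root\<close>. A nonzero
  defect of some column would then be a root form with \<open>h \<noteq> 0\<close>, and its normal
  form is Type 2 or Type 3.\<close>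

lemma additive_imp_linear:
  assumes F: "additive_on S F" "range_preserving n q S F"
    and bound: "fn.dim W + 3 \<le> 2 * n" and card: "\<exists>a::'a. a \<noteq> 0 \<and> a \<noteq> 1"
    and nondeg: "\<forall>x\<in>carrier_vec p. (\<forall>M\<in>S. M *\<^sub>v x = 0\<^sub>v n) \<longrightarrow> x = 0\<^sub>v p"
    and types: "\<not> type1 n p S" "\<not> type2 n p S" "\<not> type3 n p S"
  shows "linear_on S F"
  unfolding linear_on_def
proof (intro conjI ballI allI)
  show "F (A + B) = F A + F B" if "A \<in> S" "B \<in> S" for A B using F(1) that by (simp add: additive_on_def)
  fix c :: 'a and A assume A: "A \<in> S"
  have Fc: "F M \<in> carrier_mat n q" if "M \<in> S" for M using F(2) that by (simp add: range_preserving_def)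
  have sl: "fn.dim (slice (fsup n) W x) + 2 \<le> fn.dim (fsup n :: (nat \<Rightarrow> 'a) set)" if "x \<in> fsup p" "x \<noteq> 0" for x
  proof (rule ccontr)
    assume "\<not> ?thesis"
    then have "n \<le> Suc (fn.dim (slice (fsup n) W x))" by (simp add: dim_fsup)
    then show False using type1_if_large_slice[OF that _ nondeg] types(1) by blast
  qed
  have defect: "defect c (column_map F j) s f = 0" if j: "j < q" and s: "s \<in> ann W" and f: "f \<in> fsup n" for j s f
  proof (rule ccontr)
    assume nz: "defect c (column_map F j) s f \<noteq> 0"
    note rc = range_compatible_column[OF F j]
    have "fn.dim W + 3 \<le> fn.dim (TP (fsup n) {0 :: nat \<Rightarrow> 'a}) + 2 * fn.dim (fsup n :: (nat \<Rightarrow> 'a) set)"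
      using bound by (simp add: dim_fsup)
    from homogeneous_or_root[OF rc this card, of c] sl nz s f
    obtain h b where h: "sym_form (fsup n) (fsup p) W h" and rf: "root_form (fsup n) W (defect c (column_map F j)) h b" by auto
    have b0: "b 0 = 0" and eq: "defect c (column_map F j) s f = b (s (tens f (h f)))" and char: "(1::'a) + 1 = 0"
    proof -
      have "b (0 + 0) = b 0 + b 0" using rf unfolding root_form_def by blast
      then show "b 0 = 0" by (simp only: add_0_left add_cancel_right_right)
      show "defect c (column_map F j) s f = b (s (tens f (h f)))" using rf s f unfolding root_form_def by blast
      show "(1::'a) + 1 = 0" using rf unfolding root_form_def by blast
    qed
    have "h f \<noteq> 0"
    proof
      assume "h f = 0"
      then show False using nz eq b0 by (simp add: tens_simps functional_0[OF annD(1)[OF s]])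
    qed
    moreover have "fn.dim W + 3 \<le> 2 * fn.dim (fsup n :: (nat \<Rightarrow> 'a) set)" using bound by (simp add: dim_fsup)
    ultimately obtain r bs xs where "basis_list (fsup n) bs" "basis_list (fsup p) xs" "r \<le> length bs" "r \<le> length xs"
      "r = 2 \<or> r = 3 \<and> length bs = 3" "W = sym_space r bs xs"
      using sym_form_normal[OF rc h f _ sl] by blast
    from type23_if_sym_space[OF this char] types show False by blast
  qed
  let ?s = "pair n p (fun_of n p A)"
  have As: "mat_of n p ?s = A" by (rule mat_of_pair[OF carrier[OF A]])
  show "F (c \<cdot>\<^sub>m A) = c \<cdot>\<^sub>m F A"
  proof (rule eq_matI)
    fix i j assume "i < dim_row (c \<cdot>\<^sub>m F A)" "j < dim_col (c \<cdot>\<^sub>m F A)"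
    then have ij: "i < n" "j < q" using Fc[OF A] by simp_all
    show "F (c \<cdot>\<^sub>m A) $$ (i, j) = (c \<cdot>\<^sub>m F A) $$ (i, j)"
      using defect[OF ij(2) pair_ann[OF A] unitv_in_fsup[OF ij(1)]] ij Fc[OF A]
      by (simp add: defect_def column_map_unitv mat_of_sc As)
  qed (use Fc[OF A] Fc[OF smult_mem[OF A, of c]] in simp_all)
qed

end

theorem theorem7p4:
  fixes S :: "'a::field mat set" and n p q :: nat
  assumes subsp: "subspace (class_ring :: 'a ring) S (module_mat TYPE('a) n p)"
    and codim: "int (n * p) - int (mat_subspace_dim n p S) \<le> d_n TYPE('a) n"
    and nondeg: "\<forall>x\<in>carrier_vec p. (\<forall>M\<in>S. M *\<^sub>v x = 0\<^sub>v n) \<longrightarrow> x = 0\<^sub>v p"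
    and q: "1 \<le> q"
  shows "(\<forall>F. (linear_on S F \<and> range_preserving n q S F) \<longleftrightarrow> standard_map_on p q S F)
       \<and> (\<not> type1 n p S \<and> \<not> type2 n p S \<and> \<not> type3 n p S \<longrightarrow>
           (\<forall>F. (additive_on S F \<and> range_preserving n q S F) \<longleftrightarrow> standard_map_on p q S F))"
proof -
  interpret mat_space S n p by (rule mat_space.intro[OF subsp])
  have dW: "int (fn.dim W) \<le> d_n TYPE('a) n"
    using codim dim_W_le mat_subspace_dim_le by linarith
  \<comment> \<open>The two values of \<open>d_n\<close> match the two admissible excesses; a field
    has exactly two elements when every scalar is 0 or 1.\<close>
  have bound: "fn.dim W + 4 \<le> 2 * n \<and> (\<forall>c::'a. c = 0 \<or> c = 1) \<or> fn.dim W + 3 \<le> 2 * n \<and> (\<exists>a::'a. a \<noteq> 0 \<and> a \<noteq> 1)"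
  proof (cases "\<exists>a::'a. a \<noteq> 0 \<and> a \<noteq> 1")
    case True
    then obtain a :: 'a where a: "a \<noteq> 0" "a \<noteq> 1" by blast
    have "card (UNIV :: 'a set) \<noteq> 2"
    proof
      assume c: "card (UNIV :: 'a set) = 2"
      then have "finite (UNIV :: 'a set)" by (metis card.infinite zero_neq_numeral)
      then have "card {0, 1, a} \<le> card (UNIV :: 'a set)" by (rule card_mono) simp
      moreover have "card {0, 1, a} = 3" using a by simp
      ultimately show False using c by linarith
    qed
    then show ?thesis using dW True by (simp add: d_n_def)
  next
    case False
    then have "(UNIV :: 'a set) = {0, 1}" by blast
    then have "card (UNIV :: 'a set) = 2" by (metis card_2_iff zero_neq_one)
    then have "fn.dim W + 4 \<le> 2 * n" using dW by (simp add: d_n_def)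
    then show ?thesis using False by blast
  qed
  have lin: "linear_on S F \<and> range_preserving n q S F \<longleftrightarrow> standard_map_on p q S F" for F
  proof
    assume F: "linear_on S F \<and> range_preserving n q S F"
    have b: "fn.dim W + 4 \<le> 2 * n \<or> fn.dim W + 3 \<le> 2 * n \<and> (\<exists>a::'a. a \<noteq> 0 \<and> a \<noteq> 1)"
      using bound by blast
    show "standard_map_on p q S F" by (rule linear_imp_standard[OF conjunct1[OF F] conjunct2[OF F] b nondeg])
  next
    assume F: "standard_map_on p q S F"
    show "linear_on S F \<and> range_preserving n q S F"
      by (rule conjI[OF standard_imp_linear_range_preserving[OF F]])
  qed
  have add: "additive_on S F \<and> range_preserving n q S F \<longleftrightarrow> standard_map_on p q S F"
    if t: "\<not> type1 n p S \<and> \<not> type2 n p S \<and> \<not> type3 n p S" for F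
  proof
    assume "additive_on S F \<and> range_preserving n q S F"
    then have F: "additive_on S F" "range_preserving n q S F" by simp_all
    \<comment> \<open>Over two elements homogeneity is automatic for additive maps; only larger
      fields call for the analysis of the defect and the exclusion of the types.\<close>
    from bound have "linear_on S F"
    proof
      assume "fn.dim W + 4 \<le> 2 * n \<and> (\<forall>c::'a. c = 0 \<or> c = 1)"
      then have "c = 0 \<or> c = 1" for c :: 'a by blast
      then show ?thesis by (rule additive_imp_linear_two_elements[OF F])
    next
      assume "fn.dim W + 3 \<le> 2 * n \<and> (\<exists>a::'a. a \<noteq> 0 \<and> a \<noteq> 1)"
      then have b: "fn.dim W + 3 \<le> 2 * n" "\<exists>a::'a. a \<noteq> 0 \<and> a \<noteq> 1" by simp_all
      show ?thesis
        by (rule additive_imp_linear[OF F b nondeg conjunct1[OF t] conjunct1[OF conjunct2[OF t]] conjunct2[OF conjunct2[OF t]]])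
    qed
    then show "standard_map_on p q S F" using F(2) lin[of F] by blast
  next
    assume "standard_map_on p q S F"
    then have "linear_on S F" "range_preserving n q S F" using lin[of F] by blast+
    then show "additive_on S F \<and> range_preserving n q S F" by (simp add: linear_on_def additive_on_def)
  qed
  show ?thesis
  proof (rule conjI)
    show "\<forall>F. (linear_on S F \<and> range_preserving n q S F) \<longleftrightarrow> standard_map_on p q S F"
      by (rule allI, rule lin)
    show "\<not> type1 n p S \<and> \<not> type2 n p S \<and> \<not> type3 n p S \<longrightarrow>
        (\<forall>F. (additive_on S F \<and> range_preserving n q S F) \<longleftrightarrow> standard_map_on p q S F)"
      by (rule impI, rule allI, rule add)
  qed
qed

end
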